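(* Let $\mathcal{G}$ be the three-dimensional cubic grid with edge length $\ell>0$. For $p>2$ let $$E(\psi)=\frac12\|\psi'\|_{L^2(\mathcal{G})}^2-\frac1p\|\psi\|_{L^p(\mathcal{G})}^p,\qquad \psi\in H^1(\mathcal{G}),$$ and for $\mu>0$ call a ground state of mass $\mu$ any minimizer of $E$ among all functions $\psi\in H^1(\mathcal{G})$ with $\|\psi\|_{L^2(\mathcal{G})}^2=\mu$. Then: 1. If $2<p<\frac{10}{3}$, then for every $\mu>0$ there exists a ground state of mass $\mu$, and it has negative energy. 2. For every $p\in\left[\frac{10}{3},6\right]$ there exists a critical mass $\mu_p>0$ such that: (a) If $0<\mu<\mu_p$, then every $\psi\in H^1(\mathcal{G})$ with $\|\psi\|_{L^2(\mathcal{G})}^2=\mu$ satisfies $E(\psi)>0$, and a ground state of mass $\mu$ does not exist. (b) If $p\neq\frac{10}{3}$, $p\neq 6$ and $\mu=\mu_p$, then there exists a ground state of mass $\mu$ with zero energy, i.e. $E=0$. (c) If $p\neq 6$ and $\mu>\mu_p$, then there exists a ground state of mass $\mu$ with negative energy. (d) If $p=6$ and $\mu\geq\mu_p$, then ground states of mass $\mu$ do not exist.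
   Context: Fix $\ell>0$. The three-dimensional grid $\mathcal{G}$ is the metric graph embedded in $\mathbb{R}^3$ with vertex set $\{(i\ell,j\ell,k\ell): (i,j,k)\in\mathbb{Z}^3\}$ and whose edges are the segments of length $\ell$ joining nearest-neighbour vertices (parallel to the coordinate axes). Equivalently $\mathcal{G}$ is the union of the lines $X_{j,k}=\mathbb{R}\times\{j\ell\}\times\{k\ell\}$, $Y_{i,k}=\{i\ell\}\times\mathbb{R}\times\{k\ell\}$, $Z_{i,j}=\{i\ell\}\times\{j\ell\}\times\mathbb{R}$, for $i,j,k\in\mathbb{Z}$. Functions on $\mathcal{G}$ are complex-valued, and $\psi'$ denotes the derivative along each line with respect to arc length. The norms are $$\|\psi\|_{L^p(\mathcal{G})}^p=\sum_{(j,k)\in\mathbb{Z}^2}\int_{X_{j,k}}|\psi|^p\,dx+\sum_{(i,k)\in\mathbb{Z}^2}\int_{Y_{i,k}}|\psi|^p\,dx+\sum_{(i,j)\in\mathbb{Z}^2}\int_{Z_{i,j}}|\psi|^p\,dx,$$ and $\|\psi\|_{H^1(\mathcal{G})}^2=\|\psi\|_{L^2(\mathcal{G})}^2+\|\psi'\|_{L^2(\mathcal{G})}^2$. The space $H^1(\mathcal{G})$ consists of the functions whose restriction to every line $X_{j,k},Y_{i,k},Z_{i,j}$ belongs to $H^1(\mathbb{R})$, which are continuous at every vertex of $\mathcal{G}$, and for which $\|\psi\|_{H^1(\mathcal{G})}<\infty$. *)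

theory Defs
  imports "HOL-Analysis.Analysis"
begin

section \<open>The Sobolev space on the real line\<close>

definition square_integrable :: "(real \<Rightarrow> complex) \<Rightarrow> bool" where
  "square_integrable u \<longleftrightarrow>
     u \<in> borel_measurable lborel \<and> (\<integral>\<^sup>+ t. ennreal (norm (u t) powr 2) \<partial>lborel) < \<infinity>"

text \<open>Test functions are of class C1 with compact support, as in Brezis' definition of Sobolev
  spaces on intervals; smooth test functions yield the same weak derivatives.\<close>

definition test_function :: "(real \<Rightarrow> real) \<Rightarrow> bool" where
  "test_function \<phi> \<longleftrightarrow> \<phi> C1_differentiable_on UNIV \<and> compact (closure {t. \<phi> t \<noteq> 0})"

definition is_weak_deriv :: "(real \<Rightarrow> complex) \<Rightarrow> (real \<Rightarrow> complex) \<Rightarrow> bool" where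
  "is_weak_deriv u v \<longleftrightarrow>
     (\<forall>a b. set_integrable lborel {a..b} v) \<and>
     (\<forall>\<phi>. test_function \<phi> \<longrightarrow>
        (LINT t|lborel. deriv \<phi> t *\<^sub>R u t) = - (LINT t|lborel. \<phi> t *\<^sub>R v t))"

text \<open>Weak derivatives are unique up to null sets, so the choice does not affect any integral.\<close>

definition weak_deriv :: "(real \<Rightarrow> complex) \<Rightarrow> real \<Rightarrow> complex" where
  "weak_deriv u = (SOME v. is_weak_deriv u v)"

text \<open>Elements of the Sobolev space are represented by their unique continuous representatives.\<close>

definition H1_real :: "(real \<Rightarrow> complex) set" where
  "H1_real = {u. continuous_on UNIV u \<and> square_integrable u \<and>
                 (\<exists>v. is_weak_deriv u v \<and> square_integrable v)}"

section \<open>The three-dimensional grid\<close>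

datatype axis = XAxis | YAxis | ZAxis

text \<open>Arc-length parametrisations of the lines \<open>X\<^sub>j\<^sub>,\<^sub>k\<close>, \<open>Y\<^sub>i\<^sub>,\<^sub>k\<close>, \<open>Z\<^sub>i\<^sub>,\<^sub>j\<close>; the two integers are
  the subscripts, in this order.\<close>

fun grid_line :: "real \<Rightarrow> axis \<Rightarrow> int \<Rightarrow> int \<Rightarrow> real \<Rightarrow> real ^ 3" where
  "grid_line l XAxis j k t = vector [t, of_int j * l, of_int k * l]"
| "grid_line l YAxis i k t = vector [of_int i * l, t, of_int k * l]"
| "grid_line l ZAxis i j t = vector [of_int i * l, of_int j * l, t]"

definition grid :: "real \<Rightarrow> (real ^ 3) set" where
  "grid l = (\<Union>a m n. range (grid_line l a m n))"

definition grid_vertices :: "real \<Rightarrow> (real ^ 3) set" where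
  "grid_vertices l = {vector [of_int i * l, of_int j * l, of_int k * l] | i j k :: int. True}"

section \<open>Function spaces and energy on the grid\<close>

text \<open>A function on the grid is given by a function on the ambient space, of which only the values
  on the grid are ever used. The derivative has a separate value for each line through a vertex,
  so integrands are represented as families of functions indexed by the lines.\<close>

type_synonym line_family = "axis \<Rightarrow> int \<Rightarrow> int \<Rightarrow> real \<Rightarrow> complex"

definition grid_restrict :: "real \<Rightarrow> (real ^ 3 \<Rightarrow> complex) \<Rightarrow> line_family" where
  "grid_restrict l \<psi> = (\<lambda>a m n t. \<psi> (grid_line l a m n t))"

definition grid_deriv :: "real \<Rightarrow> (real ^ 3 \<Rightarrow> complex) \<Rightarrow> line_family" where
  "grid_deriv l \<psi> = (\<lambda>a m n. weak_deriv (grid_restrict l \<psi> a m n))"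

text \<open>The \<open>p\<close>-th power of the \<open>L\<^sup>p\<close> norm, with values in \<open>[0, \<infinity>]\<close>.\<close>

definition Lp_norm_pow :: "real \<Rightarrow> line_family \<Rightarrow> ennreal" where
  "Lp_norm_pow p f =
     (\<Sum>\<^sub>\<infinity>(j, k)\<in>UNIV. \<integral>\<^sup>+ t. ennreal (norm (f XAxis j k t) powr p) \<partial>lborel) +
     (\<Sum>\<^sub>\<infinity>(i, k)\<in>UNIV. \<integral>\<^sup>+ t. ennreal (norm (f YAxis i k t) powr p) \<partial>lborel) +
     (\<Sum>\<^sub>\<infinity>(i, j)\<in>UNIV. \<integral>\<^sup>+ t. ennreal (norm (f ZAxis i j t) powr p) \<partial>lborel)"

definition H1_norm_sq :: "real \<Rightarrow> (real ^ 3 \<Rightarrow> complex) \<Rightarrow> ennreal" where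
  "H1_norm_sq l \<psi> = Lp_norm_pow 2 (grid_restrict l \<psi>) + Lp_norm_pow 2 (grid_deriv l \<psi>)"

definition H1_grid :: "real \<Rightarrow> (real ^ 3 \<Rightarrow> complex) set" where
  "H1_grid l = {\<psi>. (\<forall>a m n. grid_restrict l \<psi> a m n \<in> H1_real) \<and>
                    (\<forall>v\<in>grid_vertices l. continuous (at v within grid l) \<psi>) \<and>
                    H1_norm_sq l \<psi> < \<infinity>}"

text \<open>For functions in \<open>H1_grid l\<close> and \<open>p > 2\<close> all norms below are finite, so \<open>enn2real\<close> only
  changes the type.\<close>

definition grid_mass :: "real \<Rightarrow> (real ^ 3 \<Rightarrow> complex) \<Rightarrow> real" where
  "grid_mass l \<psi> = enn2real (Lp_norm_pow 2 (grid_restrict l \<psi>))"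

definition grid_energy :: "real \<Rightarrow> real \<Rightarrow> (real ^ 3 \<Rightarrow> complex) \<Rightarrow> real" where
  "grid_energy l p \<psi> =
     1 / 2 * enn2real (Lp_norm_pow 2 (grid_deriv l \<psi>))
     - 1 / p * enn2real (Lp_norm_pow p (grid_restrict l \<psi>))"

definition ground_state :: "real \<Rightarrow> real \<Rightarrow> real \<Rightarrow> (real ^ 3 \<Rightarrow> complex) \<Rightarrow> bool" where
  "ground_state l p \<mu> \<psi> \<longleftrightarrow>
     \<psi> \<in> H1_grid l \<and> grid_mass l \<psi> = \<mu> \<and>
     (\<forall>\<phi>\<in>H1_grid l. grid_mass l \<phi> = \<mu> \<longrightarrow> grid_energy l p \<psi> \<le> grid_energy l p \<phi>)"

end

(*
  A continuous function on a line has the weak derivative v iff it is a primitive of v, and the grid becomes the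
  measure space of countably many lines. Applying the Loomis-Whitney inequality to the total variation
  of |u|^4 along the lines gives the Sobolev bound of ||u||_6^6 by ||u'||_2^6, besides the
  one-dimensional bound of |u|^2 by ||u||_2 ||u'||_2. Interpolation shows that small masses have
  positive energy when p >= 10/3, while for p < 10/3 slowly decaying exponentials have negative energy,
  as has a large multiple of any nonzero function for every p > 2. The critical mass for p < 6 is the infimum of the
  masses admitting negative energy.

  For p < 6 a minimising sequence that does not vanish is translated to have a nonzero pointwise
  limit. Splitting it by sin^2 + cos^2 = 1 into a piece near and a piece far from the origin, and using
  that scaling the mass up lowers the energy superlinearly, shows that no mass is lost; the
  parallelogram identity then makes the derivatives converge strongly. At the critical mass with
  10/3 < p < 6 functions of negative energy with masses decreasing to it do not vanish, since vanishing
  would force positive energy.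

  For p = 6 and M = sup |u|, put H(s) = s sqrt((M^4 - s^4) / 3). Then
  |u'|^2 + H(|u|)^2 >= 2 |u'| H(|u|), and integrating along a line on which |u| comes close to M gives
  2 E(u) >= M^4/3 (sqrt 3 pi / 2 - mass). Equality would force |u'| <= c |u|, hence u would have no zero
  on some line, and a line crossing it contributes an additional positive amount. Conversely a truncated
  soliton concentrated in one edge has energy tending to minus infinity as soon as the mass exceeds sqrt 3 pi / 2.
*)

theory Submission
  imports Defs "HOL-Complex_Analysis.Great_Picard" "HOL-Real_Asymp.Real_Asymp"
begin

section \<open>Primitives of locally integrable functions\<close>

text \<open>The grid is one-dimensional at small scales and three-dimensional at large ones, and has
  lattice translations but no dilations. This explains both exponents: \<open>10/3 = 2 + 4/3\<close>
  and \<open>6 = 2 + 4/1\<close> are the mass-critical powers in dimensions 3 and 1. For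
  \<open>p < 6\<close> the one-dimensional inequality bounds the kinetic term by the energy, so
  concentration cannot occur and only vanishing and escape of mass remain. At the critical mass
  vanishing is excluded by a sup bound with exponent \<open>p - 10/3\<close>, which is void at
  \<open>p = 10/3\<close>; hence no claim is made there. Weak compactness is avoided: limits of
  functions are pointwise, and derivatives converge because they form a Cauchy sequence in L2.

  Calculus uses \<open>is_primitive\<close> instead of pointwise derivatives: absolute continuity
  means being the integral of some locally integrable \<open>v\<close>. Borel measurability belongs
  to the notion so that derivatives chosen line by line are measurable on the whole grid.\<close>

definition is_primitive :: "(real \<Rightarrow> 'a::euclidean_space) \<Rightarrow> (real \<Rightarrow> 'a) \<Rightarrow> bool" where
  "is_primitive u v \<longleftrightarrow> v \<in> borel_measurable borel \<and>
     (\<forall>a b. set_integrable lborel {a..b} v) \<and>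
     (\<forall>a b. a \<le> b \<longrightarrow> u b - u a = (LINT t:{a..b}|lborel. v t))"

lemma is_primitiveD:
  assumes "is_primitive u v"
  shows "v \<in> borel_measurable borel" "set_integrable lborel {a..b} v"
    "a \<le> b \<Longrightarrow> u b - u a = (LINT t:{a..b}|lborel. v t)"
  using assms by (auto simp: is_primitive_def)

lemma set_lebesgue_integral_combine:
  fixes v :: "real \<Rightarrow> 'a::euclidean_space"
  assumes "set_integrable lborel {a..c} v" "a \<le> b" "b \<le> c"
  shows "(LINT t:{a..c}|lborel. v t) = (LINT t:{a..b}|lborel. v t) + (LINT t:{b..c}|lborel. v t)"
proof -
  have 1: "set_integrable lborel {a..b} v" "set_integrable lborel {b..c} v"
    by (rule set_integrable_subset[OF assms(1)]; use assms in auto)+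
  show ?thesis
    using set_borel_integral_eq_integral[OF assms(1)] set_borel_integral_eq_integral[OF 1(1)]
      set_borel_integral_eq_integral[OF 1(2)]
      Henstock_Kurzweil_Integration.integral_combine[OF assms(2,3), of v] by simp
qed

lemma is_primitive_continuous:
  fixes u :: "real \<Rightarrow> 'a::euclidean_space"
  assumes "is_primitive u v"
  shows "continuous_on UNIV u"
proof -
  have "continuous (at x) u" for x
  proof -
    have int: "v integrable_on {x-1..x+1}"
      using set_borel_integral_eq_integral[OF is_primitiveD(2)[OF assms]] by simp
    have "continuous_on {x-1..x+1} (\<lambda>t. u (x-1) + integral {x-1..t} v)"
      by (intro continuous_intros indefinite_integral_continuous_1 int)
    moreover have "u (x-1) + integral {x-1..t} v = u t" if "t \<in> {x-1..x+1}" for t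
      using is_primitiveD(3)[OF assms, of "x-1" t] that
        set_borel_integral_eq_integral[OF is_primitiveD(2)[OF assms, of "x-1" t]] by (simp add: algebra_simps)
    ultimately have "continuous_on {x-1..x+1} u" by (metis (no_types, lifting) continuous_on_cong)
    then show ?thesis
      by (rule continuous_on_interior) (auto simp: interior_atLeastAtMost_real)
  qed
  then show ?thesis by (simp add: continuous_at_imp_continuous_on)
qed

lemma is_primitive_borel:
  assumes "is_primitive u v" shows "u \<in> borel_measurable borel"
  using is_primitive_continuous[OF assms] by (rule borel_measurable_continuous_onI)

text \<open>A local version of the fundamental theorem, with an error controlled by an integral, is
  globalised by bisection. All product and chain rules below are instances.\<close>

lemma local_primitive_imp_global:
  fixes W :: "real \<Rightarrow> 'a::euclidean_space" and w :: "real \<Rightarrow> 'a" and k :: "real \<Rightarrow> real"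
  assumes "a \<le> b" and w: "set_integrable lborel {a..b} w" and k: "set_integrable lborel {a..b} k"
    and loc: "\<And>\<epsilon> x. \<epsilon> > 0 \<Longrightarrow> a \<le> x \<Longrightarrow> x \<le> b \<Longrightarrow> \<exists>d>0. \<forall>c e. a \<le> c \<and> c \<le> x \<and> x \<le> e \<and> e \<le> b \<and> e - c < d \<longrightarrow>
        norm (W e - W c - (LINT t:{c..e}|lborel. w t)) \<le> \<epsilon> * (LINT t:{c..e}|lborel. k t)"
  shows "W b - W a = (LINT t:{a..b}|lborel. w t)"
proof -
  have *: "norm (W b - W a - (LINT t:{a..b}|lborel. w t)) \<le> \<epsilon> * (LINT t:{a..b}|lborel. k t)" if "\<epsilon> > 0" for \<epsilon>
  proof -
    define P where "P c e \<longleftrightarrow> (a \<le> c \<longrightarrow> c \<le> e \<longrightarrow> e \<le> b \<longrightarrow>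
       norm (W e - W c - (LINT t:{c..e}|lborel. w t)) \<le> \<epsilon> * (LINT t:{c..e}|lborel. k t))" for c e
    \<comment> \<open>Bisection: the estimate is additive under concatenation of intervals, and
      \<open>loc\<close> gives it on all short intervals around each point.\<close>
    have "P a b" using \<open>a \<le> b\<close>
    proof (induction rule: Bolzano)
      case (trans c d e)
      show ?case unfolding P_def
      proof (intro impI)
        assume H: "a \<le> c" "c \<le> e" "e \<le> b"
        have sw: "set_integrable lborel {c..e} w" "set_integrable lborel {c..e} k"
          by (rule set_integrable_subset[OF w] set_integrable_subset[OF k]; use H in auto)+
        have "norm (W e - W c - (LINT t:{c..e}|lborel. w t)) =
          norm ((W d - W c - (LINT t:{c..d}|lborel. w t)) + (W e - W d - (LINT t:{d..e}|lborel. w t)))"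
          using set_lebesgue_integral_combine[OF sw(1) trans(3,4)] by (simp add: algebra_simps)
        also have "\<dots> \<le> \<epsilon> * (LINT t:{c..d}|lborel. k t) + \<epsilon> * (LINT t:{d..e}|lborel. k t)"
          by (rule norm_triangle_le, rule add_mono) (use trans H in \<open>auto simp: P_def\<close>)
        also have "\<dots> = \<epsilon> * (LINT t:{c..e}|lborel. k t)"
          using set_lebesgue_integral_combine[OF sw(2) trans(3,4)] by (simp add: algebra_simps)
        finally show "norm (W e - W c - (LINT t:{c..e}|lborel. w t)) \<le> \<epsilon> * (LINT t:{c..e}|lborel. k t)" .
      qed
    next
      case (local x)
      then show ?case using loc[OF that, of x] unfolding P_def by blast
    qed
    then show ?thesis using \<open>a \<le> b\<close> by (simp add: P_def)
  qed
  \<comment> \<open>The right-hand integral does not depend on \<open>\<epsilon>\<close>, so letting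
    \<open>\<epsilon>\<close> tend to 0 forces the defect to vanish.\<close>
  have "((\<lambda>\<epsilon>. \<epsilon> * (LINT t:{a..b}|lborel. k t)) \<longlongrightarrow> 0 * (LINT t:{a..b}|lborel. k t)) (at_right 0)"
    by (intro tendsto_intros)
  moreover have "eventually (\<lambda>\<epsilon>. norm (W b - W a - (LINT t:{a..b}|lborel. w t)) \<le> \<epsilon> * (LINT t:{a..b}|lborel. k t)) (at_right 0)"
    using * by (intro eventually_at_rightI[of 0 1]) auto
  ultimately have "norm (W b - W a - (LINT t:{a..b}|lborel. w t)) \<le> 0"
    by (intro tendsto_lowerbound) (auto simp: trivial_limit_at_right_real)
  then show ?thesis by simp
qed

lemma set_integrable_bounded_mult:
  fixes f :: "real \<Rightarrow> 'a::euclidean_space" and h :: "real \<Rightarrow> 'b::euclidean_space"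
  assumes f: "set_integrable lborel A f" and A: "A \<in> sets borel"
    and h[measurable]: "h \<in> borel_measurable borel"
    and b: "\<And>t. t \<in> A \<Longrightarrow> norm (h t) \<le> C * norm (f t)"
  shows "set_integrable lborel A h"
  by (rule set_integrable_bound[of lborel A "\<lambda>t. C *\<^sub>R f t"])
    (use assms in \<open>auto simp: set_borel_measurable_def abs_mult intro!: set_integrable_scaleR_right order_trans[OF b] mult_right_mono\<close>)

lemma continuous_bounded_Icc:
  fixes u :: "real \<Rightarrow> 'a::euclidean_space"
  assumes "continuous_on UNIV u"
  obtains B where "B > 0" "\<And>t. t \<in> {a..b} \<Longrightarrow> norm (u t) \<le> B"
proof -
  have "compact (u ` {a..b})"
    by (intro compact_continuous_image continuous_on_subset[OF assms]) auto
  then have "bounded (u ` {a..b})" by (rule compact_imp_bounded)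
  then show ?thesis using that by (auto simp: bounded_pos)
qed

text \<open>One product rule serves scaling (test functions, cut-offs), the inner product (squared
  modulus) and multiplication (fourth powers, exponential weights). On a short interval both factors
  are almost constant, so the error is their oscillation times the integral of
  \<open>norm f + norm g\<close>.\<close>

lemma is_primitive_bilinear:
  fixes F :: "real \<Rightarrow> 'a::euclidean_space" and G :: "real \<Rightarrow> 'b::euclidean_space"
    and pr :: "'a \<Rightarrow> 'b \<Rightarrow> 'c::euclidean_space"
  assumes bl: "bounded_bilinear pr" and F: "is_primitive F f" and G: "is_primitive G g"
  shows "is_primitive (\<lambda>t. pr (F t) (G t)) (\<lambda>t. pr (f t) (G t) + pr (F t) (g t))"
proof -
  interpret bounded_bilinear pr by (rule bl)
  obtain K where K: "K > 0" "\<And>a b. norm (pr a b) \<le> norm a * norm b * K" using pos_bounded by blast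
  have prm: "(\<lambda>t. pr (x t) (y t)) \<in> borel_measurable borel" if "x \<in> borel_measurable borel" "y \<in> borel_measurable borel"
    for x y :: "real \<Rightarrow> _"
  proof -
    have "continuous_on UNIV (\<lambda>z. pr (fst z) (snd z))"
      by (rule bounded_bilinear.continuous_on[OF bl]) (auto intro!: continuous_intros)
    then show ?thesis by (rule borel_measurable_continuous_Pair[OF that])
  qed
  note cF = is_primitive_continuous[OF F] and cG = is_primitive_continuous[OF G]
  note mF[measurable] = is_primitive_borel[OF F] is_primitiveD(1)[OF F]
  note mG[measurable] = is_primitive_borel[OF G] is_primitiveD(1)[OF G]
  have i1: "set_integrable lborel {a..b} (\<lambda>t. pr (f t) (y t))" if y: "continuous_on UNIV y" for y :: "real \<Rightarrow> 'b" and a b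
  proof -
    obtain B where B: "B > 0" "\<And>t. t \<in> {a..b} \<Longrightarrow> norm (y t) \<le> B" using continuous_bounded_Icc[OF y] by blast
    have "norm (pr (f t) (y t)) \<le> (B * K) * norm (f t)" if "t \<in> {a..b}" for t
    proof -
      have "norm (f t) * norm (y t) * K \<le> norm (f t) * B * K"
        by (intro mult_right_mono mult_left_mono B that) (use K in auto)
      then show ?thesis using K(2)[of "f t" "y t"] by (simp add: mult_ac)
    qed
    then show ?thesis
      by (intro set_integrable_bounded_mult[OF is_primitiveD(2)[OF F, of a b]] prm mF borel_measurable_continuous_onI[OF y]) auto
  qed
  have i2: "set_integrable lborel {a..b} (\<lambda>t. pr (y t) (g t))" if y: "continuous_on UNIV y" for y :: "real \<Rightarrow> 'a" and a b
  proof -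
    obtain B where B: "B > 0" "\<And>t. t \<in> {a..b} \<Longrightarrow> norm (y t) \<le> B" using continuous_bounded_Icc[OF y] by blast
    have "norm (pr (y t) (g t)) \<le> (B * K) * norm (g t)" if "t \<in> {a..b}" for t
    proof -
      have "norm (y t) * norm (g t) * K \<le> B * norm (g t) * K"
        by (intro mult_right_mono B that) (use K in auto)
      then show ?thesis using K(2)[of "y t" "g t"] by (simp add: mult_ac)
    qed
    then show ?thesis
      by (intro set_integrable_bounded_mult[OF is_primitiveD(2)[OF G, of a b]] prm mG borel_measurable_continuous_onI[OF y]) auto
  qed
  have int: "set_integrable lborel {a..b} (\<lambda>t. pr (f t) (G t) + pr (F t) (g t))" for a b
    using set_integral_add(1)[OF i1[OF cG] i2[OF cF]] .
  have nf: "set_integrable lborel {a..b} (\<lambda>t. norm (f t))" "set_integrable lborel {a..b} (\<lambda>t. norm (g t))" for a b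
    using is_primitiveD(2)[OF F, of a b] is_primitiveD(2)[OF G, of a b] by (auto intro!: set_integrable_norm)
  show ?thesis unfolding is_primitive_def
  proof (intro conjI allI impI)
    show "(\<lambda>t. pr (f t) (G t) + pr (F t) (g t)) \<in> borel_measurable borel"
      by (intro borel_measurable_add prm) measurable
    show "set_integrable lborel {a..b} (\<lambda>t. pr (f t) (G t) + pr (F t) (g t))" for a b by (rule int)
    fix a b :: real assume "a \<le> b"
    show "pr (F b) (G b) - pr (F a) (G a) = (LINT t:{a..b}|lborel. pr (f t) (G t) + pr (F t) (g t))"
    proof (rule local_primitive_imp_global[OF \<open>a \<le> b\<close> int, where k = "\<lambda>t. K * (norm (f t) + norm (g t))"])
      show "set_integrable lborel {a..b} (\<lambda>t. K * (norm (f t) + norm (g t)))"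
        by (intro set_integrable_mult_right impI set_integral_add(1) nf)
      fix \<epsilon> x :: real assume "\<epsilon> > 0" "a \<le> x" "x \<le> b"
      have "isCont F x" "isCont G x" using cF cG by (auto simp: continuous_on_eq_continuous_at)
      then obtain d1 d2 where d: "d1 > 0" "\<And>y. dist y x < d1 \<Longrightarrow> dist (F y) (F x) < \<epsilon>/2"
        "d2 > 0" "\<And>y. dist y x < d2 \<Longrightarrow> dist (G y) (G x) < \<epsilon>/2"
        using \<open>\<epsilon> > 0\<close> unfolding continuous_at_eps_delta by (metis half_gt_zero)
      show "\<exists>d>0. \<forall>c e. a \<le> c \<and> c \<le> x \<and> x \<le> e \<and> e \<le> b \<and> e - c < d \<longrightarrow>
         norm (pr (F e) (G e) - pr (F c) (G c) - (LINT t:{c..e}|lborel. pr (f t) (G t) + pr (F t) (g t)))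
            \<le> \<epsilon> * (LINT t:{c..e}|lborel. K * (norm (f t) + norm (g t)))"
      proof (intro exI conjI allI impI)
        show "min d1 d2 > 0" using d by simp
        fix c e assume H: "a \<le> c \<and> c \<le> x \<and> x \<le> e \<and> e \<le> b \<and> e - c < min d1 d2"
        have near: "dist (F t) (F s) \<le> \<epsilon>" "dist (G t) (G s) \<le> \<epsilon>" if "t \<in> {c..e}" "s \<in> {c..e}" for t s
          using d(2)[of t] d(2)[of s] d(4)[of t] d(4)[of s] that H
            dist_triangle_half_l[of "F t" "F x" \<epsilon> "F s"] dist_triangle_half_l[of "G t" "G x" \<epsilon> "G s"]
          by (auto simp: dist_real_def dist_commute)
        have ce: "c \<le> e" using H by simp
        \<comment> \<open>Only one factor varies in each summand, so the constant factor can be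
          moved into the integral of \<open>f\<close> or \<open>g\<close>.\<close>
        have "pr (F e) (G e) - pr (F c) (G c) = pr (F e - F c) (G e) + pr (F c) (G e - G c)"
          by (simp add: diff_left diff_right)
        also have "pr (F e - F c) (G e) = (LINT t:{c..e}|lborel. pr (f t) (G e))"
          unfolding is_primitiveD(3)[OF F ce] set_lebesgue_integral_def
          using integral_bounded_linear[OF bounded_linear_left[of "G e"], of lborel "\<lambda>t. indicator {c..e} t *\<^sub>R f t"] is_primitiveD(2)[OF F, of c e]
          by (simp add: scaleR_left set_integrable_def)
        also have "pr (F c) (G e - G c) = (LINT t:{c..e}|lborel. pr (F c) (g t))"
          unfolding is_primitiveD(3)[OF G ce] set_lebesgue_integral_def
          using integral_bounded_linear[OF bounded_linear_right[of "F c"], of lborel "\<lambda>t. indicator {c..e} t *\<^sub>R g t"] is_primitiveD(2)[OF G, of c e]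
          by (simp add: scaleR_right set_integrable_def)
        also have "(LINT t:{c..e}|lborel. pr (f t) (G e)) + (LINT t:{c..e}|lborel. pr (F c) (g t))
           = (LINT t:{c..e}|lborel. pr (f t) (G e) + pr (F c) (g t))"
          by (rule set_integral_add(2)[symmetric]) (auto intro!: i1 i2 continuous_intros)
        finally have "pr (F e) (G e) - pr (F c) (G c) - (LINT t:{c..e}|lborel. pr (f t) (G t) + pr (F t) (g t)) =
            (LINT t:{c..e}|lborel. (pr (f t) (G e) + pr (F c) (g t)) - (pr (f t) (G t) + pr (F t) (g t)))"
          by (simp only:, intro set_integral_diff(2)[symmetric] int set_integral_add(1)) (auto intro!: i1 i2 continuous_intros)
        also have "norm \<dots> \<le> (LINT t:{c..e}|lborel. norm ((pr (f t) (G e) + pr (F c) (g t)) - (pr (f t) (G t) + pr (F t) (g t))))"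
          by (intro set_integral_norm_bound set_integral_diff(1) set_integral_add(1) int) (auto intro!: i1 i2 continuous_intros)
        also have "\<dots> \<le> (LINT t:{c..e}|lborel. \<epsilon> * (K * (norm (f t) + norm (g t))))"
        proof (rule set_integral_mono)
          show "set_integrable lborel {c..e} (\<lambda>t. norm ((pr (f t) (G e) + pr (F c) (g t)) - (pr (f t) (G t) + pr (F t) (g t))))"
            by (intro set_integrable_norm set_integral_diff(1) set_integral_add(1) int) (auto intro!: i1 i2 continuous_intros)
          show "set_integrable lborel {c..e} (\<lambda>t. \<epsilon> * (K * (norm (f t) + norm (g t))))"
            by (intro set_integrable_mult_right impI set_integral_add(1) nf)
          fix t assume t: "t \<in> {c..e}"
          have "(pr (f t) (G e) + pr (F c) (g t)) - (pr (f t) (G t) + pr (F t) (g t)) = pr (f t) (G e - G t) + pr (F c - F t) (g t)"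
            by (simp add: diff_left diff_right)
          also have "norm \<dots> \<le> norm (f t) * norm (G e - G t) * K + norm (F c - F t) * norm (g t) * K"
            by (intro norm_triangle_le add_mono K)
          also have "\<dots> \<le> norm (f t) * \<epsilon> * K + \<epsilon> * norm (g t) * K"
            using near(1)[of c t] near(2)[of e t] t ce K(1)
            by (intro add_mono mult_right_mono mult_left_mono) (auto simp: dist_norm)
          finally show "norm ((pr (f t) (G e) + pr (F c) (g t)) - (pr (f t) (G t) + pr (F t) (g t))) \<le> \<epsilon> * (K * (norm (f t) + norm (g t)))"
            by (simp add: algebra_simps)
        qed
        also have "\<dots> = \<epsilon> * (LINT t:{c..e}|lborel. K * (norm (f t) + norm (g t)))" by simp
        finally show "norm (pr (F e) (G e) - pr (F c) (G c) - (LINT t:{c..e}|lborel. pr (f t) (G t) + pr (F t) (g t)))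
            \<le> \<epsilon> * (LINT t:{c..e}|lborel. K * (norm (f t) + norm (g t)))" .
      qed
    qed
  qed
qed

lemma is_primitive_linear:
  fixes u :: "real \<Rightarrow> 'a::euclidean_space" and L :: "'a \<Rightarrow> 'b::euclidean_space"
  assumes L: "bounded_linear L" and u: "is_primitive u v"
  shows "is_primitive (\<lambda>t. L (u t)) (\<lambda>t. L (v t))"
proof -
  interpret L: bounded_linear L by (rule L)
  note [measurable] = is_primitiveD(1)[OF u]
  have i: "integrable lborel (\<lambda>t. indicator {a..b} t *\<^sub>R v t)" for a b
    using is_primitiveD(2)[OF u, of a b] by (simp add: set_integrable_def)
  show ?thesis unfolding is_primitive_def
  proof (intro conjI allI impI)
    show "(\<lambda>t. L (v t)) \<in> borel_measurable borel"
      using borel_measurable_continuous_onI[OF L.continuous_on[OF continuous_on_id]] by measurable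
    show "set_integrable lborel {a..b} (\<lambda>t. L (v t))" for a b
      using integrable_bounded_linear[OF L i[of a b]] by (simp add: set_integrable_def L.scaleR)
    show "L (u b) - L (u a) = (LINT t:{a..b}|lborel. L (v t))" if "a \<le> b" for a b
      using is_primitiveD(3)[OF u that] integral_bounded_linear[OF L i[of a b]]
      by (simp add: set_lebesgue_integral_def L.scaleR flip: L.diff)
  qed
qed

lemma is_primitive_add:
  assumes "is_primitive u v" "is_primitive u' v'"
  shows "is_primitive (\<lambda>t. u t + u' t) (\<lambda>t. v t + v' t)"
  unfolding is_primitive_def
proof (intro conjI allI impI)
  show "(\<lambda>t. v t + v' t) \<in> borel_measurable borel"
    using assms by (intro borel_measurable_add) (auto dest: is_primitiveD)
  show "set_integrable lborel {a..b} (\<lambda>t. v t + v' t)" for a b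
    by (intro set_integral_add(1) is_primitiveD(2)[OF assms(1)] is_primitiveD(2)[OF assms(2)])
  show "u b + u' b - (u a + u' a) = (LINT t:{a..b}|lborel. v t + v' t)" if "a \<le> b" for a b
    using is_primitiveD(2,3)[OF assms(1), where a=a and b=b] is_primitiveD(2,3)[OF assms(2), where a=a and b=b] that
    by (simp add: set_integral_add(2) algebra_simps)
qed

text \<open>The finite exceptional set admits kinks: the peak of
  \<open>exp (- \<epsilon> * \<bar>t\<bar>)\<close> at 0 and the two ends of the truncated soliton.
  Local boundedness of \<open>v\<close> supplies its local integrability.\<close>

lemma is_primitive_FTC:
  fixes u :: "real \<Rightarrow> 'a::euclidean_space"
  assumes u: "continuous_on UNIV u" and S: "finite S"
    and d: "\<And>x. x \<notin> S \<Longrightarrow> (u has_vector_derivative v x) (at x)"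
    and v[measurable]: "v \<in> borel_measurable borel"
    and B: "\<And>a b. \<exists>B. \<forall>t\<in>{a..b}. norm (v t) \<le> B"
  shows "is_primitive u v"
  unfolding is_primitive_def
proof (intro conjI allI impI)
  show I: "set_integrable lborel {a..b} v" for a b
  proof -
    obtain B where "\<forall>t\<in>{a..b}. norm (v t) \<le> B" using B by blast
    moreover have "set_integrable lborel {a..b} (\<lambda>t. 1::real)" by (intro borel_integrable_atLeastAtMost' continuous_intros)
    ultimately show ?thesis
      by - (rule set_integrable_bounded_mult[where f="\<lambda>t. 1::real" and C=B], auto simp: v)
  qed
  fix a b :: real assume "a \<le> b"
  have "(v has_integral (u b - u a)) {a..b}"
    by (rule fundamental_theorem_of_calculus_interior_strong[OF S \<open>a \<le> b\<close> d])
       (auto intro: continuous_on_subset[OF u])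
  then show "u b - u a = (LINT t:{a..b}|lborel. v t)"
    using set_borel_integral_eq_integral[OF I[of a b]] by (simp add: integral_unique)
qed (fact v)

text \<open>The outer function lives only on \<open>{lo..hi}\<close>, with derivatives within that
  interval, because it is applied to the antiderivative \<open>level_cost\<close> on
  \<open>{0..R}\<close>, whose argument may reach the end points.\<close>

lemma is_primitive_chain:
  fixes f :: "real \<Rightarrow> real"
  assumes f: "is_primitive f g" and J: "\<And>t. f t \<in> {lo..hi}"
    and d: "\<And>x. x \<in> {lo..hi} \<Longrightarrow> (\<Phi> has_real_derivative \<phi> x) (at x within {lo..hi})"
    and c: "continuous_on {lo..hi} \<phi>"
  shows "is_primitive (\<lambda>t. \<Phi> (f t)) (\<lambda>t. \<phi> (f t) * g t)"
proof -
  note cf = is_primitive_continuous[OF f]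
  have cp: "continuous_on UNIV (\<lambda>t. \<phi> (f t))"
    by (rule continuous_on_compose2[OF c cf]) (use J in auto)
  note [measurable] = is_primitiveD(1)[OF f] borel_measurable_continuous_onI[OF cp]
  have int: "set_integrable lborel {a..b} (\<lambda>t. \<phi> (f t) * g t)" for a b
  proof -
    obtain B where "B > 0" "\<And>t. t \<in> {a..b} \<Longrightarrow> norm (\<phi> (f t)) \<le> B"
      using continuous_bounded_Icc[OF cp] by blast
    then show ?thesis
      by (intro set_integrable_bounded_mult[OF is_primitiveD(2)[OF f], where C=B])
        (auto simp: abs_mult intro!: mult_right_mono)
  qed
  show ?thesis unfolding is_primitive_def
  proof (intro conjI allI impI)
    show "(\<lambda>t. \<phi> (f t) * g t) \<in> borel_measurable borel" by measurable
    show "set_integrable lborel {a..b} (\<lambda>t. \<phi> (f t) * g t)" for a b by (rule int)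
    fix a b :: real assume "a \<le> b"
    show "\<Phi> (f b) - \<Phi> (f a) = (LINT t:{a..b}|lborel. \<phi> (f t) * g t)"
    proof (rule local_primitive_imp_global[OF \<open>a \<le> b\<close> int, where k = "\<lambda>t. \<bar>g t\<bar>"])
      show "set_integrable lborel {a..b} (\<lambda>t. \<bar>g t\<bar>)"
        by (intro set_integrable_abs is_primitiveD(2)[OF f])
      fix \<epsilon> x :: real assume "\<epsilon> > 0" "a \<le> x" "x \<le> b"
      have "isCont (\<lambda>t. \<phi> (f t)) x" using cp by (auto simp: continuous_on_eq_continuous_at)
      then obtain d where d0: "d > 0" "\<And>y. dist y x < d \<Longrightarrow> dist (\<phi> (f y)) (\<phi> (f x)) < \<epsilon>/2"
        using \<open>\<epsilon> > 0\<close> unfolding continuous_at_eps_delta by (metis half_gt_zero)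
      show "\<exists>d>0. \<forall>c e. a \<le> c \<and> c \<le> x \<and> x \<le> e \<and> e \<le> b \<and> e - c < d \<longrightarrow>
         norm (\<Phi> (f e) - \<Phi> (f c) - (LINT t:{c..e}|lborel. \<phi> (f t) * g t))
            \<le> \<epsilon> * (LINT t:{c..e}|lborel. \<bar>g t\<bar>)"
      proof (intro exI conjI allI impI)
        show "d > 0" using d0 by simp
        fix c e assume H: "a \<le> c \<and> c \<le> x \<and> x \<le> e \<and> e \<le> b \<and> e - c < d"
        have near: "dist (\<phi> (f t)) (\<phi> (f s)) \<le> \<epsilon>" if "t \<in> {c..e}" "s \<in> {c..e}" for t s
          using d0(2)[of t] d0(2)[of s] that H
            dist_triangle_half_l[of "\<phi> (f t)" "\<phi> (f x)" \<epsilon> "\<phi> (f s)"]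
          by (auto simp: dist_real_def dist_commute)
        have ce: "c \<le> e" using H by simp
        have mvt: "\<exists>z. min p q \<le> z \<and> z \<le> max p q \<and> \<Phi> q - \<Phi> p = \<phi> z * (q - p)"
          if pq: "p \<in> {lo..hi}" "q \<in> {lo..hi}" for p q
        proof -
          have *: "\<exists>z. p \<le> z \<and> z \<le> q \<and> \<Phi> q - \<Phi> p = \<phi> z * (q - p)" if "p < q" "p \<in> {lo..hi}" "q \<in> {lo..hi}" for p q
          proof -
            have "\<exists>z\<in>{p<..<q}. \<Phi> q - \<Phi> p = (\<lambda>h. h * \<phi> z) (q - p)"
            proof (rule mvt_simple[OF \<open>p < q\<close>])
              fix z assume "p \<le> z" "z \<le> q"
              then have "(\<Phi> has_real_derivative \<phi> z) (at z within {p..q})"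
                using that by (intro DERIV_subset[OF d]) auto
              then show "(\<Phi> has_derivative (\<lambda>h. h * \<phi> z)) (at z within {p..q})"
                by (simp add: has_field_derivative_def mult_commute_abs)
            qed
            then obtain z where "z \<in> {p<..<q}" "\<Phi> q - \<Phi> p = (q - p) * \<phi> z" by blast
            then show ?thesis by (intro exI[of _ z]) auto
          qed
          show ?thesis
          proof (cases p q rule: linorder_cases)
            case less then show ?thesis using *[OF less] pq by auto
          next
            case equal then show ?thesis by auto
          next
            case greater
            then obtain z where "q \<le> z" "z \<le> p" "\<Phi> p - \<Phi> q = \<phi> z * (p - q)" using *[OF greater] pq by auto
            then show ?thesis using greater by (intro exI[of _ z]) (auto simp: algebra_simps)
          qed
        qed
        obtain z where z: "min (f c) (f e) \<le> z" "z \<le> max (f c) (f e)" "\<Phi> (f e) - \<Phi> (f c) = \<phi> z * (f e - f c)"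
          using mvt[OF J J] by blast
        \<comment> \<open>The intermediate point of the mean value theorem is turned into a value
          \<open>f \<tau>\<close> with \<open>\<tau>\<close> in the same short interval; the
          continuity of \<open>\<phi>\<close> along \<open>f\<close> then controls the
          error.\<close>
        have "connected (f ` {c..e})"
          by (intro connected_continuous_image continuous_on_subset[OF cf]) auto
        then have "z \<in> f ` {c..e}"
          using z ce connectedD_interval[of "f ` {c..e}" "f c" "f e" z] connectedD_interval[of "f ` {c..e}" "f e" "f c" z]
          by (auto simp: min_def max_def split: if_splits)
        then obtain \<tau> where tau: "\<tau> \<in> {c..e}" "z = f \<tau>" by auto
        have i1: "set_integrable lborel {c..e} (\<lambda>t. \<phi> (f \<tau>) * g t)"
          by (intro set_integrable_mult_right impI is_primitiveD(2)[OF f])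
        have "\<Phi> (f e) - \<Phi> (f c) - (LINT t:{c..e}|lborel. \<phi> (f t) * g t) =
            (LINT t:{c..e}|lborel. \<phi> (f \<tau>) * g t) - (LINT t:{c..e}|lborel. \<phi> (f t) * g t)"
          using z(3) tau is_primitiveD(3)[OF f ce] by simp
        also have "\<dots> = (LINT t:{c..e}|lborel. \<phi> (f \<tau>) * g t - \<phi> (f t) * g t)"
          by (intro set_integral_diff(2)[symmetric] int i1)
        also have "norm \<dots> \<le> (LINT t:{c..e}|lborel. norm (\<phi> (f \<tau>) * g t - \<phi> (f t) * g t))"
          by (intro set_integral_norm_bound set_integral_diff(1) int i1)
        also have "\<dots> \<le> (LINT t:{c..e}|lborel. \<epsilon> * \<bar>g t\<bar>)"
        proof (rule set_integral_mono)
          show "set_integrable lborel {c..e} (\<lambda>t. norm (\<phi> (f \<tau>) * g t - \<phi> (f t) * g t))"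
            by (intro set_integrable_norm set_integral_diff(1) int i1)
          show "set_integrable lborel {c..e} (\<lambda>t. \<epsilon> * \<bar>g t\<bar>)"
            by (intro set_integrable_mult_right impI set_integrable_abs is_primitiveD(2)[OF f])
          fix t assume t: "t \<in> {c..e}"
          have "norm (\<phi> (f \<tau>) * g t - \<phi> (f t) * g t) = \<bar>\<phi> (f \<tau>) - \<phi> (f t)\<bar> * \<bar>g t\<bar>"
            by (simp add: abs_mult flip: left_diff_distrib)
          also have "\<dots> \<le> \<epsilon> * \<bar>g t\<bar>"
            using near[OF tau(1) t] by (intro mult_right_mono) (auto simp: dist_real_def)
          finally show "norm (\<phi> (f \<tau>) * g t - \<phi> (f t) * g t) \<le> \<epsilon> * \<bar>g t\<bar>" .
        qed
        finally show "norm (\<Phi> (f e) - \<Phi> (f c) - (LINT t:{c..e}|lborel. \<phi> (f t) * g t))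
            \<le> \<epsilon> * (LINT t:{c..e}|lborel. \<bar>g t\<bar>)" by simp
      qed
    qed
  qed
qed

text \<open>Cutting off to \<open>{-n..n}\<close> makes the function integrable on the line. Its
  integral then vanishes on every Borel set, since intervals form an intersection-stable generator
  and the sets with zero integral are closed under complements and disjoint unions.\<close>

lemma AE_eq_0_if_interval_integrals_eq_0:
  fixes v :: "real \<Rightarrow> 'a::euclidean_space"
  assumes int: "\<And>a b. set_integrable lborel {a..b} v"
    and z: "\<And>a b. a \<le> b \<Longrightarrow> (LINT t:{a..b}|lborel. v t) = 0"
  shows "AE t in lborel. v t = 0"
proof -
  have *: "AE t in lborel. indicator {-real n..real n} t *\<^sub>R v t = 0" for n
  proof -
    define f where "f t = indicator {-real n..real n} t *\<^sub>R v t" for t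
    have f: "integrable lborel f" using int[of "-real n" "real n"] by (simp add: set_integrable_def f_def[abs_def])
    have sf: "set_integrable lborel A f" if "A \<in> sets lborel" for A
      using f that unfolding set_integrable_def by (intro integrable_mult_indicator)
    have tot: "integral\<^sup>L lborel f = 0"
      using z[of "-real n" "real n"] by (simp add: set_lebesgue_integral_def f_def[abs_def])
    have I: "(LINT t:{a..b}|lborel. f t) = 0" for a b
    proof -
      have "(LINT t:{a..b}|lborel. f t) = (LINT t:{max a (-real n)..min b (real n)}|lborel. v t)"
        unfolding set_lebesgue_integral_def f_def
        by (intro Bochner_Integration.integral_cong) (auto simp: indicator_def)
      also have "\<dots> = 0"
      proof (cases "max a (-real n) \<le> min b (real n)")
        case True then show ?thesis using z by blast
      next
        case False then show ?thesis by (simp add: set_lebesgue_integral_def)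
      qed
      finally show ?thesis .
    qed
    have "AE t in lborel. f t = 0"
    proof (rule sigma_finite_measure.density_zero[OF sigma_finite_lborel f])
      fix A assume "A \<in> sets (lborel :: real measure)"
      then have A_in: "A \<in> sigma_sets UNIV (range (\<lambda>(a,b). {a..b::real}))"
        by (simp add: borel_eq_atLeastAtMost)
      have IS: "Int_stable (range (\<lambda>(a,b). {a..b::real}))"
        by (auto simp: Int_stable_def)
      have PU: "range (\<lambda>(a,b). {a..b::real}) \<subseteq> Pow UNIV" by simp
      show "(LINT t:A|lborel. f t) = 0" using A_in
      proof (induction rule: sigma_sets_induct_disjoint[OF IS PU, consumes 1, case_names basic empty compl union])
        case (basic A) then show ?case using I by auto
      next
        case empty then show ?case by (simp add: set_lebesgue_integral_def)
      next
        case (compl A)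
        then have A: "A \<in> sets lborel" by (simp add: borel_eq_atLeastAtMost)
        have "(LINT t:(A \<union> (UNIV - A))|lborel. f t) = (LINT t:A|lborel. f t) + (LINT t:(UNIV-A)|lborel. f t)"
          by (intro set_integral_Un sf) (use A in auto)
        then show ?case using compl tot by (simp add: set_lebesgue_integral_def)
      next
        case (union A)
        then have A: "A i \<in> sets lborel" for i using union(2) by (auto simp: borel_eq_atLeastAtMost)
        have "(LINT t:(\<Union>i. A i)|lborel. f t) = (\<Sum>i. LINT t:A i|lborel. f t)"
          by (rule lebesgue_integral_countable_add) (use A union(1) in \<open>auto intro!: sf simp: disjoint_family_on_def\<close>)
        then show ?case using union by simp
      qed
    qed
    then show ?thesis by (simp add: f_def)
  qed
  then have "AE t in lborel. \<forall>n. indicator {-real n..real n} t *\<^sub>R v t = 0"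
    unfolding AE_all_countable by blast
  then show ?thesis
  proof eventually_elim
    case (elim t)
    obtain n where "\<bar>t\<bar> \<le> real n" using real_arch_simple by blast
    then show ?case using elim[rule_format, of n] by (auto simp: indicator_def)
  qed
qed

lemma is_primitive_AE_unique:
  fixes v :: "real \<Rightarrow> 'a::euclidean_space"
  assumes "is_primitive u v" "is_primitive u w"
  shows "AE t in lborel. v t = w t"
proof -
  have "AE t in lborel. v t - w t = 0"
    using assms by (intro AE_eq_0_if_interval_integrals_eq_0) (auto simp: is_primitive_def)
  then show ?thesis by simp
qed

section \<open>Weak derivatives\<close>

lemma test_function_support:
  assumes "test_function \<phi>"
  obtains R where "R > 0" "\<And>t. \<bar>t\<bar> \<ge> R \<Longrightarrow> \<phi> t = 0" "\<And>t. \<bar>t\<bar> \<ge> R \<Longrightarrow> deriv \<phi> t = 0"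
proof -
  define S where "S = closure {t. \<phi> t \<noteq> 0}"
  have "bounded S" using assms compact_imp_bounded by (auto simp: S_def test_function_def)
  then obtain R where R: "R > 0" "\<And>t. t \<in> S \<Longrightarrow> \<bar>t\<bar> \<le> R" by (auto simp: bounded_pos)
  have out: "\<phi> t = 0" if "t \<notin> S" for t
    using that closure_subset[of "{t. \<phi> t \<noteq> 0}"] by (auto simp: S_def)
  have "deriv \<phi> t = 0" if "t \<notin> S" for t
  proof -
    have "open (- S)" by (simp add: S_def open_Compl)
    then have "(\<phi> has_field_derivative 0) (at t)"
      by - (rule has_field_derivative_transform_within_open[where f = "\<lambda>_. 0" and S = "- S"], use that out in auto)
    then show ?thesis by (rule DERIV_imp_deriv)
  qed
  moreover have "t \<notin> S" if "\<bar>t\<bar> \<ge> R + 1" for t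
    using R(2)[of t] that by auto
  ultimately show ?thesis using that[of "R+1"] R(1) out by simp
qed

lemma test_function_primitive:
  assumes "test_function \<phi>"
  shows "is_primitive \<phi> (deriv \<phi>)" "continuous_on UNIV (deriv \<phi>)"
proof -
  obtain D where D: "\<And>x. (\<phi> has_vector_derivative D x) (at x)" "continuous_on UNIV D"
    using assms by (auto simp: test_function_def C1_differentiable_on_def)
  have "deriv \<phi> = D" using D(1)
    by (auto simp: fun_eq_iff has_real_derivative_iff_has_vector_derivative[symmetric] intro: DERIV_imp_deriv)
  then show c: "continuous_on UNIV (deriv \<phi>)" using D by simp
  have "continuous_on UNIV \<phi>"
    using D(1) by (meson continuous_at_imp_continuous_on has_vector_derivative_continuous)
  moreover have "(\<phi> has_vector_derivative deriv \<phi> x) (at x)" for x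
    using D(1) \<open>deriv \<phi> = D\<close> by simp
  moreover have "\<exists>B. \<forall>t\<in>{a..b}. norm (deriv \<phi> t) \<le> B" for a b
    by (rule continuous_bounded_Icc[OF c, of a b]) blast
  ultimately show "is_primitive \<phi> (deriv \<phi>)"
    by (intro is_primitive_FTC[where S="{}"] borel_measurable_continuous_onI[OF c]) simp_all
qed

lemma integrable_vanishing_outside_Icc:
  fixes f :: "real \<Rightarrow> 'a::euclidean_space"
  assumes f: "set_integrable lborel {a..b} f" and z: "\<And>t. t \<notin> {a..b} \<Longrightarrow> f t = 0"
  shows "integrable lborel f" "integral\<^sup>L lborel f = (LINT t:{a..b}|lborel. f t)"
proof -
  have "f = (\<lambda>t. indicator {a..b} t *\<^sub>R f t)" using z by (auto simp: fun_eq_iff indicator_def)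
  then show "integrable lborel f" "integral\<^sup>L lborel f = (LINT t:{a..b}|lborel. f t)"
    using f by (simp_all add: set_integrable_def set_lebesgue_integral_def)
qed

text \<open>Integration by parts: the product rule is applied on an interval outside which the test
  function vanishes, so no boundary term survives.\<close>

lemma is_weak_deriv_if_is_primitive:
  assumes uv: "is_primitive u v"
  shows "is_weak_deriv u v"
  unfolding is_weak_deriv_def
proof (intro conjI allI impI)
  show "set_integrable lborel {a..b} v" for a b by (rule is_primitiveD(2)[OF uv])
  fix \<phi> assume \<phi>: "test_function \<phi>"
  obtain R where R: "R > 0" "\<And>t. \<bar>t\<bar> \<ge> R \<Longrightarrow> \<phi> t = 0" "\<And>t. \<bar>t\<bar> \<ge> R \<Longrightarrow> deriv \<phi> t = 0"
    using test_function_support[OF \<phi>] by blast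
  note P = test_function_primitive[OF \<phi>]
  note cu = is_primitive_continuous[OF uv] and c\<phi> = is_primitive_continuous[OF P(1)]
  have pr: "is_primitive (\<lambda>t. \<phi> t *\<^sub>R u t) (\<lambda>t. deriv \<phi> t *\<^sub>R u t + \<phi> t *\<^sub>R v t)"
    by (rule is_primitive_bilinear[OF bounded_bilinear_scaleR P(1) uv])
  have i1: "set_integrable lborel {-R..R} (\<lambda>t. deriv \<phi> t *\<^sub>R u t)"
    by (intro borel_integrable_atLeastAtMost' continuous_intros continuous_on_subset[OF cu] continuous_on_subset[OF P(2)]) auto
  have i2: "set_integrable lborel {-R..R} (\<lambda>t. \<phi> t *\<^sub>R v t)"
    using set_integral_diff(1)[OF is_primitiveD(2)[OF pr, of "-R" R] i1] by simp
  have "0 = \<phi> R *\<^sub>R u R - \<phi> (-R) *\<^sub>R u (-R)" using R by simp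
  also have "\<dots> = (LINT t:{-R..R}|lborel. deriv \<phi> t *\<^sub>R u t) + (LINT t:{-R..R}|lborel. \<phi> t *\<^sub>R v t)"
    using is_primitiveD(3)[OF pr, of "-R" R] R set_integral_add(2)[OF i1 i2] by simp
  finally have 0: "0 = (LINT t:{-R..R}|lborel. deriv \<phi> t *\<^sub>R u t) + (LINT t:{-R..R}|lborel. \<phi> t *\<^sub>R v t)" .
  show "(LINT t|lborel. deriv \<phi> t *\<^sub>R u t) = - (LINT t|lborel. \<phi> t *\<^sub>R v t)"
  proof -
    have "\<phi> t = 0 \<and> deriv \<phi> t = 0" if "t \<notin> {-R..R}" for t using R(2,3)[of t] that by auto
    then have "(LINT t|lborel. deriv \<phi> t *\<^sub>R u t) = (LINT t:{-R..R}|lborel. deriv \<phi> t *\<^sub>R u t)"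
      "(LINT t|lborel. \<phi> t *\<^sub>R v t) = (LINT t:{-R..R}|lborel. \<phi> t *\<^sub>R v t)"
      by (auto intro!: integrable_vanishing_outside_Icc(2) i1 i2)
    then show ?thesis using 0 by (simp add: eq_neg_iff_add_eq_0)
  qed
qed

text \<open>Test functions need only be C1, so piecewise quadratic functions suffice; this one is
  the building block of the steps used in the next lemma.\<close>

lemma DERIV_max_0_square:
  "((\<lambda>t::real. (max 0 t)\<^sup>2 / 2) has_real_derivative max 0 x) (at x)"
proof (cases x "0::real" rule: linorder_cases)
  case less
  have "((\<lambda>t::real. 0) has_real_derivative max 0 x) (at x)" using less by simp
  then show ?thesis
    by (rule has_field_derivative_transform_within_open[where S="{..<0}"]) (use less in auto)
next
  case greater
  have "((\<lambda>t::real. t\<^sup>2/2) has_real_derivative max 0 x) (at x)" using greater by (auto intro!: derivative_eq_intros)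
  then show ?thesis
    by (rule has_field_derivative_transform_within_open[where S="{0<..}"]) (use greater in auto)
next
  case equal
  have "((\<lambda>h::real. (max 0 h)\<^sup>2 / 2 / h) \<longlongrightarrow> 0) (at 0)"
  proof (rule Lim_null_comparison[where g = "\<lambda>h. \<bar>h\<bar>"])
    show "\<forall>\<^sub>F x in at 0. norm ((max 0 x)\<^sup>2 / 2 / x) \<le> \<bar>x\<bar>"
      by (rule always_eventually) (auto simp: max_def power2_eq_square)
    show "((\<lambda>h::real. \<bar>h\<bar>) \<longlongrightarrow> 0) (at 0)" by (intro tendsto_rabs_zero tendsto_ident_at)
  qed
  then show ?thesis using equal by (simp add: has_field_derivative_iff)
qed

text \<open>The du Bois-Reymond lemma. A test function whose derivative is a narrow hat around
  \<open>a\<close> minus the same hat around \<open>b\<close> shows that weighted means of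
  \<open>w\<close> near the two points agree; by continuity this contradicts
  \<open>w a \<noteq> w b\<close> once the hats are narrow enough.\<close>

lemma continuous_constant_if_orthogonal_to_derivs:
  fixes w :: "real \<Rightarrow> complex"
  assumes w: "continuous_on UNIV w"
    and orth: "\<And>\<phi>. test_function \<phi> \<Longrightarrow> (LINT t|lborel. deriv \<phi> t *\<^sub>R w t) = 0"
  shows "w a = w b"
proof (rule ccontr)
  assume ne: "w a \<noteq> w b"
  define D where "D s = w (s + a) - w (s + b)" for s
  have cD: "continuous_on UNIV D" unfolding D_def
    by (intro continuous_intros continuous_on_compose2[OF w]) auto
  define e where "e = norm (D 0)"
  have e: "e > 0" using ne by (simp add: D_def e_def)
  have "isCont D 0" using cD by (auto simp: continuous_on_eq_continuous_at)
  then obtain \<delta>' where \<delta>': "\<delta>' > 0" "\<And>s. dist s 0 < \<delta>' \<Longrightarrow> dist (D s) (D 0) < e/2"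
    using e unfolding continuous_at_eps_delta by (metis half_gt_zero)
  define \<delta> where "\<delta> = \<delta>' / 2"
  have \<delta>: "\<delta> > 0" "\<And>s. \<bar>s\<bar> \<le> \<delta> \<Longrightarrow> norm (D s - D 0) \<le> e/2"
  proof -
    show "\<delta> > 0" using \<delta>' by (simp add: \<delta>_def)
    show "norm (D s - D 0) \<le> e/2" if "\<bar>s\<bar> \<le> \<delta>" for s
      using \<delta>'(2)[of s] that \<delta>'(1) by (auto simp: \<delta>_def dist_norm)
  qed
  define p where "p t = (max 0 t)\<^sup>2 / 2" for t :: real
  \<comment> \<open>A second difference of \<open>p\<close>: a C1 step from 0 to the square of
    \<open>\<delta>\<close>, constant outside \<open>{-\<delta>..\<delta>}\<close>. Its derivative
    \<open>k\<close> is the hat function supported there.\<close>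
  define K where "K t = p (t + \<delta>) - 2 * p t + p (t - \<delta>)" for t
  define k where "k t = max 0 (t + \<delta>) - 2 * max 0 t + max 0 (t - \<delta>)" for t
  have dp: "((\<lambda>t. p (t + c)) has_real_derivative max 0 (x + c)) (at x)" for x c
    using DERIV_max_0_square[of "x + c"] unfolding p_def by (subst (asm) DERIV_shift)
  have dK: "(K has_real_derivative k x) (at x)" for x
    unfolding K_def[abs_def] k_def
    using dp[of \<delta> x] dp[of 0 x] dp[of "-\<delta>" x]
    by (auto intro!: derivative_eq_intros)
  have ck: "continuous_on UNIV k" unfolding k_def[abs_def] by (intro continuous_intros)
  have k0: "k t = 0" if "\<bar>t\<bar> \<ge> \<delta>" for t using that \<delta>(1) by (auto simp: k_def max_def)
  have kn: "k t \<ge> 0" for t using \<delta>(1) by (auto simp: k_def max_def)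
  have KL: "K t = 0" if "t \<le> -\<delta>" for t using that \<delta>(1) by (auto simp: K_def p_def max_def)
  have KR: "K t = \<delta>\<^sup>2" if "t \<ge> \<delta>" for t using that \<delta>(1)
    by (auto simp: K_def p_def max_def power2_eq_square field_simps)
  have ik: "(LINT t:{-\<delta>..\<delta>}|lborel. k t) = \<delta>\<^sup>2"
    unfolding set_lebesgue_integral_def
    using integral_FTC_Icc[of "-\<delta>" \<delta> K k] dK \<delta>(1) KL[of "-\<delta>"] KR[of \<delta>]
    by (auto simp: has_real_derivative_iff_has_vector_derivative[symmetric] continuous_on_subset[OF ck]
          intro: DERIV_subset)
  \<comment> \<open>A single step does not have compact support; the difference of two translates
    does.\<close>
  define \<phi> where "\<phi> t = K (t - a) - K (t - b)" for t
  have d\<phi>: "(\<phi> has_real_derivative (k (x - a) - k (x - b))) (at x)" for x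
    unfolding \<phi>_def[abs_def]
    using dK[of "x - a"] dK[of "x - b"] DERIV_shift[of K _ x "-a"] DERIV_shift[of K _ x "-b"]
    by (auto intro!: derivative_eq_intros)
  then have deriv: "deriv \<phi> x = k (x - a) - k (x - b)" for x by (rule DERIV_imp_deriv)
  have sup: "\<phi> t = 0" if "t \<notin> {min a b - \<delta>..max a b + \<delta>}" for t
  proof -
    have "t - a \<le> -\<delta> \<and> t - b \<le> -\<delta> \<or> t - a \<ge> \<delta> \<and> t - b \<ge> \<delta>" using that by (auto simp: min_def max_def split: if_splits)
    then show ?thesis using KL KR by (auto simp: \<phi>_def)
  qed
  have tf: "test_function \<phi>" unfolding test_function_def
  proof
    have "continuous_on UNIV (\<lambda>x. k (x - a) - k (x - b))"
      by (intro continuous_intros continuous_on_compose2[OF ck]) auto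
    then show "\<phi> C1_differentiable_on UNIV" unfolding C1_differentiable_on_def
      using d\<phi> by (auto simp: has_real_derivative_iff_has_vector_derivative[symmetric] intro!: exI[of _ "\<lambda>x. k (x - a) - k (x - b)"])
    have "closure {t. \<phi> t \<noteq> 0} \<subseteq> {min a b - \<delta>..max a b + \<delta>}"
      using sup by (intro closure_minimal) (blast, simp)
    then show "compact (closure {t. \<phi> t \<noteq> 0})"
      by (meson bounded_closed_interval bounded_subset closed_closure compact_eq_bounded_closed)
  qed
  have ii: "integrable lborel (\<lambda>s. k s *\<^sub>R w (s + c))" for c
    by (rule integrable_vanishing_outside_Icc[of "-\<delta>" \<delta>])
      (auto simp: k0 intro!: borel_integrable_atLeastAtMost' continuous_intros continuous_on_subset[OF ck] continuous_on_compose2[OF w])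
  have ii': "integrable lborel (\<lambda>s. k (s - c) *\<^sub>R w s)"
    "(LINT s|lborel. k (s - c) *\<^sub>R w s) = (LINT s|lborel. k s *\<^sub>R w (s + c))" for c
    using lborel_integrable_real_affine[OF ii[of c], of 1 "-c"] lborel_integral_real_affine[of 1 "\<lambda>s. k s *\<^sub>R w (s + c)" "-c"] by simp_all
  have "0 = (LINT s|lborel. k (s - a) *\<^sub>R w s - k (s - b) *\<^sub>R w s)"
    using orth[OF tf] by (simp add: deriv scaleR_diff_left)
  also have "\<dots> = (LINT s|lborel. k s *\<^sub>R D s)"
    by (simp add: ii' ii D_def scaleR_diff_right)
  also have "\<dots> = (LINT s:{-\<delta>..\<delta>}|lborel. k s *\<^sub>R D s)"
    by (rule integrable_vanishing_outside_Icc(2))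
      (auto simp: k0 intro!: borel_integrable_atLeastAtMost' continuous_intros continuous_on_subset[OF ck] continuous_on_subset[OF cD])
  finally have z: "(LINT s:{-\<delta>..\<delta>}|lborel. k s *\<^sub>R D s) = 0" by simp
  have i3: "set_integrable lborel {-\<delta>..\<delta>} (\<lambda>s. k s *\<^sub>R D s)" "set_integrable lborel {-\<delta>..\<delta>} k" "set_integrable lborel {-\<delta>..\<delta>} (\<lambda>s. k s *\<^sub>R D 0)"
    by (auto intro!: borel_integrable_atLeastAtMost' continuous_intros continuous_on_subset[OF ck] continuous_on_subset[OF cD])
  have i4: "(LINT s:{-\<delta>..\<delta>}|lborel. k s *\<^sub>R D 0) = \<delta>\<^sup>2 *\<^sub>R D 0"
    using ik i3(2) by (simp add: set_lebesgue_integral_def set_integrable_def)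
  have "\<delta>\<^sup>2 * e = norm ((LINT s:{-\<delta>..\<delta>}|lborel. k s *\<^sub>R D s) - \<delta>\<^sup>2 *\<^sub>R D 0)"
    unfolding z by (simp add: e_def)
  also have "\<dots> = norm (LINT s:{-\<delta>..\<delta>}|lborel. k s *\<^sub>R D s - k s *\<^sub>R D 0)"
    by (simp add: set_integral_diff(2)[OF i3(1,3)] i4)
  also have "\<dots> \<le> (LINT s:{-\<delta>..\<delta>}|lborel. norm (k s *\<^sub>R D s - k s *\<^sub>R D 0))"
    by (intro set_integral_norm_bound set_integral_diff(1) i3)
  also have "\<dots> \<le> (LINT s:{-\<delta>..\<delta>}|lborel. (e/2) * k s)"
  proof (rule set_integral_mono)
    show "set_integrable lborel {-\<delta>..\<delta>} (\<lambda>s. norm (k s *\<^sub>R D s - k s *\<^sub>R D 0))"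
      by (intro set_integrable_norm set_integral_diff(1) i3)
    show "set_integrable lborel {-\<delta>..\<delta>} (\<lambda>s. (e/2) * k s)" using i3(2) by simp
    fix s assume "s \<in> {-\<delta>..\<delta>}"
    then have "norm (D s - D 0) \<le> e/2" by (intro \<delta>(2)) auto
    then have "k s * norm (D s - D 0) \<le> k s * (e/2)" using kn by (intro mult_left_mono)
    then show "norm (k s *\<^sub>R D s - k s *\<^sub>R D 0) \<le> (e/2) * k s"
      using kn[of s] by (simp add: mult.commute flip: scaleR_diff_right)
  qed
  also have "\<dots> = (e/2) * \<delta>\<^sup>2" using ik by simp
  finally show False using e \<delta>(1) by (simp add: field_simps)
qed

lemma ex_is_primitive:
  fixes v :: "real \<Rightarrow> 'a::euclidean_space"
  assumes v: "v \<in> borel_measurable borel" "\<And>a b. set_integrable lborel {a..b} v"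
  obtains U where "is_primitive U v"
proof
  define U where "U t = (if 0 \<le> t then LINT s:{0..t}|lborel. v s else - (LINT s:{t..0}|lborel. v s))" for t
  show "is_primitive U v" unfolding is_primitive_def
  proof (intro conjI allI impI v)
    fix a b :: real assume "a \<le> b"
    consider "0 \<le> a" | "b < 0" | "a < 0" "0 \<le> b" by linarith
    then show "U b - U a = (LINT t:{a..b}|lborel. v t)"
    proof cases
      case 1 then show ?thesis using \<open>a \<le> b\<close> set_lebesgue_integral_combine[OF v(2), of 0 a b] by (simp add: U_def)
    next
      case 2 then show ?thesis using \<open>a \<le> b\<close> set_lebesgue_integral_combine[OF v(2), of a b 0] by (simp add: U_def)
    next
      case 3 then show ?thesis using \<open>a \<le> b\<close> set_lebesgue_integral_combine[OF v(2), of a 0 b] by (simp add: U_def)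
    qed
  qed
qed

lemma borel_measurable_if_set_integrable:
  fixes v :: "real \<Rightarrow> 'a::euclidean_space"
  assumes "\<And>a b. set_integrable lborel {a..b} v"
  shows "v \<in> borel_measurable borel"
proof (rule borel_measurable_LIMSEQ_metric)
  show "(\<lambda>t. indicator {-real n..real n} t *\<^sub>R v t) \<in> borel_measurable borel" for n
    using assms[of "-real n" "real n"] by (auto simp: set_integrable_def dest: borel_measurable_integrable)
  fix t
  obtain N where "\<bar>t\<bar> \<le> real N" using real_arch_simple by blast
  then have "\<forall>\<^sub>F n in sequentially. indicator {-real n..real n} t *\<^sub>R v t = v t"
    by (intro eventually_sequentiallyI[of N]) (auto simp: indicator_def abs_le_iff)
  then show "(\<lambda>n. indicator {-real n..real n} t *\<^sub>R v t) \<longlonglongrightarrow> v t"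
    by (rule tendsto_eventually)
qed

text \<open>For the forward direction let \<open>U\<close> be any primitive of \<open>v\<close>.
  Then \<open>u - U\<close> is orthogonal to all derivatives of test functions, hence
  constant.\<close>

lemma is_weak_deriv_iff_is_primitive:
  assumes u: "continuous_on UNIV u"
  shows "is_weak_deriv u v \<longleftrightarrow> is_primitive u v"
proof
  assume wd: "is_weak_deriv u v"
  then have v: "set_integrable lborel {a..b} v" for a b by (simp add: is_weak_deriv_def)
  obtain U where U: "is_primitive U v" by (rule ex_is_primitive[OF borel_measurable_if_set_integrable[OF v] v])
  note cU = is_primitive_continuous[OF U]
  have "u a - U a = u b - U b" for a b
  proof (rule continuous_constant_if_orthogonal_to_derivs[of "\<lambda>t. u t - U t"])
    show "continuous_on UNIV (\<lambda>t. u t - U t)" by (intro continuous_intros u cU)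
    fix \<phi> assume \<phi>: "test_function \<phi>"
    obtain R where R: "R > 0" "\<And>t. \<bar>t\<bar> \<ge> R \<Longrightarrow> \<phi> t = 0" "\<And>t. \<bar>t\<bar> \<ge> R \<Longrightarrow> deriv \<phi> t = 0"
      using test_function_support[OF \<phi>] by blast
    have "integrable lborel (\<lambda>t. deriv \<phi> t *\<^sub>R y t)" if y: "continuous_on UNIV y" for y :: "real \<Rightarrow> complex"
    proof (rule integrable_vanishing_outside_Icc(1))
      show "set_integrable lborel {-R..R} (\<lambda>t. deriv \<phi> t *\<^sub>R y t)"
        by (intro borel_integrable_atLeastAtMost' continuous_on_scaleR continuous_on_subset[OF y]
            continuous_on_subset[OF test_function_primitive(2)[OF \<phi>]] subset_UNIV)
      show "deriv \<phi> t *\<^sub>R y t = 0" if "t \<notin> {-R..R}" for t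
        using R(3)[of t] that by auto
    qed
    then show "(LINT t|lborel. deriv \<phi> t *\<^sub>R (u t - U t)) = 0"
      using wd is_weak_deriv_if_is_primitive[OF U] \<phi> u cU by (simp add: scaleR_diff_right is_weak_deriv_def)
  qed
  then have *: "u t - U t = u 0 - U 0" for t .
  have "u b - u a = U b - U a" for a b
  proof -
    have "u b - u a = (u b - U b) - (u a - U a) + (U b - U a)" by simp
    then show ?thesis unfolding *[of b] *[of a] by simp
  qed
  then show "is_primitive u v" using U unfolding is_primitive_def by metis
qed (rule is_weak_deriv_if_is_primitive)

text \<open>Connects the derivative selected by choice in \<open>weak_deriv\<close> with any
  explicitly known one, so that all norms may be computed from the latter.\<close>

lemma weak_deriv_AE:
  assumes u: "is_primitive u v"
  shows "is_primitive u (weak_deriv u)" "AE t in lborel. weak_deriv u t = v t"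
proof -
  note c = is_primitive_continuous[OF u]
  have "is_weak_deriv u (weak_deriv u)" unfolding weak_deriv_def
    using is_weak_deriv_if_is_primitive[OF u] by (rule someI[where P = "is_weak_deriv u"])
  then show *: "is_primitive u (weak_deriv u)" using is_weak_deriv_iff_is_primitive[OF c] by simp
  show "AE t in lborel. weak_deriv u t = v t" by (rule is_primitive_AE_unique[OF * u])
qed

text \<open>With countably many lines, measurability on the grid can be checked on each line
  separately.\<close>

instance axis :: countable by countable_datatype

section \<open>The grid as a measure space\<close>

lemma UNIV_axis: "(UNIV :: axis set) = {XAxis, YAxis, ZAxis}"
  using axis.exhaust by blast

text \<open>Both sides equal the series along an enumeration of the pairs of integers. This turns
  the sums over lines in \<open>Lp_norm_pow\<close> into integrals, to which Fubini, Fatou and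
  dominated convergence apply.\<close>

lemma infsum_ennreal_eq_nn_integral:
  fixes f :: "int \<times> int \<Rightarrow> ennreal"
  shows "(\<Sum>\<^sub>\<infinity>x\<in>UNIV. f x) = (\<integral>\<^sup>+x. f x \<partial>count_space UNIV)"
proof -
  have "countable (UNIV :: (int \<times> int) set)" "infinite (UNIV :: (int \<times> int) set)"
    by (auto simp: finite_prod infinite_UNIV_int)
  then obtain g :: "nat \<Rightarrow> int \<times> int" where g: "bij_betw g UNIV UNIV"
    using bij_betw_from_nat_into by blast
  have "(\<Sum>\<^sub>\<infinity>x\<in>UNIV. f x) = (\<Sum>\<^sub>\<infinity>x\<in>UNIV. f (g x))"
    by (rule infsum_reindex_bij_betw[OF g, symmetric])
  also have "\<dots> = (\<Sum>x. f (g x))"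
  proof (rule sums_unique[OF has_sum_imp_sums])
    have "(\<lambda>x. f (g x)) summable_on UNIV" by (rule nonneg_summable_on_complete) simp
    then show "((\<lambda>x. f (g x)) has_sum (\<Sum>\<^sub>\<infinity>x. f (g x))) UNIV" by (rule has_sum_infsum)
  qed
  also have "\<dots> = (\<integral>\<^sup>+x. f (g x) \<partial>count_space UNIV)"
    by (simp add: nn_integral_count_space_nat)
  also have "\<dots> = (\<integral>\<^sup>+x. f x \<partial>count_space UNIV)"
    by (rule nn_integral_bij_count_space[OF g])
  finally show ?thesis .
qed

type_synonym grid_line_index = "axis \<times> int \<times> int"

text \<open>A disjoint union of the lines. A vertex occurs on three of them, but single points are
  null, so integrals are those over the grid. Functions on this space may take three values at a
  vertex, as derivatives do.\<close>

definition grid_measure :: "(grid_line_index \<times> real) measure" where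
  "grid_measure = count_space UNIV \<Otimes>\<^sub>M lborel"

definition grid_point :: "real \<Rightarrow> grid_line_index \<times> real \<Rightarrow> real ^ 3" where
  "grid_point l = (\<lambda>((a, m, n), t). grid_line l a m n t)"

lemma space_grid_measure [simp]: "space grid_measure = UNIV"
  by (simp add: grid_measure_def space_pair_measure)

lemma borel_measurable_grid:
  assumes "\<And>i. (\<lambda>t. f (i, t)) \<in> borel_measurable borel"
  shows "f \<in> borel_measurable grid_measure"
  unfolding grid_measure_def
  by (rule measurable_pair_measure_countable1) (use assms in auto)

lemma borel_measurable_grid_section:
  assumes "f \<in> borel_measurable grid_measure"
  shows "(\<lambda>t. f (i, t)) \<in> borel_measurable borel"
  using assms measurable_Pair2[of f "count_space UNIV" lborel borel i] by (simp add: grid_measure_def)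

lemma nn_integral_grid:
  assumes "f \<in> borel_measurable grid_measure"
  shows "(\<integral>\<^sup>+x. f x \<partial>grid_measure) = (\<integral>\<^sup>+i. (\<integral>\<^sup>+t. f (i, t) \<partial>lborel) \<partial>count_space UNIV)"
  using lborel.nn_integral_fst[of f "count_space UNIV"] assms by (simp add: grid_measure_def)

lemma nn_integral_grid_ge_line:
  assumes "f \<in> borel_measurable grid_measure"
  shows "(\<integral>\<^sup>+t. f (i, t) \<partial>lborel) \<le> (\<integral>\<^sup>+x. f x \<partial>grid_measure)"
  unfolding nn_integral_grid[OF assms] by (rule nn_integral_ge_point) simp

lemma AE_gridI:
  assumes "\<And>i. AE t in lborel. P (i, t)" and P: "Measurable.pred grid_measure P"
  shows "AE x in grid_measure. P x"
proof -
  have "{x \<in> space grid_measure. \<not> P x} \<in> sets grid_measure" using P by measurable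
  then have N[measurable]: "{x. \<not> P x} \<in> sets grid_measure" by (simp add: space_grid_measure)
  have "(\<integral>\<^sup>+x. indicator {x. \<not> P x} x \<partial>grid_measure) = (\<integral>\<^sup>+i. (\<integral>\<^sup>+t. indicator {x. \<not> P x} (i, t) \<partial>lborel) \<partial>count_space UNIV)"
    by (rule nn_integral_grid) measurable
  also have "\<dots> = (\<integral>\<^sup>+(i::grid_line_index). 0 \<partial>count_space UNIV)"
  proof (rule nn_integral_cong)
    fix i :: grid_line_index
    show "(\<integral>\<^sup>+t. indicator {x. \<not> P x} (i, t) \<partial>lborel) = (0::ennreal)"
    proof -
      have "AE t in lborel. indicator {x. \<not> P x} (i, t) = (0::ennreal)"
        using assms(1)[of i] by eventually_elim simp
      from nn_integral_cong_AE[OF this] show ?thesis by simp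
    qed
  qed
  finally have "emeasure grid_measure {x. \<not> P x} = 0"
    using N by simp
  then show ?thesis
    by (intro AE_I[of _ _ "{x. \<not> P x}"]) (use N in auto)
qed

lemma Lp_norm_pow_eq:
  assumes f[measurable]: "\<And>a m n. f a m n \<in> borel_measurable borel"
  shows "Lp_norm_pow p f = (\<integral>\<^sup>+((a, m, n), t). ennreal (norm (f a m n t) powr p) \<partial>grid_measure)"
proof -
  have "(\<integral>\<^sup>+((a, m, n), t). ennreal (norm (f a m n t) powr p) \<partial>grid_measure)
     = (\<integral>\<^sup>+i. (\<integral>\<^sup>+t. (case i of (a, m, n) \<Rightarrow> ennreal (norm (f a m n t) powr p)) \<partial>lborel) \<partial>count_space UNIV)"
    by (subst nn_integral_grid) (auto intro!: borel_measurable_grid simp: split_beta)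
  also have "\<dots> = (\<integral>\<^sup>+a. (\<integral>\<^sup>+mn. (\<integral>\<^sup>+t. ennreal (norm (f a (fst mn) (snd mn) t) powr p) \<partial>lborel) \<partial>count_space UNIV) \<partial>count_space UNIV)"
    by (subst nn_integral_fst_count_space[symmetric]) (simp add: split_beta)
  also have "\<dots> = (\<Sum>a\<in>UNIV. (\<integral>\<^sup>+mn. (\<integral>\<^sup>+t. ennreal (norm (f a (fst mn) (snd mn) t) powr p) \<partial>lborel) \<partial>count_space UNIV))"
    by (rule nn_integral_count_space_finite) (simp add: UNIV_axis)
  finally show ?thesis
    by (simp add: UNIV_axis Lp_norm_pow_def infsum_ennreal_eq_nn_integral split_beta add.assoc)
qed

text \<open>Carries the derivative along with the function, so that sums, products, translates and
  limits come with explicit derivatives. Continuity at the vertices is not demanded, because it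
  follows from continuity along all lines by \<open>continuous_at_grid_vertex\<close>.\<close>

definition H1_pair :: "real \<Rightarrow> (real ^ 3 \<Rightarrow> complex) \<Rightarrow> (grid_line_index \<times> real \<Rightarrow> complex) \<Rightarrow> bool" where
  "H1_pair l \<psi> V \<longleftrightarrow> (\<forall>i. is_primitive (\<lambda>t. \<psi> (grid_point l (i, t))) (\<lambda>t. V (i, t))) \<and>
     integrable grid_measure (\<lambda>x. (norm (\<psi> (grid_point l x)))\<^sup>2) \<and>
     integrable grid_measure (\<lambda>x. (norm (V x))\<^sup>2)"

lemma H1_pairD:
  assumes "H1_pair l \<psi> V"
  shows "is_primitive (\<lambda>t. \<psi> (grid_point l (i, t))) (\<lambda>t. V (i, t))"
    "integrable grid_measure (\<lambda>x. (norm (\<psi> (grid_point l x)))\<^sup>2)"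
    "integrable grid_measure (\<lambda>x. (norm (V x))\<^sup>2)"
    "(\<lambda>x. \<psi> (grid_point l x)) \<in> borel_measurable grid_measure" "V \<in> borel_measurable grid_measure"
proof -
  show 1: "is_primitive (\<lambda>t. \<psi> (grid_point l (i, t))) (\<lambda>t. V (i, t))" for i
    using assms unfolding H1_pair_def by blast
  show "integrable grid_measure (\<lambda>x. (norm (\<psi> (grid_point l x)))\<^sup>2)"
    "integrable grid_measure (\<lambda>x. (norm (V x))\<^sup>2)"
    using assms unfolding H1_pair_def by blast+
  show "(\<lambda>x. \<psi> (grid_point l x)) \<in> borel_measurable grid_measure"
    by (rule borel_measurable_grid) (rule is_primitive_borel[OF 1])
  show "V \<in> borel_measurable grid_measure"
    by (rule borel_measurable_grid) (rule is_primitiveD(1)[OF 1])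
qed

text \<open>Within distance \<open>l\<close> of a vertex the grid consists of the three lines
  through it, so three one-dimensional moduli of continuity suffice; this is why \<open>l\<close>
  itself enters the minimum \<open>dd\<close>.\<close>

lemma continuous_at_grid_vertex:
  fixes \<psi> :: "real ^ 3 \<Rightarrow> complex"
  assumes l: "l > 0" and c: "\<And>a m n. continuous_on UNIV (\<lambda>t. \<psi> (grid_line l a m n t))"
    and v: "v \<in> grid_vertices l"
  shows "continuous (at v within grid l) \<psi>"
proof -
  obtain i j k :: int where v: "v = vector [of_int i * l, of_int j * l, of_int k * l]"
    using v by (auto simp: grid_vertices_def)
  have vl: "v = grid_line l XAxis j k (of_int i * l)" "v = grid_line l YAxis i k (of_int j * l)"
    "v = grid_line l ZAxis i j (of_int k * l)" by (simp_all add: v)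
  have same: "m = m'" if "\<bar>of_int m * l - of_int m' * l\<bar> < l" for m m' :: int
  proof -
    have "of_int m * l - of_int m' * l = real_of_int (m - m') * l" by (simp add: left_diff_distrib)
    then have "\<bar>real_of_int (m - m')\<bar> * l < 1 * l" using that l by (simp add: abs_mult)
    then have "\<bar>real_of_int (m - m')\<bar> < 1" using l by (simp only: mult_less_cancel_right_pos)
    then show ?thesis by linarith
  qed
  show ?thesis unfolding continuous_within_eps_delta
  proof (intro allI impI)
    fix e :: real assume "e > 0"
    have "\<exists>d>0. \<forall>t. dist t s < d \<longrightarrow> dist (\<psi> (grid_line l a m n t)) (\<psi> (grid_line l a m n s)) < e" for a m n s
      using c[of a m n] \<open>e > 0\<close> by (simp add: continuous_on_eq_continuous_at continuous_at_eps_delta)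
    note ex = this
    obtain d1 where d1: "d1 > 0" "\<And>t. dist t (of_int i * l) < d1 \<Longrightarrow> dist (\<psi> (grid_line l XAxis j k t)) (\<psi> v) < e"
      using ex[of "of_int i * l" XAxis j k] unfolding vl(1)[symmetric] by blast
    obtain d2 where d2: "d2 > 0" "\<And>t. dist t (of_int j * l) < d2 \<Longrightarrow> dist (\<psi> (grid_line l YAxis i k t)) (\<psi> v) < e"
      using ex[of "of_int j * l" YAxis i k] unfolding vl(2)[symmetric] by blast
    obtain d3 where d3: "d3 > 0" "\<And>t. dist t (of_int k * l) < d3 \<Longrightarrow> dist (\<psi> (grid_line l ZAxis i j t)) (\<psi> v) < e"
      using ex[of "of_int k * l" ZAxis i j] unfolding vl(3)[symmetric] by blast
    define dd where "dd = Min {l, d1, d2, d3}"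
    show "\<exists>d>0. \<forall>x'\<in>grid l. dist x' v < d \<longrightarrow> dist (\<psi> x') (\<psi> v) < e"
    proof (intro exI conjI ballI impI)
      show "dd > 0" using l d1(1) d2(1) d3(1) by (simp add: dd_def)
      fix x assume "x \<in> grid l" and dx: "dist x v < dd"
      then obtain a m n t where x: "x = grid_line l a m n t" by (auto simp: grid_def)
      have comp: "\<bar>x $ q - v $ q\<bar> < dd" for q
        using component_le_norm_cart[of "x - v" q] dx by (simp add: dist_norm)
      show "dist (\<psi> x) (\<psi> v) < e"
      proof (cases a)
        case XAxis
        have "m = j" "n = k" "\<bar>t - of_int i * l\<bar> < dd"
          using comp[of 1] comp[of 2] comp[of 3] by (auto simp: x XAxis v dd_def intro!: same)
        then show ?thesis using d1(2)[of t] by (simp add: x XAxis dd_def dist_real_def)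
      next
        case YAxis
        have "m = i" "n = k" "\<bar>t - of_int j * l\<bar> < dd"
          using comp[of 1] comp[of 2] comp[of 3] by (auto simp: x YAxis v dd_def intro!: same)
        then show ?thesis using d2(2)[of t] by (simp add: x YAxis dd_def dist_real_def)
      next
        case ZAxis
        have "m = i" "n = j" "\<bar>t - of_int k * l\<bar> < dd"
          using comp[of 1] comp[of 2] comp[of 3] by (auto simp: x ZAxis v dd_def intro!: same)
        then show ?thesis using d3(2)[of t] by (simp add: x ZAxis dd_def dist_real_def)
      qed
    qed
  qed
qed

lemma norm_powr_2: "norm z powr 2 = (norm z)\<^sup>2"
  by (cases "norm z = 0") auto

lemma grid_restrict_eq: "grid_restrict l \<psi> a m n = (\<lambda>t. \<psi> (grid_point l ((a, m, n), t)))"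
  by (simp add: grid_restrict_def grid_point_def)

lemma Lp_norm_pow_restrict:
  assumes "H1_pair l \<psi> V"
  shows "Lp_norm_pow p (grid_restrict l \<psi>) = (\<integral>\<^sup>+x. ennreal (norm (\<psi> (grid_point l x)) powr p) \<partial>grid_measure)"
proof -
  have "Lp_norm_pow p (grid_restrict l \<psi>) = (\<integral>\<^sup>+((a, m, n), t). ennreal (norm (grid_restrict l \<psi> a m n t) powr p) \<partial>grid_measure)"
    unfolding grid_restrict_eq by (intro Lp_norm_pow_eq is_primitive_borel[OF H1_pairD(1)[OF assms]])
  then show ?thesis by (simp add: case_prod_unfold grid_restrict_eq)
qed

lemma Lp_norm_pow_deriv:
  assumes "H1_pair l \<psi> V"
  shows "Lp_norm_pow p (grid_deriv l \<psi>) = (\<integral>\<^sup>+x. ennreal (norm (V x) powr p) \<partial>grid_measure)"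
proof -
  define W where "W x = (case x of ((a, m, n), t) \<Rightarrow> grid_deriv l \<psi> a m n t)" for x
  have prim: "is_primitive (grid_restrict l \<psi> a m n) (\<lambda>t. V ((a, m, n), t))" for a m n
    using H1_pairD(1)[OF assms, of "(a, m, n)"] by (simp add: grid_restrict_eq)
  have m: "grid_deriv l \<psi> a m n \<in> borel_measurable borel" for a m n
    using weak_deriv_AE(1)[OF prim] by (simp add: grid_deriv_def is_primitive_def)
  have W: "W \<in> borel_measurable grid_measure"
    by (rule borel_measurable_grid) (auto simp: W_def m split_beta)
  note V = H1_pairD(5)[OF assms]
  have "Lp_norm_pow p (grid_deriv l \<psi>) = (\<integral>\<^sup>+x. ennreal (norm (W x) powr p) \<partial>grid_measure)"
    unfolding Lp_norm_pow_eq[OF m] by (simp add: W_def case_prod_unfold)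
  also have "\<dots> = (\<integral>\<^sup>+x. ennreal (norm (V x) powr p) \<partial>grid_measure)"
  proof (rule nn_integral_cong_AE)
    have "AE x in grid_measure. W x = V x"
    proof (rule AE_gridI)
      show "AE t in lborel. W (i, t) = V (i, t)" for i
        using weak_deriv_AE(2)[OF prim[of "fst i" "fst (snd i)" "snd (snd i)"]] by (simp add: W_def grid_deriv_def split_beta)
      show "Measurable.pred grid_measure (\<lambda>x. W x = V x)" using V W by measurable
    qed
    then show "AE x in grid_measure. ennreal (norm (W x) powr p) = ennreal (norm (V x) powr p)" by eventually_elim simp
  qed
  finally show ?thesis .
qed

lemma grid_mass_eq:
  assumes "H1_pair l \<psi> V"
  shows "grid_mass l \<psi> = (\<integral>x. (norm (\<psi> (grid_point l x)))\<^sup>2 \<partial>grid_measure)"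
  unfolding grid_mass_def Lp_norm_pow_restrict[OF assms] norm_powr_2
  by (rule integral_eq_nn_integral[symmetric]) (use H1_pairD(2,4)[OF assms] in auto)

lemma grid_energy_eq:
  assumes "H1_pair l \<psi> V"
  shows "grid_energy l p \<psi> = 1/2 * (\<integral>x. (norm (V x))\<^sup>2 \<partial>grid_measure) -
      1/p * (\<integral>x. norm (\<psi> (grid_point l x)) powr p \<partial>grid_measure)"
proof -
  note [measurable] = H1_pairD(4,5)[OF assms]
  show ?thesis
    unfolding grid_energy_def Lp_norm_pow_restrict[OF assms] Lp_norm_pow_deriv[OF assms] norm_powr_2
    by (subst (1 2) integral_eq_nn_integral) auto
qed

lemma H1_pair_imp_H1_grid:
  assumes l: "l > 0" and H: "H1_pair l \<psi> V"
  shows "\<psi> \<in> H1_grid l"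
proof -
  note [measurable] = H1_pairD(4,5)[OF H]
  have fin: "(\<integral>\<^sup>+x. ennreal (norm (\<psi> (grid_point l x)) powr 2) \<partial>grid_measure) < \<infinity>"
    "(\<integral>\<^sup>+x. ennreal (norm (V x) powr 2) \<partial>grid_measure) < \<infinity>"
    using H1_pairD(2,3)[OF H] by (simp_all add: norm_powr_2 integrable_iff_bounded)
  have "grid_restrict l \<psi> a m n \<in> H1_real" for a m n
  proof -
    note prim = H1_pairD(1)[OF H, of "(a, m, n)"]
    have "square_integrable (\<lambda>t. \<psi> (grid_point l ((a, m, n), t)))"
      unfolding square_integrable_def using is_primitive_borel[OF prim]
        le_less_trans[OF nn_integral_grid_ge_line[of "\<lambda>x. ennreal (norm (\<psi> (grid_point l x)) powr 2)" "(a, m, n)"] fin(1)] by auto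
    moreover have "square_integrable (\<lambda>t. V ((a, m, n), t))"
      unfolding square_integrable_def using is_primitiveD(1)[OF prim]
        le_less_trans[OF nn_integral_grid_ge_line[of "\<lambda>x. ennreal (norm (V x) powr 2)" "(a, m, n)"] fin(2)] by auto
    ultimately show ?thesis
      using is_weak_deriv_if_is_primitive[OF prim] is_primitive_continuous[OF prim]
      by (auto simp: H1_real_def grid_restrict_eq)
  qed
  moreover have "continuous (at v within grid l) \<psi>" if "v \<in> grid_vertices l" for v
  proof (rule continuous_at_grid_vertex[OF l _ that])
    show "continuous_on UNIV (\<lambda>t. \<psi> (grid_line l a m n t))" for a m n
      using is_primitive_continuous[OF H1_pairD(1)[OF H, of "(a, m, n)"]] by (simp add: grid_point_def)
  qed
  moreover have "H1_norm_sq l \<psi> < \<infinity>"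
    unfolding H1_norm_sq_def Lp_norm_pow_restrict[OF H] Lp_norm_pow_deriv[OF H] using fin by simp
  ultimately show ?thesis by (auto simp: H1_grid_def)
qed

lemma H1_grid_obtain_pair:
  assumes "\<psi> \<in> H1_grid l"
  obtains V where "H1_pair l \<psi> V"
proof
  define V where "V = (\<lambda>((a, m, n), t). grid_deriv l \<psi> a m n t)"
  have prim: "is_primitive (grid_restrict l \<psi> a m n) (grid_deriv l \<psi> a m n)" for a m n
  proof -
    have "grid_restrict l \<psi> a m n \<in> H1_real" using assms by (auto simp: H1_grid_def)
    then obtain v where "is_primitive (grid_restrict l \<psi> a m n) v"
      using is_weak_deriv_iff_is_primitive by (auto simp: H1_real_def)
    then show ?thesis unfolding grid_deriv_def by (rule weak_deriv_AE(1))
  qed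
  have m: "grid_restrict l \<psi> a m n \<in> borel_measurable borel" "grid_deriv l \<psi> a m n \<in> borel_measurable borel" for a m n
    using is_primitive_borel[OF prim] is_primitiveD(1)[OF prim] by auto
  have [measurable]: "V \<in> borel_measurable grid_measure" "(\<lambda>x. \<psi> (grid_point l x)) \<in> borel_measurable grid_measure"
    using m by (auto simp: V_def split_beta grid_restrict_eq intro!: borel_measurable_grid)
  have e: "Lp_norm_pow 2 (grid_restrict l \<psi>) = (\<integral>\<^sup>+x. ennreal (norm (\<psi> (grid_point l x)) powr 2) \<partial>grid_measure)"
    "Lp_norm_pow 2 (grid_deriv l \<psi>) = (\<integral>\<^sup>+x. ennreal (norm (V x) powr 2) \<partial>grid_measure)"
    unfolding Lp_norm_pow_eq[OF m(1)] Lp_norm_pow_eq[OF m(2)]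
    by (simp_all add: V_def case_prod_unfold grid_restrict_eq)
  have "H1_norm_sq l \<psi> < \<infinity>" using assms by (auto simp: H1_grid_def)
  then have "integrable grid_measure (\<lambda>x. (norm (\<psi> (grid_point l x)))\<^sup>2)" "integrable grid_measure (\<lambda>x. (norm (V x))\<^sup>2)"
    by (auto simp: H1_norm_sq_def e norm_powr_2 integrable_iff_bounded)
  then show "H1_pair l \<psi> V"
    using prim by (auto simp: H1_pair_def V_def grid_restrict_eq split_beta)
qed

section \<open>Elementary estimates on the grid\<close>

lemma integrable_grid_line:
  fixes f :: "grid_line_index \<times> real \<Rightarrow> real"
  assumes f: "integrable grid_measure f"
  shows "integrable lborel (\<lambda>t. f (i, t))"
proof -
  have [measurable]: "f \<in> borel_measurable grid_measure" using f by auto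
  have "(\<integral>\<^sup>+t. ennreal (norm (f (i, t))) \<partial>lborel) \<le> (\<integral>\<^sup>+x. ennreal (norm (f x)) \<partial>grid_measure)"
    by (rule nn_integral_grid_ge_line[of "\<lambda>x. ennreal (norm (f x))"]) measurable
  also have "\<dots> < \<infinity>" using f by (simp add: integrable_iff_bounded)
  finally show ?thesis using borel_measurable_grid_section[of f i] by (simp add: integrable_iff_bounded)
qed

lemma sum_grid_lines_le_integral:
  fixes f :: "grid_line_index \<times> real \<Rightarrow> real"
  assumes f: "integrable grid_measure f" and nn: "\<And>x. f x \<ge> 0" and I: "finite I"
  shows "(\<Sum>i\<in>I. \<integral>t. f (i, t) \<partial>lborel) \<le> (\<integral>x. f x \<partial>grid_measure)"
proof -
  have [measurable]: "f \<in> borel_measurable grid_measure" using f by auto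
  have "ennreal (\<Sum>i\<in>I. \<integral>t. f (i, t) \<partial>lborel) = (\<Sum>i\<in>I. \<integral>\<^sup>+t. ennreal (f (i, t)) \<partial>lborel)"
    by (subst sum_ennreal[symmetric])
      (auto intro!: integral_nonneg_AE sum.cong nn_integral_eq_integral[symmetric] integrable_grid_line f nn)
  also have "\<dots> = (\<integral>\<^sup>+i. (\<integral>\<^sup>+t. ennreal (f (i, t)) \<partial>lborel) * indicator I i \<partial>count_space UNIV)"
    by (subst nn_integral_count_space_indicator[symmetric]) (auto simp: nn_integral_count_space_finite I)
  also have "\<dots> \<le> (\<integral>\<^sup>+i. (\<integral>\<^sup>+t. ennreal (f (i, t)) \<partial>lborel) \<partial>count_space UNIV)"
    by (intro nn_integral_mono) (auto simp: indicator_def)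
  also have "\<dots> = (\<integral>\<^sup>+x. ennreal (f x) \<partial>grid_measure)"
    by (rule nn_integral_grid[symmetric]) measurable
  also have "\<dots> = ennreal (\<integral>x. f x \<partial>grid_measure)"
    by (rule nn_integral_eq_integral) (auto simp: f nn)
  finally show ?thesis
    by (subst (asm) ennreal_le_iff) (auto intro!: integral_nonneg_AE simp: nn)
qed

lemma integral_grid_line_le:
  fixes f :: "grid_line_index \<times> real \<Rightarrow> real"
  assumes f: "integrable grid_measure f" and nn: "\<And>x. f x \<ge> 0"
  shows "(\<integral>t. f (i, t) \<partial>lborel) \<le> (\<integral>x. f x \<partial>grid_measure)"
  using sum_grid_lines_le_integral[OF assms, of "{i}"] by simp

lemma integrable_mult_if_squares:
  fixes f g :: "'a \<Rightarrow> real"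
  assumes [measurable]: "f \<in> borel_measurable M" "g \<in> borel_measurable M"
    and f: "integrable M (\<lambda>x. (f x)\<^sup>2)" and g: "integrable M (\<lambda>x. (g x)\<^sup>2)"
  shows "integrable M (\<lambda>x. f x * g x)"
proof (rule Bochner_Integration.integrable_bound)
  show "integrable M (\<lambda>x. (f x)\<^sup>2 + (g x)\<^sup>2)" using f g by simp
  have "\<bar>a * b\<bar> \<le> a\<^sup>2 + b\<^sup>2" for a b :: real
  proof -
    have "2 * (\<bar>a\<bar> * \<bar>b\<bar>) \<le> a\<^sup>2 + b\<^sup>2" using sum_squares_bound[of "\<bar>a\<bar>" "\<bar>b\<bar>"] by (simp add: mult.assoc)
    moreover have "0 \<le> \<bar>a\<bar> * \<bar>b\<bar>" by simp
    ultimately show ?thesis unfolding abs_mult by linarith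
  qed
  then show "AE x in M. norm (f x * g x) \<le> norm ((f x)\<^sup>2 + (g x)\<^sup>2)" by simp
qed measurable

text \<open>The integral of the square of \<open>t * f + g\<close> is a nonnegative quadratic in
  \<open>t\<close>, evaluated at its minimum \<open>- B / A\<close>. If \<open>A = 0\<close> it is
  linear in \<open>t\<close>, and a nonzero slope would make it negative somewhere.\<close>

lemma Cauchy_Schwarz_integral:
  fixes f g :: "'a \<Rightarrow> real"
  assumes m: "f \<in> borel_measurable M" "g \<in> borel_measurable M"
    and f: "integrable M (\<lambda>x. (f x)\<^sup>2)" and g: "integrable M (\<lambda>x. (g x)\<^sup>2)"
  shows "(\<integral>x. f x * g x \<partial>M)\<^sup>2 \<le> (\<integral>x. (f x)\<^sup>2 \<partial>M) * (\<integral>x. (g x)\<^sup>2 \<partial>M)"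
proof -
  define A B C where "A = (\<integral>x. (f x)\<^sup>2 \<partial>M)" and "B = (\<integral>x. f x * g x \<partial>M)" and "C = (\<integral>x. (g x)\<^sup>2 \<partial>M)"
  note fg = integrable_mult_if_squares[OF m f g]
  have q: "0 \<le> t\<^sup>2 * A + 2 * t * B + C" for t
  proof -
    have "0 \<le> (\<integral>x. (t * f x + g x)\<^sup>2 \<partial>M)" by (intro integral_nonneg_AE) simp
    also have "(\<lambda>x. (t * f x + g x)\<^sup>2) = (\<lambda>x. t\<^sup>2 * (f x)\<^sup>2 + 2 * t * (f x * g x) + (g x)\<^sup>2)"
      by (auto simp: power2_eq_square algebra_simps)
    also have "(\<integral>x. t\<^sup>2 * (f x)\<^sup>2 + 2 * t * (f x * g x) + (g x)\<^sup>2 \<partial>M) = t\<^sup>2 * A + 2 * t * B + C"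
      using f g fg by (simp add: A_def B_def C_def)
    finally show ?thesis .
  qed
  have "A \<ge> 0" unfolding A_def by (intro integral_nonneg_AE) simp
  show ?thesis
  proof (cases "A = 0")
    case True
    have "B = 0"
    proof (rule ccontr)
      assume "B \<noteq> 0"
      then show False using q[of "-(C + 1) / (2 * B)"] True by (simp add: field_simps)
    qed
    then show ?thesis using True by (simp add: A_def B_def)
  next
    case False
    then have "A > 0" using \<open>A \<ge> 0\<close> by simp
    then have "0 \<le> C - B\<^sup>2 / A" using q[of "- B / A"] by (simp add: power2_eq_square field_simps)
    then show ?thesis using \<open>A > 0\<close> unfolding A_def[symmetric] B_def[symmetric] C_def[symmetric] by (simp add: field_simps)
  qed
qed

section \<open>Decay along lines and variation bounds\<close>

lemma is_primitive_norm_square: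
  fixes u :: "real \<Rightarrow> complex"
  assumes "is_primitive u v"
  shows "is_primitive (\<lambda>t. (norm (u t))\<^sup>2) (\<lambda>t. 2 * (u t \<bullet> v t))"
proof -
  have "is_primitive (\<lambda>t. u t \<bullet> u t) (\<lambda>t. v t \<bullet> u t + u t \<bullet> v t)"
    by (rule is_primitive_bilinear[OF bounded_bilinear_inner assms assms])
  then show ?thesis by (simp add: power2_norm_eq_inner inner_commute)
qed

text \<open>A half-line has infinite measure, so an integrable function cannot stay above
  \<open>\<epsilon>\<close> on it. Small values at some far points replace limits at infinity
  wherever boundary terms are discarded.\<close>

lemma integrable_continuous_small_beyond:
  fixes f :: "real \<Rightarrow> real"
  assumes f: "integrable lborel f" and nn: "\<And>t. f t \<ge> 0" and \<epsilon>: "\<epsilon> > 0"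
  shows "\<exists>s\<ge>t. f s < \<epsilon>" "\<exists>s\<le>t. f s < \<epsilon>"
proof -
  have *: False if A: "A \<in> sets lborel" "emeasure lborel A = \<infinity>" and ge: "\<And>s. s \<in> A \<Longrightarrow> f s \<ge> \<epsilon>" for A
  proof -
    have "ennreal \<epsilon> * emeasure lborel A = (\<integral>\<^sup>+s. ennreal \<epsilon> * indicator A s \<partial>lborel)"
      using A by (simp add: nn_integral_cmult_indicator)
    also have "\<dots> \<le> (\<integral>\<^sup>+s. ennreal (norm (f s)) \<partial>lborel)"
      by (intro nn_integral_mono) (use ge in \<open>auto simp: indicator_def nn intro!: ennreal_leI\<close>)
    also have "\<dots> < \<infinity>" using f by (simp add: integrable_iff_bounded)
    finally show False using A \<epsilon> by (simp add: ennreal_mult_top)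
  qed
  have big: "emeasure lborel A = \<infinity>" if nA: "\<And>n::nat. \<exists>a. {a..a + real n} \<subseteq> A" and A: "A \<in> sets borel" for A :: "real set"
  proof (rule ccontr)
    assume "emeasure lborel A \<noteq> \<infinity>"
    then obtain n :: nat where n: "emeasure lborel A < of_nat n" using ennreal_Ex_less_of_nat by (auto simp: less_top)
    obtain a where "{a..a + real n} \<subseteq> A" using nA[of n] by blast
    then have "emeasure lborel {a..a + real n} \<le> emeasure lborel A" using A by (intro emeasure_mono) auto
    then show False using n by (simp add: ennreal_of_nat_eq_real_of_nat)
  qed
  have "emeasure lborel {t..} = \<infinity>"
  proof (rule big)
    show "\<exists>a. {a..a + real n} \<subseteq> {t..}" for n by (rule exI[of _ t]) auto
  qed simp
  moreover have "emeasure lborel {..t} = \<infinity>"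
  proof (rule big)
    show "\<exists>a. {a..a + real n} \<subseteq> {..t}" for n by (rule exI[of _ "t - real n"]) auto
  qed simp
  ultimately show "\<exists>s\<ge>t. f s < \<epsilon>" "\<exists>s\<le>t. f s < \<epsilon>"
    using *[of "{t..}"] *[of "{..t}"] by (force simp: not_less)+
qed

text \<open>The value at \<open>t\<close> has to be gained on the left and lost again on the right,
  so it is counted twice in the total variation. The factor 2 is essential for the sharp critical
  mass at exponent 6.\<close>

lemma two_sided_primitive_bound:
  fixes F :: "real \<Rightarrow> real"
  assumes F: "is_primitive F g" and g: "integrable lborel g"
    and right: "\<And>\<epsilon>. \<epsilon> > 0 \<Longrightarrow> \<exists>s\<ge>t. F s < \<epsilon>" and left: "\<And>\<epsilon>. \<epsilon> > 0 \<Longrightarrow> \<exists>s\<le>t. F s < \<epsilon>"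
  shows "2 * F t \<le> (\<integral>s. \<bar>g s\<bar> \<partial>lborel)"
proof (rule field_le_epsilon)
  fix e :: real assume "e > 0"
  then have "e / 2 > 0" by simp
  obtain b where b: "b \<ge> t" "F b < e/2" using right[OF \<open>e/2 > 0\<close>] by blast
  obtain a where a: "a \<le> t" "F a < e/2" using left[OF \<open>e/2 > 0\<close>] by blast
  have ga: "integrable lborel (\<lambda>s. \<bar>g s\<bar>)" using g by simp
  have si: "set_integrable lborel A (\<lambda>s. \<bar>g s\<bar>)" if "A \<in> sets borel" for A
    using that ga unfolding set_integrable_def by (intro integrable_mult_indicator) auto
  have 1: "\<bar>F d - F c\<bar> \<le> (LINT s:{c..d}|lborel. \<bar>g s\<bar>)" if "c \<le> d" for c d
    using set_integral_norm_bound[OF is_primitiveD(2)[OF F], of c d] is_primitiveD(3)[OF F that] by simp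
  have "2 * F t \<le> (LINT s:{a..t}|lborel. \<bar>g s\<bar>) + (LINT s:{t..b}|lborel. \<bar>g s\<bar>) + e"
    using 1[OF a(1)] 1[OF b(1)] a b by linarith
  also have "(LINT s:{a..t}|lborel. \<bar>g s\<bar>) + (LINT s:{t..b}|lborel. \<bar>g s\<bar>) = (LINT s:{a..b}|lborel. \<bar>g s\<bar>)"
    by (rule set_lebesgue_integral_combine[symmetric]) (use a b in \<open>auto intro: si\<close>)
  also have "\<dots> \<le> (\<integral>s. \<bar>g s\<bar> \<partial>lborel)"
    unfolding set_lebesgue_integral_def
    using si[of "{a..b}"] ga by (intro integral_mono) (auto simp: set_integrable_def indicator_def)
  finally show "2 * F t \<le> (\<integral>s. \<bar>g s\<bar> \<partial>lborel) + e" by simp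
qed

lemma H1_pair_scale:
  assumes "H1_pair l \<psi> V"
  shows "H1_pair l (\<lambda>x. c * \<psi> x) (\<lambda>x. c * V x)"
  unfolding H1_pair_def
proof (intro conjI allI)
  show "is_primitive (\<lambda>t. c * \<psi> (grid_point l (i, t))) (\<lambda>t. c * V (i, t))" for i
    by (rule is_primitive_linear[OF bounded_linear_mult_right H1_pairD(1)[OF assms]])
qed (use H1_pairD(2,3)[OF assms] in \<open>auto simp: norm_mult power_mult_distrib\<close>)

lemma integrable_norm_square_add:
  fixes f g :: "'a \<Rightarrow> complex"
  assumes [measurable]: "f \<in> borel_measurable M" "g \<in> borel_measurable M"
    and f: "integrable M (\<lambda>x. (norm (f x))\<^sup>2)" and g: "integrable M (\<lambda>x. (norm (g x))\<^sup>2)"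
  shows "integrable M (\<lambda>x. (norm (f x + g x))\<^sup>2)"
proof (rule Bochner_Integration.integrable_bound)
  show "integrable M (\<lambda>x. 2 * (norm (f x))\<^sup>2 + 2 * (norm (g x))\<^sup>2)" using f g by simp
  have "(norm (a + b))\<^sup>2 \<le> 2 * (norm a)\<^sup>2 + 2 * (norm b)\<^sup>2" for a b :: complex
  proof -
    have "(norm (a + b))\<^sup>2 \<le> (norm a + norm b)\<^sup>2" by (intro power_mono norm_triangle_ineq) simp
    also have "\<dots> \<le> 2 * (norm a)\<^sup>2 + 2 * (norm b)\<^sup>2"
      using sum_squares_bound[of "norm a" "norm b"] by (simp add: power2_sum)
    finally show ?thesis .
  qed
  then show "AE x in M. norm ((norm (f x + g x))\<^sup>2) \<le> norm (2 * (norm (f x))\<^sup>2 + 2 * (norm (g x))\<^sup>2)"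
    by (simp add: abs_of_nonneg)
qed measurable

lemma H1_pair_add:
  assumes "H1_pair l \<psi> V" "H1_pair l \<phi> W"
  shows "H1_pair l (\<lambda>x. \<psi> x + \<phi> x) (\<lambda>x. V x + W x)"
  unfolding H1_pair_def
proof (intro conjI allI)
  show "is_primitive (\<lambda>t. \<psi> (grid_point l (i, t)) + \<phi> (grid_point l (i, t))) (\<lambda>t. V (i, t) + W (i, t))" for i
    by (rule is_primitive_add[OF H1_pairD(1)[OF assms(1)] H1_pairD(1)[OF assms(2)]])
qed (intro integrable_norm_square_add H1_pairD[OF assms(1)] H1_pairD[OF assms(2)])+

section \<open>The mass, power and kinetic functionals and their one-dimensional bounds\<close>

definition mass_of :: "real \<Rightarrow> (real ^ 3 \<Rightarrow> complex) \<Rightarrow> real" where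
  "mass_of l \<psi> = (\<integral>x. (norm (\<psi> (grid_point l x)))\<^sup>2 \<partial>grid_measure)"

definition power_of :: "real \<Rightarrow> real \<Rightarrow> (real ^ 3 \<Rightarrow> complex) \<Rightarrow> real" where
  "power_of l p \<psi> = (\<integral>x. norm (\<psi> (grid_point l x)) powr p \<partial>grid_measure)"

definition kinetic :: "(grid_line_index \<times> real \<Rightarrow> complex) \<Rightarrow> real" where
  "kinetic V = (\<integral>x. (norm (V x))\<^sup>2 \<partial>grid_measure)"

lemma mass_of_nonneg [simp]: "0 \<le> mass_of l \<psi>" and power_of_nonneg [simp]: "0 \<le> power_of l p \<psi>"
  and kinetic_nonneg [simp]: "0 \<le> kinetic V"
  unfolding mass_of_def power_of_def kinetic_def by (auto intro!: integral_nonneg_AE)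

lemma mass_of_scale: "mass_of l (\<lambda>x. c * \<psi> x) = (norm c)\<^sup>2 * mass_of l \<psi>"
  and power_of_scale: "power_of l p (\<lambda>x. c * \<psi> x) = norm c powr p * power_of l p \<psi>"
  and kinetic_scale: "kinetic (\<lambda>x. c * V x) = (norm c)\<^sup>2 * kinetic V"
  unfolding mass_of_def power_of_def kinetic_def by (simp_all add: norm_mult power_mult_distrib powr_mult)

lemma integrable_norm_mult_deriv:
  assumes "H1_pair l \<psi> V"
  shows "integrable grid_measure (\<lambda>x. norm (\<psi> (grid_point l x)) * norm (V x))"
    "(\<integral>x. norm (\<psi> (grid_point l x)) * norm (V x) \<partial>grid_measure) \<le> sqrt (mass_of l \<psi> * kinetic V)"
proof -
  note [measurable] = H1_pairD(4,5)[OF assms]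
  show "integrable grid_measure (\<lambda>x. norm (\<psi> (grid_point l x)) * norm (V x))"
    by (intro integrable_mult_if_squares H1_pairD(2,3)[OF assms]) measurable
  have "(\<integral>x. norm (\<psi> (grid_point l x)) * norm (V x) \<partial>grid_measure)\<^sup>2 \<le> mass_of l \<psi> * kinetic V"
    unfolding mass_of_def kinetic_def
    by (intro Cauchy_Schwarz_integral H1_pairD(2,3)[OF assms]) measurable
  then show "(\<integral>x. norm (\<psi> (grid_point l x)) * norm (V x) \<partial>grid_measure) \<le> sqrt (mass_of l \<psi> * kinetic V)"
    by (rule real_le_rsqrt)
qed

text \<open>The derivative of the squared modulus is at most \<open>2 * norm u * norm v\<close>, and
  its factor 2 cancels against that of the two-sided bound.\<close>

lemma norm_square_le_line_integral:
  assumes H: "H1_pair l \<psi> V"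
  shows "(norm (\<psi> (grid_point l (i, t))))\<^sup>2 \<le> (\<integral>s. norm (\<psi> (grid_point l (i, s))) * norm (V (i, s)) \<partial>lborel)"
proof -
  define u v where "u = (\<lambda>s. \<psi> (grid_point l (i, s)))" and "v = (\<lambda>s. V (i, s))"
  have uv: "is_primitive u v" using H1_pairD(1)[OF H, of i] by (simp add: u_def v_def)
  note P = is_primitive_norm_square[OF uv]
  note [measurable] = is_primitiveD(1)[OF uv] is_primitive_borel[OF uv]
  have iu: "integrable lborel (\<lambda>s. (norm (u s))\<^sup>2)"
    using integrable_grid_line[OF H1_pairD(2)[OF H], of i] by (simp add: u_def)
  have iuv: "integrable lborel (\<lambda>s. norm (u s) * norm (v s))"
    using integrable_grid_line[OF integrable_norm_mult_deriv(1)[OF H], of i] by (simp add: u_def v_def)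
  have b: "\<bar>2 * (u s \<bullet> v s)\<bar> \<le> 2 * (norm (u s) * norm (v s))" for s
    using Cauchy_Schwarz_ineq2[of "u s" "v s"] by (simp add: abs_mult)
  have ig: "integrable lborel (\<lambda>s. 2 * (u s \<bullet> v s))"
    by (rule Bochner_Integration.integrable_bound[of _ "\<lambda>s. 2 * (norm (u s) * norm (v s))"])
      (use iuv b in auto)
  have "2 * (norm (u t))\<^sup>2 \<le> (\<integral>s. \<bar>2 * (u s \<bullet> v s)\<bar> \<partial>lborel)"
    by (intro two_sided_primitive_bound[OF P ig] integrable_continuous_small_beyond[OF iu]) auto
  also have "\<dots> \<le> (\<integral>s. 2 * (norm (u s) * norm (v s)) \<partial>lborel)"
    by (intro integral_mono) (use ig iuv b in auto)
  finally show ?thesis by (simp add: u_def v_def)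
qed

lemma norm_square_le_sqrt_mass_kinetic:
  assumes H: "H1_pair l \<psi> V"
  shows "(norm (\<psi> (grid_point l x)))\<^sup>2 \<le> sqrt (mass_of l \<psi> * kinetic V)"
proof (cases x)
  case (Pair i t)
  have "(norm (\<psi> (grid_point l (i, t))))\<^sup>2 \<le> (\<integral>s. norm (\<psi> (grid_point l (i, s))) * norm (V (i, s)) \<partial>lborel)"
    by (rule norm_square_le_line_integral[OF H])
  also have "\<dots> \<le> (\<integral>x. norm (\<psi> (grid_point l x)) * norm (V x) \<partial>grid_measure)"
    by (rule integral_grid_line_le[OF integrable_norm_mult_deriv(1)[OF H]]) simp
  also have "\<dots> \<le> sqrt (mass_of l \<psi> * kinetic V)" by (rule integrable_norm_mult_deriv(2)[OF H])
  finally show ?thesis by (simp add: Pair)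
qed

lemma norm_powr_le:
  fixes z :: complex
  assumes "norm z \<le> B" "p \<ge> q"
  shows "norm z powr p \<le> B powr (p - q) * norm z powr q"
proof (cases "z = 0")
  case False
  have "norm z powr p = norm z powr (p - q) * norm z powr q" by (simp flip: powr_add)
  also have "\<dots> \<le> B powr (p - q) * norm z powr q"
    using assms by (intro mult_right_mono powr_mono2) auto
  finally show ?thesis .
qed simp

lemma integrable_power_of:
  assumes H: "H1_pair l \<psi> V" and p: "p \<ge> 2"
  shows "integrable grid_measure (\<lambda>x. norm (\<psi> (grid_point l x)) powr p)"
proof -
  note [measurable] = H1_pairD(4)[OF H]
  define B where "B = sqrt (sqrt (mass_of l \<psi> * kinetic V))"
  have B: "norm (\<psi> (grid_point l x)) \<le> B" for x
    using norm_square_le_sqrt_mass_kinetic[OF H, of x] unfolding B_def by (rule real_le_rsqrt)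
  show ?thesis
  proof (rule Bochner_Integration.integrable_bound)
    show "integrable grid_measure (\<lambda>x. B powr (p - 2) * (norm (\<psi> (grid_point l x)))\<^sup>2)"
      using H1_pairD(2)[OF H] by simp
    show "AE x in grid_measure. norm (norm (\<psi> (grid_point l x)) powr p) \<le> norm (B powr (p - 2) * (norm (\<psi> (grid_point l x)))\<^sup>2)"
      using norm_powr_le[OF B p] by (simp add: norm_powr_2)
  qed measurable
qed

lemma power_of_le:
  assumes H: "H1_pair l \<psi> V" and pq: "q \<le> p" "2 \<le> q" and B: "\<And>x. norm (\<psi> (grid_point l x)) \<le> B"
  shows "power_of l p \<psi> \<le> B powr (p - q) * power_of l q \<psi>"
proof -
  have "power_of l p \<psi> \<le> (\<integral>x. B powr (p - q) * norm (\<psi> (grid_point l x)) powr q \<partial>grid_measure)"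
    unfolding power_of_def
    by (intro integral_mono integrable_power_of[OF H] norm_powr_le B integrable_mult_right impI) (use pq in auto)
  then show ?thesis by (simp add: power_of_def)
qed

lemma power_of_2: "power_of l 2 \<psi> = mass_of l \<psi>"
  by (simp add: power_of_def mass_of_def norm_powr_2)

lemma sup_norm_bound:
  assumes H: "H1_pair l \<psi> V"
  shows "norm (\<psi> (grid_point l x)) \<le> (mass_of l \<psi> * kinetic V) powr (1/4)"
proof -
  have "norm (\<psi> (grid_point l x)) \<le> sqrt (sqrt (mass_of l \<psi> * kinetic V))"
    using norm_square_le_sqrt_mass_kinetic[OF H, of x] by (rule real_le_rsqrt)
  then show ?thesis by (simp add: powr_half_sqrt[symmetric] powr_powr)
qed

text \<open>The one-dimensional Gagliardo-Nirenberg inequality: bound all but two powers by the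
  supremum. The exponent of the kinetic term is below 1 exactly when \<open>p < 6\<close> and equals
  1 at \<open>p = 6\<close>.\<close>

lemma power_of_le_mass_kinetic:
  assumes H: "H1_pair l \<psi> V" and p: "2 \<le> p"
  shows "power_of l p \<psi> \<le> (mass_of l \<psi> * kinetic V) powr ((p - 2) / 4) * mass_of l \<psi>"
proof -
  have "power_of l p \<psi> \<le> ((mass_of l \<psi> * kinetic V) powr (1/4)) powr (p - 2) * power_of l 2 \<psi>"
    by (rule power_of_le[OF H p _ sup_norm_bound[OF H]]) simp
  then show ?thesis by (simp add: powr_powr power_of_2)
qed

text \<open>Cauchy-Schwarz against the indicator of the interval. A bound on the kinetic term thus
  gives equicontinuity along all lines at once, which the compactness arguments rely on.\<close>

lemma Hoelder_half:
  assumes H: "H1_pair l \<psi> V"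
  shows "norm (\<psi> (grid_point l (i, t)) - \<psi> (grid_point l (i, s))) \<le> sqrt (\<bar>t - s\<bar> * kinetic V)"
proof -
  have *: "norm (\<psi> (grid_point l (i, t)) - \<psi> (grid_point l (i, s))) \<le> sqrt (\<bar>t - s\<bar> * kinetic V)" if "s \<le> t" for s t
  proof -
    note prim = H1_pairD(1)[OF H, of i]
    note [measurable] = is_primitiveD(1)[OF prim]
    have iV: "integrable lborel (\<lambda>r. (norm (V (i, r)))\<^sup>2)"
      using integrable_grid_line[OF H1_pairD(3)[OF H], of i] .
    have sq: "(\<lambda>r. (indicator {s..t} r)\<^sup>2) = (indicator {s..t} :: real \<Rightarrow> real)" by (auto simp: indicator_def)
    have i1: "integrable lborel (\<lambda>r. (indicator {s..t} r)\<^sup>2 :: real)"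
      unfolding sq by (intro integrable_real_indicator) (auto simp: emeasure_lborel_Icc_eq)
    have "norm (\<psi> (grid_point l (i, t)) - \<psi> (grid_point l (i, s))) \<le> (LINT r:{s..t}|lborel. norm (V (i, r)))"
      unfolding is_primitiveD(3)[OF prim that] by (rule set_integral_norm_bound[OF is_primitiveD(2)[OF prim]])
    also have "\<dots> \<le> sqrt (\<bar>t - s\<bar> * kinetic V)"
    proof (rule real_le_rsqrt)
      have "(LINT r:{s..t}|lborel. norm (V (i, r)))\<^sup>2 = (\<integral>r. indicator {s..t} r * norm (V (i, r)) \<partial>lborel)\<^sup>2"
        by (simp add: set_lebesgue_integral_def)
      also have "\<dots> \<le> (\<integral>r. (indicator {s..t} r)\<^sup>2 \<partial>lborel) * (\<integral>r. (norm (V (i, r)))\<^sup>2 \<partial>lborel)"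
        by (intro Cauchy_Schwarz_integral iV i1) measurable
      also have "(\<integral>r. (indicator {s..t} r)\<^sup>2 \<partial>lborel) = t - s"
        unfolding sq using that by simp
      also have "(t - s) * (\<integral>r. (norm (V (i, r)))\<^sup>2 \<partial>lborel) \<le> (t - s) * kinetic V"
        unfolding kinetic_def using that
        by (intro mult_left_mono integral_grid_line_le[OF H1_pairD(3)[OF H]]) auto
      finally show "(LINT r:{s..t}|lborel. norm (V (i, r)))\<^sup>2 \<le> \<bar>t - s\<bar> * kinetic V" using that by simp
    qed
    finally show ?thesis .
  qed
  show ?thesis using *[of s t] *[of t s] by (cases "s \<le> t") (auto simp: norm_minus_commute abs_minus_commute)
qed

lemma mass_of_eq_0_iff:
  assumes H: "H1_pair l \<psi> V"
  shows "mass_of l \<psi> = 0 \<longleftrightarrow> (\<forall>x. \<psi> (grid_point l x) = 0)"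
proof
  assume m: "mass_of l \<psi> = 0"
  show "\<forall>x. \<psi> (grid_point l x) = 0"
  proof
    fix x :: "grid_line_index \<times> real"
    have "(norm (\<psi> (grid_point l x)))\<^sup>2 \<le> 0"
      using norm_square_le_sqrt_mass_kinetic[OF H, of x] m by simp
    then show "\<psi> (grid_point l x) = 0" by simp
  qed
next
  assume z: "\<forall>x. \<psi> (grid_point l x) = 0"
  have "(\<lambda>x. (norm (\<psi> (grid_point l x)))\<^sup>2) = (\<lambda>x. 0)" unfolding z[rule_format] by simp
  then show "mass_of l \<psi> = 0" by (simp add: mass_of_def)
qed

text \<open>Asks only for measurability and integrability because it is also applied to the
  pointwise limit of a minimising sequence, at a stage when that limit has no derivative
  yet.\<close>

lemma power_of_pos_if_integrable:
  assumes m: "(\<lambda>x. \<psi> (grid_point l x)) \<in> borel_measurable grid_measure"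
    and ip: "integrable grid_measure (\<lambda>x. norm (\<psi> (grid_point l x)) powr p)"
    and pos: "mass_of l \<psi> > 0"
  shows "power_of l p \<psi> > 0"
proof (rule ccontr)
  assume "\<not> 0 < power_of l p \<psi>"
  then have "power_of l p \<psi> = 0" using power_of_nonneg[of l p \<psi>] by linarith
  then have "AE x in grid_measure. norm (\<psi> (grid_point l x)) powr p = 0"
    using integral_nonneg_eq_0_iff_AE[OF ip] by (simp add: power_of_def)
  then have z: "AE x in grid_measure. (norm (\<psi> (grid_point l x)))\<^sup>2 = 0" by eventually_elim simp
  have "mass_of l \<psi> = (\<integral>x. 0 \<partial>(grid_measure :: (grid_line_index \<times> real) measure))" unfolding mass_of_def
    by (rule integral_cong_AE) (use z m in auto)
  then show False using pos by simp
qed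

lemma power_of_pos:
  assumes H: "H1_pair l \<psi> V" and p: "p \<ge> 2" and m: "mass_of l \<psi> > 0"
  shows "power_of l p \<psi> > 0"
  by (rule power_of_pos_if_integrable[OF H1_pairD(4)[OF H] integrable_power_of[OF H p] m])

lemma kinetic_pos:
  assumes H: "H1_pair l \<psi> V" and m: "mass_of l \<psi> > 0"
  shows "kinetic V > 0"
proof (rule ccontr)
  assume "\<not> kinetic V > 0"
  then have K: "kinetic V = 0" using kinetic_nonneg[of V] by linarith
  have "\<psi> (grid_point l x) = 0" for x
    using norm_square_le_sqrt_mass_kinetic[OF H, of x] K by simp
  then show False using m by (simp add: mass_of_def)
qed

definition energy_of :: "real \<Rightarrow> real \<Rightarrow> (real ^ 3 \<Rightarrow> complex) \<Rightarrow> (grid_line_index \<times> real \<Rightarrow> complex) \<Rightarrow> real" where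
  "energy_of l p \<psi> V = 1/2 * kinetic V - 1/p * power_of l p \<psi>"

lemma energy_of_scale:
  "energy_of l p (\<lambda>x. c * \<psi> x) (\<lambda>x. c * V x) = (norm c)\<^sup>2 / 2 * kinetic V - norm c powr p / p * power_of l p \<psi>"
  by (simp add: energy_of_def kinetic_scale power_of_scale)

section \<open>The three-dimensional Gagliardo-Nirenberg inequality\<close>

lemma nn_integral_count_space_swap:
  "(\<integral>\<^sup>+p. f (snd p, fst p) \<partial>count_space UNIV) = (\<integral>\<^sup>+p. f p \<partial>count_space (UNIV :: ('a \<times> 'b) set))"
proof -
  have "bij_betw prod.swap (UNIV :: ('b \<times> 'a) set) (UNIV :: ('a \<times> 'b) set)" by (simp add: bij_swap)
  from nn_integral_bij_count_space[OF this, of f] show ?thesis by (simp add: prod.swap_def)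
qed

text \<open>The discrete inequality for functions of two of three coordinates, with
  \<open>p = (j, k)\<close>: the weights depend on \<open>(j, k)\<close>, \<open>(i, k)\<close> and
  \<open>(i, j)\<close>. Cauchy-Schwarz in \<open>i\<close> separates \<open>\<beta>\<close> from
  \<open>\<gamma>\<close>, and a second one in \<open>p\<close> separates \<open>\<alpha>\<close>
  from both; the remaining double sum factorises.\<close>

lemma Loomis_Whitney:
  fixes \<alpha> \<beta> \<gamma> :: "int \<times> int \<Rightarrow> ennreal"
  shows "(\<integral>\<^sup>+p. (\<integral>\<^sup>+i. \<alpha> p * \<beta> (i, snd p) * \<gamma> (i, fst p) \<partial>count_space UNIV) \<partial>count_space UNIV)\<^sup>2
    \<le> (\<integral>\<^sup>+p. (\<alpha> p)\<^sup>2 \<partial>count_space UNIV) * (\<integral>\<^sup>+p. (\<beta> p)\<^sup>2 \<partial>count_space UNIV) * (\<integral>\<^sup>+p. (\<gamma> p)\<^sup>2 \<partial>count_space UNIV)"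
proof -
  define D where "D p = (\<integral>\<^sup>+i. \<beta> (i, snd p) * \<gamma> (i, fst p) \<partial>count_space UNIV)" for p
  define B where "B k = (\<integral>\<^sup>+i. (\<beta> (i, k))\<^sup>2 \<partial>count_space UNIV)" for k
  define C where "C j = (\<integral>\<^sup>+i. (\<gamma> (i, j))\<^sup>2 \<partial>count_space UNIV)" for j
  have D: "(D p)\<^sup>2 \<le> B (snd p) * C (fst p)" for p
    unfolding D_def B_def C_def by (rule Cauchy_Schwarz_nn_integral) auto
  have "(\<integral>\<^sup>+p. (\<integral>\<^sup>+i. \<alpha> p * \<beta> (i, snd p) * \<gamma> (i, fst p) \<partial>count_space UNIV) \<partial>count_space UNIV)
    = (\<integral>\<^sup>+p. \<alpha> p * D p \<partial>count_space UNIV)"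
    unfolding D_def by (intro nn_integral_cong) (simp add: mult.assoc nn_integral_cmult)
  also have "\<dots>\<^sup>2 \<le> (\<integral>\<^sup>+p. (\<alpha> p)\<^sup>2 \<partial>count_space UNIV) * (\<integral>\<^sup>+p. (D p)\<^sup>2 \<partial>count_space UNIV)"
    by (rule Cauchy_Schwarz_nn_integral) auto
  also have "(\<integral>\<^sup>+p. (D p)\<^sup>2 \<partial>count_space UNIV) \<le> (\<integral>\<^sup>+p. B (snd p) * C (fst p) \<partial>count_space UNIV)"
    by (intro nn_integral_mono D)
  also have "\<dots> = (\<integral>\<^sup>+j. (\<integral>\<^sup>+k. B k * C j \<partial>count_space UNIV) \<partial>count_space UNIV)"
    by (subst nn_integral_fst_count_space[symmetric]) simp
  also have "\<dots> = (\<integral>\<^sup>+k. B k \<partial>count_space UNIV) * (\<integral>\<^sup>+j. C j \<partial>count_space UNIV)"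
    by (simp add: nn_integral_multc nn_integral_cmult)
  also have "(\<integral>\<^sup>+k. B k \<partial>count_space UNIV) = (\<integral>\<^sup>+p. (\<beta> p)\<^sup>2 \<partial>count_space UNIV)"
    unfolding B_def by (rule nn_integral_snd_count_space)
  also have "(\<integral>\<^sup>+j. C j \<partial>count_space UNIV) = (\<integral>\<^sup>+p. (\<gamma> p)\<^sup>2 \<partial>count_space UNIV)"
    unfolding C_def by (rule nn_integral_snd_count_space)
  finally show ?thesis by (simp add: mult_left_mono mult.assoc)
qed

lemma nn_integral_cells:
  fixes f :: "real \<Rightarrow> ennreal"
  assumes l: "l > 0" and [measurable]: "f \<in> borel_measurable borel"
  shows "(\<integral>\<^sup>+t. f t \<partial>lborel) = (\<integral>\<^sup>+q. (\<integral>\<^sup>+t. f t * indicator {real_of_int q * l..<(real_of_int q + 1) * l} t \<partial>lborel) \<partial>count_space UNIV)"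
proof -
  have 1: "(\<integral>\<^sup>+q. f t * indicator {real_of_int q * l..<(real_of_int q + 1) * l} t \<partial>count_space UNIV) = f t" for t
  proof -
    have iff: "t \<in> {real_of_int q * l..<(real_of_int q + 1) * l} \<longleftrightarrow> q = \<lfloor>t / l\<rfloor>" for q
      using l by (auto simp: floor_eq_iff field_simps eq_commute[of q])
    have "(\<integral>\<^sup>+q. f t * indicator {real_of_int q * l..<(real_of_int q + 1) * l} t \<partial>count_space UNIV)
      = (\<integral>\<^sup>+q. f t * indicator {\<lfloor>t / l\<rfloor>} q \<partial>count_space UNIV)"
      by (intro nn_integral_cong) (simp add: indicator_def iff del: atLeastLessThan_iff)
    also have "\<dots> = f t" by (subst nn_integral_cmult_indicator) auto
    finally show ?thesis .
  qed
  have "(\<integral>\<^sup>+q. (\<integral>\<^sup>+t. f t * indicator {real_of_int q * l..<(real_of_int q + 1) * l} t \<partial>lborel) \<partial>count_space UNIV)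
    = (\<integral>\<^sup>+t. (\<integral>\<^sup>+q. f t * indicator {real_of_int q * l..<(real_of_int q + 1) * l} t \<partial>count_space UNIV) \<partial>lborel)"
  proof -
    interpret pair_sigma_finite "count_space (UNIV :: int set)" lborel
      by (intro pair_sigma_finite.intro sigma_finite_measure_count_space_countable sigma_finite_lborel) auto
    show ?thesis
      by (rule Fubini'[of "\<lambda>q t. f t * indicator {real_of_int q * l..<(real_of_int q + 1) * l} t", symmetric])
        (auto intro!: measurable_pair_measure_countable1)
  qed
  then show ?thesis by (simp add: 1)
qed

lemma ennreal_le_if_square_le:
  assumes "x\<^sup>2 \<le> (ennreal c)\<^sup>2" "c \<ge> 0"
  shows "x \<le> ennreal c"
proof (cases x)
  case (real r)
  then have "r\<^sup>2 \<le> c\<^sup>2" using assms by (simp add: ennreal_power)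
  then show ?thesis using real assms by (auto intro!: ennreal_leI dest: power2_le_imp_le)
next
  case top
  then have "x\<^sup>2 = top" by (simp add: power2_eq_square)
  then show ?thesis using assms by (simp add: ennreal_power top_unique)
qed

lemma cube_add_le:
  fixes b y :: real
  assumes "b \<ge> 0" "y \<ge> 0"
  shows "(b + y) ^ 3 \<le> 4 * (b ^ 3 + y ^ 3)"
proof -
  have "4 * (b ^ 3 + y ^ 3) - (b + y) ^ 3 = 3 * (b + y) * (b - y)\<^sup>2" by algebra
  moreover have "3 * (b + y) * (b - y)\<^sup>2 \<ge> 0" using assms by simp
  ultimately show ?thesis by linarith
qed

text \<open>\<open>w\<close> dominates the derivative of the fourth power of the modulus along
  lines. The fourth power is chosen because three lines meet at a vertex, so that its bounds
  multiply to the twelfth power, the square of the sixth; moreover \<open>J\<close> is controlled by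
  the sixth power and the kinetic term, which closes the estimate.\<close>

context
  fixes l :: real and \<psi> V J w
  assumes l: "l > 0" and H: "H1_pair l \<psi> V"
  defines "w \<equiv> \<lambda>x. 4 * ((norm (\<psi> (grid_point l x))) ^ 3 * norm (V x))"
    and "J \<equiv> \<integral>x. w x \<partial>grid_measure"
begin

lemma fourth_power_deriv_integrable: "integrable grid_measure w" and fourth_power_deriv_nonneg: "w x \<ge> 0"
proof -
  note [measurable] = H1_pairD(4,5)[OF H]
  show "w x \<ge> 0" by (simp add: w_def)
  show "integrable grid_measure w"
  proof (rule Bochner_Integration.integrable_bound)
    let ?C = "sqrt (mass_of l \<psi> * kinetic V)"
    show "integrable grid_measure (\<lambda>x. 4 * ?C * (norm (\<psi> (grid_point l x)) * norm (V x)))"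
      using integrable_norm_mult_deriv(1)[OF H] by simp
    have "w x \<le> 4 * ?C * (norm (\<psi> (grid_point l x)) * norm (V x))" for x
    proof -
      have "w x = 4 * ((norm (\<psi> (grid_point l x)))\<^sup>2 * (norm (\<psi> (grid_point l x)) * norm (V x)))"
        by (simp add: w_def power3_eq_cube power2_eq_square)
      also have "\<dots> \<le> 4 * (?C * (norm (\<psi> (grid_point l x)) * norm (V x)))"
        by (intro mult_left_mono mult_right_mono norm_square_le_sqrt_mass_kinetic[OF H]) auto
      finally show ?thesis by simp
    qed
    then show "AE x in grid_measure. norm (w x) \<le> norm (4 * ?C * (norm (\<psi> (grid_point l x)) * norm (V x)))"
      by (simp add: w_def)
  qed (simp add: w_def)
qed

lemma fourth_power_variation_nonneg: "J \<ge> 0"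
  unfolding J_def by (intro integral_nonneg_AE) (simp add: fourth_power_deriv_nonneg)

lemma fourth_power_primitive:
  "is_primitive (\<lambda>t. (norm (\<psi> (grid_point l (i, t)))) ^ 4)
     (\<lambda>t. 4 * (norm (\<psi> (grid_point l (i, t))))\<^sup>2 * (\<psi> (grid_point l (i, t)) \<bullet> V (i, t)))"
proof -
  note P = is_primitive_norm_square[OF H1_pairD(1)[OF H, of i]]
  have "is_primitive (\<lambda>t. (norm (\<psi> (grid_point l (i, t))))\<^sup>2 * (norm (\<psi> (grid_point l (i, t))))\<^sup>2)
     (\<lambda>t. 4 * (norm (\<psi> (grid_point l (i, t))))\<^sup>2 * (\<psi> (grid_point l (i, t)) \<bullet> V (i, t)))"
    using is_primitive_bilinear[OF bounded_bilinear_mult P P] by (simp add: algebra_simps)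
  moreover have "x\<^sup>2 * x\<^sup>2 = x ^ 4" for x :: real by (simp flip: power_add)
  ultimately show ?thesis by simp
qed

lemma fourth_power_deriv_le:
  "\<bar>4 * (norm (\<psi> (grid_point l x)))\<^sup>2 * (\<psi> (grid_point l x) \<bullet> V x)\<bar> \<le> w x"
proof -
  have "\<bar>4 * (norm (\<psi> (grid_point l x)))\<^sup>2 * (\<psi> (grid_point l x) \<bullet> V x)\<bar>
    \<le> 4 * (norm (\<psi> (grid_point l x)))\<^sup>2 * (norm (\<psi> (grid_point l x)) * norm (V x))"
    unfolding abs_mult by (intro mult_mono Cauchy_Schwarz_ineq2) auto
  also have "\<dots> = w x" by (simp add: w_def power3_eq_cube power2_eq_square)
  finally show ?thesis .
qed

text \<open>The two-sided bound again; its factor 2 is given away here, since the constant in the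
  Sobolev inequality is of no importance.\<close>

lemma fourth_power_le_line:
  "(norm (\<psi> (grid_point l (i, t)))) ^ 4 \<le> (\<integral>s. w (i, s) \<partial>lborel)"
proof -
  let ?g = "\<lambda>t. 4 * (norm (\<psi> (grid_point l (i, t))))\<^sup>2 * (\<psi> (grid_point l (i, t)) \<bullet> V (i, t))"
  note P = fourth_power_primitive[of i]
  note wi = integrable_grid_line[OF fourth_power_deriv_integrable, of i]
  have "norm (?g s) \<le> norm (w (i, s))" for s
    using fourth_power_deriv_le[of "(i, s)"] fourth_power_deriv_nonneg[of "(i, s)"] by simp
  then have ig: "integrable lborel ?g"
    using is_primitiveD(1)[OF P] by (intro Bochner_Integration.integrable_bound[OF wi] AE_I2) simp_all
  have "integrable lborel (\<lambda>s. (norm (\<psi> (grid_point l (i, s))))\<^sup>2)"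
    using integrable_grid_line[OF H1_pairD(2)[OF H], of i] .
  note small = integrable_continuous_small_beyond[OF this]
  have sm: "x ^ 4 < \<epsilon>" if "x\<^sup>2 < min 1 \<epsilon>" "\<epsilon> > 0" for x \<epsilon> :: real
  proof -
    have "x ^ 4 = x\<^sup>2 * x\<^sup>2" by (simp add: power2_eq_square power4_eq_xxxx)
    also have "\<dots> \<le> 1 * x\<^sup>2" using that by (intro mult_right_mono) auto
    finally show ?thesis using that by simp
  qed
  have "2 * (norm (\<psi> (grid_point l (i, t)))) ^ 4 \<le> (\<integral>s. \<bar>?g s\<bar> \<partial>lborel)"
  proof (rule two_sided_primitive_bound[OF P ig])
    fix \<epsilon> :: real assume e: "\<epsilon> > 0"
    show "\<exists>s\<ge>t. (norm (\<psi> (grid_point l (i, s)))) ^ 4 < \<epsilon>"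
      using small(1)[of "min 1 \<epsilon>" t] e sm by fastforce
    show "\<exists>s\<le>t. (norm (\<psi> (grid_point l (i, s)))) ^ 4 < \<epsilon>"
      using small(2)[of "min 1 \<epsilon>" t] e sm by fastforce
  qed
  also have "\<dots> \<le> (\<integral>s. w (i, s) \<partial>lborel)"
    by (intro integral_mono integrable_abs ig wi fourth_power_deriv_le)
  finally have "2 * (norm (\<psi> (grid_point l (i, t)))) ^ 4 \<le> (\<integral>s. w (i, s) \<partial>lborel)" .
  moreover have "0 \<le> (norm (\<psi> (grid_point l (i, t)))) ^ 4" by simp
  ultimately show ?thesis by linarith
qed

definition vertex_value :: "int \<Rightarrow> int \<Rightarrow> int \<Rightarrow> real" where
  "vertex_value i j k = norm (\<psi> (vector [of_int i * l, of_int j * l, of_int k * l]))"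

definition line_weight :: "axis \<Rightarrow> int \<times> int \<Rightarrow> real" where
  "line_weight a p = (\<integral>s. w ((a, p), s) \<partial>lborel)"

lemma line_weight_nonneg: "line_weight a p \<ge> 0"
  unfolding line_weight_def by (intro integral_nonneg_AE) (simp add: fourth_power_deriv_nonneg)

lemma vertex_value_eq:
  "vertex_value i j k = norm (\<psi> (grid_point l ((XAxis, j, k), of_int i * l)))"
  "vertex_value i j k = norm (\<psi> (grid_point l ((YAxis, i, k), of_int j * l)))"
  "vertex_value i j k = norm (\<psi> (grid_point l ((ZAxis, i, j), of_int k * l)))"
  by (simp_all add: vertex_value_def grid_point_def)

text \<open>Each of the three lines through the vertex bounds the fourth power by its weight.
  Multiply the three bounds and take the square root.\<close>

lemma vertex_value_power6_le:
  "ennreal (vertex_value i j k ^ 6) \<le> ennreal (sqrt (line_weight XAxis (j, k))) * ennreal (sqrt (line_weight YAxis (i, k))) * ennreal (sqrt (line_weight ZAxis (i, j)))"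
proof -
  let ?a = "line_weight XAxis (j, k)" and ?b = "line_weight YAxis (i, k)" and ?c = "line_weight ZAxis (i, j)"
  have 4: "vertex_value i j k ^ 4 \<le> ?a" "vertex_value i j k ^ 4 \<le> ?b" "vertex_value i j k ^ 4 \<le> ?c"
    unfolding line_weight_def by (metis vertex_value_eq fourth_power_le_line)+
  have "(vertex_value i j k ^ 6)\<^sup>2 = vertex_value i j k ^ 4 * vertex_value i j k ^ 4 * vertex_value i j k ^ 4"
    by (simp flip: power_mult power_add)
  also have "\<dots> \<le> ?a * ?b * ?c"
    using 4 by (intro mult_mono) (auto simp: line_weight_nonneg)
  finally have "vertex_value i j k ^ 6 \<le> sqrt (?a * ?b * ?c)" by (rule real_le_rsqrt)
  then show ?thesis
    by (simp add: real_sqrt_mult line_weight_nonneg flip: ennreal_mult)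
qed

lemma sum_line_weights_le: "(\<integral>\<^sup>+p. ennreal (line_weight a p) \<partial>count_space UNIV) \<le> ennreal J"
proof -
  have [measurable]: "w \<in> borel_measurable grid_measure" using fourth_power_deriv_integrable by auto
  have "ennreal J = (\<integral>\<^sup>+x. ennreal (w x) \<partial>grid_measure)"
    unfolding J_def by (rule nn_integral_eq_integral[symmetric]) (auto simp: fourth_power_deriv_integrable fourth_power_deriv_nonneg)
  also have "\<dots> = (\<integral>\<^sup>+i. (\<integral>\<^sup>+s. ennreal (w (i, s)) \<partial>lborel) \<partial>count_space UNIV)"
    by (rule nn_integral_grid) measurable
  also have "\<dots> = (\<integral>\<^sup>+i. ennreal (line_weight (fst i) (snd i)) \<partial>count_space UNIV)"
    unfolding line_weight_def
    by (intro nn_integral_cong, unfold prod.collapse, intro nn_integral_eq_integral integrable_grid_line fourth_power_deriv_integrable)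
      (simp add: fourth_power_deriv_nonneg)
  also have "\<dots> = (\<integral>\<^sup>+a. (\<integral>\<^sup>+p. ennreal (line_weight a p) \<partial>count_space UNIV) \<partial>count_space UNIV)"
    by (subst nn_integral_fst_count_space[symmetric]) simp
  finally show ?thesis
    using nn_integral_ge_point[of a UNIV "\<lambda>a. \<integral>\<^sup>+p. ennreal (line_weight a p) \<partial>count_space UNIV"] by simp
qed

lemma sum_sqrt_line_weights_le: "(\<integral>\<^sup>+p. (ennreal (sqrt (line_weight a p)))\<^sup>2 \<partial>count_space UNIV) \<le> ennreal J"
  using sum_line_weights_le[of a] by (simp add: ennreal_power line_weight_nonneg)

text \<open>For a fixed axis \<open>a\<close>, a line index \<open>p\<close> together with a
  position \<open>i\<close> on the line enumerates every vertex once, so the same bound over all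
  vertices holds for each of the three directions.\<close>

lemma sum_vertices_le:
  "(\<integral>\<^sup>+p. (\<integral>\<^sup>+i. ennreal (norm (\<psi> (grid_point l ((a, p), of_int i * l))) ^ 6) \<partial>count_space UNIV) \<partial>count_space UNIV)\<^sup>2
     \<le> ennreal J ^ 3"
proof -
  define X Y Z where "X = (\<lambda>p. ennreal (sqrt (line_weight XAxis p)))" and "Y = (\<lambda>p. ennreal (sqrt (line_weight YAxis p)))"
    and "Z = (\<lambda>p. ennreal (sqrt (line_weight ZAxis p)))"
  have s: "(\<integral>\<^sup>+p. (X p)\<^sup>2 \<partial>count_space UNIV) \<le> ennreal J" "(\<integral>\<^sup>+p. (Y p)\<^sup>2 \<partial>count_space UNIV) \<le> ennreal J"
    "(\<integral>\<^sup>+p. (Z p)\<^sup>2 \<partial>count_space UNIV) \<le> ennreal J"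
    unfolding X_def Y_def Z_def by (rule sum_sqrt_line_weights_le)+
  \<comment> \<open>The inequality \<open>Loomis_Whitney\<close> prescribes the order of its index
    pairs. For Y and Z lines some weights appear with their two indices reversed, which leaves their
    sums unchanged.\<close>
  have s': "(\<integral>\<^sup>+p. (X (snd p, fst p))\<^sup>2 \<partial>count_space UNIV) \<le> ennreal J" "(\<integral>\<^sup>+p. (Y (snd p, fst p))\<^sup>2 \<partial>count_space UNIV) \<le> ennreal J"
    "(\<integral>\<^sup>+p. (Z (snd p, fst p))\<^sup>2 \<partial>count_space UNIV) \<le> ennreal J"
    using s nn_integral_count_space_swap[of "\<lambda>p. (X p)\<^sup>2"] nn_integral_count_space_swap[of "\<lambda>p. (Y p)\<^sup>2"]
      nn_integral_count_space_swap[of "\<lambda>p. (Z p)\<^sup>2"] by simp_all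
  have *: "(\<integral>\<^sup>+p. (\<integral>\<^sup>+i. f i p \<partial>count_space UNIV) \<partial>count_space UNIV)\<^sup>2 \<le> ennreal J ^ 3"
    if f: "\<And>i p. f i p \<le> \<alpha> p * \<beta> (i, snd p) * \<gamma> (i, fst p)"
      and b: "(\<integral>\<^sup>+p. (\<alpha> p)\<^sup>2 \<partial>count_space UNIV) \<le> ennreal J" "(\<integral>\<^sup>+p. (\<beta> p)\<^sup>2 \<partial>count_space UNIV) \<le> ennreal J" "(\<integral>\<^sup>+p. (\<gamma> p)\<^sup>2 \<partial>count_space UNIV) \<le> ennreal J"
    for f :: "int \<Rightarrow> int \<times> int \<Rightarrow> ennreal" and \<alpha> \<beta> \<gamma>
  proof -
    have "(\<integral>\<^sup>+p. (\<integral>\<^sup>+i. f i p \<partial>count_space UNIV) \<partial>count_space UNIV)\<^sup>2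
      \<le> (\<integral>\<^sup>+p. (\<integral>\<^sup>+i. \<alpha> p * \<beta> (i, snd p) * \<gamma> (i, fst p) \<partial>count_space UNIV) \<partial>count_space UNIV)\<^sup>2"
      by (intro power_mono nn_integral_mono f) simp
    also have "\<dots> \<le> (\<integral>\<^sup>+p. (\<alpha> p)\<^sup>2 \<partial>count_space UNIV) * (\<integral>\<^sup>+p. (\<beta> p)\<^sup>2 \<partial>count_space UNIV) * (\<integral>\<^sup>+p. (\<gamma> p)\<^sup>2 \<partial>count_space UNIV)"
      by (rule Loomis_Whitney)
    also have "\<dots> \<le> ennreal J * ennreal J * ennreal J" by (intro mult_mono b) auto
    finally show ?thesis by (simp add: power3_eq_cube)
  qed
  have v: "ennreal (vertex_value i j k ^ 6) \<le> X (j, k) * Y (i, k) * Z (i, j)" for i j k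
    using vertex_value_power6_le by (simp add: X_def Y_def Z_def)
  show ?thesis
  proof (cases a)
    case XAxis
    have f: "ennreal (norm (\<psi> (grid_point l ((XAxis, p), of_int i * l))) ^ 6) \<le> X p * Y (i, snd p) * Z (i, fst p)" for i p
      using v[of i "fst p" "snd p"] unfolding vertex_value_eq(1)[of i "fst p" "snd p"] by simp
    show ?thesis unfolding XAxis by (rule *[OF f s])
  next
    case YAxis
    have f: "ennreal (norm (\<psi> (grid_point l ((YAxis, p), of_int i * l))) ^ 6) \<le> Y p * X (i, snd p) * Z (snd (i, fst p), fst (i, fst p))" for i p
      using v[of "fst p" i "snd p"] unfolding vertex_value_eq(2)[of "fst p" i "snd p"] by (simp add: mult.commute mult.left_commute)
    show ?thesis unfolding YAxis by (rule *[OF f s(2,1) s'(3)])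
  next
    case ZAxis
    have f: "ennreal (norm (\<psi> (grid_point l ((ZAxis, p), of_int i * l))) ^ 6)
        \<le> Z p * X (snd (i, snd p), fst (i, snd p)) * Y (snd (i, fst p), fst (i, fst p))" for i p
      using v[of "fst p" "snd p" i] unfolding vertex_value_eq(3)[of "fst p" "snd p" i] by (simp add: mult.commute mult.left_commute)
    show ?thesis unfolding ZAxis by (rule *[OF f s(3) s'(1,2)])
  qed
qed

text \<open>Inside an edge the fourth power exceeds its value at the left vertex by at most the
  variation \<open>y\<close> of that edge. Taking roots and cubing leaves the term
  \<open>sqrt y * y\<close>; bounding \<open>sqrt y\<close> by \<open>sqrt J\<close> makes it linear
  in \<open>y\<close>, hence summable over the edges.\<close>

lemma power6_cell_le:
  assumes "t \<in> {of_int q * l..<(of_int q + 1) * l}"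
  shows "norm (\<psi> (grid_point l (i, t))) ^ 6 \<le> 4 * (norm (\<psi> (grid_point l (i, of_int q * l))) ^ 6 +
     sqrt J * (\<integral>s. w (i, s) * indicator {of_int q * l..<(of_int q + 1) * l} s \<partial>lborel))"
proof -
  let ?I = "{of_int q * l..<(of_int q + 1) * l}"
  define y where "y = (\<integral>s. w (i, s) * indicator ?I s \<partial>lborel)"
  define a b where "a = (norm (\<psi> (grid_point l (i, t))))\<^sup>2" and "b = (norm (\<psi> (grid_point l (i, of_int q * l))))\<^sup>2"
  note P = fourth_power_primitive[of i]
  note wi = integrable_grid_line[OF fourth_power_deriv_integrable, of i]
  have wI: "integrable lborel (\<lambda>s. w (i, s) * indicator A s)" if "A \<in> sets borel" for A
    using integrable_mult_indicator[OF _ wi, of A] that by (simp add: mult.commute)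
  have y0: "y \<ge> 0" unfolding y_def by (intro integral_nonneg_AE) (auto simp: fourth_power_deriv_nonneg)
  have "y \<le> (\<integral>s. w (i, s) \<partial>lborel)" unfolding y_def
    by (intro integral_mono wi wI) (auto simp: indicator_def fourth_power_deriv_nonneg)
  also have "\<dots> \<le> J" unfolding J_def by (rule integral_grid_line_le[OF fourth_power_deriv_integrable fourth_power_deriv_nonneg])
  finally have yJ: "y \<le> J" .
  have le: "of_int q * l \<le> t" using assms by simp
  have "a\<^sup>2 - b\<^sup>2 = (LINT s:{of_int q * l..t}|lborel. 4 * (norm (\<psi> (grid_point l (i, s))))\<^sup>2 * (\<psi> (grid_point l (i, s)) \<bullet> V (i, s)))"
    using is_primitiveD(3)[OF P le] by (simp add: a_def b_def)
  also have "\<dots> \<le> (LINT s:{of_int q * l..t}|lborel. w (i, s))"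
  proof (rule set_integral_mono[OF is_primitiveD(2)[OF P]])
    show "set_integrable lborel {of_int q * l..t} (\<lambda>s. w (i, s))"
      using wI[of "{of_int q * l..t}"] by (simp add: set_integrable_def mult.commute)
    show "4 * (norm (\<psi> (grid_point l (i, s))))\<^sup>2 * (\<psi> (grid_point l (i, s)) \<bullet> V (i, s)) \<le> w (i, s)" for s
      using fourth_power_deriv_le[of "(i, s)"] by linarith
  qed
  also have "\<dots> \<le> y" unfolding y_def set_lebesgue_integral_def
    using assms wI[of "{of_int q * l..t}"]
    by (intro integral_mono wI) (auto simp: indicator_def fourth_power_deriv_nonneg mult.commute)
  finally have "a\<^sup>2 \<le> b\<^sup>2 + y" by simp
  also have "\<dots> \<le> (b + sqrt y)\<^sup>2" using y0 by (simp add: power2_sum b_def)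
  finally have "a \<le> b + sqrt y" by (rule power2_le_imp_le) (use y0 in \<open>auto simp: b_def\<close>)
  then have "a ^ 3 \<le> (b + sqrt y) ^ 3" by (intro power_mono) (auto simp: a_def)
  also have "\<dots> \<le> 4 * (b ^ 3 + sqrt y ^ 3)" by (rule cube_add_le) (use y0 in \<open>auto simp: b_def\<close>)
  also have "sqrt y ^ 3 = sqrt y * y" using y0 by (simp add: power3_eq_cube)
  also have "sqrt y * y \<le> sqrt J * y" using y0 yJ by (intro mult_right_mono) auto
  finally show ?thesis by (simp add: a_def b_def y_def flip: power_mult)
qed

lemma power6_line_le:
  "(\<integral>\<^sup>+t. ennreal (norm (\<psi> (grid_point l (i, t))) ^ 6) \<partial>lborel) \<le>
    ennreal (4 * l) * ((\<integral>\<^sup>+q. ennreal (norm (\<psi> (grid_point l (i, of_int q * l))) ^ 6) \<partial>count_space UNIV)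
      + ennreal (sqrt J) * (\<integral>\<^sup>+s. ennreal (w (i, s)) \<partial>lborel))"
proof -
  define I where "I q = {real_of_int q * l..<(real_of_int q + 1) * l}" for q
  define y where "y q = (\<integral>s. w (i, s) * indicator (I q) s \<partial>lborel)" for q
  define b where "b q = norm (\<psi> (grid_point l (i, of_int q * l))) ^ 6" for q
  note [measurable] = is_primitive_borel[OF H1_pairD(1)[OF H, of i]]
  note wi = integrable_grid_line[OF fourth_power_deriv_integrable, of i]
  have [measurable]: "(\<lambda>s. w (i, s)) \<in> borel_measurable borel" using wi by auto
  have I[measurable]: "I q \<in> sets borel" for q by (simp add: I_def)
  have wI: "integrable lborel (\<lambda>s. w (i, s) * indicator (I q) s)" for q
    using integrable_mult_indicator[OF _ wi, of "I q"] by (simp add: mult.commute)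
  have y: "ennreal (y q) = (\<integral>\<^sup>+s. ennreal (w (i, s)) * indicator (I q) s \<partial>lborel)" "y q \<ge> 0" for q
  proof -
    have "(\<integral>\<^sup>+s. ennreal (w (i, s)) * indicator (I q) s \<partial>lborel) = (\<integral>\<^sup>+s. ennreal (w (i, s) * indicator (I q) s) \<partial>lborel)"
      by (intro nn_integral_cong) (auto simp: indicator_def)
    also have "\<dots> = ennreal (y q)" unfolding y_def by (rule nn_integral_eq_integral[OF wI]) (auto simp: fourth_power_deriv_nonneg)
    finally show "ennreal (y q) = (\<integral>\<^sup>+s. ennreal (w (i, s)) * indicator (I q) s \<partial>lborel)" by simp
    show "y q \<ge> 0" unfolding y_def by (intro integral_nonneg_AE) (auto simp: fourth_power_deriv_nonneg)
  qed
  have eI: "emeasure lborel (I q) = ennreal l" for q using l by (simp add: I_def algebra_simps)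
  have "(\<integral>\<^sup>+t. ennreal (norm (\<psi> (grid_point l (i, t))) ^ 6) \<partial>lborel) =
    (\<integral>\<^sup>+q. (\<integral>\<^sup>+t. ennreal (norm (\<psi> (grid_point l (i, t))) ^ 6) * indicator (I q) t \<partial>lborel) \<partial>count_space UNIV)"
    unfolding I_def by (rule nn_integral_cells[OF l]) measurable
  also have "\<dots> \<le> (\<integral>\<^sup>+q. (\<integral>\<^sup>+t. ennreal (4 * (b q + sqrt J * y q)) * indicator (I q) t \<partial>lborel) \<partial>count_space UNIV)"
  proof (intro nn_integral_mono)
    show "ennreal (norm (\<psi> (grid_point l (i, t))) ^ 6) * indicator (I q) t \<le> ennreal (4 * (b q + sqrt J * y q)) * indicator (I q) t" for q t
      using power6_cell_le[of t q i] by (auto simp: indicator_def I_def b_def y_def intro!: ennreal_leI)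
  qed
  also have "\<dots> = (\<integral>\<^sup>+q. ennreal (4 * l) * (ennreal (b q) + ennreal (sqrt J) * ennreal (y q)) \<partial>count_space UNIV)"
  proof (rule nn_integral_cong)
    fix q
    have "b q \<ge> 0" by (simp add: b_def)
    have "(\<integral>\<^sup>+t. ennreal (4 * (b q + sqrt J * y q)) * indicator (I q) t \<partial>lborel) = ennreal (4 * (b q + sqrt J * y q)) * ennreal l"
      by (simp add: nn_integral_cmult_indicator eI)
    also have "\<dots> = ennreal (4 * l) * (ennreal (b q) + ennreal (sqrt J) * ennreal (y q))"
      using l y(2)[of q] fourth_power_variation_nonneg \<open>b q \<ge> 0\<close> by (simp add: mult_ac flip: ennreal_mult ennreal_plus)
    finally show "(\<integral>\<^sup>+t. ennreal (4 * (b q + sqrt J * y q)) * indicator (I q) t \<partial>lborel) = ennreal (4 * l) * (ennreal (b q) + ennreal (sqrt J) * ennreal (y q))" .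
  qed
  also have "\<dots> = ennreal (4 * l) * ((\<integral>\<^sup>+q. ennreal (b q) \<partial>count_space UNIV) + ennreal (sqrt J) * (\<integral>\<^sup>+q. ennreal (y q) \<partial>count_space UNIV))"
    by (simp add: nn_integral_cmult nn_integral_add)
  also have "(\<integral>\<^sup>+q. ennreal (y q) \<partial>count_space UNIV) = (\<integral>\<^sup>+s. ennreal (w (i, s)) \<partial>lborel)"
    unfolding y I_def by (rule nn_integral_cells[OF l, symmetric]) measurable
  finally show ?thesis by (simp add: b_def)
qed

lemma power6_total_le: "power_of l 6 \<psi> \<le> 16 * l * (sqrt J * J)"
proof -
  note [measurable] = H1_pairD(4,5)[OF H]
  have [measurable]: "w \<in> borel_measurable grid_measure" using fourth_power_deriv_integrable by auto
  define T where "T i = (\<integral>\<^sup>+q. ennreal (norm (\<psi> (grid_point l (i, of_int q * l))) ^ 6) \<partial>count_space UNIV)" for i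
  have p6: "norm z powr 6 = norm z ^ 6" for z :: complex by (cases "z = 0") auto
  have J: "ennreal J = (\<integral>\<^sup>+x. ennreal (w x) \<partial>grid_measure)"
    unfolding J_def by (rule nn_integral_eq_integral[symmetric]) (auto simp: fourth_power_deriv_integrable fourth_power_deriv_nonneg)
  have Tle: "(\<integral>\<^sup>+p. T (a, p) \<partial>count_space UNIV) \<le> ennreal (sqrt J * J)" for a
  proof -
    have "(ennreal (sqrt J * J))\<^sup>2 = ennreal ((sqrt J * J)\<^sup>2)"
      by (rule ennreal_power) (simp add: fourth_power_variation_nonneg)
    also have "(sqrt J * J)\<^sup>2 = J ^ 3"
      using fourth_power_variation_nonneg by (simp add: power_mult_distrib power3_eq_cube power2_eq_square)
    also have "ennreal (J ^ 3) = ennreal J ^ 3" by (rule ennreal_power[symmetric]) (rule fourth_power_variation_nonneg)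
    finally have "(\<integral>\<^sup>+p. T (a, p) \<partial>count_space UNIV)\<^sup>2 \<le> (ennreal (sqrt J * J))\<^sup>2"
      using sum_vertices_le[of a] by (simp add: T_def)
    then show ?thesis by (rule ennreal_le_if_square_le) (simp add: fourth_power_variation_nonneg)
  qed
  have "(\<integral>\<^sup>+i. T i \<partial>count_space UNIV) = (\<Sum>a\<in>UNIV. (\<integral>\<^sup>+p. T (a, p) \<partial>count_space UNIV))"
    by (subst nn_integral_fst_count_space[symmetric]) (simp add: nn_integral_count_space_finite UNIV_axis)
  also have "\<dots> \<le> (\<Sum>a\<in>(UNIV::axis set). ennreal (sqrt J * J))" by (intro sum_mono Tle)
  also have "\<dots> = 3 * ennreal (sqrt J * J)" by (simp add: UNIV_axis)
  also have "\<dots> = ennreal (3 * (sqrt J * J))"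
    using ennreal_mult[of 3 "sqrt J * J"] fourth_power_variation_nonneg by simp
  finally have Tsum: "(\<integral>\<^sup>+i. T i \<partial>count_space UNIV) \<le> ennreal (3 * (sqrt J * J))" .
  have "ennreal (power_of l 6 \<psi>) = (\<integral>\<^sup>+x. ennreal (norm (\<psi> (grid_point l x)) ^ 6) \<partial>grid_measure)"
    unfolding power_of_def p6[symmetric]
    by (rule nn_integral_eq_integral[symmetric]) (use integrable_power_of[OF H, of 6] in auto)
  also have "\<dots> = (\<integral>\<^sup>+i. (\<integral>\<^sup>+t. ennreal (norm (\<psi> (grid_point l (i, t))) ^ 6) \<partial>lborel) \<partial>count_space UNIV)"
    by (rule nn_integral_grid) measurable
  also have "\<dots> \<le> (\<integral>\<^sup>+i. ennreal (4 * l) * (T i + ennreal (sqrt J) * (\<integral>\<^sup>+s. ennreal (w (i, s)) \<partial>lborel)) \<partial>count_space UNIV)"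
    unfolding T_def by (intro nn_integral_mono power6_line_le)
  also have "\<dots> = ennreal (4 * l) * ((\<integral>\<^sup>+i. T i \<partial>count_space UNIV) + ennreal (sqrt J) * (\<integral>\<^sup>+i. (\<integral>\<^sup>+s. ennreal (w (i, s)) \<partial>lborel) \<partial>count_space UNIV))"
    by (simp add: nn_integral_cmult nn_integral_add)
  also have "(\<integral>\<^sup>+i. (\<integral>\<^sup>+s. ennreal (w (i, s)) \<partial>lborel) \<partial>count_space UNIV) = ennreal J"
    unfolding J by (rule nn_integral_grid[symmetric]) measurable
  also have "ennreal (4 * l) * ((\<integral>\<^sup>+i. T i \<partial>count_space UNIV) + ennreal (sqrt J) * ennreal J) \<le>
     ennreal (4 * l) * (ennreal (3 * (sqrt J * J)) + ennreal (sqrt J) * ennreal J)"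
    by (intro mult_left_mono add_right_mono Tsum) auto
  \<comment> \<open>The constant is \<open>16 = 4 * (3 + 1)\<close>: the vertex sum occurs once for
    each of the three directions, while the variations of all edges add up to \<open>J\<close> only
    once.\<close>
  also have "ennreal (4 * l) * (ennreal (3 * (sqrt J * J)) + ennreal (sqrt J) * ennreal J) = ennreal (16 * l * (sqrt J * J))"
    using fourth_power_variation_nonneg l by (simp flip: ennreal_mult ennreal_plus)
  finally have "ennreal (power_of l 6 \<psi>) \<le> ennreal (16 * l * (sqrt J * J))" .
  then show ?thesis using fourth_power_variation_nonneg l by (subst (asm) ennreal_le_iff) auto
qed

text \<open>A self-improving estimate. With \<open>S\<close> the left side,
  \<open>S \<le> 16 * l * J powr (3/2)\<close> while \<open>J\<close> squared is at most
  \<open>16 * S * K\<close>. Fourth powers give \<open>S ^ 4\<close> bounded by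
  \<open>S ^ 3\<close>, and since \<open>S\<close> is a finite number one may divide;
  \<open>2 ^ 16 * 16 ^ 3 = 2 ^ 28\<close>.\<close>

lemma Sobolev_6: "power_of l 6 \<psi> \<le> 2 ^ 28 * l ^ 4 * kinetic V ^ 3"
proof -
  note [measurable] = H1_pairD(4,5)[OF H]
  define S K where "S = power_of l 6 \<psi>" and "K = kinetic V"
  have p6: "norm z powr 6 = (norm z ^ 3)\<^sup>2" for z :: complex by (cases "z = 0") auto
  have "(\<integral>x. norm (\<psi> (grid_point l x)) ^ 3 * norm (V x) \<partial>grid_measure)\<^sup>2 \<le> S * K"
    unfolding S_def K_def power_of_def kinetic_def p6
    using integrable_power_of[OF H, of 6] H1_pairD(3)[OF H]
    by (intro Cauchy_Schwarz_integral) (auto simp: p6)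
  then have J2: "J\<^sup>2 \<le> 16 * (S * K)"
    by (simp add: J_def w_def power_mult_distrib)
  have S0: "S \<ge> 0" "K \<ge> 0" by (simp_all add: S_def K_def)
  have "S ^ 4 \<le> (16 * l * (sqrt J * J)) ^ 4"
    using power6_total_le S0 by (intro power_mono) (auto simp: S_def)
  also have "\<dots> = 2 ^ 16 * l ^ 4 * (J\<^sup>2) ^ 3"
  proof -
    have "sqrt J ^ 4 = (sqrt J ^ 2) ^ 2" by (simp flip: power_mult)
    then have "sqrt J ^ 4 = J\<^sup>2" using fourth_power_variation_nonneg by simp
    then show ?thesis by (simp add: power_mult_distrib flip: power_mult power_add)
  qed
  also have "\<dots> \<le> 2 ^ 16 * l ^ 4 * (16 * (S * K)) ^ 3"
    using J2 l by (intro mult_left_mono power_mono) auto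
  also have "\<dots> = 2 ^ 28 * l ^ 4 * K ^ 3 * S ^ 3" by (simp add: power_mult_distrib)
  finally have *: "S * S ^ 3 \<le> (2 ^ 28 * l ^ 4 * K ^ 3) * S ^ 3" by (simp add: power4_eq_xxxx power3_eq_cube mult.assoc)
  show ?thesis
  proof (cases "S = 0")
    case True then show ?thesis using S0 l by (simp add: S_def[symmetric] K_def[symmetric])
  next
    case False
    then have "S ^ 3 > 0" using S0 by simp
    then show ?thesis using * unfolding S_def[symmetric] K_def[symmetric] by (rule mult_right_le_imp_le[rotated])
  qed
qed

end

text \<open>Split at \<open>x powr (4/3) = \<kappa>\<close>: below it the first term alone suffices,
  above it the second. The free parameter takes the place of Hoelder's inequality, since it can be
  tuned after integration.\<close>

lemma powr_interpolation:
  fixes x :: real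
  assumes "x \<ge> 0" "\<kappa> > 0"
  shows "x powr (10/3) \<le> \<kappa> * x\<^sup>2 + x powr 6 / \<kappa>\<^sup>2"
proof (cases "x powr (4/3) \<le> \<kappa>")
  case True
  have "x powr (10/3) = x powr (4/3) * x powr 2" by (simp flip: powr_add)
  also have "x powr 2 = x\<^sup>2" using assms by (cases "x = 0") auto
  also have "x powr (4/3) * x\<^sup>2 \<le> \<kappa> * x\<^sup>2" using True by (intro mult_right_mono) auto
  finally show ?thesis using assms by (smt (verit) divide_nonneg_nonneg powr_ge_zero zero_le_power2)
next
  case False
  then have "\<kappa>\<^sup>2 \<le> (x powr (4/3))\<^sup>2" using assms by (intro power_mono) auto
  also have "(x powr (4/3))\<^sup>2 = x powr (8/3)" by (simp add: power2_eq_square flip: powr_add)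
  finally have "x powr (10/3) * \<kappa>\<^sup>2 \<le> x powr (10/3) * x powr (8/3)" by (intro mult_left_mono) auto
  also have "\<dots> = x powr 6" by (simp flip: powr_add)
  finally have "x powr (10/3) \<le> x powr 6 / \<kappa>\<^sup>2" using assms by (simp add: field_simps)
  then show ?thesis using assms by (smt (verit) mult_nonneg_nonneg zero_le_power2)
qed

text \<open>At exponent \<open>10/3\<close> the kinetic term enters linearly, as it does in the
  energy. A small mass therefore makes the power term a small fraction of the kinetic one, whatever
  the kinetic term is.\<close>

lemma Gagliardo_Nirenberg_3d:
  assumes l: "l > 0" and H: "H1_pair l \<psi> V"
  shows "power_of l (10/3) \<psi> \<le> (1 + 2 ^ 28 * l ^ 4) * mass_of l \<psi> powr (2/3) * kinetic V"
proof (cases "mass_of l \<psi> > 0")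
  case False
  then have "\<psi> (grid_point l x) = 0" for x
    using mass_of_eq_0_iff[OF H] mass_of_nonneg[of l \<psi>] by (metis not_less order.antisym)
  then have "power_of l (10/3) \<psi> = 0" by (simp add: power_of_def)
  then show ?thesis using l by (auto intro!: mult_nonneg_nonneg add_nonneg_nonneg)
next
  case True
  define m K where "m = mass_of l \<psi>" and "K = kinetic V"
  have m: "m > 0" and K: "K > 0" using True kinetic_pos[OF H True] by (auto simp: m_def K_def)
  \<comment> \<open>This choice balances the two terms of the interpolation: both become multiples
    of \<open>m powr (2/3) * K\<close>.\<close>
  define \<kappa> where "\<kappa> = K * m powr (-1/3)"
  have lam: "\<kappa> > 0" using m K by (simp add: \<kappa>_def)
  have "power_of l (10/3) \<psi> \<le> (\<integral>x. \<kappa> * (norm (\<psi> (grid_point l x)))\<^sup>2 + norm (\<psi> (grid_point l x)) powr 6 / \<kappa>\<^sup>2 \<partial>grid_measure)"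
    unfolding power_of_def
    by (intro integral_mono powr_interpolation lam Bochner_Integration.integrable_add integrable_power_of[OF H])
      (use integrable_power_of[OF H, of 6] H1_pairD(2)[OF H] in auto)
  also have "\<dots> = \<kappa> * m + power_of l 6 \<psi> / \<kappa>\<^sup>2"
    using integrable_power_of[OF H, of 6] H1_pairD(2)[OF H] by (simp add: m_def mass_of_def power_of_def)
  also have "\<dots> \<le> \<kappa> * m + 2 ^ 28 * l ^ 4 * K ^ 3 / \<kappa>\<^sup>2"
    using Sobolev_6[OF l H] by (intro add_left_mono divide_right_mono) (auto simp: K_def)
  also have "\<kappa> * m = K * m powr (2/3)"
  proof -
    have "m powr (-1/3) * m = m powr (2/3)"
      using powr_add[of m "-1/3" 1] m by (simp add: mult.commute)
    then show ?thesis by (simp add: \<kappa>_def)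
  qed
  also have "2 ^ 28 * l ^ 4 * K ^ 3 / \<kappa>\<^sup>2 = 2 ^ 28 * l ^ 4 * (K * m powr (2/3))"
  proof -
    have "(m powr (-1/3))\<^sup>2 = m powr (-2/3)" by (simp add: power2_eq_square flip: powr_add)
    also have "\<dots> = 1 / m powr (2/3)" using powr_minus_divide[of m "2/3"] by simp
    finally have "\<kappa>\<^sup>2 = K\<^sup>2 / m powr (2/3)" by (simp add: \<kappa>_def power_mult_distrib)
    then show ?thesis using K m by (simp add: power3_eq_cube power2_eq_square)
  qed
  finally show ?thesis by (simp add: m_def K_def algebra_simps)
qed

section \<open>Spread-out functions\<close>

text \<open>The taxicab norm is additive in the coordinates, so
  \<open>exp (- c * l1_norm3 x)\<close> factorises on each line into two functions of its indices
  and one of its parameter.\<close>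

definition l1_norm3 :: "real ^ 3 \<Rightarrow> real" where
  "l1_norm3 x = \<bar>x $ 1\<bar> + \<bar>x $ 2\<bar> + \<bar>x $ 3\<bar>"

lemma l1_norm3_grid_point:
  assumes "l > 0"
  shows "l1_norm3 (grid_point l ((a, m, n), t)) = \<bar>t\<bar> + l * \<bar>of_int m\<bar> + l * \<bar>of_int n\<bar>"
  using assms by (cases a) (auto simp: l1_norm3_def grid_point_def abs_mult)

lemma nn_integral_exp_abs:
  assumes c: "c > 0"
  shows "(\<integral>\<^sup>+t. ennreal (exp (- c * \<bar>t\<bar>)) \<partial>lborel) = ennreal (2 / c)"
proof -
  have 1: "(\<integral>\<^sup>+t. ennreal (exp (- c * t)) * indicator {0..} t \<partial>lborel) = ennreal (1 / c)"
  proof -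
    have "(\<integral>\<^sup>+t. ennreal (exp (- c * t)) * indicator {0..} t \<partial>lborel) = ennreal (0 - (- exp (- c * 0) / c))"
    proof (rule nn_integral_FTC_atLeast)
      show "((\<lambda>t. - exp (- c * t) / c) has_real_derivative exp (- c * t)) (at t)" for t
        using c by (auto intro!: derivative_eq_intros)
      show "((\<lambda>t. - exp (- c * t) / c) \<longlongrightarrow> 0) at_top" using c by real_asymp
    qed auto
    then show ?thesis by simp
  qed
  have 2: "(\<integral>\<^sup>+t. ennreal (exp (c * t)) * indicator {..0} t \<partial>lborel) = ennreal (1 / c)"
    using nn_integral_real_affine[of "\<lambda>t. ennreal (exp (- c * t)) * indicator {0..} t" "-1" 0]
      1 by (simp add: indicator_def)
  have "(\<integral>\<^sup>+t. ennreal (exp (- c * \<bar>t\<bar>)) \<partial>lborel) =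
     (\<integral>\<^sup>+t. ennreal (exp (- c * t)) * indicator {0..} t + ennreal (exp (c * t)) * indicator {..0} t \<partial>lborel)"
  proof (rule nn_integral_cong_AE)
    have "AE t in lborel. t \<noteq> (0::real)" by (rule AE_lborel_singleton)
    then show "AE t in lborel. ennreal (exp (- c * \<bar>t\<bar>)) = ennreal (exp (- c * t)) * indicator {0..} t + ennreal (exp (c * t)) * indicator {..0} t"
      by eventually_elim (auto simp: indicator_def)
  qed
  also have "\<dots> = ennreal (1 / c) + ennreal (1 / c)"
    by (subst nn_integral_add) (use 1 2 in auto)
  also have "\<dots> = ennreal (2 / c)" using c by (simp flip: ennreal_plus)
  finally show ?thesis .
qed

lemma nn_integral_geometric_int:
  assumes x: "x > (0::real)"
  shows "(\<integral>\<^sup>+m. ennreal (exp (- x * \<bar>of_int m\<bar>)) \<partial>count_space (UNIV :: int set)) \<le> ennreal (2 / (1 - exp (- x)))"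
    and "ennreal (1 / (1 - exp (- x))) \<le> (\<integral>\<^sup>+m. ennreal (exp (- x * \<bar>of_int m\<bar>)) \<partial>count_space (UNIV :: int set))"
proof -
  let ?f = "\<lambda>m::int. ennreal (exp (- x * \<bar>of_int m\<bar>))"
  have nat: "(\<integral>\<^sup>+n. ennreal (exp (- x * real n)) \<partial>count_space (UNIV :: nat set)) = ennreal (1 / (1 - exp (- x)))"
  proof -
    have "(\<lambda>n. exp (- x) ^ n) sums (1 / (1 - exp (- x)))"
      using x by (intro geometric_sums) auto
    then have "(\<lambda>n. exp (- x * real n)) sums (1 / (1 - exp (- x)))"
      by (simp add: exp_of_nat_mult[symmetric] mult.commute)
    then have "(\<Sum>n. ennreal (exp (- x * real n))) = ennreal (1 / (1 - exp (- x)))"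
      by (intro suminf_ennreal_eq) auto
    then show ?thesis by (simp add: nn_integral_count_space_nat)
  qed
  have "bij_betw int UNIV {0..}" by (rule bij_betwI[where g = nat]) auto
  from nn_integral_bij_count_space[OF this, of ?f]
  have pos: "(\<integral>\<^sup>+m. ?f m * indicator {0..} m \<partial>count_space UNIV) = ennreal (1 / (1 - exp (- x)))"
    using nat by (simp add: nn_integral_count_space_indicator)
  have "bij_betw (\<lambda>n. - int n) UNIV {..0}" by (rule bij_betwI[where g = "\<lambda>m. nat (- m)"]) auto
  from nn_integral_bij_count_space[OF this, of ?f]
  have neg: "(\<integral>\<^sup>+m. ?f m * indicator {..0} m \<partial>count_space UNIV) = ennreal (1 / (1 - exp (- x)))"
    using nat by (simp add: nn_integral_count_space_indicator)
  show "ennreal (1 / (1 - exp (- x))) \<le> (\<integral>\<^sup>+m. ?f m \<partial>count_space UNIV)"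
    unfolding pos[symmetric] by (intro nn_integral_mono) (auto simp: indicator_def)
  \<comment> \<open>Index 0 is counted in both half-series. The resulting factor 2 is harmless,
    since only the order of growth for small \<open>x\<close> matters.\<close>
  have "(\<integral>\<^sup>+m. ?f m \<partial>count_space UNIV) \<le> (\<integral>\<^sup>+m. ?f m * indicator {0..} m + ?f m * indicator {..0} m \<partial>count_space UNIV)"
    by (intro nn_integral_mono) (auto simp: indicator_def)
  also have "\<dots> = ennreal (1 / (1 - exp (- x))) + ennreal (1 / (1 - exp (- x)))"
    by (subst nn_integral_add) (simp_all only: pos neg, auto)
  also have "\<dots> = ennreal (2 / (1 - exp (- x)))" using x by (simp flip: ennreal_plus)
  finally show "(\<integral>\<^sup>+m. ?f m \<partial>count_space UNIV) \<le> ennreal (2 / (1 - exp (- x)))" .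
qed

lemma exp_decay_integral_eq:
  assumes l: "l > 0" and c: "c > 0"
  defines "Q \<equiv> (\<integral>\<^sup>+m. ennreal (exp (- (c * l) * \<bar>of_int m\<bar>)) \<partial>count_space (UNIV :: int set))"
  shows "(\<integral>\<^sup>+x. ennreal (exp (- c * l1_norm3 (grid_point l x))) \<partial>grid_measure) = 3 * (Q * Q * ennreal (2 / c))"
    and "(\<lambda>x. exp (- c * l1_norm3 (grid_point l x))) \<in> borel_measurable grid_measure"
proof -
  have e: "exp (- c * l1_norm3 (grid_point l ((a, m, n), t))) = exp (- (c * l) * \<bar>of_int m\<bar>) * (exp (- (c * l) * \<bar>of_int n\<bar>) * exp (- c * \<bar>t\<bar>))" for a m n t
    unfolding l1_norm3_grid_point[OF l] by (simp add: algebra_simps flip: exp_add)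
  show m[measurable]: "(\<lambda>x. exp (- c * l1_norm3 (grid_point l x))) \<in> borel_measurable grid_measure"
  proof (rule borel_measurable_grid)
    show "(\<lambda>t. exp (- c * l1_norm3 (grid_point l (i, t)))) \<in> borel_measurable borel" for i
      by (cases i) (simp only: e, measurable)
  qed
  have ee: "(\<integral>\<^sup>+t. ennreal (exp (- c * l1_norm3 (grid_point l ((a, m, n), t)))) \<partial>lborel)
     = ennreal (exp (- (c * l) * \<bar>of_int m\<bar>)) * (ennreal (exp (- (c * l) * \<bar>of_int n\<bar>)) * ennreal (2 / c))" for a m n
    unfolding e by (simp add: ennreal_mult nn_integral_cmult nn_integral_exp_abs[OF c, simplified])
  define F where "F m n = ennreal (exp (- (c * l) * \<bar>of_int m\<bar>)) * (ennreal (exp (- (c * l) * \<bar>of_int n\<bar>)) * ennreal (2 / c))" for m n :: int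
  have "(\<integral>\<^sup>+x. ennreal (exp (- c * l1_norm3 (grid_point l x))) \<partial>grid_measure) =
    (\<integral>\<^sup>+i. (\<integral>\<^sup>+t. ennreal (exp (- c * l1_norm3 (grid_point l (i, t)))) \<partial>lborel) \<partial>count_space UNIV)"
    by (rule nn_integral_grid) measurable
  also have "\<dots> = (\<integral>\<^sup>+i. F (fst (snd i)) (snd (snd i)) \<partial>count_space (UNIV :: grid_line_index set))"
  proof (rule nn_integral_cong)
    fix i :: grid_line_index
    obtain a m n where i: "i = (a, m, n)" by (cases i)
    show "(\<integral>\<^sup>+t. ennreal (exp (- c * l1_norm3 (grid_point l (i, t)))) \<partial>lborel) = F (fst (snd i)) (snd (snd i))"
      unfolding i ee F_def by simp
  qed
  also have "\<dots> = (\<integral>\<^sup>+a. (\<integral>\<^sup>+m. (\<integral>\<^sup>+n. F m n \<partial>count_space UNIV) \<partial>count_space UNIV) \<partial>count_space (UNIV :: axis set))"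
    by (simp add: nn_integral_fst_count_space[symmetric])
  also have "(\<integral>\<^sup>+m. (\<integral>\<^sup>+n. F m n \<partial>count_space UNIV) \<partial>count_space UNIV) = Q * (Q * ennreal (2 / c))"
    unfolding F_def Q_def by (simp add: nn_integral_cmult nn_integral_multc)
  also have "(\<integral>\<^sup>+a. Q * (Q * ennreal (2 / c)) \<partial>count_space (UNIV :: axis set)) = 3 * (Q * Q * ennreal (2 / c))"
    by (simp add: nn_integral_count_space_finite UNIV_axis mult.assoc mult.commute mult.left_commute)
  finally show "(\<integral>\<^sup>+x. ennreal (exp (- c * l1_norm3 (grid_point l x))) \<partial>grid_measure) = 3 * (Q * Q * ennreal (2 / c))" .
qed

lemma integrable_exp_decay:
  assumes l: "l > 0" and c: "c > 0"
  shows "integrable grid_measure (\<lambda>x. exp (- c * l1_norm3 (grid_point l x)))"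
proof (rule integrableI_nonneg)
  define Q where "Q = (\<integral>\<^sup>+m. ennreal (exp (- (c * l) * \<bar>of_int m\<bar>)) \<partial>count_space (UNIV :: int set))"
  have "Q < \<infinity>" using nn_integral_geometric_int(1)[of "c * l"] l c unfolding Q_def by (auto intro: le_less_trans)
  then have "Q * Q * ennreal (2 / c) < \<infinity>" by (auto simp: ennreal_mult_less_top)
  then show "(\<integral>\<^sup>+x. ennreal (exp (- c * l1_norm3 (grid_point l x))) \<partial>grid_measure) < \<infinity>"
    unfolding exp_decay_integral_eq(1)[OF l c] Q_def by (auto simp: ennreal_mult_less_top)
qed (use exp_decay_integral_eq(2)[OF l c] in simp_all)

definition exp_decay_integral :: "real \<Rightarrow> real \<Rightarrow> real" where
  "exp_decay_integral l c = (\<integral>x. exp (- c * l1_norm3 (grid_point l x)) \<partial>grid_measure)"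

text \<open>The order \<open>c powr (-3)\<close> is three-dimensional volume growth at scale
  \<open>1 / c\<close>, the source of the exponent \<open>10/3\<close>. The constants are
  \<open>6 = 3 * 2\<close> and \<open>96 = 3 * 4 * 4 * 2\<close>: three axes, two index sums of size
  between \<open>1 / (c * l)\<close> and \<open>4 / (c * l)\<close>, and \<open>2 / c\<close> along
  the line.\<close>

lemma exp_decay_integral_bounds:
  assumes l: "l > 0" and c: "c > 0"
  shows "exp_decay_integral l c \<ge> 6 / (c ^ 3 * l\<^sup>2)"
    and "c * l \<le> 1 \<Longrightarrow> exp_decay_integral l c \<le> 96 / (c ^ 3 * l\<^sup>2)"
proof -
  define Q where "Q = (\<integral>\<^sup>+m. ennreal (exp (- (c * l) * \<bar>of_int m\<bar>)) \<partial>count_space (UNIV :: int set))"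
  have cl: "c * l > 0" using l c by simp
  have e: "ennreal (exp_decay_integral l c) = 3 * (Q * Q * ennreal (2 / c))"
    unfolding exp_decay_integral_def Q_def exp_decay_integral_eq(1)[OF l c, symmetric]
    by (rule nn_integral_eq_integral[symmetric]) (auto simp: integrable_exp_decay[OF l c, simplified])
  have nn: "exp_decay_integral l c \<ge> 0" unfolding exp_decay_integral_def by (intro integral_nonneg_AE) auto
  have lt1: "exp (- (c * l)) < 1" using cl by simp
  have up1: "1 - exp (- (c * l)) \<le> c * l" using exp_ge_add_one_self[of "- (c * l)"] by linarith
  have "1 / (c * l) \<le> 1 / (1 - exp (- (c * l)))" using up1 lt1 cl by (intro divide_left_mono) auto
  then have Ql: "ennreal (1 / (c * l)) \<le> Q"
    using nn_integral_geometric_int(2)[OF cl] unfolding Q_def by (meson ennreal_leI order_trans)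
  have "ennreal (6 / (c ^ 3 * l\<^sup>2)) = 3 * (ennreal (1 / (c * l)) * ennreal (1 / (c * l)) * ennreal (2 / c))"
    using l c by (simp add: power2_eq_square power3_eq_cube field_simps ennreal_numeral[symmetric] flip: ennreal_mult del: ennreal_numeral)
  also have "\<dots> \<le> 3 * (Q * Q * ennreal (2 / c))" by (intro mult_mono Ql) auto
  finally show "exp_decay_integral l c \<ge> 6 / (c ^ 3 * l\<^sup>2)"
    unfolding e[symmetric] using nn by (subst (asm) ennreal_le_iff) auto
  assume c1: "c * l \<le> 1"
  have "exp (- (c * l)) \<le> 1 / (1 + c * l)"
    using exp_ge_add_one_self[of "c * l"] cl by (simp add: exp_minus field_simps)
  also have "\<dots> \<le> 1 - c * l / 2"
  proof -
    have "(c * l) * (1 - c * l) \<ge> 0" using cl c1 mult_nonneg_nonneg[of "c * l" "1 - c * l"] by simp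
    then have "1 \<le> (1 - c * l / 2) * (1 + c * l)" by (simp add: algebra_simps)
    then show ?thesis using cl by (simp add: pos_divide_le_eq)
  qed
  finally have "c * l / 2 \<le> 1 - exp (- (c * l))" by linarith
  then have "2 / (1 - exp (- (c * l))) \<le> 2 / (c * l / 2)" using cl lt1 by (intro divide_left_mono) auto
  also have "\<dots> = 4 / (c * l)" by simp
  finally have Qu: "Q \<le> ennreal (4 / (c * l))"
    using nn_integral_geometric_int(1)[OF cl] unfolding Q_def by (meson ennreal_leI order_trans)
  have "3 * (Q * Q * ennreal (2 / c)) \<le> 3 * (ennreal (4 / (c * l)) * ennreal (4 / (c * l)) * ennreal (2 / c))"
    by (intro mult_mono Qu) auto
  also have "\<dots> = ennreal (96 / (c ^ 3 * l\<^sup>2))"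
    using l c by (simp add: power2_eq_square power3_eq_cube field_simps ennreal_numeral[symmetric] flip: ennreal_mult del: ennreal_numeral)
  finally show "exp_decay_integral l c \<le> 96 / (c ^ 3 * l\<^sup>2)"
    unfolding e[symmetric] using l c by (subst (asm) ennreal_le_iff) auto
qed

lemma exp_decay_primitive:
  assumes l: "l > 0"
  shows "is_primitive (\<lambda>t. complex_of_real (exp (- \<epsilon> * l1_norm3 (grid_point l (i, t)))))
     (\<lambda>t. complex_of_real ((if 0 \<le> t then - \<epsilon> else \<epsilon>) * exp (- \<epsilon> * l1_norm3 (grid_point l (i, t)))))"
proof -
  obtain a m n where i: "i = (a, m, n)" by (cases i)
  define k where "k = l * \<bar>of_int m\<bar> + l * \<bar>of_int n\<bar>"
  have N: "l1_norm3 (grid_point l (i, t)) = \<bar>t\<bar> + k" for t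
    unfolding i l1_norm3_grid_point[OF l] by (simp add: k_def)
  have "is_primitive (\<lambda>t. exp (- \<epsilon> * (\<bar>t\<bar> + k))) (\<lambda>t. (if 0 \<le> t then - \<epsilon> else \<epsilon>) * exp (- \<epsilon> * (\<bar>t\<bar> + k)))"
  proof (rule is_primitive_FTC[where S = "{0}"])
    show "continuous_on UNIV (\<lambda>t. exp (- \<epsilon> * (\<bar>t\<bar> + k)))" by (intro continuous_intros)
    show "((\<lambda>t. exp (- \<epsilon> * (\<bar>t\<bar> + k))) has_vector_derivative (if 0 \<le> x then - \<epsilon> else \<epsilon>) * exp (- \<epsilon> * (\<bar>x\<bar> + k))) (at x)"
      if "x \<notin> {0}" for x
    proof -
      have abs_derivative: "((\<lambda>t. \<bar>t\<bar>) has_real_derivative sgn x) (at x)"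
      proof (cases "x > 0")
        case True
        have "((\<lambda>t. t) has_real_derivative sgn x) (at x)" using True by simp
        then show ?thesis
          by (rule has_field_derivative_transform_within_open[where S = "{0<..}"]) (use True in auto)
      next
        case False
        then have "((\<lambda>t. - t) has_real_derivative sgn x) (at x)" using that by (auto intro!: derivative_eq_intros)
        then show ?thesis
          by (rule has_field_derivative_transform_within_open[where S = "{..<0}"]) (use False that in auto)
      qed
      have "((\<lambda>t. exp (- \<epsilon> * (\<bar>t\<bar> + k))) has_real_derivative exp (- \<epsilon> * (\<bar>x\<bar> + k)) * (- \<epsilon> * sgn x)) (at x)"
        by (rule derivative_eq_intros abs_derivative refl)+ simp
      then show ?thesis using that
        by (auto simp: has_real_derivative_iff_has_vector_derivative[symmetric] sgn_if mult.commute split: if_splits)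
    qed
    fix a b :: real
    have c: "continuous_on UNIV (\<lambda>t. \<epsilon> * exp (- \<epsilon> * (\<bar>t\<bar> + k)))" by (intro continuous_intros)
    obtain B where "\<And>t. t \<in> {a..b} \<Longrightarrow> norm (\<epsilon> * exp (- \<epsilon> * (\<bar>t\<bar> + k))) \<le> B" by (rule continuous_bounded_Icc[OF c]) blast
    moreover have "norm ((if 0 \<le> t then - \<epsilon> else \<epsilon>) * exp (- \<epsilon> * (\<bar>t\<bar> + k))) = norm (\<epsilon> * exp (- \<epsilon> * (\<bar>t\<bar> + k)))" for t
      by (auto simp: norm_mult)
    ultimately show "\<exists>B. \<forall>t\<in>{a..b}. norm ((if 0 \<le> t then - \<epsilon> else \<epsilon>) * exp (- \<epsilon> * (\<bar>t\<bar> + k))) \<le> B"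
      by metis
  qed auto
  from is_primitive_linear[OF bounded_linear_of_real this] show ?thesis by (simp only: N)
qed

text \<open>A normalised exponential. The modulus of its derivative is \<open>\<epsilon>\<close>
  times its own modulus at every point, so the kinetic term is exact and tends to 0 with
  \<open>\<epsilon>\<close> at fixed mass.\<close>

lemma spread_function:
  assumes l: "l > 0" and \<epsilon>: "\<epsilon> > 0" and \<mu>: "\<mu> > 0"
  obtains \<psi> V where "H1_pair l \<psi> V" "mass_of l \<psi> = \<mu>" "kinetic V = \<epsilon>\<^sup>2 * \<mu>"
    "\<And>p. p > 0 \<Longrightarrow> power_of l p \<psi> = (\<mu> / exp_decay_integral l (2 * \<epsilon>)) powr (p / 2) * exp_decay_integral l (p * \<epsilon>)"
proof -
  define I where "I = exp_decay_integral l (2 * \<epsilon>)"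
  have "6 / ((2 * \<epsilon>) ^ 3 * l\<^sup>2) > 0" using l \<epsilon> by simp
  then have I: "I > 0" using exp_decay_integral_bounds(1)[of l "2 * \<epsilon>"] l \<epsilon> unfolding I_def by linarith
  define A where "A = sqrt (\<mu> / I)"
  have A: "A > 0" "A\<^sup>2 = \<mu> / I" using \<mu> I by (auto simp: A_def)
  define \<phi> :: "real ^ 3 \<Rightarrow> complex" where "\<phi> x = complex_of_real (exp (- \<epsilon> * l1_norm3 x))" for x
  define W where "W x = complex_of_real ((if 0 \<le> snd x then - \<epsilon> else \<epsilon>) * exp (- \<epsilon> * l1_norm3 (grid_point l x)))" for x
  have n\<phi>: "norm (\<phi> (grid_point l x)) = exp (- \<epsilon> * l1_norm3 (grid_point l x))" for x by (simp add: \<phi>_def)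
  have sq: "(exp (- \<epsilon> * s))\<^sup>2 = exp (- (2 * \<epsilon>) * s)" for s by (simp add: power2_eq_square flip: exp_add)
  have nW: "(norm (W x))\<^sup>2 = \<epsilon>\<^sup>2 * exp (- (2 * \<epsilon>) * l1_norm3 (grid_point l x))" for x
    using \<epsilon> by (simp add: W_def norm_mult power_mult_distrib sq[simplified])
  have int: "integrable grid_measure (\<lambda>x. exp (- (2 * \<epsilon>) * l1_norm3 (grid_point l x)))"
    using integrable_exp_decay[OF l, of "2 * \<epsilon>"] \<epsilon> by simp
  have H: "H1_pair l \<phi> W" unfolding H1_pair_def
  proof (intro conjI allI)
    show "is_primitive (\<lambda>t. \<phi> (grid_point l (i, t))) (\<lambda>t. W (i, t))" for i
      unfolding \<phi>_def W_def using exp_decay_primitive[OF l, of \<epsilon> i] by simp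
    show "integrable grid_measure (\<lambda>x. (norm (\<phi> (grid_point l x)))\<^sup>2)" unfolding n\<phi> sq by (rule int)
    show "integrable grid_measure (\<lambda>x. (norm (W x))\<^sup>2)" unfolding nW using int by simp
  qed
  show thesis
  proof (rule that)
    show "H1_pair l (\<lambda>x. of_real A * \<phi> x) (\<lambda>x. of_real A * W x)" by (rule H1_pair_scale[OF H])
    have m: "mass_of l \<phi> = I" unfolding mass_of_def n\<phi> sq I_def exp_decay_integral_def ..
    show "mass_of l (\<lambda>x. of_real A * \<phi> x) = \<mu>" using A I by (simp add: mass_of_scale m)
    have "kinetic W = \<epsilon>\<^sup>2 * I" unfolding kinetic_def nW I_def exp_decay_integral_def by simp
    then show "kinetic (\<lambda>x. of_real A * W x) = \<epsilon>\<^sup>2 * \<mu>" using A I by (simp add: kinetic_scale)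
    fix p :: real assume "p > 0"
    have "power_of l p \<phi> = exp_decay_integral l (p * \<epsilon>)"
      unfolding power_of_def n\<phi> exp_decay_integral_def by (simp add: powr_def mult_ac)
    moreover have "A powr p = (\<mu> / I) powr (p / 2)"
      using \<mu> I by (simp add: A_def powr_half_sqrt[symmetric] powr_powr)
    ultimately show "power_of l p (\<lambda>x. of_real A * \<phi> x) = (\<mu> / exp_decay_integral l (2 * \<epsilon>)) powr (p / 2) * exp_decay_integral l (p * \<epsilon>)"
      using A by (simp add: power_of_scale I_def)
  qed
qed

text \<open>At fixed mass the kinetic term has order \<open>\<epsilon> powr 2\<close> and the power
  term order \<open>\<epsilon> powr (3 * p / 2 - 3)\<close>. The second dominates as
  \<open>\<epsilon>\<close> tends to 0 exactly when \<open>p < 10/3\<close>.\<close>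

lemma negative_energy_subcritical:
  assumes l: "l > 0" and p: "2 < p" "p < 10/3" and \<mu>: "\<mu> > 0"
  obtains \<psi> V where "H1_pair l \<psi> V" "mass_of l \<psi> = \<mu>" "energy_of l p \<psi> V < 0"
proof -
  \<comment> \<open>Combines the upper bound for the normalising integral at
    \<open>2 * \<epsilon>\<close>, valid once \<open>2 * \<epsilon> * l \<le> 1\<close>, with the
    lower bound for the integral at \<open>p * \<epsilon>\<close>.\<close>
  define C where "C = (\<mu> * l\<^sup>2 / 12) powr (p / 2) * (6 / (p ^ 3 * l\<^sup>2))"
  have C: "C > 0" using l p \<mu> by (simp add: C_def)
  have "((\<lambda>\<epsilon>::real. \<epsilon> powr (5 - 3 * p / 2)) \<longlongrightarrow> 0) (at_right 0)"
    using p by real_asymp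
  moreover have "2 * C / (p * \<mu>) > 0" using C p \<mu> by simp
  ultimately have "\<forall>\<^sub>F \<epsilon> in at_right 0. \<epsilon> powr (5 - 3 * p / 2) < 2 * C / (p * \<mu>)"
    by (rule order_tendstoD(2))
  moreover have "\<forall>\<^sub>F \<epsilon> in at_right 0. 0 < \<epsilon> \<and> \<epsilon> < 1 / (2 * l)"
    using l by (auto simp: eventually_at_right_field intro!: exI[of _ "1 / (2 * l)"])
  ultimately have "\<forall>\<^sub>F \<epsilon> in at_right 0. 0 < \<epsilon> \<and> \<epsilon> < 1 / (2 * l) \<and> \<epsilon> powr (5 - 3 * p / 2) < 2 * C / (p * \<mu>)"
    by eventually_elim simp
  then obtain \<epsilon> where e: "\<epsilon> > 0" "\<epsilon> < 1 / (2 * l)" "\<epsilon> powr (5 - 3 * p / 2) < 2 * C / (p * \<mu>)"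
    using eventually_happens[of _ "at_right (0::real)"] by (auto simp: trivial_limit_at_right_real)
  obtain \<psi> V where \<psi>: "H1_pair l \<psi> V" "mass_of l \<psi> = \<mu>" "kinetic V = \<epsilon>\<^sup>2 * \<mu>"
    "\<And>p. p > 0 \<Longrightarrow> power_of l p \<psi> = (\<mu> / exp_decay_integral l (2 * \<epsilon>)) powr (p / 2) * exp_decay_integral l (p * \<epsilon>)"
    using spread_function[OF l e(1) \<mu>] by metis
  have el: "2 * \<epsilon> * l \<le> 1" using e l by (simp add: field_simps)
  define I where "I = exp_decay_integral l (2 * \<epsilon>)"
  have "6 / ((2 * \<epsilon>) ^ 3 * l\<^sup>2) > 0" using l e by simp
  then have I: "I > 0" using exp_decay_integral_bounds(1)[of l "2 * \<epsilon>"] l e unfolding I_def by linarith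
  have "I \<le> 96 / ((2 * \<epsilon>) ^ 3 * l\<^sup>2)" unfolding I_def by (rule exp_decay_integral_bounds(2)) (use l e el in auto)
  also have "\<dots> = 12 / (\<epsilon> ^ 3 * l\<^sup>2)" by (simp add: power_mult_distrib)
  finally have "\<mu> * l\<^sup>2 / 12 * \<epsilon> ^ 3 \<le> \<mu> / I" using I \<mu> l e by (simp add: field_simps)
  then have "(\<mu> * l\<^sup>2 / 12 * \<epsilon> ^ 3) powr (p / 2) \<le> (\<mu> / I) powr (p / 2)"
    using p \<mu> l e by (intro powr_mono2) auto
  moreover have "6 / ((p * \<epsilon>) ^ 3 * l\<^sup>2) \<le> exp_decay_integral l (p * \<epsilon>)"
    by (rule exp_decay_integral_bounds(1)) (use l e p in auto)
  ultimately have "(\<mu> * l\<^sup>2 / 12 * \<epsilon> ^ 3) powr (p / 2) * (6 / ((p * \<epsilon>) ^ 3 * l\<^sup>2)) \<le>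
      (\<mu> / I) powr (p / 2) * exp_decay_integral l (p * \<epsilon>)"
    by (rule mult_mono) (use l e p in auto)
  also have "\<dots> = power_of l p \<psi>" using p by (simp add: \<psi>(4) I_def)
  also have "(\<mu> * l\<^sup>2 / 12 * \<epsilon> ^ 3) powr (p / 2) * (6 / ((p * \<epsilon>) ^ 3 * l\<^sup>2)) = C * \<epsilon> powr (3 * p / 2 - 3)"
  proof -
    have "(\<mu> * l\<^sup>2 / 12 * \<epsilon> ^ 3) powr (p / 2) = (\<mu> * l\<^sup>2 / 12) powr (p / 2) * (\<epsilon> powr 3) powr (p / 2)"
      using \<mu> l e by (subst powr_mult) (auto simp: powr_realpow[of \<epsilon> 3, simplified])
    moreover have "6 / ((p * \<epsilon>) ^ 3 * l\<^sup>2) = 6 / (p ^ 3 * l\<^sup>2) * \<epsilon> powr (-3)"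
      using e powr_realpow[of \<epsilon> 3] by (simp add: powr_minus power_mult_distrib field_simps)
    moreover have "(\<epsilon> powr 3) powr (p / 2) * \<epsilon> powr (-3) = \<epsilon> powr (3 * p / 2 - 3)"
      by (simp add: powr_powr flip: powr_add)
    ultimately show ?thesis by (simp add: C_def mult_ac)
  qed
  finally have S: "C * \<epsilon> powr (3 * p / 2 - 3) \<le> power_of l p \<psi>" .
  have "\<epsilon> powr (5 - 3 * p / 2) * \<epsilon> powr (3 * p / 2 - 3) < 2 * C / (p * \<mu>) * \<epsilon> powr (3 * p / 2 - 3)"
    using e by (intro mult_strict_right_mono) auto
  also have "\<epsilon> powr (5 - 3 * p / 2) * \<epsilon> powr (3 * p / 2 - 3) = \<epsilon>\<^sup>2"
    using e by (simp flip: powr_add)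
  finally have "\<epsilon>\<^sup>2 * \<mu> / 2 < C * \<epsilon> powr (3 * p / 2 - 3) / p" using p \<mu> by (simp add: field_simps)
  also have "\<dots> \<le> power_of l p \<psi> / p" using S p by (intro divide_right_mono) auto
  finally have "energy_of l p \<psi> V < 0" by (simp add: energy_of_def \<psi>(3))
  then show thesis using that \<psi> by blast
qed

section \<open>Scaling\<close>

lemma Fatou_integral_le:
  fixes f :: "nat \<Rightarrow> 'a \<Rightarrow> real"
  assumes f: "\<And>n. integrable M (f n)" and nn: "\<And>n x. f n x \<ge> 0"
    and lim: "AE x in M. (\<lambda>n. f n x) \<longlonglongrightarrow> g x" and g[measurable]: "g \<in> borel_measurable M"
    and le: "\<And>n. (\<integral>x. f n x \<partial>M) \<le> c n" and c: "c \<longlonglongrightarrow> C"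
  shows "integrable M g" "(\<integral>x. g x \<partial>M) \<le> C"
proof -
  have [measurable]: "f n \<in> borel_measurable M" for n using f by auto
  have g0: "AE x in M. 0 \<le> g x"
    using lim by eventually_elim (auto intro: LIMSEQ_le_const nn)
  have "0 \<le> (\<integral>x. f n x \<partial>M)" for n by (intro integral_nonneg_AE) (simp add: nn)
  then have c0: "c n \<ge> 0" for n using le[of n] order_trans by blast
  then have C0: "C \<ge> 0" using c by (auto intro: LIMSEQ_le_const)
  have "(\<integral>\<^sup>+x. ennreal (g x) \<partial>M) = (\<integral>\<^sup>+x. liminf (\<lambda>n. ennreal (f n x)) \<partial>M)"
  proof (rule nn_integral_cong_AE)
    show "AE x in M. ennreal (g x) = liminf (\<lambda>n. ennreal (f n x))"
      using lim by eventually_elim (rule lim_imp_Liminf[symmetric], auto intro: tendsto_ennrealI)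
  qed
  also have "\<dots> \<le> liminf (\<lambda>n. \<integral>\<^sup>+x. ennreal (f n x) \<partial>M)"
    by (rule nn_integral_liminf) auto
  also have "\<dots> \<le> liminf (\<lambda>n. ennreal (c n))"
  proof (rule Liminf_mono, rule always_eventually, rule allI)
    fix n
    have "(\<integral>\<^sup>+x. ennreal (f n x) \<partial>M) = ennreal (\<integral>x. f n x \<partial>M)"
      by (rule nn_integral_eq_integral) (auto simp: f nn)
    then show "(\<integral>\<^sup>+x. ennreal (f n x) \<partial>M) \<le> ennreal (c n)" using le[of n] by (simp add: ennreal_leI)
  qed
  also have "\<dots> = ennreal C" by (rule lim_imp_Liminf) (auto intro: tendsto_ennrealI c)
  finally have *: "(\<integral>\<^sup>+x. ennreal (g x) \<partial>M) \<le> ennreal C" .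
  show i: "integrable M g"
    by (rule integrableI_nonneg) (use g0 * in \<open>auto intro: le_less_trans\<close>)
  have "ennreal (\<integral>x. g x \<partial>M) \<le> ennreal C"
    using * nn_integral_eq_integral[OF i g0] by simp
  then show "(\<integral>x. g x \<partial>M) \<le> C" using C0 by simp
qed

text \<open>Multiplying by the square root of \<open>r = \<mu> / mass\<close> scales the kinetic
  term by \<open>r\<close> but the power term by the larger \<open>r powr (p / 2)\<close>. The
  difference is kept on the left as a quantitative gain; it replaces strict subadditivity of the
  ground state energy.\<close>

lemma energy_scale_up:
  assumes p: "p > 2" and \<mu>: "\<mu> > 0"
    and inf: "\<And>\<psi> V. H1_pair l \<psi> V \<Longrightarrow> mass_of l \<psi> = \<mu> \<Longrightarrow> I \<le> energy_of l p \<psi> V"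
    and H: "H1_pair l \<phi> W" and m: "mass_of l \<phi> > 0"
  shows "mass_of l \<phi> / \<mu> * I + ((\<mu> / mass_of l \<phi>) powr ((p - 2) / 2) - 1) / p * power_of l p \<phi> \<le> energy_of l p \<phi> W"
proof -
  define r where "r = \<mu> / mass_of l \<phi>"
  have r: "r > 0" using \<mu> m by (simp add: r_def)
  define c where "c = complex_of_real (sqrt r)"
  have nc: "norm c = sqrt r" using r by (simp add: c_def)
  have "mass_of l (\<lambda>x. c * \<phi> x) = \<mu>" using m r by (simp add: mass_of_scale nc r_def)
  then have "I \<le> energy_of l p (\<lambda>x. c * \<phi> x) (\<lambda>x. c * W x)"
    by (rule inf[OF H1_pair_scale[OF H]])
  also have "\<dots> = r / 2 * kinetic W - sqrt r powr p / p * power_of l p \<phi>"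
    using r by (simp add: energy_of_scale nc)
  also have "sqrt r powr p = r * r powr ((p - 2) / 2)"
  proof -
    have "sqrt r powr p = r powr (1 + (p - 2) / 2)" using r by (simp add: powr_half_sqrt[symmetric] powr_powr field_simps)
    also have "\<dots> = r * r powr ((p - 2) / 2)" using r by (simp add: powr_add)
    finally show ?thesis .
  qed
  also have "r / 2 * kinetic W - r * r powr ((p - 2) / 2) / p * power_of l p \<phi> =
    r * (energy_of l p \<phi> W - (r powr ((p - 2) / 2) - 1) / p * power_of l p \<phi>)"
    using p by (simp add: energy_of_def field_simps)
  finally have "I / r \<le> energy_of l p \<phi> W - (r powr ((p - 2) / 2) - 1) / p * power_of l p \<phi>"
    using r by (simp add: pos_divide_le_eq mult.commute)
  moreover have "I / r = mass_of l \<phi> / \<mu> * I" by (simp add: r_def)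
  ultimately show ?thesis unfolding r_def[symmetric] by linarith
qed

lemma energy_ge_proportion:
  assumes p: "p > 2" and \<mu>: "\<mu> > 0"
    and inf: "\<And>\<psi> V. H1_pair l \<psi> V \<Longrightarrow> mass_of l \<psi> = \<mu> \<Longrightarrow> I \<le> energy_of l p \<psi> V"
    and H: "H1_pair l \<phi> W" and m: "mass_of l \<phi> \<le> \<mu>"
  shows "mass_of l \<phi> / \<mu> * I \<le> energy_of l p \<phi> W"
proof (cases "mass_of l \<phi> = 0")
  case True
  then have z: "\<phi> (grid_point l x) = 0" for x using mass_of_eq_0_iff[OF H] by blast
  have "power_of l p \<phi> = 0" unfolding power_of_def z by simp
  then show ?thesis using True by (simp add: energy_of_def)
next
  case False
  then have m0: "mass_of l \<phi> > 0" using mass_of_nonneg[of l \<phi>] by linarith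
  have "1 \<le> (\<mu> / mass_of l \<phi>) powr ((p - 2) / 2)"
    using p m m0 by (intro ge_one_powr_ge_zero) (auto simp: le_divide_eq)
  then have "0 \<le> ((\<mu> / mass_of l \<phi>) powr ((p - 2) / 2) - 1) / p * power_of l p \<phi>" using p by simp
  then show ?thesis using energy_scale_up[OF p \<mu> inf H m0] by linarith
qed

section \<open>Translations along the lattice\<close>

definition line_shift :: "(axis \<Rightarrow> int) \<Rightarrow> grid_line_index \<Rightarrow> grid_line_index" where
  "line_shift s = (\<lambda>(a, m, n). case a of XAxis \<Rightarrow> (a, m + s YAxis, n + s ZAxis)
     | YAxis \<Rightarrow> (a, m + s XAxis, n + s ZAxis) | ZAxis \<Rightarrow> (a, m + s XAxis, n + s YAxis))"

text \<open>The component of the shift along the axis of the line moves the parameter; the two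
  transverse components move the line index, through \<open>line_shift\<close>.\<close>

definition grid_shift :: "real \<Rightarrow> (axis \<Rightarrow> int) \<Rightarrow> grid_line_index \<times> real \<Rightarrow> grid_line_index \<times> real" where
  "grid_shift l s x = (line_shift s (fst x), snd x + of_int (s (fst (fst x))) * l)"

definition shift_vector :: "real \<Rightarrow> (axis \<Rightarrow> int) \<Rightarrow> real ^ 3" where
  "shift_vector l s = vector [of_int (s XAxis) * l, of_int (s YAxis) * l, of_int (s ZAxis) * l]"

lemma grid_point_shift: "grid_point l (grid_shift l s x) = grid_point l x + shift_vector l s"
proof -
  obtain a m n t where x: "x = ((a, m, n), t)" by (metis prod.exhaust)
  show ?thesis
    by (cases a) (simp_all add: x grid_point_def grid_shift_def line_shift_def shift_vector_def vec_eq_iff forall_3 algebra_simps)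
qed

lemma grid_shift_Pair: "grid_shift l s (i, t) = (line_shift s i, t + of_int (s (fst i)) * l)"
  by (simp add: grid_shift_def)

lemma measurable_grid_shift: "grid_shift l s \<in> measurable grid_measure grid_measure"
  unfolding grid_measure_def
proof (rule measurable_pair_measure_countable1)
  show "(\<lambda>t. grid_shift l s (i, t)) \<in> measurable lborel (count_space UNIV \<Otimes>\<^sub>M lborel)" for i
    unfolding grid_shift_Pair by measurable
qed simp

lemma nn_integral_grid_shift:
  assumes f: "f \<in> borel_measurable grid_measure"
  shows "(\<integral>\<^sup>+x. f (grid_shift l s x) \<partial>grid_measure) = (\<integral>\<^sup>+x. f x \<partial>grid_measure)"
proof -
  define T where "T = line_shift s"
  have bij: "bij_betw T UNIV UNIV"
  proof (rule bij_betwI)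
    define T' where "T' = line_shift (\<lambda>a. - s a)"
    show "T' (T i) = i" "T (T' i) = i" for i
      by (cases i; cases "fst i"; auto simp: T_def T'_def line_shift_def)+
  qed auto
  have "(\<integral>\<^sup>+x. f (grid_shift l s x) \<partial>grid_measure) = (\<integral>\<^sup>+i. (\<integral>\<^sup>+t. f (grid_shift l s (i, t)) \<partial>lborel) \<partial>count_space UNIV)"
    by (rule nn_integral_grid) (use measurable_compose[OF measurable_grid_shift f] in simp)
  also have "\<dots> = (\<integral>\<^sup>+i. (\<integral>\<^sup>+t. f (T i, t) \<partial>lborel) \<partial>count_space UNIV)"
  proof (rule nn_integral_cong)
    fix i :: grid_line_index
    have "(\<integral>\<^sup>+t. f (T i, t) \<partial>lborel) = (\<integral>\<^sup>+t. f (T i, of_int (s (fst i)) * l + t) \<partial>lborel)"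
      using nn_integral_real_affine[of "\<lambda>t. f (T i, t)" 1 "of_int (s (fst i)) * l"] borel_measurable_grid_section[OF f] by simp
    then show "(\<integral>\<^sup>+t. f (grid_shift l s (i, t)) \<partial>lborel) = (\<integral>\<^sup>+t. f (T i, t) \<partial>lborel)"
      by (simp add: grid_shift_Pair T_def add.commute)
  qed
  also have "\<dots> = (\<integral>\<^sup>+i. (\<integral>\<^sup>+t. f (i, t) \<partial>lborel) \<partial>count_space UNIV)"
    by (rule nn_integral_bij_count_space[OF bij])
  also have "\<dots> = (\<integral>\<^sup>+x. f x \<partial>grid_measure)" by (rule nn_integral_grid[OF f, symmetric])
  finally show ?thesis .
qed

lemma distr_grid_shift: "distr grid_measure grid_measure (grid_shift l s) = grid_measure"
proof (rule measure_eqI)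
  fix A assume "A \<in> sets (distr grid_measure grid_measure (grid_shift l s))"
  then have A[measurable]: "A \<in> sets grid_measure" by simp
  note measurable_grid_shift[measurable]
  have "emeasure (distr grid_measure grid_measure (grid_shift l s)) A = (\<integral>\<^sup>+x. indicator A x \<partial>distr grid_measure grid_measure (grid_shift l s))"
    by simp
  also have "\<dots> = (\<integral>\<^sup>+x. indicator A (grid_shift l s x) \<partial>grid_measure)"
    by (rule nn_integral_distr) (auto simp: measurable_grid_shift)
  also have "\<dots> = (\<integral>\<^sup>+x. indicator A x \<partial>grid_measure)" by (rule nn_integral_grid_shift) measurable
  finally show "emeasure (distr grid_measure grid_measure (grid_shift l s)) A = emeasure grid_measure A" by simp
qed simp

lemma integral_grid_shift:
  fixes f :: "grid_line_index \<times> real \<Rightarrow> real"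
  assumes f: "f \<in> borel_measurable grid_measure"
  shows "(\<integral>x. f (grid_shift l s x) \<partial>grid_measure) = (\<integral>x. f x \<partial>grid_measure)"
    "integrable grid_measure f \<Longrightarrow> integrable grid_measure (\<lambda>x. f (grid_shift l s x))"
  using integral_distr[OF measurable_grid_shift f] integrable_distr[OF measurable_grid_shift, of l s f]
  by (simp_all add: distr_grid_shift)

lemma is_primitive_shift:
  fixes u :: "real \<Rightarrow> 'a::euclidean_space"
  assumes "is_primitive u v"
  shows "is_primitive (\<lambda>t. u (t + c)) (\<lambda>t. v (t + c))"
  unfolding is_primitive_def
proof (intro conjI allI impI)
  note [measurable] = is_primitiveD(1)[OF assms]
  show "(\<lambda>t. v (t + c)) \<in> borel_measurable borel" by measurable
  have e: "(\<lambda>t. indicator {a..b} t *\<^sub>R v (t + c)) = (\<lambda>t. (\<lambda>s. indicator {a + c..b + c} s *\<^sub>R v s) (c + 1 * t))" for a b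
    by (auto simp: indicator_def add.commute)
  have i: "integrable lborel (\<lambda>s. indicator {a + c..b + c} s *\<^sub>R v s)" for a b
    using is_primitiveD(2)[OF assms, of "a + c" "b + c"] by (simp add: set_integrable_def)
  show "set_integrable lborel {a..b} (\<lambda>t. v (t + c))" for a b
    unfolding set_integrable_def e by (rule lborel_integrable_real_affine[OF i]) simp
  show "u (b + c) - u (a + c) = (LINT t:{a..b}|lborel. v (t + c))" if "a \<le> b" for a b
    using is_primitiveD(3)[OF assms, of "a + c" "b + c"] that
      lborel_integral_real_affine[of 1 "\<lambda>s. indicator {a + c..b + c} s *\<^sub>R v s" c]
    unfolding set_lebesgue_integral_def e by simp
qed

lemma H1_pair_translate:
  fixes s l \<psi> V
  assumes H: "H1_pair l \<psi> V"
  defines "\<psi>' \<equiv> \<lambda>x. \<psi> (x + shift_vector l s)" and "V' \<equiv> \<lambda>x. V (grid_shift l s x)"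
  shows "H1_pair l \<psi>' V'" "mass_of l \<psi>' = mass_of l \<psi>" "power_of l p \<psi>' = power_of l p \<psi>" "kinetic V' = kinetic V"
proof -
  note [measurable] = H1_pairD(4,5)[OF H]
  have e: "\<psi>' (grid_point l x) = \<psi> (grid_point l (grid_shift l s x))" for x
    by (simp add: \<psi>'_def grid_point_shift)
  show "H1_pair l \<psi>' V'" unfolding H1_pair_def e V'_def
  proof (intro conjI allI)
    show "is_primitive (\<lambda>t. \<psi> (grid_point l (grid_shift l s (i, t)))) (\<lambda>t. V (grid_shift l s (i, t)))" for i
      unfolding grid_shift_Pair by (rule is_primitive_shift[OF H1_pairD(1)[OF H]])
  qed (intro integral_grid_shift(2) H1_pairD(2,3)[OF H]; measurable)+
  show "mass_of l \<psi>' = mass_of l \<psi>" unfolding mass_of_def e by (rule integral_grid_shift(1)) measurable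
  show "power_of l p \<psi>' = power_of l p \<psi>" unfolding power_of_def e by (rule integral_grid_shift(1)) measurable
  show "kinetic V' = kinetic V" unfolding kinetic_def V'_def by (rule integral_grid_shift(1)) measurable
qed

text \<open>Up to translation every point of the grid lies on one of three edges at the origin. A
  translated sequence can thus keep its large values inside a fixed compact set.\<close>

lemma ex_shift_to_cell:
  assumes l: "l > 0"
  obtains s t where "t \<in> {0..l}" "grid_shift l s ((a, 0, 0), t) = ((a, m, n), r)"
proof -
  define q where "q = \<lfloor>r / l\<rfloor>"
  define t where "t = r - of_int q * l"
  have "of_int q \<le> r / l" "r / l < of_int q + 1" by (auto simp: q_def floor_less_iff)
  then have t: "t \<in> {0..l}" using l by (simp add: t_def field_simps)
  define s where "s b = (if b = a then q else case a of XAxis \<Rightarrow> (if b = YAxis then m else n)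
     | YAxis \<Rightarrow> (if b = XAxis then m else n) | ZAxis \<Rightarrow> (if b = XAxis then m else n))" for b
  have "grid_shift l s ((a, 0, 0), t) = ((a, m, n), r)"
    by (cases a) (simp_all add: grid_shift_def line_shift_def s_def t_def)
  then show thesis using that t by blast
qed

section \<open>Localisation\<close>

text \<open>The angle is \<open>pi / 2\<close> at the origin and decays at infinity; for fixed
  \<open>x\<close> it tends to \<open>pi / 2\<close> as \<open>\<epsilon>\<close> tends to 0. The
  exponential tail, unlike a compact support, keeps the sine positive everywhere and still
  integrable.\<close>

definition loc_angle :: "real \<Rightarrow> real ^ 3 \<Rightarrow> real" where
  "loc_angle \<epsilon> x = pi / 2 * exp (- \<epsilon> * l1_norm3 x)"

lemma l1_norm3_nonneg [simp]: "l1_norm3 x \<ge> 0" by (simp add: l1_norm3_def)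

lemma loc_angle_bounds:
  assumes "\<epsilon> \<ge> 0"
  shows "loc_angle \<epsilon> x > 0" "loc_angle \<epsilon> x \<le> pi / 2"
  using assms by (auto simp: loc_angle_def)

lemma loc_angle_sin_cos:
  assumes "\<epsilon> \<ge> 0"
  shows "0 < sin (loc_angle \<epsilon> x)" "0 \<le> cos (loc_angle \<epsilon> x)" "sin (loc_angle \<epsilon> x) \<le> 1" "cos (loc_angle \<epsilon> x) \<le> 1"
    "sin (loc_angle \<epsilon> x) \<le> pi / 2 * exp (- \<epsilon> * l1_norm3 x)"
proof -
  note b = loc_angle_bounds[OF assms, of x]
  show "0 < sin (loc_angle \<epsilon> x)" using b by (intro sin_gt_zero) auto
  show "0 \<le> cos (loc_angle \<epsilon> x)" using b by (intro cos_ge_zero) auto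
  have "sin (loc_angle \<epsilon> x) \<le> loc_angle \<epsilon> x" using b by (intro sin_x_le_x) auto
  then show "sin (loc_angle \<epsilon> x) \<le> pi / 2 * exp (- \<epsilon> * l1_norm3 x)" by (simp add: loc_angle_def)
qed auto

lemma loc_angle_measurable:
  assumes l: "l > 0" and e: "\<epsilon> > 0"
  shows "(\<lambda>x. loc_angle \<epsilon> (grid_point l x)) \<in> borel_measurable grid_measure"
  unfolding loc_angle_def using exp_decay_integral_eq(2)[OF l e] by simp

definition loc_angle_deriv :: "real \<Rightarrow> real \<Rightarrow> grid_line_index \<times> real \<Rightarrow> real" where
  "loc_angle_deriv l \<epsilon> x = pi / 2 * ((if 0 \<le> snd x then - \<epsilon> else \<epsilon>) * exp (- \<epsilon> * l1_norm3 (grid_point l x)))"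

lemma loc_angle_deriv_bound:
  assumes "\<epsilon> > 0"
  shows "(loc_angle_deriv l \<epsilon> x)\<^sup>2 \<le> (pi / 2 * \<epsilon>)\<^sup>2"
proof -
  have "\<bar>loc_angle_deriv l \<epsilon> x\<bar> = pi / 2 * (\<epsilon> * exp (- \<epsilon> * l1_norm3 (grid_point l x)))"
    using assms by (auto simp: loc_angle_deriv_def abs_mult)
  also have "\<dots> \<le> pi / 2 * (\<epsilon> * 1)" using assms by (intro mult_left_mono) auto
  finally have "\<bar>loc_angle_deriv l \<epsilon> x\<bar> \<le> \<bar>pi / 2 * \<epsilon>\<bar>" using assms by simp
  then show ?thesis by (simp only: abs_le_square_iff)
qed

lemma loc_primitive:
  assumes l: "l > 0" and e: "\<epsilon> > 0"
  shows "is_primitive (\<lambda>t. sin (loc_angle \<epsilon> (grid_point l (i, t)))) (\<lambda>t. cos (loc_angle \<epsilon> (grid_point l (i, t))) * loc_angle_deriv l \<epsilon> (i, t))"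
    "is_primitive (\<lambda>t. cos (loc_angle \<epsilon> (grid_point l (i, t)))) (\<lambda>t. - sin (loc_angle \<epsilon> (grid_point l (i, t))) * loc_angle_deriv l \<epsilon> (i, t))"
proof -
  have P: "is_primitive (\<lambda>t. exp (- \<epsilon> * l1_norm3 (grid_point l (i, t)))) (\<lambda>t. (if 0 \<le> t then - \<epsilon> else \<epsilon>) * exp (- \<epsilon> * l1_norm3 (grid_point l (i, t))))"
    using is_primitive_linear[OF bounded_linear_Re exp_decay_primitive[OF l, of \<epsilon> i]] by simp
  have J: "exp (- \<epsilon> * l1_norm3 (grid_point l (i, t))) \<in> {0..1}" for t using e by simp
  have "is_primitive (\<lambda>t. sin (pi / 2 * exp (- \<epsilon> * l1_norm3 (grid_point l (i, t)))))
    (\<lambda>t. (cos (pi / 2 * exp (- \<epsilon> * l1_norm3 (grid_point l (i, t)))) * (pi / 2)) * ((if 0 \<le> t then - \<epsilon> else \<epsilon>) * exp (- \<epsilon> * l1_norm3 (grid_point l (i, t)))))"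
    by (rule is_primitive_chain[OF P J, of "\<lambda>y. sin (pi / 2 * y)" "\<lambda>y. cos (pi / 2 * y) * (pi / 2)"])
      (auto intro!: derivative_eq_intros continuous_intros)
  then show "is_primitive (\<lambda>t. sin (loc_angle \<epsilon> (grid_point l (i, t)))) (\<lambda>t. cos (loc_angle \<epsilon> (grid_point l (i, t))) * loc_angle_deriv l \<epsilon> (i, t))"
    unfolding loc_angle_def loc_angle_deriv_def by (simp add: mult.assoc)
  have "is_primitive (\<lambda>t. cos (pi / 2 * exp (- \<epsilon> * l1_norm3 (grid_point l (i, t)))))
    (\<lambda>t. (- sin (pi / 2 * exp (- \<epsilon> * l1_norm3 (grid_point l (i, t)))) * (pi / 2)) * ((if 0 \<le> t then - \<epsilon> else \<epsilon>) * exp (- \<epsilon> * l1_norm3 (grid_point l (i, t)))))"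
    by (rule is_primitive_chain[OF P J, of "\<lambda>y. cos (pi / 2 * y)" "\<lambda>y. - sin (pi / 2 * y) * (pi / 2)"])
      (auto intro!: derivative_eq_intros continuous_intros)
  then show "is_primitive (\<lambda>t. cos (loc_angle \<epsilon> (grid_point l (i, t)))) (\<lambda>t. - sin (loc_angle \<epsilon> (grid_point l (i, t))) * loc_angle_deriv l \<epsilon> (i, t))"
    unfolding loc_angle_def loc_angle_deriv_def by (simp add: mult.assoc)
qed

lemma norm_scaleR_add_square:
  fixes f v :: complex
  shows "(norm (a *\<^sub>R f + b *\<^sub>R v))\<^sup>2 = a\<^sup>2 * (norm f)\<^sup>2 + 2 * (a * b) * (f \<bullet> v) + b\<^sup>2 * (norm v)\<^sup>2"
  unfolding power2_norm_eq_inner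
  by (simp add: inner_add_left inner_add_right inner_commute power2_eq_square algebra_simps)

text \<open>The two derivatives are a rotation by the cut-off angle applied to
  \<open>d *\<^sub>R f\<close> and \<open>v\<close>, so the cross terms cancel. This is the IMS
  localisation formula: the splitting costs only the squared derivative of the angle.\<close>

lemma rotation_norm_identity:
  fixes f v :: complex
  assumes "s\<^sup>2 + c\<^sup>2 = 1"
  shows "(norm ((c * d) *\<^sub>R f + s *\<^sub>R v))\<^sup>2 + (norm ((- s * d) *\<^sub>R f + c *\<^sub>R v))\<^sup>2 = d\<^sup>2 * (norm f)\<^sup>2 + (norm v)\<^sup>2"
proof -
  have "(norm ((c * d) *\<^sub>R f + s *\<^sub>R v))\<^sup>2 + (norm ((- s * d) *\<^sub>R f + c *\<^sub>R v))\<^sup>2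
    = (s\<^sup>2 + c\<^sup>2) * (d\<^sup>2 * (norm f)\<^sup>2 + (norm v)\<^sup>2)"
    unfolding norm_scaleR_add_square by (simp add: power_mult_distrib algebra_simps)
  then show ?thesis by (simp add: assms)
qed

text \<open>Unlike the mass, the \<open>p\<close>-th power is not additive under the splitting; this
  is the fraction of it that gets lost.\<close>

definition loc_defect :: "real \<Rightarrow> real \<Rightarrow> real ^ 3 \<Rightarrow> real" where
  "loc_defect p \<epsilon> x = 1 - sin (loc_angle \<epsilon> x) powr p - cos (loc_angle \<epsilon> x) powr p"

text \<open>The linear bound in the sine makes the defect integrable over the grid, as dominated
  convergence requires. It comes from \<open>p \<le> 6\<close>: the \<open>p\<close>-th power of the
  cosine is at least its sixth power, the cube of \<open>1 - s^2\<close>, which is at least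
  \<open>1 - 3 * s^2\<close>.\<close>

lemma loc_defect_bounds:
  assumes p: "2 \<le> p" "p \<le> 6" and e: "\<epsilon> \<ge> 0"
  shows "0 \<le> loc_defect p \<epsilon> x" "loc_defect p \<epsilon> x \<le> 1" "loc_defect p \<epsilon> x \<le> 3 * sin (loc_angle \<epsilon> x)"
proof -
  define s c where "s = sin (loc_angle \<epsilon> x)" and "c = cos (loc_angle \<epsilon> x)"
  note b = loc_angle_sin_cos[OF e, of x, folded s_def c_def]
  have sc: "s\<^sup>2 + c\<^sup>2 = 1" by (simp add: s_def c_def)
  have "y powr p \<le> y\<^sup>2" if "0 \<le> y" "y \<le> 1" for y :: real
  proof -
    have "y powr p \<le> y powr 2" using that p by (intro powr_mono') auto
    then show ?thesis using that by (cases "y = 0") auto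
  qed
  from this[of s] this[of c] show "0 \<le> loc_defect p \<epsilon> x" using b sc by (simp add: loc_defect_def s_def[symmetric] c_def[symmetric])
  show "loc_defect p \<epsilon> x \<le> 1"
    using powr_ge_zero[of s p] powr_ge_zero[of c p] unfolding loc_defect_def s_def[symmetric] c_def[symmetric] by linarith
  have "c powr 6 \<le> c powr p" using b p by (intro powr_mono') auto
  moreover have "c powr 6 = (1 - s\<^sup>2) ^ 3"
  proof -
    have "c powr 6 = (c\<^sup>2) ^ 3" using b by (cases "c = 0") (auto simp flip: power_mult)
    moreover have "c\<^sup>2 = 1 - s\<^sup>2" using sc by simp
    ultimately show ?thesis by simp
  qed
  moreover have "1 - 3 * s\<^sup>2 \<le> (1 - s\<^sup>2) ^ 3"
  proof -
    have "0 \<le> s ^ 4 * (3 - s\<^sup>2)" using b power_le_one[of s 2] by (intro mult_nonneg_nonneg) auto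
    then show ?thesis by (simp add: power3_eq_cube algebra_simps power2_eq_square power4_eq_xxxx)
  qed
  moreover have "s\<^sup>2 \<le> s" using b by (simp add: power2_eq_square mult_left_le)
  moreover have "0 \<le> s powr p" by simp
  ultimately show "loc_defect p \<epsilon> x \<le> 3 * sin (loc_angle \<epsilon> x)"
    unfolding loc_defect_def s_def[symmetric] c_def[symmetric] by linarith
qed

text \<open>Masses add exactly, while the energies add up to two errors: the derivative of the
  angle, of order \<open>\<epsilon>\<close> squared, and the defect of the \<open>p\<close>-th
  power.\<close>

lemma localisation:
  assumes l: "l > 0" and e: "\<epsilon> > 0" and p: "2 \<le> p" "p \<le> 6" and H: "H1_pair l f V"
  obtains W1 W2 where
    "H1_pair l (\<lambda>x. sin (loc_angle \<epsilon> x) *\<^sub>R f x) W1" "H1_pair l (\<lambda>x. cos (loc_angle \<epsilon> x) *\<^sub>R f x) W2"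
    "mass_of l (\<lambda>x. sin (loc_angle \<epsilon> x) *\<^sub>R f x) + mass_of l (\<lambda>x. cos (loc_angle \<epsilon> x) *\<^sub>R f x) = mass_of l f"
    "energy_of l p (\<lambda>x. sin (loc_angle \<epsilon> x) *\<^sub>R f x) W1 + energy_of l p (\<lambda>x. cos (loc_angle \<epsilon> x) *\<^sub>R f x) W2
      \<le> energy_of l p f V + (pi / 2 * \<epsilon>)\<^sup>2 / 2 * mass_of l f
        + 1 / p * (\<integral>x. loc_defect p \<epsilon> (grid_point l x) * norm (f (grid_point l x)) powr p \<partial>grid_measure)"
proof -
  note [measurable] = H1_pairD(4,5)[OF H] loc_angle_measurable[OF l e]
  define \<theta> where "\<theta> x = loc_angle \<epsilon> (grid_point l x)" for x
  define d where "d = loc_angle_deriv l \<epsilon>"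
  define F where "F x = f (grid_point l x)" for x
  define W1 where "W1 x = (cos (\<theta> x) * d x) *\<^sub>R F x + sin (\<theta> x) *\<^sub>R V x" for x
  define W2 where "W2 x = (- sin (\<theta> x) * d x) *\<^sub>R F x + cos (\<theta> x) *\<^sub>R V x" for x
  have prim1: "is_primitive (\<lambda>t. sin (\<theta> (i, t)) *\<^sub>R F (i, t)) (\<lambda>t. W1 (i, t))"
    and prim2: "is_primitive (\<lambda>t. cos (\<theta> (i, t)) *\<^sub>R F (i, t)) (\<lambda>t. W2 (i, t))" for i
    using is_primitive_bilinear[OF bounded_bilinear_scaleR loc_primitive(1)[OF l e, of i] H1_pairD(1)[OF H, of i]]
      is_primitive_bilinear[OF bounded_bilinear_scaleR loc_primitive(2)[OF l e, of i] H1_pairD(1)[OF H, of i]]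
    unfolding W1_def W2_def \<theta>_def F_def d_def by simp_all
  have [measurable]: "W1 \<in> borel_measurable grid_measure" "W2 \<in> borel_measurable grid_measure"
    by (rule borel_measurable_grid, rule is_primitiveD(1)[OF prim1], rule borel_measurable_grid, rule is_primitiveD(1)[OF prim2])
  have [measurable]: "F \<in> borel_measurable grid_measure" "\<theta> \<in> borel_measurable grid_measure"
    unfolding F_def[abs_def] \<theta>_def[abs_def] by measurable
  have iF: "integrable grid_measure (\<lambda>x. (norm (F x))\<^sup>2)" and iV: "integrable grid_measure (\<lambda>x. (norm (V x))\<^sup>2)"
    using H1_pairD(2,3)[OF H] by (simp_all add: F_def)
  have sum: "(norm (W1 x))\<^sup>2 + (norm (W2 x))\<^sup>2 = (d x)\<^sup>2 * (norm (F x))\<^sup>2 + (norm (V x))\<^sup>2" for x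
    unfolding W1_def W2_def by (rule rotation_norm_identity) simp
  have sum_le: "(norm (W1 x))\<^sup>2 + (norm (W2 x))\<^sup>2 \<le> (pi / 2 * \<epsilon>)\<^sup>2 * (norm (F x))\<^sup>2 + (norm (V x))\<^sup>2" for x
    unfolding sum d_def by (intro add_right_mono mult_right_mono loc_angle_deriv_bound e) simp
  have ib: "integrable grid_measure (\<lambda>x. (pi / 2 * \<epsilon>)\<^sup>2 * (norm (F x))\<^sup>2 + (norm (V x))\<^sup>2)" using iF iV by simp
  have b: "norm ((norm (W1 x))\<^sup>2) \<le> norm ((pi / 2 * \<epsilon>)\<^sup>2 * (norm (F x))\<^sup>2 + (norm (V x))\<^sup>2)"
    "norm ((norm (W2 x))\<^sup>2) \<le> norm ((pi / 2 * \<epsilon>)\<^sup>2 * (norm (F x))\<^sup>2 + (norm (V x))\<^sup>2)" for x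
    using sum_le[of x] zero_le_power2[of "norm (W1 x)"] zero_le_power2[of "norm (W2 x)"]
    unfolding real_norm_def by linarith+
  have iW1: "integrable grid_measure (\<lambda>x. (norm (W1 x))\<^sup>2)"
    by (rule Bochner_Integration.integrable_bound[OF ib _ AE_I2[OF b(1)]]) measurable
  have iW2: "integrable grid_measure (\<lambda>x. (norm (W2 x))\<^sup>2)"
    by (rule Bochner_Integration.integrable_bound[OF ib _ AE_I2[OF b(2)]]) measurable
  have n1: "norm (sin (\<theta> x) *\<^sub>R F x) = sin (\<theta> x) * norm (F x)" "norm (cos (\<theta> x) *\<^sub>R F x) = cos (\<theta> x) * norm (F x)" for x
    using loc_angle_sin_cos(1,2)[of \<epsilon> "grid_point l x"] e unfolding \<theta>_def by simp_all
  have i1: "integrable grid_measure (\<lambda>x. (norm (sin (\<theta> x) *\<^sub>R F x))\<^sup>2)"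
    by (rule Bochner_Integration.integrable_bound[OF iF]) (auto simp: power_mult_distrib abs_square_le_1 intro!: mult_left_le_one_le)
  have i2: "integrable grid_measure (\<lambda>x. (norm (cos (\<theta> x) *\<^sub>R F x))\<^sup>2)"
    by (rule Bochner_Integration.integrable_bound[OF iF]) (auto simp: power_mult_distrib abs_square_le_1 intro!: mult_left_le_one_le)
  have H1: "H1_pair l (\<lambda>x. sin (loc_angle \<epsilon> x) *\<^sub>R f x) W1"
    unfolding H1_pair_def using prim1 i1 iW1 unfolding \<theta>_def F_def by blast
  have H2: "H1_pair l (\<lambda>x. cos (loc_angle \<epsilon> x) *\<^sub>R f x) W2"
    unfolding H1_pair_def using prim2 i2 iW2 unfolding \<theta>_def F_def by blast
  have mass: "mass_of l (\<lambda>x. sin (loc_angle \<epsilon> x) *\<^sub>R f x) + mass_of l (\<lambda>x. cos (loc_angle \<epsilon> x) *\<^sub>R f x) = mass_of l f"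
  proof -
    have "(\<integral>x. (norm (sin (\<theta> x) *\<^sub>R F x))\<^sup>2 \<partial>grid_measure) + (\<integral>x. (norm (cos (\<theta> x) *\<^sub>R F x))\<^sup>2 \<partial>grid_measure)
      = (\<integral>x. (norm (sin (\<theta> x) *\<^sub>R F x))\<^sup>2 + (norm (cos (\<theta> x) *\<^sub>R F x))\<^sup>2 \<partial>grid_measure)"
      by (rule Bochner_Integration.integral_add[OF i1 i2, symmetric])
    also have "(\<lambda>x. (norm (sin (\<theta> x) *\<^sub>R F x))\<^sup>2 + (norm (cos (\<theta> x) *\<^sub>R F x))\<^sup>2) = (\<lambda>x. (norm (F x))\<^sup>2)"
      unfolding n1 power_mult_distrib by (simp flip: distrib_right)
    finally show ?thesis by (simp only: mass_of_def \<theta>_def F_def)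
  qed
  have kin: "kinetic W1 + kinetic W2 \<le> kinetic V + (pi / 2 * \<epsilon>)\<^sup>2 * mass_of l f"
  proof -
    have "kinetic W1 + kinetic W2 = (\<integral>x. (norm (W1 x))\<^sup>2 + (norm (W2 x))\<^sup>2 \<partial>grid_measure)"
      unfolding kinetic_def by (rule Bochner_Integration.integral_add[OF iW1 iW2, symmetric])
    also have "\<dots> \<le> (\<integral>x. (pi / 2 * \<epsilon>)\<^sup>2 * (norm (F x))\<^sup>2 + (norm (V x))\<^sup>2 \<partial>grid_measure)"
      by (intro integral_mono ib Bochner_Integration.integrable_add iW1 iW2 sum_le)
    also have "\<dots> = (pi / 2 * \<epsilon>)\<^sup>2 * mass_of l f + kinetic V"
      using iF iV by (simp add: mass_of_def kinetic_def F_def)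
    finally show ?thesis by simp
  qed
  define D where "D = (\<integral>x. loc_defect p \<epsilon> (grid_point l x) * norm (f (grid_point l x)) powr p \<partial>grid_measure)"
  have pow: "power_of l p f = power_of l p (\<lambda>x. sin (loc_angle \<epsilon> x) *\<^sub>R f x) + power_of l p (\<lambda>x. cos (loc_angle \<epsilon> x) *\<^sub>R f x) + D"
  proof -
    have ip: "integrable grid_measure (\<lambda>x. norm (F x) powr p)"
      using integrable_power_of[OF H p(1)] by (simp add: F_def)
    have ip1: "integrable grid_measure (\<lambda>x. norm (sin (\<theta> x) *\<^sub>R F x) powr p)"
      and ip2: "integrable grid_measure (\<lambda>x. norm (cos (\<theta> x) *\<^sub>R F x) powr p)"
      using integrable_power_of[OF H1 p(1)] integrable_power_of[OF H2 p(1)] unfolding \<theta>_def F_def by simp_all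
    have D: "D = (\<integral>x. norm (F x) powr p - norm (sin (\<theta> x) *\<^sub>R F x) powr p - norm (cos (\<theta> x) *\<^sub>R F x) powr p \<partial>grid_measure)"
      unfolding D_def loc_defect_def n1
      by (intro Bochner_Integration.integral_cong refl)
        (use loc_angle_sin_cos(1,2)[of \<epsilon>] e in \<open>simp add: \<theta>_def F_def powr_mult algebra_simps less_imp_le\<close>)
    show ?thesis unfolding D using ip ip1 ip2 by (simp add: power_of_def \<theta>_def F_def)
  qed
  have "energy_of l p (\<lambda>x. sin (loc_angle \<epsilon> x) *\<^sub>R f x) W1 + energy_of l p (\<lambda>x. cos (loc_angle \<epsilon> x) *\<^sub>R f x) W2
      \<le> energy_of l p f V + (pi / 2 * \<epsilon>)\<^sup>2 / 2 * mass_of l f + 1 / p * D"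
  proof -
    have "1 / p * power_of l p f = 1 / p * power_of l p (\<lambda>x. sin (loc_angle \<epsilon> x) *\<^sub>R f x) + 1 / p * power_of l p (\<lambda>x. cos (loc_angle \<epsilon> x) *\<^sub>R f x) + 1 / p * D"
      unfolding pow by (simp only: distrib_left)
    then show ?thesis using kin unfolding energy_of_def by (simp add: distrib_left[symmetric] field_simps)
  qed
  then show thesis using that[OF H1 H2 mass] unfolding D_def by blast
qed

section \<open>Limits of bounded sequences\<close>

text \<open>A diagonal argument gives convergence at the rational points of all lines, a countable
  set; the uniform Hoelder bound extends it to every point.\<close>

lemma pointwise_convergent_subsequence:
  assumes H: "\<And>n. H1_pair l (f n) (V n)" and K: "\<And>n. kinetic (V n) \<le> K" and B: "\<And>n x. norm (f n (grid_point l x)) \<le> B"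
  obtains r \<psi> where "strict_mono (r :: nat \<Rightarrow> nat)" "\<And>x. (\<lambda>n. f (r n) (grid_point l x)) \<longlonglongrightarrow> \<psi> (grid_point l x)"
proof -
  define S where "S = (UNIV :: grid_line_index set) \<times> (\<rat> :: real set)"
  have "countable S" unfolding S_def by (intro countable_SIGMA countable_rat) auto
  then obtain r where r: "strict_mono r" "\<And>x. x \<in> S \<Longrightarrow> \<exists>L. (\<lambda>n. f (r n) (grid_point l x)) \<longlonglongrightarrow> L"
    using function_convergent_subsequence[of S "\<lambda>n x. f n (grid_point l x)" B] B by metis
  have K0: "K \<ge> 0" using K[of 0] kinetic_nonneg[of "V 0"] by linarith
  have "convergent (\<lambda>n. f (r n) (grid_point l (i, t)))" for i t
  proof (rule Cauchy_convergent, rule metric_CauchyI)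
    fix e :: real assume e: "e > 0"
    \<comment> \<open>Makes the Hoelder bound over a distance \<open>d\<close> smaller than
      \<open>e / 3\<close>; the summand 1 covers the case \<open>K = 0\<close>.\<close>
    define d where "d = (e / 3)\<^sup>2 / (K + 1)"
    have d: "d > 0" using e K0 by (simp add: d_def)
    obtain q where q: "q \<in> \<rat>" "t < q" "q < t + d" using Rats_dense_in_real[of t "t + d"] d by auto
    have near: "dist (f n (grid_point l (i, t))) (f n (grid_point l (i, q))) < e / 3" for n
    proof -
      have "norm (f n (grid_point l (i, t)) - f n (grid_point l (i, q))) \<le> sqrt (\<bar>t - q\<bar> * kinetic (V n))"
        by (rule Hoelder_half[OF H])
      also have "\<dots> < sqrt ((e / 3)\<^sup>2)"
      proof (rule real_sqrt_less_mono)
        have "\<bar>t - q\<bar> * kinetic (V n) \<le> d * K" using q K[of n] K0 by (intro mult_mono) auto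
        also have "\<dots> < d * (K + 1)" using d by simp
        also have "\<dots> = (e / 3)\<^sup>2" using K0 by (simp add: d_def)
        finally show "\<bar>t - q\<bar> * kinetic (V n) < (e / 3)\<^sup>2" .
      qed
      finally show ?thesis using e by (simp add: dist_norm)
    qed
    have "(i, q) \<in> S" using q by (simp add: S_def)
    then have "Cauchy (\<lambda>n. f (r n) (grid_point l (i, q)))" using r(2) LIMSEQ_imp_Cauchy by blast
    then obtain N where N: "\<And>m n. m \<ge> N \<Longrightarrow> n \<ge> N \<Longrightarrow> dist (f (r m) (grid_point l (i, q))) (f (r n) (grid_point l (i, q))) < e / 3"
      using metric_CauchyD[of _ "e/3"] e by (metis divide_pos_pos zero_less_numeral)
    show "\<exists>N. \<forall>m\<ge>N. \<forall>n\<ge>N. dist (f (r m) (grid_point l (i, t))) (f (r n) (grid_point l (i, t))) < e"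
    proof (intro exI allI impI)
      fix m n assume "m \<ge> N" "n \<ge> N"
      then show "dist (f (r m) (grid_point l (i, t))) (f (r n) (grid_point l (i, t))) < e"
        using near[of "r m"] near[of "r n"] N[of m n]
          dist_triangle[of "f (r m) (grid_point l (i, t))" "f (r n) (grid_point l (i, t))" "f (r m) (grid_point l (i, q))"]
          dist_triangle[of "f (r m) (grid_point l (i, q))" "f (r n) (grid_point l (i, t))" "f (r n) (grid_point l (i, q))"]
          dist_commute[of "f (r n) (grid_point l (i, q))" "f (r n) (grid_point l (i, t))"]
        by linarith
    qed
  qed
  then have "(\<lambda>n. f (r n) (grid_point l x)) \<longlonglongrightarrow> lim (\<lambda>n. f (r n) (grid_point l x))" for x
    by (cases x) (simp add: convergent_LIMSEQ_iff)
  \<comment> \<open>The limit is taken point by point in the ambient space, so the three lines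
    through a vertex automatically receive the same value there.\<close>
  then show thesis using that[of r "\<lambda>y. lim (\<lambda>n. f (r n) y)"] r(1) by blast
qed

text \<open>The positive square-integrable weight \<open>h\<close> makes \<open>h * V n\<close> a
  Cauchy sequence in L1 even on a space of infinite measure. A subsequence then converges almost
  everywhere, and dividing by \<open>h\<close> gives the limit of \<open>V n\<close> itself.\<close>

lemma L2_complete:
  fixes V :: "nat \<Rightarrow> 'a \<Rightarrow> complex" and h :: "'a \<Rightarrow> real"
  assumes V[measurable]: "\<And>n. V n \<in> borel_measurable M" and iV: "\<And>n. integrable M (\<lambda>x. (norm (V n x))\<^sup>2)"
    and h[measurable]: "h \<in> borel_measurable M" and ih: "integrable M (\<lambda>x. (h x)\<^sup>2)" and h0: "\<And>x. h x > 0"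
    and C: "\<And>e. e > 0 \<Longrightarrow> \<exists>N. \<forall>i\<ge>N. \<forall>j\<ge>N. (\<integral>x. (norm (V i x - V j x))\<^sup>2 \<partial>M) < e"
  obtains W r where "W \<in> borel_measurable M" "integrable M (\<lambda>x. (norm (W x))\<^sup>2)" "(\<lambda>n. \<integral>x. (norm (V n x - W x))\<^sup>2 \<partial>M) \<longlonglongrightarrow> 0"
    "strict_mono (r :: nat \<Rightarrow> nat)" "AE x in M. (\<lambda>i. V (r i) x) \<longlonglongrightarrow> W x"
proof -
  have id: "integrable M (\<lambda>x. (norm (V i x - V j x))\<^sup>2)" for i j
    using integrable_norm_square_add[of "V i" M "\<lambda>x. - V j x"] iV by simp
  have ihV: "integrable M (\<lambda>x. complex_of_real (h x) * V n x)" for n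
  proof -
    have "integrable M (\<lambda>x. h x * norm (V n x))" by (rule integrable_mult_if_squares) (use ih iV in auto)
    then show ?thesis
      by (rule Bochner_Integration.integrable_bound) (auto simp: norm_mult)
  qed
  define A where "A = (\<integral>x. (h x)\<^sup>2 \<partial>M)"
  have A: "A \<ge> 0" unfolding A_def by (intro integral_nonneg_AE) simp
  have L1: "(\<integral>x. norm (complex_of_real (h x) * V i x - complex_of_real (h x) * V j x) \<partial>M)\<^sup>2 \<le> A * (\<integral>x. (norm (V i x - V j x))\<^sup>2 \<partial>M)" for i j
  proof -
    have "(\<lambda>x. norm (complex_of_real (h x) * V i x - complex_of_real (h x) * V j x)) = (\<lambda>x. h x * norm (V i x - V j x))"
      using h0 by (auto simp: norm_mult less_imp_le simp flip: right_diff_distrib)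
    then show ?thesis
      unfolding A_def by (simp, intro Cauchy_Schwarz_integral ih id) auto
  qed
  obtain r where r: "strict_mono r" "AE x in M. Cauchy (\<lambda>i. complex_of_real (h x) * V (r i) x)"
  proof (rule cauchy_L1_AE_cauchy_subseq[of M "\<lambda>n x. complex_of_real (h x) * V n x"])
    show "integrable M (\<lambda>x. complex_of_real (h x) * V n x)" for n by (rule ihV)
    fix e :: real assume e: "e > 0"
    then have "e\<^sup>2 / (A + 1) > 0" using A by simp
    then obtain N where N: "\<And>i j. i \<ge> N \<Longrightarrow> j \<ge> N \<Longrightarrow> (\<integral>x. (norm (V i x - V j x))\<^sup>2 \<partial>M) < e\<^sup>2 / (A + 1)" using C by blast
    show "\<exists>N. \<forall>i\<ge>N. \<forall>j\<ge>N. (\<integral>x. norm (complex_of_real (h x) * V i x - complex_of_real (h x) * V j x) \<partial>M) < e"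
    proof (intro exI allI impI)
      fix i j assume ij: "i \<ge> N" "j \<ge> N"
      have "A * (\<integral>x. (norm (V i x - V j x))\<^sup>2 \<partial>M) \<le> A * (e\<^sup>2 / (A + 1))"
        using N[OF ij] A by (intro mult_left_mono) auto
      also have "\<dots> < e\<^sup>2" using A e by (simp add: field_simps)
      finally show "(\<integral>x. norm (complex_of_real (h x) * V i x - complex_of_real (h x) * V j x) \<partial>M) < e"
        using L1[of i j] e by (meson le_less_trans less_imp_le power2_less_imp_less)
    qed
  qed
  define W where "W x = lim (\<lambda>i. V (r i) x)" for x
  have W[measurable]: "W \<in> borel_measurable M" unfolding W_def by (rule borel_measurable_lim_metric) simp
  have conv: "AE x in M. (\<lambda>i. V (r i) x) \<longlonglongrightarrow> W x"
    using r(2)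
  proof eventually_elim
    case (elim x)
    then have "convergent (\<lambda>i. complex_of_real (h x) * V (r i) x)" by (rule Cauchy_convergent)
    then have "convergent (\<lambda>i. inverse (complex_of_real (h x)) * (complex_of_real (h x) * V (r i) x))"
      by - (rule convergent_mult[OF convergent_const])
    moreover have "(\<lambda>i. inverse (complex_of_real (h x)) * (complex_of_real (h x) * V (r i) x)) = (\<lambda>i. V (r i) x)"
      using h0[of x] by (auto simp: fun_eq_iff)
    ultimately have "convergent (\<lambda>i. V (r i) x)" by (simp only:)
    then show ?case by (simp add: W_def convergent_LIMSEQ_iff)
  qed
  \<comment> \<open>Fatou along the subsequence turns the Cauchy estimate between \<open>V i\<close>
    and \<open>V (r (j + N))\<close> into an estimate between \<open>V i\<close> and
    \<open>W\<close>.\<close>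
  have *: "integrable M (\<lambda>x. (norm (V i x - W x))\<^sup>2) \<and> (\<integral>x. (norm (V i x - W x))\<^sup>2 \<partial>M) \<le> e"
    if N: "\<And>i j. i \<ge> N \<Longrightarrow> j \<ge> N \<Longrightarrow> (\<integral>x. (norm (V i x - V j x))\<^sup>2 \<partial>M) < e" and i: "i \<ge> N" for N i e
  proof -
    have rN: "r (j + N) \<ge> N" for j using seq_suble[OF r(1), of "j + N"] by linarith
    have lim: "AE x in M. (\<lambda>j. (norm (V i x - V (r (j + N)) x))\<^sup>2) \<longlonglongrightarrow> (norm (V i x - W x))\<^sup>2"
      using conv by eventually_elim (intro tendsto_intros LIMSEQ_ignore_initial_segment)
    show ?thesis
      using Fatou_integral_le[OF id _ lim, of "\<lambda>_. e" e] N[OF i rN] by (auto simp: less_imp_le)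
  qed
  show thesis
  proof
    show "W \<in> borel_measurable M" "strict_mono r" "AE x in M. (\<lambda>i. V (r i) x) \<longlonglongrightarrow> W x" by fact+
    obtain N where N: "\<And>i j. i \<ge> N \<Longrightarrow> j \<ge> N \<Longrightarrow> (\<integral>x. (norm (V i x - V j x))\<^sup>2 \<partial>M) < 1" using C[of 1] by auto
    have "integrable M (\<lambda>x. (norm (V N x - W x))\<^sup>2)" using *[OF N] by auto
    then have "integrable M (\<lambda>x. (norm (V N x + (W x - V N x)))\<^sup>2)"
      by (intro integrable_norm_square_add iV) (auto simp: norm_minus_commute)
    then show "integrable M (\<lambda>x. (norm (W x))\<^sup>2)" by simp
    show "(\<lambda>n. \<integral>x. (norm (V n x - W x))\<^sup>2 \<partial>M) \<longlonglongrightarrow> 0"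
    proof (rule LIMSEQ_I)
      fix e :: real assume e: "e > 0"
      then obtain N where N: "\<And>i j. i \<ge> N \<Longrightarrow> j \<ge> N \<Longrightarrow> (\<integral>x. (norm (V i x - V j x))\<^sup>2 \<partial>M) < e / 2" using C[of "e/2"] by auto
      have "norm ((\<integral>x. (norm (V n x - W x))\<^sup>2 \<partial>M) - 0) < e" if n: "n \<ge> N" for n
      proof -
        have "0 \<le> (\<integral>x. (norm (V n x - W x))\<^sup>2 \<partial>M)" by (intro integral_nonneg_AE) simp
        moreover have "(\<integral>x. (norm (V n x - W x))\<^sup>2 \<partial>M) \<le> e / 2" using *[of N "e/2" n] N n by blast
        ultimately show ?thesis using e by simp
      qed
      then show "\<exists>N. \<forall>n\<ge>N. norm ((\<integral>x. (norm (V n x - W x))\<^sup>2 \<partial>M) - 0) < e" by blast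
    qed
  qed
qed

text \<open>Convergence of the derivatives in L2 gives convergence of their integrals over every
  bounded interval, by Cauchy-Schwarz, so the primitive relation passes to the pointwise
  limit.\<close>

lemma H1_pair_limit:
  assumes l: "l > 0" and H: "\<And>n. H1_pair l (f n) (V n)"
    and lim: "\<And>x. (\<lambda>n. f n (grid_point l x)) \<longlonglongrightarrow> \<psi> (grid_point l x)"
    and i\<psi>: "integrable grid_measure (\<lambda>x. (norm (\<psi> (grid_point l x)))\<^sup>2)"
    and W: "W \<in> borel_measurable grid_measure" "integrable grid_measure (\<lambda>x. (norm (W x))\<^sup>2)"
    and L: "(\<lambda>n. \<integral>x. (norm (V n x - W x))\<^sup>2 \<partial>grid_measure) \<longlonglongrightarrow> 0"
  shows "H1_pair l \<psi> W"
  unfolding H1_pair_def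
proof (intro conjI allI)
  fix i :: grid_line_index
  note Wm[measurable] = borel_measurable_grid_section[OF W(1), of i]
  have iW: "integrable lborel (\<lambda>t. (norm (W (i, t)))\<^sup>2)" using integrable_grid_line[OF W(2), of i] .
  have iI: "integrable lborel (\<lambda>t. (indicator {a..b} t)\<^sup>2 :: real)" for a b :: real
  proof -
    have "(\<lambda>t. (indicator {a..b} t)\<^sup>2) = (indicator {a..b} :: real \<Rightarrow> real)" by (auto simp: indicator_def)
    then show ?thesis by (simp only:) (intro integrable_real_indicator, auto simp: emeasure_lborel_Icc_eq)
  qed
  have sW: "set_integrable lborel {a..b} (\<lambda>t. W (i, t))" for a b
    unfolding set_integrable_def
  proof (rule Bochner_Integration.integrable_bound)
    show "integrable lborel (\<lambda>t. indicator {a..b} t * norm (W (i, t)))"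
      by (rule integrable_mult_if_squares) (use iW iI in auto)
  qed auto
  show "is_primitive (\<lambda>t. \<psi> (grid_point l (i, t))) (\<lambda>t. W (i, t))"
    unfolding is_primitive_def
  proof (intro conjI allI impI Wm sW)
    fix a b :: real assume ab: "a \<le> b"
    define D where "D n = (\<integral>x. (norm (V n x - W x))\<^sup>2 \<partial>grid_measure)" for n
    have iD: "integrable grid_measure (\<lambda>x. (norm (V n x - W x))\<^sup>2)" for n
      using integrable_norm_square_add[of "V n" grid_measure "\<lambda>x. - W x"] H1_pairD(3,5)[OF H[of n]] W by simp
    have bound: "norm ((LINT t:{a..b}|lborel. V n (i, t)) - (LINT t:{a..b}|lborel. W (i, t))) \<le> sqrt ((b - a) * D n)" for n
    proof -
      note [measurable] = is_primitiveD(1)[OF H1_pairD(1)[OF H[of n], of i]]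
      note sV = is_primitiveD(2)[OF H1_pairD(1)[OF H[of n], of i]]
      have "norm ((LINT t:{a..b}|lborel. V n (i, t)) - (LINT t:{a..b}|lborel. W (i, t))) = norm (LINT t:{a..b}|lborel. V n (i, t) - W (i, t))"
        by (simp add: set_integral_diff(2)[OF sV sW])
      also have "\<dots> \<le> (LINT t:{a..b}|lborel. norm (V n (i, t) - W (i, t)))"
        by (rule set_integral_norm_bound) (intro set_integral_diff(1) sV sW)
      also have "\<dots> \<le> sqrt ((b - a) * D n)"
      proof (rule real_le_rsqrt)
        have "(LINT t:{a..b}|lborel. norm (V n (i, t) - W (i, t)))\<^sup>2 = (\<integral>t. indicator {a..b} t * norm (V n (i, t) - W (i, t)) \<partial>lborel)\<^sup>2"
          by (simp add: set_lebesgue_integral_def)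
        also have "\<dots> \<le> (\<integral>t. (indicator {a..b} t)\<^sup>2 \<partial>lborel) * (\<integral>t. (norm (V n (i, t) - W (i, t)))\<^sup>2 \<partial>lborel)"
          by (intro Cauchy_Schwarz_integral iI integrable_grid_line[OF iD]) measurable
        also have "(\<integral>t. (indicator {a..b} t)\<^sup>2 \<partial>lborel) = b - a"
        proof -
          have "(\<lambda>t. (indicator {a..b} t)\<^sup>2) = (indicator {a..b} :: real \<Rightarrow> real)" by (auto simp: indicator_def)
          then show ?thesis using ab by simp
        qed
        also have "(b - a) * (\<integral>t. (norm (V n (i, t) - W (i, t)))\<^sup>2 \<partial>lborel) \<le> (b - a) * D n"
          unfolding D_def using ab by (intro mult_left_mono integral_grid_line_le[OF iD]) auto
        finally show "(LINT t:{a..b}|lborel. norm (V n (i, t) - W (i, t)))\<^sup>2 \<le> (b - a) * D n" .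
      qed
      finally show ?thesis .
    qed
    have "(\<lambda>n. sqrt ((b - a) * D n)) \<longlonglongrightarrow> sqrt ((b - a) * 0)"
      using L unfolding D_def by (intro tendsto_intros)
    then have "(\<lambda>n. (LINT t:{a..b}|lborel. V n (i, t)) - (LINT t:{a..b}|lborel. W (i, t))) \<longlonglongrightarrow> 0"
      using bound by (intro Lim_null_comparison[OF always_eventually[OF allI[OF bound]]]) simp
    then have "(\<lambda>n. LINT t:{a..b}|lborel. V n (i, t)) \<longlonglongrightarrow> (LINT t:{a..b}|lborel. W (i, t))"
      by (simp add: LIM_zero_iff)
    moreover have "(\<lambda>n. f n (grid_point l (i, b)) - f n (grid_point l (i, a))) \<longlonglongrightarrow> \<psi> (grid_point l (i, b)) - \<psi> (grid_point l (i, a))"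
      by (intro tendsto_intros lim)
    moreover have "(\<lambda>n. f n (grid_point l (i, b)) - f n (grid_point l (i, a))) = (\<lambda>n. LINT t:{a..b}|lborel. V n (i, t))"
      by (rule ext) (rule is_primitiveD(3)[OF H1_pairD(1)[OF H] ab])
    ultimately show "\<psi> (grid_point l (i, b)) - \<psi> (grid_point l (i, a)) = (LINT t:{a..b}|lborel. W (i, t))"
      by (simp only:) (rule LIMSEQ_unique)
  qed
qed (use i\<psi> W in auto)

lemma mass_of_pos_if_nonzero:
  assumes c: "continuous_on UNIV (\<lambda>t. \<psi> (grid_point l (i, t)))" and nz: "\<psi> (grid_point l (i, t0)) \<noteq> 0"
    and int: "integrable grid_measure (\<lambda>x. (norm (\<psi> (grid_point l x)))\<^sup>2)"
  shows "mass_of l \<psi> > 0"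
proof -
  define g where "g t = (norm (\<psi> (grid_point l (i, t))))\<^sup>2" for t
  have cg: "continuous_on UNIV g" unfolding g_def by (intro continuous_intros c)
  have g0: "g t0 > 0" using nz by (simp add: g_def)
  have "isCont g t0" using cg by (simp add: continuous_on_eq_continuous_at)
  then obtain d where d: "d > 0" "\<And>t. dist t t0 < d \<Longrightarrow> dist (g t) (g t0) < g t0 / 2"
    using g0 unfolding continuous_at_eps_delta by (metis half_gt_zero)
  have "g t0 / 2 * d = (\<integral>t. g t0 / 2 * indicator {t0 - d/2..t0 + d/2} t \<partial>lborel)" using d by simp
  also have "\<dots> \<le> (\<integral>t. g t \<partial>lborel)"
  proof (intro integral_mono)
    show "integrable lborel g" unfolding g_def by (rule integrable_grid_line[OF int])
    show "g t0 / 2 * indicator {t0 - d/2..t0 + d/2} t \<le> g t" for t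
    proof (cases "t \<in> {t0 - d/2..t0 + d/2}")
      case True
      then have "dist t t0 < d" using d by (auto simp: dist_real_def)
      then have "\<bar>g t - g t0\<bar> < g t0 / 2" using d(2)[of t] by (simp add: dist_real_def)
      then have "g t0 / 2 \<le> g t" by linarith
      then show ?thesis using True by simp
    qed (simp add: g_def)
  qed (auto intro!: integrable_mult_right integrable_real_indicator simp: emeasure_lborel_Icc_eq)
  also have "\<dots> \<le> mass_of l \<psi>" unfolding g_def mass_of_def by (rule integral_grid_line_le[OF int]) simp
  finally show ?thesis using g0 d by (meson half_gt_zero less_le_trans mult_pos_pos)
qed

text \<open>If the conclusion failed, each of the two summands on the right would be less than
  \<open>x / 2\<close>.\<close>

lemma powr_bootstrap:
  fixes a c x \<theta> :: real
  assumes "x \<le> a + c * x powr \<theta>" "0 \<le> x" "0 \<le> a" "0 < c" "0 < \<theta>" "\<theta> < 1"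
  shows "x \<le> max (2 * a) ((2 * c) powr (1 / (1 - \<theta>)))"
proof (rule ccontr)
  assume "\<not> ?thesis"
  then have x: "x > 2 * a" "x > (2 * c) powr (1 / (1 - \<theta>))" by auto
  then have x0: "x > 0" using assms by linarith
  have "((2 * c) powr (1 / (1 - \<theta>))) powr (1 - \<theta>) < x powr (1 - \<theta>)"
    using x assms by (intro powr_less_mono2) auto
  then have "2 * c < x powr (1 - \<theta>)" using assms by (simp add: powr_powr)
  then have "2 * c * x powr \<theta> < x powr (1 - \<theta>) * x powr \<theta>" using x0 by (intro mult_strict_right_mono) auto
  also have "\<dots> = x" using x0 by (simp flip: powr_add)
  finally show False using assms(1) x(1) by linarith
qed

text \<open>The place where \<open>p < 6\<close> excludes concentration: the power term grows like
  the kinetic term to the power \<open>(p - 2) / 4 < 1\<close>, so it cannot compensate a large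
  kinetic term.\<close>

lemma kinetic_bounded_by_energy:
  assumes p: "2 < p" "p < 6" and \<mu>: "\<mu> > 0"
  obtains K where "\<And>\<psi> V. H1_pair l \<psi> V \<Longrightarrow> mass_of l \<psi> \<le> \<mu> \<Longrightarrow> energy_of l p \<psi> V \<le> e \<Longrightarrow> kinetic V \<le> K"
proof -
  define \<theta> where "\<theta> = (p - 2) / 4"
  define c where "c = 2 / p * (\<mu> powr \<theta> * \<mu>)"
  have th: "0 < \<theta>" "\<theta> < 1" using p by (auto simp: \<theta>_def)
  have c: "c > 0" using p \<mu> by (simp add: c_def)
  show thesis
  proof
    fix \<psi> V assume H: "H1_pair l \<psi> V" and m: "mass_of l \<psi> \<le> \<mu>" and E: "energy_of l p \<psi> V \<le> e"
    have "power_of l p \<psi> \<le> (mass_of l \<psi> * kinetic V) powr \<theta> * mass_of l \<psi>"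
      unfolding \<theta>_def by (rule power_of_le_mass_kinetic[OF H]) (use p in auto)
    also have "\<dots> \<le> (\<mu> * kinetic V) powr \<theta> * \<mu>"
      using m th by (intro mult_mono powr_mono2 mult_right_mono) auto
    also have "\<dots> = \<mu> powr \<theta> * \<mu> * kinetic V powr \<theta>" using \<mu> by (simp add: powr_mult)
    finally have S: "power_of l p \<psi> \<le> \<mu> powr \<theta> * \<mu> * kinetic V powr \<theta>" .
    have "kinetic V = 2 * energy_of l p \<psi> V + 2 / p * power_of l p \<psi>" by (simp add: energy_of_def algebra_simps)
    also have "\<dots> \<le> 2 * \<bar>e\<bar> + 2 / p * (\<mu> powr \<theta> * \<mu> * kinetic V powr \<theta>)"
      using E S p by (intro add_mono mult_left_mono) auto
    also have "\<dots> = 2 * \<bar>e\<bar> + c * kinetic V powr \<theta>" by (simp add: c_def)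
    finally show "kinetic V \<le> max (2 * (2 * \<bar>e\<bar>)) ((2 * c) powr (1 / (1 - \<theta>)))"
      by (rule powr_bootstrap) (use c th in auto)
  qed
qed

section \<open>Compactness of minimising sequences\<close>

context
  fixes l p \<mu> I :: real and g :: "nat \<Rightarrow> real ^ 3 \<Rightarrow> complex" and U :: "nat \<Rightarrow> grid_line_index \<times> real \<Rightarrow> complex"
    and \<psi> :: "real ^ 3 \<Rightarrow> complex" and B Ks :: real
  assumes l: "l > 0" and p: "2 < p" "p < 6" and \<mu>: "\<mu> > 0" and I: "I \<le> 0"
    and inf: "\<And>\<phi> W. H1_pair l \<phi> W \<Longrightarrow> mass_of l \<phi> = \<mu> \<Longrightarrow> I \<le> energy_of l p \<phi> W"
    and H: "\<And>n. H1_pair l (g n) (U n)" and mass: "\<And>n. mass_of l (g n) = \<mu>"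
    and E: "(\<lambda>n. energy_of l p (g n) (U n)) \<longlonglongrightarrow> I" and K: "(\<lambda>n. kinetic (U n)) \<longlonglongrightarrow> Ks"
    and B: "\<And>n x. norm (g n (grid_point l x)) \<le> B"
    and lim: "\<And>x. (\<lambda>n. g n (grid_point l x)) \<longlonglongrightarrow> \<psi> (grid_point l x)"
    and nz: "mass_of l \<psi> > 0"
begin

lemma limit_measurable: "(\<lambda>x. \<psi> (grid_point l x)) \<in> borel_measurable grid_measure"
  by (rule borel_measurable_LIMSEQ_metric[OF H1_pairD(4)[OF H]]) (rule lim)

lemma limit_norm_le: "norm (\<psi> (grid_point l x)) \<le> B"
  by (rule LIMSEQ_le_const2[OF tendsto_norm[OF lim]]) (use B in auto)

lemma limit_integrable: "integrable grid_measure (\<lambda>x. (norm (\<psi> (grid_point l x)))\<^sup>2)"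
  and psi_mass_le: "mass_of l \<psi> \<le> \<mu>"
proof -
  have 1: "AE x in grid_measure. (\<lambda>n. (norm (g n (grid_point l x)))\<^sup>2) \<longlonglongrightarrow> (norm (\<psi> (grid_point l x)))\<^sup>2"
    by (intro AE_I2 tendsto_intros lim)
  have 2: "(\<lambda>x. (norm (\<psi> (grid_point l x)))\<^sup>2) \<in> borel_measurable grid_measure"
    using limit_measurable by measurable
  have 3: "(\<integral>x. (norm (g n (grid_point l x)))\<^sup>2 \<partial>grid_measure) \<le> \<mu>" for n
    using mass[of n] by (simp add: mass_of_def)
  note F = Fatou_integral_le[OF H1_pairD(2)[OF H] _ 1 2 3 tendsto_const]
  show "integrable grid_measure (\<lambda>x. (norm (\<psi> (grid_point l x)))\<^sup>2)" using F(1) by simp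
  show "mass_of l \<psi> \<le> \<mu>" using F(2) by (simp add: mass_of_def)
qed

lemma limit_power_integrable: "integrable grid_measure (\<lambda>x. norm (\<psi> (grid_point l x)) powr p)"
proof (rule Bochner_Integration.integrable_bound)
  show "integrable grid_measure (\<lambda>x. B powr (p - 2) * (norm (\<psi> (grid_point l x)))\<^sup>2)"
    using limit_integrable by simp
  show "AE x in grid_measure. norm (norm (\<psi> (grid_point l x)) powr p) \<le> norm (B powr (p - 2) * (norm (\<psi> (grid_point l x)))\<^sup>2)"
    using norm_powr_le[OF limit_norm_le, of 2 p] p by (simp add: norm_powr_2)
qed (use limit_measurable in measurable)

lemma limit_power_pos: "power_of l p \<psi> > 0"
  by (rule power_of_pos_if_integrable[OF limit_measurable limit_power_integrable nz])

text \<open>The piece near the origin obeys the scaling estimate with its gain, the far piece the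
  proportional bound without one. Every term left over carries a factor dominated by the integrable
  \<open>h\<close>, so it converges although mass might escape to infinity.\<close>

lemma localised_inequality:
  assumes e: "\<epsilon> > 0"
  defines "\<eta> \<equiv> \<lambda>x. sin (loc_angle \<epsilon> x) *\<^sub>R \<psi> x"
  shows "mass_of l \<eta> > 0"
    "((\<mu> / mass_of l \<eta>) powr ((p - 2) / 2) - 1) / p * power_of l p \<eta>
      \<le> (pi / 2 * \<epsilon>)\<^sup>2 / 2 * \<mu> + 1 / p * (\<integral>x. loc_defect p \<epsilon> (grid_point l x) * norm (\<psi> (grid_point l x)) powr p \<partial>grid_measure)"
proof -
  note [measurable] = limit_measurable loc_angle_measurable[OF l e] H1_pairD(4)[OF H]
  have e0: "\<epsilon> \<ge> 0" using e by simp
  define h where "h x = pi / 2 * exp (- \<epsilon> * l1_norm3 (grid_point l x))" for x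
  have ih: "integrable grid_measure h" unfolding h_def using integrable_exp_decay[OF l e] by simp
  have h: "sin (loc_angle \<epsilon> (grid_point l x)) \<le> h x" "0 < sin (loc_angle \<epsilon> (grid_point l x))" "sin (loc_angle \<epsilon> (grid_point l x)) \<le> 1" for x
    using loc_angle_sin_cos[OF e0, of "grid_point l x"] by (simp_all add: h_def)
  define \<eta>n where "\<eta>n n = (\<lambda>x. sin (loc_angle \<epsilon> x) *\<^sub>R g n x)" for n
  have sq: "(norm (sin (loc_angle \<epsilon> (grid_point l x)) *\<^sub>R z))\<^sup>2 \<le> h x * B\<^sup>2" if "norm z \<le> B" for x and z :: complex
  proof -
    have "(norm (sin (loc_angle \<epsilon> (grid_point l x)) *\<^sub>R z))\<^sup>2 = (sin (loc_angle \<epsilon> (grid_point l x)))\<^sup>2 * (norm z)\<^sup>2"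
      by (simp add: power_mult_distrib)
    also have "\<dots> \<le> sin (loc_angle \<epsilon> (grid_point l x)) * B\<^sup>2"
      using h(2,3)[of x] that by (intro mult_mono power_mono) (auto simp: power2_eq_square mult_left_le)
    also have "\<dots> \<le> h x * B\<^sup>2" using h(1) by (intro mult_right_mono) auto
    finally show ?thesis .
  qed
  have pw: "norm (sin (loc_angle \<epsilon> (grid_point l x)) *\<^sub>R z) powr p \<le> h x * B powr p" if "norm z \<le> B" for x and z :: complex
  proof -
    have "norm (sin (loc_angle \<epsilon> (grid_point l x)) *\<^sub>R z) powr p = sin (loc_angle \<epsilon> (grid_point l x)) powr p * norm z powr p"
      using h(2)[of x] by (simp add: powr_mult)
    also have "\<dots> \<le> sin (loc_angle \<epsilon> (grid_point l x)) powr 1 * B powr p"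
      using h(2,3)[of x] that p by (intro mult_mono powr_mono' powr_mono2) auto
    also have "\<dots> \<le> h x * B powr p" using h(1,2)[of x] by (intro mult_right_mono) auto
    finally show ?thesis .
  qed
  have m_lim: "(\<lambda>n. mass_of l (\<eta>n n)) \<longlonglongrightarrow> mass_of l \<eta>"
    unfolding mass_of_def \<eta>n_def \<eta>_def
  proof (rule integral_dominated_convergence)
    show "integrable grid_measure (\<lambda>x. h x * B\<^sup>2)" using ih by simp
    show "AE x in grid_measure. (\<lambda>n. (norm (sin (loc_angle \<epsilon> (grid_point l x)) *\<^sub>R g n (grid_point l x)))\<^sup>2) \<longlonglongrightarrow> (norm (sin (loc_angle \<epsilon> (grid_point l x)) *\<^sub>R \<psi> (grid_point l x)))\<^sup>2"
      by (intro AE_I2 tendsto_intros lim)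
    show "AE x in grid_measure. norm ((norm (sin (loc_angle \<epsilon> (grid_point l x)) *\<^sub>R g n (grid_point l x)))\<^sup>2) \<le> h x * B\<^sup>2" for n
      using sq[OF B] by (intro AE_I2) simp
  qed measurable
  have S_lim: "(\<lambda>n. power_of l p (\<eta>n n)) \<longlonglongrightarrow> power_of l p \<eta>"
    unfolding power_of_def \<eta>n_def \<eta>_def
  proof (rule integral_dominated_convergence)
    show "integrable grid_measure (\<lambda>x. h x * B powr p)" using ih by simp
    show "AE x in grid_measure. (\<lambda>n. norm (sin (loc_angle \<epsilon> (grid_point l x)) *\<^sub>R g n (grid_point l x)) powr p) \<longlonglongrightarrow> norm (sin (loc_angle \<epsilon> (grid_point l x)) *\<^sub>R \<psi> (grid_point l x)) powr p"
      using p by (intro AE_I2 tendsto_powr' tendsto_norm tendsto_scaleR tendsto_const lim) auto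
    show "AE x in grid_measure. norm (norm (sin (loc_angle \<epsilon> (grid_point l x)) *\<^sub>R g n (grid_point l x)) powr p) \<le> h x * B powr p" for n
      using pw[OF B] by (intro AE_I2) simp
  qed measurable
  have defect: "0 \<le> loc_defect p \<epsilon> (grid_point l x)" "loc_defect p \<epsilon> (grid_point l x) \<le> 3 * h x" for x
    using loc_defect_bounds[of p \<epsilon> "grid_point l x"] p e0 h(1)[of x] by auto
  have [measurable]: "(\<lambda>x. loc_defect p \<epsilon> (grid_point l x)) \<in> borel_measurable grid_measure"
    unfolding loc_defect_def by measurable
  define D where "D n = (\<integral>x. loc_defect p \<epsilon> (grid_point l x) * norm (g n (grid_point l x)) powr p \<partial>grid_measure)" for n
  define Dl where "Dl = (\<integral>x. loc_defect p \<epsilon> (grid_point l x) * norm (\<psi> (grid_point l x)) powr p \<partial>grid_measure)"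
  have D_lim: "D \<longlonglongrightarrow> Dl" unfolding D_def[abs_def] Dl_def
  proof (rule integral_dominated_convergence)
    show "integrable grid_measure (\<lambda>x. 3 * h x * B powr p)" using ih by simp
    show "AE x in grid_measure. (\<lambda>n. loc_defect p \<epsilon> (grid_point l x) * norm (g n (grid_point l x)) powr p) \<longlonglongrightarrow> loc_defect p \<epsilon> (grid_point l x) * norm (\<psi> (grid_point l x)) powr p"
      using p by (intro AE_I2 tendsto_mult tendsto_powr' tendsto_norm tendsto_const lim) auto
    have "loc_defect p \<epsilon> (grid_point l x) * norm (g n (grid_point l x)) powr p \<le> 3 * h x * B powr p" for n x
      using defect[of x] B[of n x] p order_trans[OF defect] by (intro mult_mono powr_mono2) auto
    then show "AE x in grid_measure. norm (loc_defect p \<epsilon> (grid_point l x) * norm (g n (grid_point l x)) powr p) \<le> 3 * h x * B powr p" for n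
      using defect(1) by (intro AE_I2) (simp add: abs_mult)
  qed measurable
  have sin_nz: "sin (loc_angle \<epsilon> (grid_point l x)) \<noteq> 0" for x using h(2)[of x] by simp
  show pos: "mass_of l \<eta> > 0"
  proof (rule ccontr)
    assume "\<not> mass_of l \<eta> > 0"
    then have z: "mass_of l \<eta> = 0" using mass_of_nonneg[of l \<eta>] by linarith
    have "integrable grid_measure (\<lambda>x. (norm (\<eta> (grid_point l x)))\<^sup>2)"
    proof (rule Bochner_Integration.integrable_bound)
      show "integrable grid_measure (\<lambda>x. h x * B\<^sup>2)" using ih by simp
      have "norm ((norm (\<eta> (grid_point l x)))\<^sup>2) \<le> norm (h x * B\<^sup>2)" for x
      proof -
        have "(norm (\<eta> (grid_point l x)))\<^sup>2 \<le> h x * B\<^sup>2" unfolding \<eta>_def by (rule sq[OF limit_norm_le])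
        then show ?thesis using zero_le_power2[of "norm (\<eta> (grid_point l x))"] unfolding real_norm_def by linarith
      qed
      then show "AE x in grid_measure. norm ((norm (\<eta> (grid_point l x)))\<^sup>2) \<le> norm (h x * B\<^sup>2)" by simp
    qed (simp add: \<eta>_def)
    then have "AE x in grid_measure. (norm (\<eta> (grid_point l x)))\<^sup>2 = 0"
      using z integral_nonneg_eq_0_iff_AE[of grid_measure "\<lambda>x. (norm (\<eta> (grid_point l x)))\<^sup>2"] by (simp add: mass_of_def)
    then have "AE x in grid_measure. (norm (\<psi> (grid_point l x)))\<^sup>2 = 0"
      by eventually_elim (use sin_nz in \<open>simp add: \<eta>_def\<close>)
    then have "mass_of l \<psi> = (\<integral>x. 0 \<partial>(grid_measure :: (grid_line_index \<times> real) measure))"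
      unfolding mass_of_def by (intro integral_cong_AE) auto
    then show False using nz by simp
  qed
  \<comment> \<open>The two proportional parts of \<open>I\<close> add up to exactly
    \<open>I\<close>, because the masses of the pieces add up to \<open>\<mu>\<close>; in the limit
    this \<open>I\<close> cancels against the limit of the energies.\<close>
  have ineq: "I + ((\<mu> / mass_of l (\<eta>n n)) powr ((p - 2) / 2) - 1) / p * power_of l p (\<eta>n n)
     \<le> energy_of l p (g n) (U n) + (pi / 2 * \<epsilon>)\<^sup>2 / 2 * \<mu> + 1 / p * D n" for n
  proof -
    obtain W1 W2 where W: "H1_pair l (\<eta>n n) W1" "H1_pair l (\<lambda>x. cos (loc_angle \<epsilon> x) *\<^sub>R g n x) W2"
      "mass_of l (\<eta>n n) + mass_of l (\<lambda>x. cos (loc_angle \<epsilon> x) *\<^sub>R g n x) = mass_of l (g n)"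
      "energy_of l p (\<eta>n n) W1 + energy_of l p (\<lambda>x. cos (loc_angle \<epsilon> x) *\<^sub>R g n x) W2
      \<le> energy_of l p (g n) (U n) + (pi / 2 * \<epsilon>)\<^sup>2 / 2 * mass_of l (g n) + 1 / p * D n"
      unfolding \<eta>n_def D_def using localisation[OF l e _ _ H[of n], of p] p by auto
    have m0: "mass_of l (\<eta>n n) > 0"
    proof (rule ccontr)
      assume "\<not> mass_of l (\<eta>n n) > 0"
      then have "mass_of l (\<eta>n n) = 0" using mass_of_nonneg[of l "\<eta>n n"] by linarith
      then have z: "\<eta>n n (grid_point l x) = 0" for x using mass_of_eq_0_iff[OF W(1)] by blast
      have "g n (grid_point l x) = 0" for x using z[of x] sin_nz[of x] by (simp add: \<eta>n_def)
      then have "mass_of l (g n) = 0" using mass_of_eq_0_iff[OF H[of n]] by blast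
      then show False using mass[of n] \<mu> by simp
    qed
    have 1: "mass_of l (\<eta>n n) / \<mu> * I + ((\<mu> / mass_of l (\<eta>n n)) powr ((p - 2) / 2) - 1) / p * power_of l p (\<eta>n n) \<le> energy_of l p (\<eta>n n) W1"
      by (rule energy_scale_up[OF p(1) \<mu> inf W(1) m0])
    have le: "mass_of l (\<lambda>x. cos (loc_angle \<epsilon> x) *\<^sub>R g n x) \<le> \<mu>" using W(3) m0 mass[of n] by linarith
    have 2: "mass_of l (\<lambda>x. cos (loc_angle \<epsilon> x) *\<^sub>R g n x) / \<mu> * I \<le> energy_of l p (\<lambda>x. cos (loc_angle \<epsilon> x) *\<^sub>R g n x) W2"
      by (rule energy_ge_proportion[OF p(1) \<mu> inf W(2) le])
    have "mass_of l (\<eta>n n) / \<mu> * I + mass_of l (\<lambda>x. cos (loc_angle \<epsilon> x) *\<^sub>R g n x) / \<mu> * I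
      = (mass_of l (\<eta>n n) + mass_of l (\<lambda>x. cos (loc_angle \<epsilon> x) *\<^sub>R g n x)) / \<mu> * I"
      by (simp only: add_divide_distrib distrib_right)
    also have "\<dots> = I" unfolding W(3) mass using \<mu> by simp
    finally show ?thesis using 1 2 W(4) unfolding mass by linarith
  qed
  have L: "(\<lambda>n. I + ((\<mu> / mass_of l (\<eta>n n)) powr ((p - 2) / 2) - 1) / p * power_of l p (\<eta>n n)) \<longlonglongrightarrow>
      I + ((\<mu> / mass_of l \<eta>) powr ((p - 2) / 2) - 1) / p * power_of l p \<eta>"
    using p \<mu> pos by (intro tendsto_intros m_lim S_lim) auto
  have R: "(\<lambda>n. energy_of l p (g n) (U n) + (pi / 2 * \<epsilon>)\<^sup>2 / 2 * \<mu> + 1 / p * D n) \<longlonglongrightarrow> I + (pi / 2 * \<epsilon>)\<^sup>2 / 2 * \<mu> + 1 / p * Dl"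
    by (intro tendsto_intros E D_lim)
  have "I + ((\<mu> / mass_of l \<eta>) powr ((p - 2) / 2) - 1) / p * power_of l p \<eta> \<le> I + (pi / 2 * \<epsilon>)\<^sup>2 / 2 * \<mu> + 1 / p * Dl"
    by (rule LIMSEQ_le[OF L R]) (use ineq in auto)
  then show "((\<mu> / mass_of l \<eta>) powr ((p - 2) / 2) - 1) / p * power_of l p \<eta>
      \<le> (pi / 2 * \<epsilon>)\<^sup>2 / 2 * \<mu> + 1 / p * (\<integral>x. loc_defect p \<epsilon> (grid_point l x) * norm (\<psi> (grid_point l x)) powr p \<partial>grid_measure)"
    unfolding Dl_def by linarith
qed

text \<open>As \<open>\<epsilon>\<close> tends to 0 the localised function tends to
  \<open>\<psi>\<close> and the error terms to 0. The gain from scaling \<open>\<psi>\<close> up to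
  mass \<open>\<mu>\<close> is then at most 0, which is possible only if nothing has to be
  scaled.\<close>

lemma limit_full_mass: "mass_of l \<psi> = \<mu>"
proof -
  define \<epsilon> where "\<epsilon> n = 1 / (real n + 1)" for n
  have e: "\<epsilon> n > 0" for n by (simp add: \<epsilon>_def)
  have e_lim: "\<epsilon> \<longlonglongrightarrow> 0" unfolding \<epsilon>_def[abs_def] by real_asymp
  note [measurable] = limit_measurable loc_angle_measurable[OF l e]
  define \<eta> where "\<eta> n = (\<lambda>x. sin (loc_angle (\<epsilon> n) x) *\<^sub>R \<psi> x)" for n
  have ang: "(\<lambda>n. loc_angle (\<epsilon> n) x) \<longlonglongrightarrow> pi / 2" for x
  proof -
    have "(\<lambda>n. pi / 2 * exp (- \<epsilon> n * l1_norm3 x)) \<longlonglongrightarrow> pi / 2 * exp (- 0 * l1_norm3 x)"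
      by (intro tendsto_intros e_lim)
    then show ?thesis by (simp add: loc_angle_def)
  qed
  have sin_lim: "(\<lambda>n. sin (loc_angle (\<epsilon> n) x)) \<longlonglongrightarrow> 1" for x using tendsto_sin[OF ang] by simp
  have cos_lim: "(\<lambda>n. cos (loc_angle (\<epsilon> n) x)) \<longlonglongrightarrow> 0" for x using tendsto_cos[OF ang] by simp
  have sc: "0 \<le> sin (loc_angle (\<epsilon> n) x)" "0 \<le> cos (loc_angle (\<epsilon> n) x)" "sin (loc_angle (\<epsilon> n) x) \<le> 1" for n x
    using loc_angle_sin_cos[of "\<epsilon> n" x] e[of n] by auto
  have def_lim: "(\<lambda>n. loc_defect p (\<epsilon> n) x) \<longlonglongrightarrow> 0" for x
  proof -
    have "(\<lambda>n. 1 - sin (loc_angle (\<epsilon> n) x) powr p - cos (loc_angle (\<epsilon> n) x) powr p) \<longlonglongrightarrow> 1 - 1 powr p - 0 powr p"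
      using p sc by (intro tendsto_diff tendsto_const tendsto_powr' sin_lim cos_lim) auto
    then show ?thesis using p by (simp add: loc_defect_def)
  qed
  have nle: "norm (\<eta> n x) \<le> norm (\<psi> x)" for n x
    using sc[of n x] by (simp add: \<eta>_def mult_left_le_one_le)
  have \<eta>_lim: "(\<lambda>n. norm (\<eta> n x)) \<longlonglongrightarrow> norm (\<psi> x)" for x
    unfolding \<eta>_def using tendsto_norm[OF tendsto_scaleR[OF sin_lim tendsto_const[of "\<psi> x"]]] by simp
  have [measurable]: "(\<lambda>x. \<eta> n (grid_point l x)) \<in> borel_measurable grid_measure" for n
    unfolding \<eta>_def by measurable
  have m_lim: "(\<lambda>n. mass_of l (\<eta> n)) \<longlonglongrightarrow> mass_of l \<psi>"
    unfolding mass_of_def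
  proof (rule integral_dominated_convergence[OF _ _ limit_integrable])
    show "AE x in grid_measure. (\<lambda>n. (norm (\<eta> n (grid_point l x)))\<^sup>2) \<longlonglongrightarrow> (norm (\<psi> (grid_point l x)))\<^sup>2"
      by (intro AE_I2 tendsto_power \<eta>_lim)
    show "AE x in grid_measure. norm ((norm (\<eta> n (grid_point l x)))\<^sup>2) \<le> (norm (\<psi> (grid_point l x)))\<^sup>2" for n
      using nle by (intro AE_I2) (simp add: power_mono)
  qed measurable
  have S_lim: "(\<lambda>n. power_of l p (\<eta> n)) \<longlonglongrightarrow> power_of l p \<psi>"
    unfolding power_of_def
  proof (rule integral_dominated_convergence[OF _ _ limit_power_integrable])
    show "AE x in grid_measure. (\<lambda>n. norm (\<eta> n (grid_point l x)) powr p) \<longlonglongrightarrow> norm (\<psi> (grid_point l x)) powr p"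
      using p by (intro AE_I2 tendsto_powr' \<eta>_lim tendsto_const) auto
    show "AE x in grid_measure. norm (norm (\<eta> n (grid_point l x)) powr p) \<le> norm (\<psi> (grid_point l x)) powr p" for n
      using nle p by (intro AE_I2) (simp add: powr_mono2)
  qed measurable
  define D where "D n = (\<integral>x. loc_defect p (\<epsilon> n) (grid_point l x) * norm (\<psi> (grid_point l x)) powr p \<partial>grid_measure)" for n
  have "D \<longlonglongrightarrow> (\<integral>x. 0 \<partial>(grid_measure :: (grid_line_index \<times> real) measure))"
    unfolding D_def[abs_def]
  proof (rule integral_dominated_convergence[OF _ _ limit_power_integrable])
    show "AE x in grid_measure. (\<lambda>n. loc_defect p (\<epsilon> n) (grid_point l x) * norm (\<psi> (grid_point l x)) powr p) \<longlonglongrightarrow> 0"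
      by (intro AE_I2 tendsto_mult_left_zero def_lim)
    have b: "0 \<le> loc_defect p (\<epsilon> n) x" "loc_defect p (\<epsilon> n) x \<le> 1" for n x
      using loc_defect_bounds[of p "\<epsilon> n" x] p e[of n] by auto
    show "AE x in grid_measure. norm (loc_defect p (\<epsilon> n) (grid_point l x) * norm (\<psi> (grid_point l x)) powr p) \<le> norm (\<psi> (grid_point l x)) powr p" for n
      using b by (intro AE_I2) (simp add: abs_mult mult_left_le_one_le)
    show "(\<lambda>x. loc_defect p (\<epsilon> n) (grid_point l x) * norm (\<psi> (grid_point l x)) powr p) \<in> borel_measurable grid_measure" for n
      unfolding loc_defect_def by measurable
  qed simp
  then have D_lim: "D \<longlonglongrightarrow> 0" by simp
  have L: "(\<lambda>n. ((\<mu> / mass_of l (\<eta> n)) powr ((p - 2) / 2) - 1) / p * power_of l p (\<eta> n)) \<longlonglongrightarrow>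
      ((\<mu> / mass_of l \<psi>) powr ((p - 2) / 2) - 1) / p * power_of l p \<psi>"
    using p \<mu> nz by (intro tendsto_intros m_lim S_lim) auto
  have "(\<lambda>n. (pi / 2 * \<epsilon> n)\<^sup>2 / 2 * \<mu> + 1 / p * D n) \<longlonglongrightarrow> (pi / 2 * 0)\<^sup>2 / 2 * \<mu> + 1 / p * 0"
    by (intro tendsto_intros e_lim D_lim) auto
  then have R: "(\<lambda>n. (pi / 2 * \<epsilon> n)\<^sup>2 / 2 * \<mu> + 1 / p * D n) \<longlonglongrightarrow> 0" by simp
  have "((\<mu> / mass_of l \<psi>) powr ((p - 2) / 2) - 1) / p * power_of l p \<psi> \<le> 0"
    by (rule LIMSEQ_le[OF L R]) (use localised_inequality(2)[OF e] in \<open>auto simp: \<eta>_def D_def\<close>)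
  then have le1: "(\<mu> / mass_of l \<psi>) powr ((p - 2) / 2) \<le> 1"
    using limit_power_pos p by (simp add: divide_le_0_iff mult_le_0_iff)
  have "\<not> \<mu> / mass_of l \<psi> > 1"
  proof
    assume "\<mu> / mass_of l \<psi> > 1"
    then have "1 < (\<mu> / mass_of l \<psi>) powr ((p - 2) / 2)" using p by (intro gr_one_powr) auto
    then show False using le1 by simp
  qed
  then have "\<mu> \<le> mass_of l \<psi>" using nz by (simp add: not_less field_simps)
  then show ?thesis using psi_mass_le by simp
qed

text \<open>Fatou gives the wrong direction for the power itself. It is applied instead to the
  nonnegative difference between \<open>B powr (p - 2)\<close> times the squared modulus and the
  \<open>p\<close>-th power; since no mass is lost, the first part drops out.\<close>

lemma power_limit_le: "p * (Ks / 2 - I) \<le> power_of l p \<psi>"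
proof -
  have S: "power_of l p (g n) = p * (kinetic (U n) / 2 - energy_of l p (g n) (U n))" for n
    using p by (simp add: energy_of_def field_simps)
  have Slim: "(\<lambda>n. power_of l p (g n)) \<longlonglongrightarrow> p * (Ks / 2 - I)"
    unfolding S by (intro tendsto_intros K E) auto
  have ig: "integrable grid_measure (\<lambda>x. norm (g n (grid_point l x)) powr p)" for n
    by (rule integrable_power_of[OF H]) (use p in simp)
  have ih: "integrable grid_measure (\<lambda>x. B powr (p - 2) * (norm (g n (grid_point l x)))\<^sup>2 - norm (g n (grid_point l x)) powr p)" for n
    using ig[of n] H1_pairD(2)[OF H[of n]] by simp
  have nn: "0 \<le> B powr (p - 2) * (norm (g n (grid_point l x)))\<^sup>2 - norm (g n (grid_point l x)) powr p" for n x
    using norm_powr_le[OF B[of n x], of 2 p] p by (simp add: norm_powr_2)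
  have li: "AE x in grid_measure. (\<lambda>n. B powr (p - 2) * (norm (g n (grid_point l x)))\<^sup>2 - norm (g n (grid_point l x)) powr p) \<longlonglongrightarrow>
      B powr (p - 2) * (norm (\<psi> (grid_point l x)))\<^sup>2 - norm (\<psi> (grid_point l x)) powr p"
    using p by (intro AE_I2 tendsto_diff tendsto_mult tendsto_power tendsto_powr' tendsto_norm tendsto_const lim) auto
  have me: "(\<lambda>x. B powr (p - 2) * (norm (\<psi> (grid_point l x)))\<^sup>2 - norm (\<psi> (grid_point l x)) powr p) \<in> borel_measurable grid_measure"
    using limit_measurable by measurable
  have int: "(\<integral>x. B powr (p - 2) * (norm (g n (grid_point l x)))\<^sup>2 - norm (g n (grid_point l x)) powr p \<partial>grid_measure) \<le> B powr (p - 2) * \<mu> - power_of l p (g n)" for n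
    using ig[of n] H1_pairD(2)[OF H[of n]] mass[of n] by (simp add: mass_of_def power_of_def)
  have cl: "(\<lambda>n. B powr (p - 2) * \<mu> - power_of l p (g n)) \<longlonglongrightarrow> B powr (p - 2) * \<mu> - p * (Ks / 2 - I)"
    by (intro tendsto_intros Slim)
  have "(\<integral>x. B powr (p - 2) * (norm (\<psi> (grid_point l x)))\<^sup>2 - norm (\<psi> (grid_point l x)) powr p \<partial>grid_measure) \<le> B powr (p - 2) * \<mu> - p * (Ks / 2 - I)"
    by (rule Fatou_integral_le(2)[OF ih nn li me int cl])
  moreover have "(\<integral>x. B powr (p - 2) * (norm (\<psi> (grid_point l x)))\<^sup>2 - norm (\<psi> (grid_point l x)) powr p \<partial>grid_measure) = B powr (p - 2) * \<mu> - power_of l p \<psi>"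
    using limit_integrable limit_power_integrable limit_full_mass by (simp add: mass_of_def power_of_def)
  ultimately show ?thesis by linarith
qed

lemma mass_of_half_sum_le:
  assumes "H1_pair l a Va" "H1_pair l b Vb" "mass_of l a = \<mu>" "mass_of l b = \<mu>"
  shows "mass_of l (\<lambda>x. (1/2) * (a x + b x)) \<le> \<mu>"
proof -
  note ab = H1_pairD(2)[OF assms(1)] H1_pairD(2)[OF assms(2)]
  note s = H1_pair_scale[OF H1_pair_add[OF assms(1,2)], of "1/2"]
  have "(norm ((1/2) * (x + y)))\<^sup>2 \<le> 1/2 * (norm x)\<^sup>2 + 1/2 * (norm y)\<^sup>2" for x y :: complex
  proof -
    have "(norm (x + y))\<^sup>2 \<le> (norm x + norm y)\<^sup>2" by (intro power_mono norm_triangle_ineq) simp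
    also have "\<dots> \<le> 2 * (norm x)\<^sup>2 + 2 * (norm y)\<^sup>2"
      using sum_squares_bound[of "norm x" "norm y"] by (simp add: power2_sum)
    finally show ?thesis by (simp add: norm_mult power_mult_distrib power2_eq_square)
  qed
  then have "mass_of l (\<lambda>x. (1/2) * (a x + b x)) \<le> (\<integral>x. 1/2 * (norm (a (grid_point l x)))\<^sup>2 + 1/2 * (norm (b (grid_point l x)))\<^sup>2 \<partial>grid_measure)"
    unfolding mass_of_def
    by (intro integral_mono H1_pairD(2)[OF s] Bochner_Integration.integrable_add integrable_mult_right ab)
  also have "\<dots> = \<mu>" using ab assms(3,4) by (simp add: mass_of_def)
  finally show ?thesis .
qed

lemma kinetic_half_sum:
  assumes "H1_pair l a Va" "H1_pair l b Vb"
  shows "kinetic (\<lambda>x. (1/2) * (Va x + Vb x)) = (kinetic Va + kinetic Vb) / 2 - (\<integral>x. (norm (Va x - Vb x))\<^sup>2 \<partial>grid_measure) / 4"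
proof -
  note V = H1_pairD(3,5)[OF assms(1)] H1_pairD(3,5)[OF assms(2)]
  have id: "integrable grid_measure (\<lambda>x. (norm (Va x - Vb x))\<^sup>2)"
    using integrable_norm_square_add[of Va grid_measure "\<lambda>x. - Vb x"] V by simp
  have "(norm ((1/2) * (x + y)))\<^sup>2 = ((norm x)\<^sup>2 + (norm y)\<^sup>2) / 2 - (norm (x - y))\<^sup>2 / 4" for x y :: complex
  proof -
    have "(norm ((1/2) * (x + y)))\<^sup>2 = (norm (x + y))\<^sup>2 / 4" by (simp add: norm_mult power_mult_distrib power2_eq_square)
    also have "(norm (x + y))\<^sup>2 = (norm x)\<^sup>2 + 2 * (x \<bullet> y) + (norm y)\<^sup>2"
      unfolding power2_norm_eq_inner by (simp add: inner_add_left inner_add_right inner_commute)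
    moreover have "(norm (x - y))\<^sup>2 = (norm x)\<^sup>2 - 2 * (x \<bullet> y) + (norm y)\<^sup>2"
      unfolding power2_norm_eq_inner by (simp add: inner_diff_left inner_diff_right inner_commute)
    ultimately show ?thesis by (simp add: field_simps)
  qed
  then have "kinetic (\<lambda>x. (1/2) * (Va x + Vb x)) = (\<integral>x. ((norm (Va x))\<^sup>2 + (norm (Vb x))\<^sup>2) / 2 - (norm (Va x - Vb x))\<^sup>2 / 4 \<partial>grid_measure)"
    by (simp only: kinetic_def)
  then show ?thesis using V id by (simp add: kinetic_def add_divide_distrib)
qed

text \<open>If the derivatives stayed apart, the parallelogram identity would lower the kinetic term
  of midpoints by a fixed amount. Midpoints also converge to \<open>\<psi>\<close> and have energy
  at least \<open>I\<close>, so their power terms, and by Fatou that of \<open>\<psi>\<close>, would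
  fall strictly below the bound of \<open>power_limit_le\<close>.\<close>

lemma derivatives_Cauchy:
  assumes e: "e > 0"
  shows "\<exists>N. \<forall>i\<ge>N. \<forall>j\<ge>N. (\<integral>x. (norm (U i x - U j x))\<^sup>2 \<partial>grid_measure) < e"
proof (rule ccontr)
  assume "\<not> ?thesis"
  then have "\<forall>N. \<exists>i j. i \<ge> N \<and> j \<ge> N \<and> (\<integral>x. (norm (U i x - U j x))\<^sup>2 \<partial>grid_measure) \<ge> e" by (meson not_less)
  then obtain i j where ij: "\<And>N. i N \<ge> N" "\<And>N. j N \<ge> N" "\<And>N. (\<integral>x. (norm (U (i N) x - U (j N) x))\<^sup>2 \<partial>grid_measure) \<ge> e"
    by metis
  have fi: "filterlim i at_top sequentially" and fj: "filterlim j at_top sequentially"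
    using ij by (auto intro!: filterlim_at_top_mono[OF filterlim_ident])
  define w where "w N = (\<lambda>x. (1/2) * (g (i N) x + g (j N) x))" for N
  define W where "W N = (\<lambda>x. (1/2) * (U (i N) x + U (j N) x))" for N
  have HW: "H1_pair l (w N) (W N)" for N unfolding w_def W_def by (rule H1_pair_scale[OF H1_pair_add[OF H H]])
  have Ew: "I \<le> energy_of l p (w N) (W N)" for N
  proof -
    have m: "mass_of l (w N) \<le> \<mu>" unfolding w_def by (rule mass_of_half_sum_le[OF H H mass mass])
    have "mass_of l (w N) / \<mu> * I \<le> energy_of l p (w N) (W N)"
      by (rule energy_ge_proportion[OF p(1) \<mu> inf HW m])
    \<comment> \<open>Midpoints may have mass less than \<open>\<mu>\<close>; as \<open>I\<close> is
      not positive, a proportion of it is still at least \<open>I\<close>.\<close>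
    moreover have "I \<le> mass_of l (w N) / \<mu> * I"
    proof -
      have "mass_of l (w N) / \<mu> \<le> 1" using m \<mu> by simp
      from mult_right_mono_neg[OF this I] show ?thesis by simp
    qed
    ultimately show ?thesis by linarith
  qed
  define c where "c N = p * ((kinetic (U (i N)) + kinetic (U (j N))) / 4 - e / 8 - I)" for N
  have Sw: "power_of l p (w N) \<le> c N" for N
  proof -
    have "kinetic (W N) \<le> (kinetic (U (i N)) + kinetic (U (j N))) / 2 - e / 4"
      unfolding W_def kinetic_half_sum[OF H H] using ij(3)[of N] by simp
    then have "energy_of l p (w N) (W N) \<le> (kinetic (U (i N)) + kinetic (U (j N))) / 4 - e / 8 - power_of l p (w N) / p"
      by (simp add: energy_of_def field_simps)
    then have "power_of l p (w N) / p \<le> (kinetic (U (i N)) + kinetic (U (j N))) / 4 - e / 8 - I" using Ew[of N] by linarith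
    then show ?thesis using p by (simp add: c_def pos_divide_le_eq mult.commute)
  qed
  have c_lim: "c \<longlonglongrightarrow> p * ((Ks + Ks) / 4 - e / 8 - I)" unfolding c_def[abs_def]
    by (intro tendsto_intros filterlim_compose[OF K fi] filterlim_compose[OF K fj]) auto
  have w_lim: "(\<lambda>N. w N (grid_point l x)) \<longlonglongrightarrow> \<psi> (grid_point l x)" for x
  proof -
    have "(\<lambda>N. w N (grid_point l x)) \<longlonglongrightarrow> (1/2) * (\<psi> (grid_point l x) + \<psi> (grid_point l x))"
      unfolding w_def by (intro tendsto_intros filterlim_compose[OF lim fi] filterlim_compose[OF lim fj])
    then show ?thesis by simp
  qed
  have li: "AE x in grid_measure. (\<lambda>N. norm (w N (grid_point l x)) powr p) \<longlonglongrightarrow> norm (\<psi> (grid_point l x)) powr p"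
    using p by (intro AE_I2 tendsto_powr' tendsto_norm tendsto_const w_lim) auto
  have "power_of l p \<psi> \<le> p * ((Ks + Ks) / 4 - e / 8 - I)"
    unfolding power_of_def
    by (rule Fatou_integral_le(2)[OF integrable_power_of[OF HW] _ li _ Sw[unfolded power_of_def] c_lim])
      (use p limit_measurable in auto)
  moreover have "p * ((Ks + Ks) / 4 - e / 8 - I) < p * (Ks / 2 - I)" using p e by (intro mult_strict_left_mono) auto
  ultimately show False using power_limit_le by linarith
qed

lemma minimiser_exists: "\<exists>W. H1_pair l \<psi> W \<and> mass_of l \<psi> = \<mu> \<and> energy_of l p \<psi> W = I"
proof -
  \<comment> \<open>A concrete positive weight of the kind that \<open>L2_complete\<close> asks
    for.\<close>
  define h where "h x = exp (- 1 * l1_norm3 (grid_point l x))" for x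
  have hm: "h \<in> borel_measurable grid_measure" unfolding h_def[abs_def] using exp_decay_integral_eq(2)[OF l, of 1] by simp
  have "(h x)\<^sup>2 = exp (- 2 * l1_norm3 (grid_point l x))" for x by (simp add: h_def power2_eq_square flip: exp_add)
  then have ih: "integrable grid_measure (\<lambda>x. (h x)\<^sup>2)" using integrable_exp_decay[OF l, of 2] by simp
  obtain W r where W: "W \<in> borel_measurable grid_measure" "integrable grid_measure (\<lambda>x. (norm (W x))\<^sup>2)"
    "(\<lambda>n. \<integral>x. (norm (U n x - W x))\<^sup>2 \<partial>grid_measure) \<longlonglongrightarrow> 0" "strict_mono r" "AE x in grid_measure. (\<lambda>i. U (r i) x) \<longlonglongrightarrow> W x"
    using L2_complete[OF H1_pairD(5)[OF H] H1_pairD(3)[OF H] hm ih _ derivatives_Cauchy] by (auto simp: h_def)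
  have HW: "H1_pair l \<psi> W" by (rule H1_pair_limit[OF l H lim limit_integrable W(1-3)])
  have Wlim: "AE x in grid_measure. (\<lambda>i. (norm (U (r i) x))\<^sup>2) \<longlonglongrightarrow> (norm (W x))\<^sup>2"
    using W(5) by eventually_elim (intro tendsto_intros)
  have "kinetic W \<le> Ks" unfolding kinetic_def
    by (rule Fatou_integral_le(2)[OF H1_pairD(3)[OF H] _ Wlim, where c = "\<lambda>i. kinetic (U (r i))"])
      (use W(1) LIMSEQ_subseq_LIMSEQ[OF K W(4)] in \<open>auto simp: kinetic_def o_def\<close>)
  moreover have "Ks / 2 - I \<le> power_of l p \<psi> / p" using power_limit_le p by (simp add: pos_le_divide_eq mult.commute)
  ultimately have "energy_of l p \<psi> W \<le> I" by (simp add: energy_of_def)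
  then show ?thesis using HW limit_full_mass inf[OF HW limit_full_mass] by (intro exI[of _ W]) auto
qed

end

text \<open>Axis and position of the large value may change with \<open>n\<close>. By equicontinuity
  some node of a fixed finite net on the three edges still carries at least
  \<open>\<delta> / 2\<close>, so the sum of the moduli over the net stays bounded below and passes
  to the limit.\<close>

lemma limit_nonzero:
  assumes l: "l > 0" and H: "\<And>n. H1_pair l (g n) (U n)" and Kb: "\<And>n. kinetic (U n) \<le> K"
    and lim: "\<And>x. (\<lambda>n. g n (grid_point l x)) \<longlonglongrightarrow> \<psi> (grid_point l x)"
    and \<delta>: "\<delta> > 0" and big: "\<And>n. \<exists>a. \<exists>t\<in>{0..l}. norm (g n (grid_point l ((a, 0, 0), t))) \<ge> \<delta>"
  obtains i t where "\<psi> (grid_point l (i, t)) \<noteq> 0" "continuous_on UNIV (\<lambda>t. \<psi> (grid_point l (i, t)))"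
proof -
  have K0: "K \<ge> 0" using Kb[of 0] kinetic_nonneg[of "U 0"] by linarith
  have hoelder: "norm (\<psi> (grid_point l (i, t)) - \<psi> (grid_point l (i, s))) \<le> sqrt (\<bar>t - s\<bar> * K)" for i t s
  proof (rule LIMSEQ_le_const2[OF tendsto_norm[OF tendsto_diff[OF lim lim]]])
    have "norm (g n (grid_point l (i, t)) - g n (grid_point l (i, s))) \<le> sqrt (\<bar>t - s\<bar> * K)" for n
      by (rule order_trans[OF Hoelder_half[OF H]]) (intro real_sqrt_le_mono mult_left_mono Kb, simp)
    then show "\<exists>N. \<forall>n\<ge>N. norm (g n (grid_point l (i, t)) - g n (grid_point l (i, s))) \<le> sqrt (\<bar>t - s\<bar> * K)" by blast
  qed
  have cont: "continuous_on UNIV (\<lambda>t. \<psi> (grid_point l (i, t)))" for i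
    unfolding continuous_on_def
  proof
    fix s :: real
    have "((\<lambda>t. \<psi> (grid_point l (i, t)) - \<psi> (grid_point l (i, s))) \<longlongrightarrow> 0) (at s)"
    proof (rule Lim_null_comparison[OF always_eventually[OF allI[OF hoelder]]])
      have "((\<lambda>t. sqrt (\<bar>t - s\<bar> * K)) \<longlongrightarrow> sqrt (\<bar>s - s\<bar> * K)) (at s)" by (intro tendsto_intros)
      then show "((\<lambda>t. sqrt (\<bar>t - s\<bar> * K)) \<longlongrightarrow> 0) (at s)" by simp
    qed
    then show "((\<lambda>t. \<psi> (grid_point l (i, t))) \<longlongrightarrow> \<psi> (grid_point l (i, s))) (at s within UNIV)"
      by (simp add: LIM_zero_iff)
  qed
  \<comment> \<open>A mesh of width \<open>l / N\<close> makes the Hoelder bound between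
    neighbouring nodes at most \<open>\<delta> / 2\<close>; the added 1 keeps \<open>N\<close>
    positive when \<open>K = 0\<close>.\<close>
  define N where "N = nat \<lceil>4 * l * K / \<delta>\<^sup>2\<rceil> + 1"
  have N: "real N > 0" "l / N * K \<le> (\<delta> / 2)\<^sup>2"
  proof -
    show "real N > 0" by (simp add: N_def)
    have "4 * l * K / \<delta>\<^sup>2 \<le> real N" unfolding N_def by linarith
    then have "4 * l * K \<le> real N * \<delta>\<^sup>2" using \<delta> by (simp add: pos_divide_le_eq)
    then show "l / N * K \<le> (\<delta> / 2)\<^sup>2" using \<open>real N > 0\<close> by (simp add: field_simps power_divide)
  qed
  define P where "P = (UNIV :: axis set) \<times> {..N}"
  define x where "x = (\<lambda>(a, k). ((a, 0, 0), real k * l / N) :: grid_line_index \<times> real)"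
  have fin: "finite P" by (simp add: P_def UNIV_axis)
  have sum: "\<delta> / 2 \<le> (\<Sum>q\<in>P. norm (g n (grid_point l (x q))))" for n
  proof -
    obtain a t where t: "t \<in> {0..l}" "norm (g n (grid_point l ((a, 0, 0), t))) \<ge> \<delta>" using big by blast
    define k where "k = nat \<lfloor>t * N / l\<rfloor>"
    have tN: "0 \<le> t * N / l" "t * N / l \<le> N" using t l N by (auto simp: field_simps)
    have k: "real k \<le> t * N / l" "t * N / l < real k + 1" using tN unfolding k_def by linarith+
    then have "real k \<le> real N" using tN by linarith
    then have kN: "k \<le> N" by simp
    have "real k * l / N \<le> t" using k N l by (auto simp: field_simps)
    moreover have "t \<le> (real k + 1) * l / N" using k(2) N l by (simp add: field_simps)
    then have "t - real k * l / N \<le> l / N" by (simp add: add_divide_distrib distrib_right)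
    ultimately have d: "\<bar>t - real k * l / N\<bar> \<le> l / N" by simp
    have "norm (g n (grid_point l ((a, 0, 0), t)) - g n (grid_point l ((a, 0, 0), real k * l / N))) \<le> sqrt (\<bar>t - real k * l / N\<bar> * kinetic (U n))"
      by (rule Hoelder_half[OF H])
    also have "\<dots> \<le> sqrt ((\<delta> / 2)\<^sup>2)"
    proof (rule real_sqrt_le_mono)
      have "\<bar>t - real k * l / N\<bar> * kinetic (U n) \<le> l / N * K" using d Kb[of n] by (intro mult_mono) (use N l in auto)
      then show "\<bar>t - real k * l / N\<bar> * kinetic (U n) \<le> (\<delta> / 2)\<^sup>2" using N by linarith
    qed
    also have "\<dots> = \<delta> / 2" using \<delta> by simp
    finally have "\<delta> / 2 \<le> norm (g n (grid_point l (x (a, k))))"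
      using t(2) norm_triangle_ineq2[of "g n (grid_point l ((a, 0, 0), t))" "g n (grid_point l ((a, 0, 0), real k * l / N))"]
      by (simp add: x_def)
    also have "\<dots> \<le> (\<Sum>q\<in>P. norm (g n (grid_point l (x q))))"
      by (rule member_le_sum) (use kN fin in \<open>auto simp: P_def\<close>)
    finally show ?thesis .
  qed
  have "(\<lambda>n. \<Sum>q\<in>P. norm (g n (grid_point l (x q)))) \<longlonglongrightarrow> (\<Sum>q\<in>P. norm (\<psi> (grid_point l (x q))))"
    by (intro tendsto_sum tendsto_norm lim)
  then have "\<delta> / 2 \<le> (\<Sum>q\<in>P. norm (\<psi> (grid_point l (x q))))" by (rule LIMSEQ_le_const) (use sum in auto)
  then have "(\<Sum>q\<in>P. norm (\<psi> (grid_point l (x q)))) \<noteq> 0" using \<delta> by linarith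
  then obtain q where "\<psi> (grid_point l (x q)) \<noteq> 0" by (metis (no_types, lifting) norm_zero sum.neutral)
  then show thesis using that[of "fst (x q)" "snd (x q)"] cont by simp
qed

text \<open>The hypothesis \<open>big\<close> excludes vanishing. All other requirements of the
  compactness argument follow from the bounded energies after translating and passing to two nested
  subsequences, for the kinetic terms and for the values.\<close>

theorem minimising_sequence_converges:
  assumes l: "l > 0" and p: "2 < p" "p < 6" and \<mu>: "\<mu> > 0" and I: "I \<le> 0"
    and inf: "\<And>\<phi> W. H1_pair l \<phi> W \<Longrightarrow> mass_of l \<phi> = \<mu> \<Longrightarrow> I \<le> energy_of l p \<phi> W"
    and H: "\<And>n. H1_pair l (f n) (V n)" and mass: "\<And>n. mass_of l (f n) = \<mu>"
    and E: "(\<lambda>n. energy_of l p (f n) (V n)) \<longlonglongrightarrow> I"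
    and \<delta>: "\<delta> > 0" and big: "\<And>n. \<exists>x. norm (f n (grid_point l x)) \<ge> \<delta>"
  shows "\<exists>\<psi> W. H1_pair l \<psi> W \<and> mass_of l \<psi> = \<mu> \<and> energy_of l p \<psi> W = I"
proof -
  have "\<exists>g U. H1_pair l g U \<and> mass_of l g = \<mu> \<and> energy_of l p g U = energy_of l p (f n) (V n) \<and>
      (\<exists>a. \<exists>t\<in>{0..l}. norm (g (grid_point l ((a, 0, 0), t))) \<ge> \<delta>)" for n
  proof -
    obtain a m k r where x: "norm (f n (grid_point l ((a, m, k), r))) \<ge> \<delta>" using big[of n] by (metis prod.exhaust)
    obtain s t where st: "t \<in> {0..l}" "grid_shift l s ((a, 0, 0), t) = ((a, m, k), r)" using ex_shift_to_cell[OF l] by metis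
    note T = H1_pair_translate[OF H[of n], where s = s]
    have "norm (f n (grid_point l ((a, 0, 0), t) + shift_vector l s)) \<ge> \<delta>"
      using x st(2) by (simp flip: grid_point_shift)
    then have "\<exists>a. \<exists>t\<in>{0..l}. norm (f n (grid_point l ((a, 0, 0), t) + shift_vector l s)) \<ge> \<delta>"
      using st(1) by blast
    then show ?thesis using T mass[of n]
      by (intro exI[of _ "\<lambda>x. f n (x + shift_vector l s)"] exI[of _ "\<lambda>x. V n (grid_shift l s x)"]) (auto simp: energy_of_def)
  qed
  then obtain g U where g: "\<And>n. H1_pair l (g n) (U n)" "\<And>n. mass_of l (g n) = \<mu>" "\<And>n. energy_of l p (g n) (U n) = energy_of l p (f n) (V n)"
     "\<And>n. \<exists>a. \<exists>t\<in>{0..l}. norm (g n (grid_point l ((a, 0, 0), t))) \<ge> \<delta>" by metis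
  have Eg: "(\<lambda>n. energy_of l p (g n) (U n)) \<longlonglongrightarrow> I" using E g(3) by simp
  then obtain e where e: "\<And>n. energy_of l p (g n) (U n) \<le> e"
    using convergent_imp_Bseq[of "\<lambda>n. energy_of l p (g n) (U n)"] unfolding convergent_def Bseq_def real_norm_def by (meson abs_le_D1)
  obtain K where K: "\<And>\<psi> V. H1_pair l \<psi> V \<Longrightarrow> mass_of l \<psi> \<le> \<mu> \<Longrightarrow> energy_of l p \<psi> V \<le> e \<Longrightarrow> kinetic V \<le> K"
    using kinetic_bounded_by_energy[OF p \<mu>] by metis
  have Kb: "kinetic (U n) \<le> K" for n using K[OF g(1)] g(2) e by simp
  define B where "B = (\<mu> * K) powr (1/4)"
  have B: "norm (g n (grid_point l x)) \<le> B" for n x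
  proof -
    have "norm (g n (grid_point l x)) \<le> (mass_of l (g n) * kinetic (U n)) powr (1/4)" by (rule sup_norm_bound[OF g(1)])
    also have "\<dots> \<le> B" unfolding B_def g(2) using \<mu> Kb[of n] by (intro powr_mono2 mult_left_mono) auto
    finally show ?thesis .
  qed
  have "bounded (range (\<lambda>n. kinetic (U n)))" using Kb by (intro boundedI[of _ K]) auto
  then obtain Ks r1 where r1: "strict_mono (r1 :: nat \<Rightarrow> nat)" "(\<lambda>n. kinetic (U (r1 n))) \<longlonglongrightarrow> Ks"
    using bounded_imp_convergent_subsequence[of "\<lambda>n. kinetic (U n)"] by (auto simp: o_def)
  obtain r2 \<psi> where r2: "strict_mono (r2 :: nat \<Rightarrow> nat)" "\<And>x. (\<lambda>n. g (r1 (r2 n)) (grid_point l x)) \<longlonglongrightarrow> \<psi> (grid_point l x)"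
    using pointwise_convergent_subsequence[of l "\<lambda>n. g (r1 n)" "\<lambda>n. U (r1 n)" K B] g(1) Kb B by metis
  define r where "r n = r1 (r2 n)" for n
  have r: "strict_mono r" using r1(1) r2(1) by (auto simp: r_def strict_mono_def)
  have lim: "(\<lambda>n. g (r n) (grid_point l x)) \<longlonglongrightarrow> \<psi> (grid_point l x)" for x using r2(2) by (simp add: r_def)
  have Er: "(\<lambda>n. energy_of l p (g (r n)) (U (r n))) \<longlonglongrightarrow> I" using LIMSEQ_subseq_LIMSEQ[OF Eg r] by (simp add: o_def)
  have Kr: "(\<lambda>n. kinetic (U (r n))) \<longlonglongrightarrow> Ks" using LIMSEQ_subseq_LIMSEQ[OF r1(2) r2(1)] by (simp add: o_def r_def)
  obtain i t where nz: "\<psi> (grid_point l (i, t)) \<noteq> 0" "continuous_on UNIV (\<lambda>t. \<psi> (grid_point l (i, t)))"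
    using limit_nonzero[of l "\<lambda>n. g (r n)" "\<lambda>n. U (r n)" K \<psi> \<delta>] l g(1,4) Kb lim \<delta> by metis
  have m2: "(\<lambda>x. (norm (\<psi> (grid_point l x)))\<^sup>2) \<in> borel_measurable grid_measure"
    using borel_measurable_LIMSEQ_metric[OF H1_pairD(4)[OF g(1)] lim] by measurable
  have "AE x in grid_measure. (\<lambda>n. (norm (g (r n) (grid_point l x)))\<^sup>2) \<longlonglongrightarrow> (norm (\<psi> (grid_point l x)))\<^sup>2"
    by (intro AE_I2 tendsto_intros lim)
  from Fatou_integral_le(1)[OF H1_pairD(2)[OF g(1)] _ this m2 _ tendsto_const[of \<mu>]] g(2)
  have "integrable grid_measure (\<lambda>x. (norm (\<psi> (grid_point l x)))\<^sup>2)" by (simp add: mass_of_def)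
  then have pos: "mass_of l \<psi> > 0" by (rule mass_of_pos_if_nonzero[OF nz(2,1)])
  show ?thesis
    using minimiser_exists[of l p \<mu> I "\<lambda>n. g (r n)" "\<lambda>n. U (r n)" Ks B \<psi>] l p \<mu> I inf g(1,2) Er Kr B lim pos by blast
qed

lemma minimiser_if_negative_energy:
  assumes l: "l > 0" and p: "2 < p" "p < 6" and \<mu>: "\<mu> > 0"
    and neg: "H1_pair l \<phi> W" "mass_of l \<phi> = \<mu>" "energy_of l p \<phi> W < 0"
  shows "\<exists>\<psi> V. H1_pair l \<psi> V \<and> mass_of l \<psi> = \<mu> \<and> energy_of l p \<psi> V < 0 \<and>
     (\<forall>\<phi> W. H1_pair l \<phi> W \<longrightarrow> mass_of l \<phi> = \<mu> \<longrightarrow> energy_of l p \<psi> V \<le> energy_of l p \<phi> W)"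
proof -
  define A where "A = {energy_of l p \<psi> V | \<psi> V. H1_pair l \<psi> V \<and> mass_of l \<psi> = \<mu>}"
  obtain K where K: "\<And>\<psi> V. H1_pair l \<psi> V \<Longrightarrow> mass_of l \<psi> \<le> \<mu> \<Longrightarrow> energy_of l p \<psi> V \<le> 0 \<Longrightarrow> kinetic V \<le> K"
    using kinetic_bounded_by_energy[OF p \<mu>] by metis
  have "bdd_below A"
  \<comment> \<open>Only functions with energy at most 0 need attention: for them the kinetic term
    is bounded, hence so is the power term. Positive energies lie above the negative bound
    anyway.\<close>
  proof (rule bdd_belowI[of _ "- (1 / p * ((\<mu> * K) powr ((p - 2) / 4) * \<mu>))"])
    fix E assume "E \<in> A"
    then obtain \<psi> V where \<psi>: "H1_pair l \<psi> V" "mass_of l \<psi> = \<mu>" "E = energy_of l p \<psi> V" by (auto simp: A_def)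
    show "- (1 / p * ((\<mu> * K) powr ((p - 2) / 4) * \<mu>)) \<le> E"
    proof (cases "E \<le> 0")
      case True
      then have k: "kinetic V \<le> K" using K \<psi> by simp
      have "power_of l p \<psi> \<le> (\<mu> * kinetic V) powr ((p - 2) / 4) * \<mu>"
        using power_of_le_mass_kinetic[OF \<psi>(1), of p] p \<psi>(2) by simp
      also have "\<dots> \<le> (\<mu> * K) powr ((p - 2) / 4) * \<mu>"
        using k \<mu> p by (intro mult_right_mono powr_mono2 mult_left_mono) auto
      finally have "1 / p * power_of l p \<psi> \<le> 1 / p * ((\<mu> * K) powr ((p - 2) / 4) * \<mu>)"
        using p by (intro mult_left_mono) auto
      moreover have "- (1 / p * power_of l p \<psi>) \<le> E" using \<psi>(3) kinetic_nonneg[of V] by (simp add: energy_of_def)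
      ultimately show ?thesis by linarith
    next
      case False
      moreover have "0 \<le> 1 / p * ((\<mu> * K) powr ((p - 2) / 4) * \<mu>)" using p \<mu> by simp
      ultimately show ?thesis by linarith
    qed
  qed
  define I where "I = Inf A"
  have inA: "energy_of l p \<phi> W \<in> A" using neg by (auto simp: A_def)
  have inf: "I \<le> energy_of l p \<psi> V" if "H1_pair l \<psi> V" "mass_of l \<psi> = \<mu>" for \<psi> V
    unfolding I_def by (rule cInf_lower) (use that \<open>bdd_below A\<close> in \<open>auto simp: A_def\<close>)
  have I: "I < 0" using inf[OF neg(1,2)] neg(3) by simp
  have "\<exists>\<psi> V. H1_pair l \<psi> V \<and> mass_of l \<psi> = \<mu> \<and> energy_of l p \<psi> V < I + 1 / (real n + 1) \<and> energy_of l p \<psi> V < I / 2" for n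
  proof -
    have "Inf A < I + min (1 / (real n + 1)) (- I / 2)" using I by (auto simp: I_def)
    then obtain E where "E \<in> A" "E < I + min (1 / (real n + 1)) (- I / 2)"
      using cInf_lessD[of A] inA by blast
    then obtain \<psi> V where "H1_pair l \<psi> V" "mass_of l \<psi> = \<mu>" "energy_of l p \<psi> V < I + min (1 / (real n + 1)) (- I / 2)"
      by (auto simp: A_def)
    moreover have "min (1 / (real n + 1)) (- I / 2) \<le> 1 / (real n + 1)" "min (1 / (real n + 1)) (- I / 2) \<le> - I / 2"
      by auto
    ultimately have "H1_pair l \<psi> V" "mass_of l \<psi> = \<mu>" "energy_of l p \<psi> V < I + 1 / (real n + 1)" "energy_of l p \<psi> V < I / 2"
      by linarith+
    then show ?thesis by blast
  qed
  then obtain f V where f: "\<And>n. H1_pair l (f n) (V n)" "\<And>n. mass_of l (f n) = \<mu>"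
    "\<And>n. energy_of l p (f n) (V n) < I + 1 / (real n + 1)" "\<And>n. energy_of l p (f n) (V n) < I / 2" by metis
  have E: "(\<lambda>n. energy_of l p (f n) (V n)) \<longlonglongrightarrow> I"
  proof (rule tendsto_sandwich[OF _ _ tendsto_const])
    show "\<forall>\<^sub>F n in sequentially. I \<le> energy_of l p (f n) (V n)" using inf f(1,2) by simp
    show "\<forall>\<^sub>F n in sequentially. energy_of l p (f n) (V n) \<le> I + 1 / (real n + 1)" using f(3) by (simp add: less_imp_le)
    show "(\<lambda>n. I + 1 / (real n + 1)) \<longlonglongrightarrow> I" by real_asymp
  qed
  \<comment> \<open>Chosen so that a function with modulus at most \<open>\<delta>\<close> has power
    term at most \<open>- p * I / 4\<close>, hence energy at least \<open>I / 4\<close>, which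
    contradicts energies below \<open>I / 2\<close>.\<close>
  define \<delta> where "\<delta> = (- p * I / (4 * \<mu>)) powr (1 / (p - 2))"
  have pI: "- p * I / (4 * \<mu>) > 0" using p I \<mu> by (simp add: divide_neg_pos mult_pos_neg)
  then have "- p * I / (4 * \<mu>) \<noteq> 0" by linarith
  then have \<delta>: "\<delta> > 0" unfolding \<delta>_def by (rule iffD2[OF powr_gt_zero])
  have big: "\<exists>x. norm (f n (grid_point l x)) \<ge> \<delta>" for n
  proof (rule ccontr)
    assume "\<not> (\<exists>x. norm (f n (grid_point l x)) \<ge> \<delta>)"
    then have le: "norm (f n (grid_point l x)) \<le> \<delta>" for x by (meson le_cases)
    have "power_of l p (f n) \<le> \<delta> powr (p - 2) * power_of l 2 (f n)"
      by (rule power_of_le[OF f(1)]) (use p le in auto)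
    also have "\<delta> powr (p - 2) = - p * I / (4 * \<mu>)"
    proof -
      have "(q powr (1 / (p - 2))) powr (p - 2) = q" if "q > 0" for q :: real using that p by (simp add: powr_powr)
      from this[OF pI] show ?thesis unfolding \<delta>_def .
    qed
    also have "- p * I / (4 * \<mu>) * power_of l 2 (f n) = - p * I / 4"
      using \<mu> by (simp add: power_of_2 f(2))
    finally have S: "power_of l p (f n) \<le> - p * I / 4" .
    have "- (power_of l p (f n) / p) \<le> energy_of l p (f n) (V n)" by (simp add: energy_of_def)
    then have "- (I / 2) < power_of l p (f n) / p" using f(4)[of n] by linarith
    also have "\<dots> \<le> - I / 4" using S p by (simp add: pos_divide_le_eq mult.commute)
    finally show False using I by linarith
  qed
  obtain \<psi> U where "H1_pair l \<psi> U" "mass_of l \<psi> = \<mu>" "energy_of l p \<psi> U = I"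
    using minimising_sequence_converges[OF l p \<mu> less_imp_le[OF I] inf f(1,2) E \<delta> big] by blast
  then show ?thesis using inf I by (intro exI[of _ \<psi>] exI[of _ U]) auto
qed

text \<open>Compactness requires functions of mass exactly \<open>\<mu>\<close>, but the exclusion
  of vanishing requires negative energy, available only above \<open>\<mu>\<close>. So the lower
  bound on the modulus is proved for \<open>\<phi> n\<close> and then carried over to its rescaling
  \<open>f n\<close>.\<close>

lemma minimiser_at_threshold:
  assumes l: "l > 0" and p: "10/3 < p" "p < 6" and \<mu>: "\<mu> > 0"
    and ge: "\<And>\<psi> V. H1_pair l \<psi> V \<Longrightarrow> mass_of l \<psi> = \<mu> \<Longrightarrow> 0 \<le> energy_of l p \<psi> V"
    and neg: "\<And>m. m > \<mu> \<Longrightarrow> \<exists>\<psi> V. H1_pair l \<psi> V \<and> mass_of l \<psi> = m \<and> energy_of l p \<psi> V < 0"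
  shows "\<exists>\<psi> V. H1_pair l \<psi> V \<and> mass_of l \<psi> = \<mu> \<and> energy_of l p \<psi> V = 0"
proof -
  define m where "m n = \<mu> * (1 + 1 / (real n + 1))" for n
  have m: "m n > \<mu>" "m n \<le> 2 * \<mu>" for n using \<mu> by (auto simp: m_def field_simps)
  obtain \<phi> W where \<phi>: "\<And>n. H1_pair l (\<phi> n) (W n)" "\<And>n. mass_of l (\<phi> n) = m n" "\<And>n. energy_of l p (\<phi> n) (W n) < 0"
    using neg[OF m(1)] by metis
  have p2: "2 < p" using p by simp
  obtain K where K: "\<And>\<psi> V. H1_pair l \<psi> V \<Longrightarrow> mass_of l \<psi> \<le> 2 * \<mu> \<Longrightarrow> energy_of l p \<psi> V \<le> 0 \<Longrightarrow> kinetic V \<le> K"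
    using kinetic_bounded_by_energy[OF p2 p(2), of "2 * \<mu>"] \<mu> by (metis mult_pos_pos zero_less_numeral)
  have Kb: "kinetic (W n) \<le> K" for n using K[OF \<phi>(1)] \<phi>(2,3) m(2) by (simp add: less_imp_le)
  define S where "S = (2 * \<mu> * K) powr ((p - 2) / 4) * (2 * \<mu>)"
  have Sb: "power_of l p (\<phi> n) \<le> S" for n
  proof -
    have "power_of l p (\<phi> n) \<le> (m n * kinetic (W n)) powr ((p - 2) / 4) * m n"
      using power_of_le_mass_kinetic[OF \<phi>(1), of p] p \<phi>(2) by simp
    also have "\<dots> \<le> S" unfolding S_def
      using Kb[of n] m[of n] \<mu> p by (intro mult_mono powr_mono2) auto
    finally show ?thesis .
  qed
  define c where "c n = sqrt (\<mu> / m n)" for n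
  have c: "0 < c n" "c n \<le> 1" "(c n)\<^sup>2 = \<mu> / m n" "1 / 2 \<le> c n" for n
  proof -
    show "0 < c n" using \<mu> m(1)[of n] by (simp add: c_def)
    show "c n \<le> 1" using \<mu> m(1)[of n] by (simp add: c_def)
    show sq: "(c n)\<^sup>2 = \<mu> / m n" using \<mu> m(1)[of n] by (simp add: c_def)
    have "(1 / 2)\<^sup>2 \<le> (c n)\<^sup>2" unfolding sq using m[of n] \<mu> by (simp add: field_simps power2_eq_square)
    then show "1 / 2 \<le> c n" by (rule power2_le_imp_le) (simp add: \<open>0 < c n\<close> less_imp_le)
  qed
  define f where "f n = (\<lambda>x. complex_of_real (c n) * \<phi> n x)" for n
  define V where "V n = (\<lambda>x. complex_of_real (c n) * W n x)" for n
  have f: "H1_pair l (f n) (V n)" "mass_of l (f n) = \<mu>" for n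
    unfolding f_def V_def using H1_pair_scale[OF \<phi>(1)] c[of n] m[of n] \<mu> by (auto simp: mass_of_scale \<phi>(2))
  have c_lim: "c \<longlonglongrightarrow> 1"
  proof -
    have "\<mu> / m n = 1 / (1 + 1 / (real n + 1))" for n using \<mu> by (simp add: m_def)
    then have "c = (\<lambda>n. sqrt (1 / (1 + 1 / (real n + 1))))" by (simp add: c_def[abs_def])
    then show ?thesis by (simp only:) real_asymp
  qed
  \<comment> \<open>Rescaling to mass \<open>\<mu>\<close> raises the energy by at most a multiple
    of \<open>1 - c n powr p\<close>, which tends to 0; together with \<open>ge\<close> this forces
    the energies to 0.\<close>
  have Eu: "energy_of l p (f n) (V n) \<le> (1 - c n powr p) / p * S" for n
  proof -
    have "energy_of l p (f n) (V n) = (c n)\<^sup>2 * energy_of l p (\<phi> n) (W n) + ((c n)\<^sup>2 - c n powr p) / p * power_of l p (\<phi> n)"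
      unfolding f_def V_def energy_of_scale using c(1)[of n] p by (simp add: energy_of_def field_simps)
    also have "\<dots> \<le> 0 + (1 - c n powr p) / p * S"
    proof (intro add_mono mult_mono)
      show "(c n)\<^sup>2 * energy_of l p (\<phi> n) (W n) \<le> 0" using \<phi>(3)[of n] by (simp add: mult_nonneg_nonpos)
      show "((c n)\<^sup>2 - c n powr p) / p \<le> (1 - c n powr p) / p"
        using power_le_one[of "c n" 2] c(1,2)[of n] p by (intro divide_right_mono diff_right_mono) auto
      show "0 \<le> (1 - c n powr p) / p" using c[of n] p by (auto intro!: divide_nonneg_nonneg powr_le1)
    qed (auto simp: Sb)
    finally show ?thesis by simp
  qed
  have E: "(\<lambda>n. energy_of l p (f n) (V n)) \<longlonglongrightarrow> 0"
  proof (rule tendsto_sandwich[OF _ _ tendsto_const])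
    show "\<forall>\<^sub>F n in sequentially. 0 \<le> energy_of l p (f n) (V n)" using ge f by simp
    show "\<forall>\<^sub>F n in sequentially. energy_of l p (f n) (V n) \<le> (1 - c n powr p) / p * S" using Eu by simp
    have "(\<lambda>n. (1 - c n powr p) / p * S) \<longlonglongrightarrow> (1 - 1 powr p) / p * S"
      using p by (intro tendsto_intros c_lim) auto
    then show "(\<lambda>n. (1 - c n powr p) / p * S) \<longlonglongrightarrow> 0" by simp
  qed
  define C where "C = (1 + 2 ^ 28 * l ^ 4) * (2 * \<mu>) powr (2/3)"
  have C: "C > 0" using l \<mu> by (auto simp: C_def intro!: mult_pos_pos add_pos_nonneg)
  \<comment> \<open>If the modulus of \<open>\<phi> n\<close> stayed below \<open>s\<close>, then
    \<open>Gagliardo_Nirenberg_3d\<close> would bound its power term by a quarter of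
    \<open>p\<close> times the kinetic term, and its energy could not be negative. The exponent
    exists because \<open>p \<noteq> 10/3\<close>.\<close>
  define s where "s = (p / (4 * C)) powr (1 / (p - 10/3))"
  have s: "s > 0" using C p by (simp add: s_def)
  have big\<phi>: "\<exists>x. norm (\<phi> n (grid_point l x)) \<ge> s" for n
  proof (rule ccontr)
    assume "\<not> (\<exists>x. norm (\<phi> n (grid_point l x)) \<ge> s)"
    then have le: "norm (\<phi> n (grid_point l x)) \<le> s" for x by (meson le_cases)
    have "power_of l p (\<phi> n) \<le> s powr (p - 10/3) * power_of l (10/3) (\<phi> n)"
      by (rule power_of_le[OF \<phi>(1)]) (use p le in auto)
    also have "s powr (p - 10/3) = p / (4 * C)" using p C by (simp add: s_def powr_powr)
    also have "p / (4 * C) * power_of l (10/3) (\<phi> n) \<le> p / (4 * C) * (C * kinetic (W n))"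
    proof (rule mult_left_mono)
      have "power_of l (10/3) (\<phi> n) \<le> (1 + 2 ^ 28 * l ^ 4) * m n powr (2/3) * kinetic (W n)"
        using Gagliardo_Nirenberg_3d[OF l \<phi>(1)] by (simp add: \<phi>(2))
      also have "\<dots> \<le> C * kinetic (W n)" unfolding C_def
        using m[of n] \<mu> l by (intro mult_right_mono mult_left_mono powr_mono2) (auto intro: add_nonneg_nonneg)
      finally show "power_of l (10/3) (\<phi> n) \<le> C * kinetic (W n)" .
    qed (use p C in simp)
    also have "p / (4 * C) * (C * kinetic (W n)) = p * kinetic (W n) / 4" using C by simp
    finally have "power_of l p (\<phi> n) \<le> p * kinetic (W n) / 4" .
    then have "1 / p * power_of l p (\<phi> n) \<le> kinetic (W n) / 4" using p by (simp add: field_simps)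
    then have "kinetic (W n) / 4 \<le> energy_of l p (\<phi> n) (W n)" by (simp add: energy_of_def)
    then show False using \<phi>(3)[of n] kinetic_nonneg[of "W n"] by linarith
  qed
  have big: "\<exists>x. norm (f n (grid_point l x)) \<ge> s / 2" for n
  proof -
    obtain x where x: "norm (\<phi> n (grid_point l x)) \<ge> s" using big\<phi> by blast
    have "1 / 2 * s \<le> c n * norm (\<phi> n (grid_point l x))" using x c[of n] s by (intro mult_mono) auto
    then show ?thesis using c(1)[of n] by (intro exI[of _ x]) (simp add: f_def norm_mult)
  qed
  show ?thesis
    using minimising_sequence_converges[OF l p2 p(2) \<mu> order_refl ge f(1,2) E _ big] s by simp
qed

section \<open>The critical power below the threshold\<close>

context
  fixes R :: real
  assumes R: "R > 0"
begin

text \<open>Written in the variable \<open>r\<close>, the squared modulus, so that \<open>R\<close>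
  is the square of the supremum. The squared modulus has a derivative of the form
  \<open>2 * (u \<bullet> v)\<close> even where the function vanishes, unlike the modulus.\<close>

definition level_speed :: "real \<Rightarrow> real" where
  "level_speed r = sqrt ((R\<^sup>2 - r\<^sup>2) / 3)"

definition level_cost :: "real \<Rightarrow> real" where
  "level_cost s = integral {0..s} level_speed"

lemma level_speed_continuous: "continuous_on A level_speed"
  unfolding level_speed_def[abs_def] by (intro continuous_intros) auto

lemma level_cost_eq:
  assumes s: "0 \<le> s" "s \<le> R"
  shows "level_cost s = (s * sqrt (R\<^sup>2 - s\<^sup>2) + R\<^sup>2 * arcsin (s / R)) / (2 * sqrt 3)"
proof -
  define F where "F r = (r * sqrt (R\<^sup>2 - r\<^sup>2) + R\<^sup>2 * arcsin (r / R)) / (2 * sqrt 3)" for r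
  have "(level_speed has_integral (F s - F 0)) {0..s}"
  proof (rule fundamental_theorem_of_calculus_interior[OF s(1)])
    show "continuous_on {0..s} F" unfolding F_def by (intro continuous_intros) (use R s in \<open>auto simp: field_simps\<close>)
    fix r assume r: "r \<in> {0<..<s}"
    have lt: "r < R" using r s by auto
    then have pos: "R\<^sup>2 - r\<^sup>2 > 0" using r R by (simp add: power_strict_mono)
    define q where "q = sqrt (R\<^sup>2 - r\<^sup>2)"
    have q: "q > 0" "q\<^sup>2 = R\<^sup>2 - r\<^sup>2" using pos by (auto simp: q_def)
    have e: "sqrt (1 - (r / R)\<^sup>2) = q / R"
    proof -
      have "1 - (r / R)\<^sup>2 = (R\<^sup>2 - r\<^sup>2) / R\<^sup>2" using R by (simp add: field_simps power_divide)
      then show ?thesis using R by (simp add: q_def real_sqrt_divide)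
    qed
    have d1: "((\<lambda>r. sqrt (R\<^sup>2 - r\<^sup>2)) has_real_derivative - r / q) (at r)"
      using pos by (auto intro!: derivative_eq_intros simp: q_def field_simps)
    have d2: "((\<lambda>r. arcsin (r / R)) has_real_derivative 1 / q) (at r)"
    proof -
      have "-1 < r / R" "r / R < 1" using r lt R by (auto simp: field_simps)
      then have "((\<lambda>r. arcsin (r / R)) has_real_derivative inverse (sqrt (1 - (r / R)\<^sup>2)) * (1 / R)) (at r)"
        by (intro DERIV_chain2[OF DERIV_arcsin]) (use R in \<open>auto intro!: derivative_eq_intros\<close>)
      then show ?thesis unfolding e using R q by (simp add: field_simps)
    qed
    have "(F has_real_derivative ((1 * q + (- r / q) * r) + R\<^sup>2 * (1 / q)) / (2 * sqrt 3)) (at r)"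
      unfolding F_def[abs_def] q_def
      by (intro DERIV_cdivide DERIV_add DERIV_mult DERIV_ident DERIV_cmult d1[unfolded q_def] d2[unfolded q_def])
    moreover have "((1 * q + (- r / q) * r) + R\<^sup>2 * (1 / q)) / (2 * sqrt 3) = level_speed r"
    proof -
      have "R\<^sup>2 = q\<^sup>2 + r\<^sup>2" using q by simp
      then have X: "(1 * q + (- r / q) * r) + R\<^sup>2 * (1 / q) = 2 * q"
        using q(1) by (simp add: field_simps power2_eq_square)
      show ?thesis unfolding X level_speed_def real_sqrt_divide q_def[symmetric] by simp
    qed
    ultimately show "(F has_vector_derivative level_speed r) (at r)"
      by (simp add: has_real_derivative_iff_has_vector_derivative)
  qed
  then show ?thesis by (simp add: level_cost_def integral_unique F_def)
qed

lemma level_cost_pos: "0 < s \<Longrightarrow> s \<le> R \<Longrightarrow> 0 < level_cost s"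
proof -
  assume s: "0 < s" "s \<le> R"
  have "0 < arcsin (s / R)" using arcsin_less_arcsin[of 0 "s / R"] s R by simp
  moreover have "s\<^sup>2 \<le> R\<^sup>2" using s by (intro power_mono) auto
  ultimately have "0 < s * sqrt (R\<^sup>2 - s\<^sup>2) + R\<^sup>2 * arcsin (s / R)"
    using s R by (intro add_nonneg_pos mult_nonneg_nonneg mult_pos_pos) auto
  then show ?thesis unfolding level_cost_eq[OF less_imp_le[OF s(1)] s(2)] by simp
qed

text \<open>The integral is the area of a quarter disc of radius \<open>R\<close> divided by
  \<open>sqrt 3\<close>. The number \<open>sqrt 3 * pi / 2\<close> appearing here is the critical
  mass for exponent 6.\<close>

lemma level_cost_R: "2 * level_cost R = R\<^sup>2 / 3 * (sqrt 3 * pi / 2)"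
proof -
  have "level_cost R = R\<^sup>2 * (pi / 2) / (2 * sqrt 3)" using level_cost_eq[of R] R by simp
  then have "2 * level_cost R = R\<^sup>2 * pi / (2 * sqrt 3)" by simp
  also have "\<dots> = R\<^sup>2 * pi * sqrt 3 / (2 * (sqrt 3 * sqrt 3))" by (simp del: real_sqrt_mult_self)
  finally show ?thesis by simp
qed

lemma level_cost_deriv:
  assumes "x \<in> {0..R}"
  shows "(level_cost has_real_derivative level_speed x) (at x within {0..R})"
  using integral_has_vector_derivative[OF level_speed_continuous assms]
  by (simp add: level_cost_def[abs_def] has_real_derivative_iff_has_vector_derivative)

lemma level_cost_continuous: "continuous_on {0..R} level_cost"
  using level_cost_deriv by (meson DERIV_continuous_on)

lemma level_cost_small:
  assumes "\<epsilon> > 0"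
  obtains d where "d > 0" "\<And>s. 0 \<le> s \<Longrightarrow> s \<le> R \<Longrightarrow> s < d \<Longrightarrow> level_cost s < \<epsilon>"
proof -
  have "level_cost 0 = 0" by (simp add: level_cost_def)
  then obtain d where d: "d > 0" "\<And>s. s \<in> {0..R} \<Longrightarrow> dist s 0 < d \<Longrightarrow> dist (level_cost s) 0 < \<epsilon>"
    using level_cost_continuous[unfolded continuous_on_iff, rule_format, of 0 \<epsilon>] assms R by auto
  then show thesis using that[of d] by (force simp: dist_real_def)
qed

context
  fixes l :: real and \<psi> V
  assumes l: "l > 0" and H: "H1_pair l \<psi> V" and le: "\<And>x. (norm (\<psi> (grid_point l x)))\<^sup>2 \<le> R"
begin

text \<open>The slope prescribed by the first integral of the quintic soliton equation: a line
  soliton with maximal squared modulus \<open>R\<close> has a derivative of exactly this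
  modulus.\<close>

definition speed :: "grid_line_index \<times> real \<Rightarrow> real" where
  "speed x = norm (\<psi> (grid_point l x)) * level_speed ((norm (\<psi> (grid_point l x)))\<^sup>2)"

lemma level_speed_arg_nonneg: "0 \<le> R\<^sup>2 - ((norm (\<psi> (grid_point l x)))\<^sup>2)\<^sup>2"
  using power_mono[OF le zero_le_power2, of x 2] by simp

lemma speed_nonneg: "speed x \<ge> 0"
  using level_speed_arg_nonneg[of x] by (simp add: speed_def level_speed_def)

lemma speed_le: "speed x \<le> R / sqrt 3 * norm (\<psi> (grid_point l x))"
proof -
  have "level_speed ((norm (\<psi> (grid_point l x)))\<^sup>2) \<le> sqrt (R\<^sup>2 / 3)"
    unfolding level_speed_def by (intro real_sqrt_le_mono divide_right_mono) auto
  then have "speed x \<le> norm (\<psi> (grid_point l x)) * sqrt (R\<^sup>2 / 3)"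
    unfolding speed_def by (rule mult_left_mono) simp
  also have "\<dots> = R / sqrt 3 * norm (\<psi> (grid_point l x))" using R by (simp add: real_sqrt_divide)
  finally show ?thesis .
qed

lemma speed_square: "(speed x)\<^sup>2 = R\<^sup>2 / 3 * (norm (\<psi> (grid_point l x)))\<^sup>2 - norm (\<psi> (grid_point l x)) powr 6 / 3"
proof -
  have p6: "norm z powr 6 = norm z ^ 6" for z :: complex by (cases "z = 0") auto
  have "(level_speed ((norm (\<psi> (grid_point l x)))\<^sup>2))\<^sup>2 = (R\<^sup>2 - ((norm (\<psi> (grid_point l x)))\<^sup>2)\<^sup>2) / 3"
    using level_speed_arg_nonneg[of x] by (simp add: level_speed_def)
  moreover have "a\<^sup>2 * ((R\<^sup>2 - (a\<^sup>2)\<^sup>2) / 3) = R\<^sup>2 / 3 * a\<^sup>2 - a ^ 6 / 3" for a :: real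
    by (simp add: field_simps eval_nat_numeral)
  ultimately show ?thesis unfolding speed_def power_mult_distrib p6 by (simp only:)
qed

lemma speed_measurable: "speed \<in> borel_measurable grid_measure"
proof -
  have [measurable]: "level_speed \<in> borel_measurable borel"
    by (rule borel_measurable_continuous_onI[OF level_speed_continuous])
  note [measurable] = H1_pairD(4)[OF H]
  show ?thesis unfolding speed_def[abs_def] by measurable
qed

lemma speed_square_integrable: "integrable grid_measure (\<lambda>x. (speed x)\<^sup>2)"
  unfolding speed_square using H1_pairD(2)[OF H] integrable_power_of[OF H, of 6] by auto

lemma speed_V_integrable: "integrable grid_measure (\<lambda>x. norm (V x) * speed x)"
  using integrable_mult_if_squares[of "\<lambda>x. norm (V x)" grid_measure speed] H1_pairD(3,5)[OF H] speed_measurable speed_square_integrable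
  by simp

text \<open>Completing the square. By \<open>speed_square\<close> the square of \<open>speed\<close>
  contains precisely the power term of twice the energy, plus a multiple of the mass.\<close>

lemma energy_calibration:
  "2 * energy_of l 6 \<psi> V = (\<integral>x. (norm (V x) - speed x)\<^sup>2 \<partial>grid_measure) + (\<integral>x. 2 * (norm (V x) * speed x) \<partial>grid_measure) - R\<^sup>2 / 3 * mass_of l \<psi>"
    "integrable grid_measure (\<lambda>x. (norm (V x) - speed x)\<^sup>2)"
proof -
  have e: "(\<lambda>x. (norm (V x) - speed x)\<^sup>2) = (\<lambda>x. (norm (V x))\<^sup>2 + (speed x)\<^sup>2 - 2 * (norm (V x) * speed x))"
    by (auto simp: power2_diff)
  show "integrable grid_measure (\<lambda>x. (norm (V x) - speed x)\<^sup>2)"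
    unfolding e using H1_pairD(3)[OF H] speed_square_integrable speed_V_integrable by simp
  have s: "(\<integral>x. (speed x)\<^sup>2 \<partial>grid_measure) = R\<^sup>2 / 3 * mass_of l \<psi> - power_of l 6 \<psi> / 3"
    unfolding speed_square mass_of_def power_of_def
    using H1_pairD(2)[OF H] integrable_power_of[OF H, of 6]
    by (subst Bochner_Integration.integral_diff) auto
  have "(\<integral>x. (norm (V x) - speed x)\<^sup>2 \<partial>grid_measure) = kinetic V + (R\<^sup>2 / 3 * mass_of l \<psi> - power_of l 6 \<psi> / 3) - (\<integral>x. 2 * (norm (V x) * speed x) \<partial>grid_measure)"
    unfolding e s[symmetric] kinetic_def using H1_pairD(3)[OF H] speed_square_integrable speed_V_integrable by simp
  then show "2 * energy_of l 6 \<psi> V = (\<integral>x. (norm (V x) - speed x)\<^sup>2 \<partial>grid_measure) + (\<integral>x. 2 * (norm (V x) * speed x) \<partial>grid_measure) - R\<^sup>2 / 3 * mass_of l \<psi>"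
    by (simp add: energy_of_def)
qed

lemma level_cost_le_line:
  "2 * level_cost ((norm (\<psi> (grid_point l (i, t))))\<^sup>2) \<le> (\<integral>s. 2 * (norm (V (i, s)) * speed (i, s)) \<partial>lborel)"
proof -
  define f where "f s = (norm (\<psi> (grid_point l (i, s))))\<^sup>2" for s
  define g where "g s = level_speed (f s) * (2 * (\<psi> (grid_point l (i, s)) \<bullet> V (i, s)))" for s
  have fP: "is_primitive f (\<lambda>s. 2 * (\<psi> (grid_point l (i, s)) \<bullet> V (i, s)))"
    unfolding f_def by (rule is_primitive_norm_square[OF H1_pairD(1)[OF H]])
  have fR: "f s \<in> {0..R}" for s using le by (simp add: f_def)
  have P: "is_primitive (\<lambda>s. level_cost (f s)) g"
    unfolding g_def by (rule is_primitive_chain[OF fP fR level_cost_deriv level_speed_continuous])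
  have wi: "integrable lborel (\<lambda>s. 2 * (norm (V (i, s)) * speed (i, s)))"
    using integrable_grid_line[OF speed_V_integrable, of i] by simp
  have b: "\<bar>g s\<bar> \<le> 2 * (norm (V (i, s)) * speed (i, s))" for s
  proof -
    have "0 \<le> level_speed (f s)" using level_speed_arg_nonneg[of "(i, s)"] by (simp add: level_speed_def f_def)
    then have "\<bar>g s\<bar> = level_speed (f s) * (2 * \<bar>\<psi> (grid_point l (i, s)) \<bullet> V (i, s)\<bar>)" by (simp add: g_def abs_mult)
    also have "\<dots> \<le> level_speed (f s) * (2 * (norm (\<psi> (grid_point l (i, s))) * norm (V (i, s))))"
      using \<open>0 \<le> level_speed (f s)\<close> by (intro mult_left_mono Cauchy_Schwarz_ineq2) auto
    finally show ?thesis by (simp add: speed_def f_def mult_ac)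
  qed
  have gi: "integrable lborel g"
    by (rule Bochner_Integration.integrable_bound[OF wi]) (use is_primitiveD(1)[OF P] b in \<open>auto intro: order_trans[OF _ abs_ge_self]\<close>)
  have fi: "integrable lborel f" unfolding f_def by (rule integrable_grid_line[OF H1_pairD(2)[OF H]])
  have "2 * level_cost (f t) \<le> (\<integral>s. \<bar>g s\<bar> \<partial>lborel)"
  proof (rule two_sided_primitive_bound[OF P gi])
    fix \<epsilon> :: real assume "\<epsilon> > 0"
    from level_cost_small[OF this]
    obtain d where d: "d > 0" "\<And>s. 0 \<le> s \<Longrightarrow> s \<le> R \<Longrightarrow> s < d \<Longrightarrow> level_cost s < \<epsilon>" by metis
    have f0: "f s \<ge> 0" for s by (simp add: f_def)
    obtain s1 where "s1 \<ge> t" "f s1 < d" using integrable_continuous_small_beyond(1)[OF fi f0 d(1)] by blast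
    then show "\<exists>s\<ge>t. level_cost (f s) < \<epsilon>" using d(2) fR[of s1] by auto
    obtain s2 where "s2 \<le> t" "f s2 < d" using integrable_continuous_small_beyond(2)[OF fi f0 d(1)] by blast
    then show "\<exists>s\<le>t. level_cost (f s) < \<epsilon>" using d(2) fR[of s2] by auto
  qed
  also have "\<dots> \<le> (\<integral>s. 2 * (norm (V (i, s)) * speed (i, s)) \<partial>lborel)"
    by (intro integral_mono integrable_abs gi wi b)
  finally show ?thesis by (simp add: f_def)
qed

lemma two_lines_cost:
  assumes "i \<noteq> j"
  shows "2 * level_cost ((norm (\<psi> (grid_point l (i, t))))\<^sup>2) + 2 * level_cost ((norm (\<psi> (grid_point l (j, s))))\<^sup>2)
     \<le> (\<integral>x. 2 * (norm (V x) * speed x) \<partial>grid_measure)"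
proof -
  have int: "integrable grid_measure (\<lambda>x. 2 * (norm (V x) * speed x))" using speed_V_integrable by simp
  have "(\<Sum>k\<in>{i, j}. \<integral>t. 2 * (norm (V (k, t)) * speed (k, t)) \<partial>lborel) \<le> (\<integral>x. 2 * (norm (V x) * speed x) \<partial>grid_measure)"
    by (rule sum_grid_lines_le_integral[OF int]) (auto simp: speed_nonneg)
  then show ?thesis using assms level_cost_le_line[of i t] level_cost_le_line[of j s] by simp
qed

lemma one_line_cost:
  "2 * level_cost ((norm (\<psi> (grid_point l x)))\<^sup>2) \<le> (\<integral>x. 2 * (norm (V x) * speed x) \<partial>grid_measure)"
proof (cases x)
  case (Pair i t)
  have int: "integrable grid_measure (\<lambda>x. 2 * (norm (V x) * speed x))" using speed_V_integrable by simp
  show ?thesis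
    using level_cost_le_line[of i t] integral_grid_line_le[OF int, of i] by (auto simp: Pair speed_nonneg intro: order_trans)
qed

text \<open>A Gronwall argument. When the square vanishes, \<open>norm V = speed\<close> almost
  everywhere, so the derivative of the squared modulus is at most \<open>c\<close> times the squared
  modulus itself; after multiplication by \<open>exp (- c * t)\<close> it decreases, and by
  \<open>exp (c * t)\<close> it increases, so a zero spreads in both directions.\<close>

lemma zero_on_line_if_calibrated:
  assumes z: "(\<integral>x. (norm (V x) - speed x)\<^sup>2 \<partial>grid_measure) = 0" and a: "\<psi> (grid_point l (i, a)) = 0"
  shows "\<psi> (grid_point l (i, b)) = 0"
proof -
  define f where "f s = (norm (\<psi> (grid_point l (i, s))))\<^sup>2" for s
  define f' where "f' s = 2 * (\<psi> (grid_point l (i, s)) \<bullet> V (i, s))" for s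
  define c where "c = 2 * (R / sqrt 3)"
  have c0: "c \<ge> 0" using R by (simp add: c_def)
  have fP: "is_primitive f f'" unfolding f_def f'_def by (rule is_primitive_norm_square[OF H1_pairD(1)[OF H]])
  have "(\<integral>s. (norm (V (i, s)) - speed (i, s))\<^sup>2 \<partial>lborel) \<le> 0"
    using integral_grid_line_le[OF energy_calibration(2), of i] z by simp
  moreover have "0 \<le> (\<integral>s. (norm (V (i, s)) - speed (i, s))\<^sup>2 \<partial>lborel)" by (intro integral_nonneg_AE) simp
  ultimately have "(\<integral>s. (norm (V (i, s)) - speed (i, s))\<^sup>2 \<partial>lborel) = 0" by linarith
  then have "AE s in lborel. (norm (V (i, s)) - speed (i, s))\<^sup>2 = 0"
    using integral_nonneg_eq_0_iff_AE[OF integrable_grid_line[OF energy_calibration(2), of i]] by simp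
  then have AEb: "AE s in lborel. \<bar>f' s\<bar> \<le> c * f s"
  proof eventually_elim
    case (elim s)
    then have Vs: "norm (V (i, s)) = speed (i, s)" by simp
    have "\<bar>f' s\<bar> \<le> 2 * (norm (\<psi> (grid_point l (i, s))) * norm (V (i, s)))"
      using Cauchy_Schwarz_ineq2[of "\<psi> (grid_point l (i, s))" "V (i, s)"] by (simp add: f'_def abs_mult)
    also have "\<dots> \<le> 2 * (norm (\<psi> (grid_point l (i, s))) * (R / sqrt 3 * norm (\<psi> (grid_point l (i, s)))))"
      unfolding Vs by (intro mult_left_mono speed_le) auto
    also have "\<dots> = c * f s" by (simp add: c_def f_def power2_eq_square)
    finally show ?case .
  qed
  have expP: "is_primitive (\<lambda>t. exp (k * t)) (\<lambda>t. k * exp (k * t))" for k :: real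
  proof (rule is_primitive_FTC[where S = "{}"])
    show "continuous_on UNIV (\<lambda>t. exp (k * t))" by (intro continuous_intros)
    show "((\<lambda>t. exp (k * t)) has_vector_derivative k * exp (k * x)) (at x)" for x
      by (auto intro!: derivative_eq_intros simp: has_real_derivative_iff_has_vector_derivative[symmetric])
    have "continuous_on UNIV (\<lambda>t. k * exp (k * t))" by (intro continuous_intros)
    from continuous_bounded_Icc[OF this] show "\<exists>B. \<forall>t\<in>{a..b}. norm (k * exp (k * t)) \<le> B" for a b by metis
  qed auto
  have prod: "is_primitive (\<lambda>t. exp (k * t) * f t) (\<lambda>t. k * exp (k * t) * f t + exp (k * t) * f' t)" for k
    using is_primitive_bilinear[OF bounded_bilinear_mult expP fP] by simp
  have fa: "f a = 0" using a by (simp add: f_def)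
  have "f b \<le> 0"
  proof (cases "a \<le> b")
    case True
    have "exp (- c * b) * f b - exp (- c * a) * f a = (LINT t:{a..b}|lborel. (- c) * exp (- c * t) * f t + exp (- c * t) * f' t)"
      by (rule is_primitiveD(3)[OF prod True])
    also have "\<dots> \<le> (LINT t:{a..b}|lborel. 0)"
    proof (rule set_integral_mono_AE[OF is_primitiveD(2)[OF prod]])
      show "AE t\<in>{a..b} in lborel. (- c) * exp (- c * t) * f t + exp (- c * t) * f' t \<le> 0"
        using AEb
      proof eventually_elim
        case (elim t)
        have "(- c) * exp (- c * t) * f t + exp (- c * t) * f' t = exp (- c * t) * (f' t - c * f t)" by (simp add: algebra_simps)
        also have "\<dots> \<le> 0" using elim by (intro mult_nonneg_nonpos) auto
        finally show ?case by simp
      qed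
    qed (simp add: set_integrable_def)
    finally show ?thesis by (simp add: fa mult_le_0_iff)
  next
    case False
    then have ba: "b \<le> a" by simp
    have "0 \<le> (LINT t:{b..a}|lborel. c * exp (c * t) * f t + exp (c * t) * f' t)"
    proof -
      have "(LINT t:{b..a}|lborel. 0) \<le> (LINT t:{b..a}|lborel. c * exp (c * t) * f t + exp (c * t) * f' t)"
      proof (rule set_integral_mono_AE[OF _ is_primitiveD(2)[OF prod]])
        show "AE t\<in>{b..a} in lborel. 0 \<le> c * exp (c * t) * f t + exp (c * t) * f' t"
          using AEb
        proof eventually_elim
          case (elim t)
          have "0 \<le> exp (c * t) * (f' t + c * f t)" using elim by (intro mult_nonneg_nonneg) auto
          then show ?case by (simp add: algebra_simps)
        qed
      qed (simp add: set_integrable_def)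
      then show ?thesis by simp
    qed
    also have "\<dots> = exp (c * a) * f a - exp (c * b) * f b" by (rule is_primitiveD(3)[OF prod ba, symmetric])
    finally show ?thesis by (simp add: fa mult_le_0_iff)
  qed
  then show ?thesis by (simp add: f_def)
qed

end

end

section \<open>Strict positivity of the energy up to the critical mass\<close>

lemma ex_other_line:
  obtains i2 t2 where "i2 \<noteq> i" "grid_point l (i2, t2) = grid_point l (i, 0)"
proof -
  obtain a m n where i: "i = (a, m, n)" by (cases i)
  show thesis
  proof (cases a)
    case XAxis
    then show thesis using that[of "(YAxis, 0, n)" "of_int m * l"] by (simp add: i grid_point_def)
  next
    case YAxis
    then show thesis using that[of "(XAxis, 0, n)" "of_int m * l"] by (simp add: i grid_point_def)
  next
    case ZAxis
    then show thesis using that[of "(XAxis, n, 0)" "of_int m * l"] by (simp add: i grid_point_def)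
  qed
qed

theorem energy_pos_critical:
  assumes l: "l > 0" and H: "H1_pair l \<psi> V" and m: "0 < mass_of l \<psi>" "mass_of l \<psi> \<le> sqrt 3 * pi / 2"
  shows "energy_of l 6 \<psi> V > 0"
proof (rule ccontr)
  assume "\<not> energy_of l 6 \<psi> V > 0"
  then have E: "energy_of l 6 \<psi> V \<le> 0" by simp
  define f where "f x = (norm (\<psi> (grid_point l x)))\<^sup>2" for x
  define R where "R = (SUP x. f x)"
  have bdd: "bdd_above (range f)"
    using norm_square_le_sqrt_mass_kinetic[OF H] by (intro bdd_aboveI2[of _ _ "sqrt (mass_of l \<psi> * kinetic V)"]) (simp add: f_def)
  have fR: "f x \<le> R" for x unfolding R_def by (rule cSUP_upper[OF _ bdd]) simp
  obtain x0 where x0: "\<psi> (grid_point l x0) \<noteq> 0" using mass_of_eq_0_iff[OF H] m by force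
  have R: "R > 0"
  proof -
    have "0 < f x0" using x0 by (simp add: f_def)
    then show ?thesis using fR[of x0] by linarith
  qed
  have le: "(norm (\<psi> (grid_point l x)))\<^sup>2 \<le> R" for x using fR[of x] by (simp add: f_def)
  note ctx = R l H le
  define T where "T = (\<integral>x. 2 * (norm (V x) * speed R l \<psi> x) \<partial>grid_measure)"
  define D where "D = (\<integral>x. (norm (V x) - speed R l \<psi> x)\<^sup>2 \<partial>grid_measure)"
  have cal: "2 * energy_of l 6 \<psi> V = D + T - R\<^sup>2 / 3 * mass_of l \<psi>"
    unfolding D_def T_def by (rule energy_calibration(1)[OF ctx])
  have D0: "D \<ge> 0" unfolding D_def by (intro integral_nonneg_AE) simp
  \<comment> \<open>The supremum \<open>R\<close> need not be attained, so a bound at every point of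
    the grid is carried over by continuity of \<open>level_cost R\<close>. The offset
    \<open>c\<close> leaves room for the crossing line used at the end.\<close>
  have sup: "2 * level_cost R R + c \<le> T" if c: "\<And>x. 2 * level_cost R (f x) + c \<le> T" for c
  proof (rule field_le_epsilon)
    fix e :: real assume e: "e > 0"
    have "continuous_on {0..R} (level_cost R)" by (rule level_cost_continuous[OF R])
    then obtain d where d: "d > 0" "\<And>s. s \<in> {0..R} \<Longrightarrow> dist s R < d \<Longrightarrow> dist (level_cost R s) (level_cost R R) < e / 2"
      unfolding continuous_on_iff using R e by (metis atLeastAtMost_iff half_gt_zero less_imp_le order_refl)
    have "R - d < (SUP x. f x)" using d by (simp add: R_def[symmetric])
    then obtain x where x: "R - d < f x" using less_cSUP_iff[OF _ bdd] by blast
    have "dist (level_cost R (f x)) (level_cost R R) < e / 2"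
      by (rule d(2)) (use x fR[of x] in \<open>auto simp: dist_real_def f_def\<close>)
    then show "2 * level_cost R R + c \<le> T + e" using c[of x] unfolding dist_real_def by linarith
  qed
  have T1: "2 * level_cost R R \<le> T"
    using sup[of 0] one_line_cost[OF ctx] by (simp add: T_def f_def)
  have LR: "2 * level_cost R R = R\<^sup>2 / 3 * (sqrt 3 * pi / 2)" by (rule level_cost_R[OF R])
  have mle: "R\<^sup>2 / 3 * mass_of l \<psi> \<le> R\<^sup>2 / 3 * (sqrt 3 * pi / 2)" using m by (intro mult_left_mono) auto
  have "D \<le> 0" using cal E T1 LR mle by linarith
  then have Dz: "D = 0" using D0 by simp
  obtain i t where x0i: "x0 = (i, t)" by (cases x0)
  \<comment> \<open>A zero at parameter 0 would spread along the whole line, which contains the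
    nonzero value at \<open>x0\<close>. Parameter 0 is a vertex, so a second line passes through
    this point.\<close>
  have nz: "\<psi> (grid_point l (i, 0)) \<noteq> 0"
    using zero_on_line_if_calibrated[OF ctx Dz[unfolded D_def], of i 0 t] x0 x0i by blast
  obtain i2 t2 where i2: "i2 \<noteq> i" "grid_point l (i2, t2) = grid_point l (i, 0)" by (rule ex_other_line)
  define c where "c = 2 * level_cost R (f (i, 0))"
  have c: "c > 0" unfolding c_def using level_cost_pos[OF R, of "f (i, 0)"] nz fR by (simp add: f_def)
  \<comment> \<open>The supremum may be approached on any line. A point outside line
    \<open>i\<close> is paired with the vertex seen on \<open>i\<close>, a point on \<open>i\<close>
    with the same vertex seen on \<open>i2\<close>; in both cases the two lines are distinct, so
    their costs add up.\<close>
  have "2 * level_cost R (f x) + c \<le> T" for x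
  proof -
    obtain j s where x: "x = (j, s)" by (cases x)
    show ?thesis
    proof (cases "j = i")
      case False
      then show ?thesis using two_lines_cost[OF ctx False, of s 0] by (simp add: x c_def f_def T_def)
    next
      case True
      then have "j \<noteq> i2" using i2 by simp
      from two_lines_cost[OF ctx this, of s t2] show ?thesis by (simp add: x c_def f_def T_def i2(2))
    qed
  qed
  then have "2 * level_cost R R + c \<le> T" by (rule sup)
  then show False using cal E D0 LR mle c by linarith
qed

section \<open>Concentration at the critical power\<close>

text \<open>The soliton lowered by its value at \<open>R\<close>, which keeps it continuous when cut
  off; with compact support a rescaled copy fits into one edge.\<close>

definition sech_profile :: "real \<Rightarrow> real \<Rightarrow> real" where
  "sech_profile R t = (if \<bar>t\<bar> \<le> R then 1 / sqrt (cosh t) - 1 / sqrt (cosh R) else 0)"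

definition sech_profile_deriv :: "real \<Rightarrow> real \<Rightarrow> real" where
  "sech_profile_deriv R t = (if \<bar>t\<bar> \<le> R then - sinh t / (2 * (cosh t * sqrt (cosh t))) else 0)"

lemma cosh_le_if_abs_le: "\<bar>t\<bar> \<le> R \<Longrightarrow> cosh t \<le> cosh R" for t R :: real
  by (metis abs_ge_zero cosh_real_abs cosh_real_nonneg_le_iff order_trans)

lemma sech_profile_bounds:
  "0 \<le> sech_profile R t" "sech_profile R t \<le> 1"
proof -
  have "1 / sqrt (cosh R) \<le> 1 / sqrt (cosh t)" if "\<bar>t\<bar> \<le> R"
    using cosh_le_if_abs_le[OF that] cosh_real_pos[of t] by (intro divide_left_mono) auto
  then show "0 \<le> sech_profile R t" by (auto simp: sech_profile_def)
  have "1 / sqrt (cosh t) \<le> 1" using cosh_real_ge_1[of t] by simp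
  moreover have "0 \<le> 1 / sqrt (cosh R)" using cosh_real_pos[of R] by simp
  ultimately have "1 / sqrt (cosh t) - 1 / sqrt (cosh R) \<le> 1" by linarith
  then show "sech_profile R t \<le> 1" unfolding sech_profile_def by (cases "\<bar>t\<bar> \<le> R") simp_all
qed

lemma sech_profile_has_deriv:
  "((\<lambda>t. 1 / sqrt (cosh t) - 1 / sqrt (cosh R)) has_real_derivative - sinh t / (2 * (cosh t * sqrt (cosh t)))) (at t)"
proof -
  have c: "cosh t > 0" by (rule cosh_real_pos)
  then have s: "sqrt (cosh t) * sqrt (cosh t) = cosh t" by simp
  have "((\<lambda>t. 1 / sqrt (cosh t) - 1 / sqrt (cosh R)) has_real_derivative
    - (sinh t * (inverse (sqrt (cosh t)) / 2)) / (sqrt (cosh t) * sqrt (cosh t))) (at t)"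
    using c less_not_sym[OF c] by (auto intro!: derivative_eq_intros simp: field_simps)
  also have "- (sinh t * (inverse (sqrt (cosh t)) / 2)) / (sqrt (cosh t) * sqrt (cosh t)) = - sinh t / (2 * (cosh t * sqrt (cosh t)))"
    unfolding s by (simp add: field_simps)
  finally show ?thesis .
qed

lemma sech_profile_primitive:
  assumes R: "R > 0"
  shows "is_primitive (sech_profile R) (sech_profile_deriv R)"
proof (rule is_primitive_FTC[where S = "{-R, R}"])
  have c: "continuous_on A (\<lambda>t. 1 / sqrt (cosh t) - 1 / sqrt (cosh R))" for A :: "real set"
    by (intro continuous_intros) (use cosh_real_pos in \<open>auto simp: less_le\<close>)
  have cd: "continuous_on A (\<lambda>t. - sinh t / (2 * (cosh t * sqrt (cosh t))))" for A :: "real set"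
    by (intro continuous_intros) (use cosh_real_pos in \<open>auto simp: less_le\<close>)
  have "continuous_on ({-R..R} \<union> ({..-R} \<union> {R..})) (\<lambda>t. if t \<in> {-R..R} then 1 / sqrt (cosh t) - 1 / sqrt (cosh R) else 0)"
    by (intro continuous_on_If closed_Un closed_atLeastAtMost closed_atMost closed_atLeast c continuous_on_const)
       (use R in \<open>auto simp: cosh_minus\<close>)
  moreover have "{-R..R} \<union> ({..-R} \<union> {R..}) = UNIV" using R by auto
  ultimately show "continuous_on UNIV (sech_profile R)"
    by (simp add: sech_profile_def[abs_def] abs_le_iff minus_le_iff conj_commute)
  show "(sech_profile R has_vector_derivative sech_profile_deriv R x) (at x)" if x: "x \<notin> {-R, R}" for x
  proof (cases "\<bar>x\<bar> < R")
    case True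
    have "(sech_profile R has_real_derivative - sinh x / (2 * (cosh x * sqrt (cosh x)))) (at x)"
      by (rule has_field_derivative_transform_within_open[OF sech_profile_has_deriv[of R], where S = "{-R<..<R}"])
        (use True in \<open>auto simp: sech_profile_def\<close>)
    then show ?thesis using True by (simp add: sech_profile_deriv_def has_real_derivative_iff_has_vector_derivative)
  next
    case False
    then have out: "\<bar>x\<bar> > R" using x by auto
    have "open {t. \<bar>t\<bar> > R}" by (intro open_Collect_less continuous_intros)
    then have "(sech_profile R has_real_derivative 0) (at x)"
      by - (rule has_field_derivative_transform_within_open[where f = "\<lambda>_. 0" and S = "{t. \<bar>t\<bar> > R}"], use out in \<open>auto simp: sech_profile_def\<close>)
    then show ?thesis using out by (simp add: sech_profile_deriv_def has_real_derivative_iff_has_vector_derivative)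
  qed
  show m: "sech_profile_deriv R \<in> borel_measurable borel"
  proof -
    have [measurable]: "(\<lambda>t::real. - sinh t / (2 * (cosh t * sqrt (cosh t)))) \<in> borel_measurable borel"
      by (rule borel_measurable_continuous_onI[OF cd])
    show ?thesis unfolding sech_profile_deriv_def[abs_def] by measurable
  qed
  obtain B where B: "B > 0" "\<And>t. t \<in> {-R..R} \<Longrightarrow> norm (- sinh t / (2 * (cosh t * sqrt (cosh t)))) \<le> B"
    by (rule continuous_bounded_Icc[OF cd]) blast
  have "norm (sech_profile_deriv R t) \<le> B" for t
  proof (cases "\<bar>t\<bar> \<le> R")
    case True
    then have "t \<in> {-R..R}" by auto
    from B(2)[OF this] True show ?thesis by (simp add: sech_profile_deriv_def)
  next
    case False
    then show ?thesis using B(1) by (simp add: sech_profile_deriv_def)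
  qed
  then show "\<exists>B. \<forall>t\<in>{a..b}. norm (sech_profile_deriv R t) \<le> B" for a b by blast
qed simp

text \<open>The limits \<open>pi\<close>, \<open>pi / 8\<close>, \<open>pi / 2\<close> are those of the critical soliton \<open>cosh\<^sup>-\<^sup>1\<^sup>/\<^sup>2\<close> on the line.\<close>

lemma sech_profile_integrals:
  assumes R: "R > 0"
  shows "integrable lborel (\<lambda>t. (sech_profile R t)\<^sup>2)" "(\<integral>t. (sech_profile R t)\<^sup>2 \<partial>lborel) \<le> pi"
    "integrable lborel (\<lambda>t. (sech_profile_deriv R t)\<^sup>2)" "(\<integral>t. (sech_profile_deriv R t)\<^sup>2 \<partial>lborel) \<le> pi / 8"
    "integrable lborel (\<lambda>t. (sech_profile R t) ^ 6)"
    "arctan (sinh R) + sinh R / (cosh R)\<^sup>2 - 12 * R / sqrt (cosh R) \<le> (\<integral>t. (sech_profile R t) ^ 6 \<partial>lborel)"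
proof -
  have cne: "cosh t \<noteq> 0" "cosh t > 0" for t :: real using cosh_real_pos[of t] by auto
  have ch: "(cosh t)\<^sup>2 = 1 + (sinh t)\<^sup>2" for t :: real using hyperbolic_pythagoras[of t] by simp
  have cu: "continuous_on UNIV (sech_profile R)" by (rule is_primitive_continuous[OF sech_profile_primitive[OF R]])
  have cR: "R \<le> R" "- R \<le> R" using R by auto
  have dA: "((\<lambda>t. arctan (sinh t)) has_real_derivative 1 / cosh t) (at t)" for t :: real
  proof -
    have "((\<lambda>t. arctan (sinh t)) has_real_derivative inverse (1 + (sinh t)\<^sup>2) * cosh t) (at t)"
      by (auto intro!: derivative_eq_intros)
    then show ?thesis unfolding ch[symmetric] using cne[of t] by (simp add: power2_eq_square field_simps)
  qed
  \<comment> \<open>Together with \<open>dA\<close> this yields antiderivatives of both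
    \<open>1 / cosh t\<close> and its cube by taking half sums and half differences.\<close>
  have dT: "((\<lambda>t. sinh t / (cosh t)\<^sup>2) has_real_derivative 2 / (cosh t) ^ 3 - 1 / cosh t) (at t)" for t :: real
  proof -
    have "((\<lambda>t. sinh t / (cosh t)\<^sup>2) has_real_derivative (cosh t * (cosh t)\<^sup>2 - sinh t * (2 * cosh t * sinh t)) / ((cosh t)\<^sup>2 * (cosh t)\<^sup>2)) (at t)"
      using cne[of t] by (auto intro!: derivative_eq_intros simp: power2_eq_square)
    moreover have "cosh t * (cosh t)\<^sup>2 - sinh t * (2 * cosh t * sinh t) = cosh t * (2 - (cosh t)\<^sup>2)"
      unfolding ch by (simp add: algebra_simps power2_eq_square)
    moreover have "cosh t * (2 - (cosh t)\<^sup>2) / ((cosh t)\<^sup>2 * (cosh t)\<^sup>2) = 2 / (cosh t) ^ 3 - 1 / cosh t"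
      using cne[of t] by (simp add: field_simps power2_eq_square power3_eq_cube)
    ultimately show ?thesis by simp
  qed
  have cinv: "continuous_on A (\<lambda>t. 1 / cosh t)" "continuous_on A (\<lambda>t. 1 / (cosh t) ^ 3)" "continuous_on A (\<lambda>t. 1 / cosh t - 1 / (cosh t) ^ 3)" for A :: "real set"
    using cne by (auto intro!: continuous_intros)
  have FTC: "(LINT t:{-R..R}|lborel. f t) = F R - F (- R)"
    if "\<And>t. (F has_real_derivative f t) (at t)" "\<And>A. continuous_on A f" for F f :: "real \<Rightarrow> real"
    unfolding set_lebesgue_integral_def
  proof (rule integral_FTC_Icc[OF cR(2)])
    show "(F has_vector_derivative f x) (at x within {- R..R})" for x
      using that(1)[of x] by (simp add: has_real_derivative_iff_has_vector_derivative has_vector_derivative_at_within)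
  qed (rule that(2))
  have I1: "(LINT t:{-R..R}|lborel. 1 / cosh t) = 2 * arctan (sinh R)"
    by (subst FTC[OF dA cinv(1)]) (simp add: arctan_minus)
  have d2: "((\<lambda>t. (arctan (sinh t) - sinh t / (cosh t)\<^sup>2) / 2) has_real_derivative 1 / cosh t - 1 / (cosh t) ^ 3) (at t)" for t :: real
  proof -
    have "((\<lambda>t. (arctan (sinh t) - sinh t / (cosh t)\<^sup>2) / 2) has_real_derivative (1 / cosh t - (2 / (cosh t) ^ 3 - 1 / cosh t)) / 2) (at t)"
      by (intro DERIV_cdivide DERIV_diff dA dT)
    also have "(1 / cosh t - (2 / (cosh t) ^ 3 - 1 / cosh t)) / 2 = 1 / cosh t - 1 / (cosh t) ^ 3" by (simp add: field_simps)
    finally show ?thesis .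
  qed
  have I2: "(LINT t:{-R..R}|lborel. 1 / cosh t - 1 / (cosh t) ^ 3) = arctan (sinh R) - sinh R / (cosh R)\<^sup>2"
    by (subst FTC[OF d2 cinv(3)]) (simp add: arctan_minus field_simps)
  have d3: "((\<lambda>t. (arctan (sinh t) + sinh t / (cosh t)\<^sup>2) / 2) has_real_derivative 1 / (cosh t) ^ 3) (at t)" for t :: real
  proof -
    have "((\<lambda>t. (arctan (sinh t) + sinh t / (cosh t)\<^sup>2) / 2) has_real_derivative (1 / cosh t + (2 / (cosh t) ^ 3 - 1 / cosh t)) / 2) (at t)"
      by (intro DERIV_cdivide DERIV_add dA dT)
    also have "(1 / cosh t + (2 / (cosh t) ^ 3 - 1 / cosh t)) / 2 = 1 / (cosh t) ^ 3" by (simp add: field_simps)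
    finally show ?thesis .
  qed
  have I3: "(LINT t:{-R..R}|lborel. 1 / (cosh t) ^ 3) = arctan (sinh R) + sinh R / (cosh R)\<^sup>2"
    by (subst FTC[OF d3 cinv(2)]) (simp add: arctan_minus field_simps)
  have out: "sech_profile R t = 0" "sech_profile_deriv R t = 0" if "t \<notin> {-R..R}" for t
    using that by (auto simp: sech_profile_def sech_profile_deriv_def abs_le_iff)
  have s2: "set_integrable lborel {-R..R} (\<lambda>t. (sech_profile R t)\<^sup>2)" and s6: "set_integrable lborel {-R..R} (\<lambda>t. (sech_profile R t) ^ 6)"
    by (intro borel_integrable_atLeastAtMost' continuous_on_power continuous_on_subset[OF cu] subset_UNIV)+
  have si: "set_integrable lborel {-R..R} (\<lambda>t. 1 / cosh t)" "set_integrable lborel {-R..R} (\<lambda>t. 1 / (cosh t) ^ 3)" "set_integrable lborel {-R..R} (\<lambda>t. 1 / cosh t - 1 / (cosh t) ^ 3)"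
    by (intro borel_integrable_atLeastAtMost' cinv)+
  show "integrable lborel (\<lambda>t. (sech_profile R t)\<^sup>2)" "integrable lborel (\<lambda>t. (sech_profile R t) ^ 6)"
    by (rule integrable_vanishing_outside_Icc(1)[OF s2], simp add: out, rule integrable_vanishing_outside_Icc(1)[OF s6], simp add: out)
  have e2: "(\<integral>t. (sech_profile R t)\<^sup>2 \<partial>lborel) = (LINT t:{-R..R}|lborel. (sech_profile R t)\<^sup>2)"
    by (rule integrable_vanishing_outside_Icc(2)[OF s2]) (simp add: out)
  have e6: "(\<integral>t. (sech_profile R t) ^ 6 \<partial>lborel) = (LINT t:{-R..R}|lborel. (sech_profile R t) ^ 6)"
    by (rule integrable_vanishing_outside_Icc(2)[OF s6]) (simp add: out)
  have sq: "(1 / sqrt (cosh t))\<^sup>2 = 1 / cosh t" for t :: real using cne[of t] by (simp add: power_divide)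
  have dpos: "0 < 1 / sqrt (cosh R)" using cne[of R] by simp
  have ple: "1 / sqrt (cosh R) \<le> 1 / sqrt (cosh t)" if "t \<in> {-R..R}" for t
    using cosh_le_if_abs_le[of t R] that cne by (intro divide_left_mono) (auto simp: abs_le_iff)
  have "(LINT t:{-R..R}|lborel. (sech_profile R t)\<^sup>2) \<le> (LINT t:{-R..R}|lborel. 1 / cosh t)"
  proof (rule set_integral_mono[OF s2 si(1)])
    fix t assume t: "t \<in> {-R..R}"
    have "sech_profile R t \<le> 1 / sqrt (cosh t)" using dpos t by (simp add: sech_profile_def)
    then have "(sech_profile R t)\<^sup>2 \<le> (1 / sqrt (cosh t))\<^sup>2" using sech_profile_bounds by (intro power_mono)
    then show "(sech_profile R t)\<^sup>2 \<le> 1 / cosh t" unfolding sq .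
  qed
  also have "\<dots> \<le> pi" using arctan_ubound[of "sinh R"] by (simp add: I1)
  finally show "(\<integral>t. (sech_profile R t)\<^sup>2 \<partial>lborel) \<le> pi" unfolding e2 .
  have v: "(sech_profile_deriv R t)\<^sup>2 = 1 / 4 * (1 / cosh t - 1 / (cosh t) ^ 3)" if "t \<in> {-R..R}" for t
  proof -
    have "(sech_profile_deriv R t)\<^sup>2 = (sinh t)\<^sup>2 / (4 * ((cosh t)\<^sup>2 * (sqrt (cosh t))\<^sup>2))"
      using that by (simp add: sech_profile_deriv_def abs_le_iff power_divide power_mult_distrib)
    also have "\<dots> = ((cosh t)\<^sup>2 - 1) / (4 * (cosh t) ^ 3)"
      using cne[of t] ch[of t] by (simp add: power2_eq_square power3_eq_cube)
    also have "\<dots> = 1 / 4 * (1 / cosh t - 1 / (cosh t) ^ 3)" using cne[of t] by (simp add: field_simps power2_eq_square power3_eq_cube)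
    finally show ?thesis .
  qed
  have sv: "set_integrable lborel {-R..R} (\<lambda>t. (sech_profile_deriv R t)\<^sup>2)"
  proof -
    have "set_integrable lborel {-R..R} (\<lambda>t. 1 / 4 * (1 / cosh t - 1 / (cosh t) ^ 3))" by (intro set_integrable_mult_right impI si)
    then show ?thesis using v by (subst set_integrable_cong[OF refl refl v]) auto
  qed
  show "integrable lborel (\<lambda>t. (sech_profile_deriv R t)\<^sup>2)"
    by (rule integrable_vanishing_outside_Icc(1)[OF sv]) (simp add: out)
  have "(\<integral>t. (sech_profile_deriv R t)\<^sup>2 \<partial>lborel) = (LINT t:{-R..R}|lborel. (sech_profile_deriv R t)\<^sup>2)"
    by (rule integrable_vanishing_outside_Icc(2)[OF sv]) (simp add: out)
  also have "\<dots> = (LINT t:{-R..R}|lborel. 1 / 4 * (1 / cosh t - 1 / (cosh t) ^ 3))"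
    by (rule set_lebesgue_integral_cong) (use v in auto)
  also have "\<dots> = 1 / 4 * (arctan (sinh R) - sinh R / (cosh R)\<^sup>2)" unfolding I2[symmetric] by (rule set_integral_mult_right)
  also have "\<dots> \<le> pi / 8"
  proof -
    have "0 \<le> sinh R / (cosh R)\<^sup>2" using R by simp
    then show ?thesis using arctan_ubound[of "sinh R"] by simp
  qed
  finally show "(\<integral>t. (sech_profile_deriv R t)\<^sup>2 \<partial>lborel) \<le> pi / 8" .
  define d where "d = 1 / sqrt (cosh R)"
  have sc: "set_integrable lborel {-R..R} (\<lambda>t. 6 * d)" by (intro borel_integrable_atLeastAtMost' continuous_intros)
  have "(LINT t:{-R..R}|lborel. 1 / (cosh t) ^ 3 - 6 * d) \<le> (LINT t:{-R..R}|lborel. (sech_profile R t) ^ 6)"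
  proof (rule set_integral_mono[OF set_integral_diff(1)[OF si(2) sc] s6])
    fix t assume t: "t \<in> {-R..R}"
    define \<phi> where "\<phi> = 1 / sqrt (cosh t)"
    have \<phi>: "0 < \<phi>" "\<phi> \<le> 1" "0 < d" "d \<le> \<phi>"
      using cne[of t] cosh_real_ge_1[of t] dpos ple[OF t] by (auto simp: \<phi>_def d_def)
    \<comment> \<open>Bernoulli's inequality bounds the loss caused by lowering the soliton by
      \<open>d\<close>: at most \<open>6 * d\<close> pointwise. Over the interval this gives the
      error term \<open>12 * R / sqrt (cosh R)\<close>, which vanishes as \<open>R\<close>
      grows.\<close>
    have "1 + real 6 * (- d / \<phi>) \<le> (1 + (- d / \<phi>)) ^ 6"
      by (rule Bernoulli_inequality) (use \<phi> in \<open>simp add: field_simps\<close>)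
    then have "\<phi> ^ 6 * (1 + real 6 * (- d / \<phi>)) \<le> \<phi> ^ 6 * (1 + (- d / \<phi>)) ^ 6" using \<phi> by (intro mult_left_mono) auto
    also have "\<phi> ^ 6 * (1 + (- d / \<phi>)) ^ 6 = (\<phi> - d) ^ 6" using \<phi> by (simp add: power_mult_distrib[symmetric] algebra_simps)
    also have "\<phi> ^ 6 * (1 + real 6 * (- d / \<phi>)) = \<phi> ^ 6 - 6 * d * \<phi> ^ 5"
      using \<phi> by (simp add: field_simps eval_nat_numeral)
    finally have "\<phi> ^ 6 - 6 * d * \<phi> ^ 5 \<le> (\<phi> - d) ^ 6" .
    moreover have "6 * d * \<phi> ^ 5 \<le> 6 * d * 1" using \<phi> by (intro mult_left_mono power_le_one) auto
    moreover have "\<phi> ^ 6 = 1 / (cosh t) ^ 3"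
    proof -
      have "\<phi> ^ 6 = (\<phi>\<^sup>2) ^ 3" by (simp flip: power_mult)
      then show ?thesis unfolding \<phi>_def sq by (simp add: power_divide)
    qed
    moreover have "sech_profile R t = \<phi> - d" using t by (simp add: sech_profile_def \<phi>_def d_def abs_le_iff)
    ultimately show "1 / (cosh t) ^ 3 - 6 * d \<le> (sech_profile R t) ^ 6" by simp
  qed
  also have "(LINT t:{-R..R}|lborel. 1 / (cosh t) ^ 3 - 6 * d) = arctan (sinh R) + sinh R / (cosh R)\<^sup>2 - (LINT t:{-R..R}|lborel. 6 * d)"
    by (simp add: set_integral_diff(2)[OF si(2) sc] I3)
  also have "(LINT t:{-R..R}|lborel. 6 * d) = 12 * R / sqrt (cosh R)"
    using R by (simp add: set_lebesgue_integral_def d_def)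
  finally show "arctan (sinh R) + sinh R / (cosh R)\<^sup>2 - 12 * R / sqrt (cosh R) \<le> (\<integral>t. (sech_profile R t) ^ 6 \<partial>lborel)"
    unfolding e6 .
qed

lemma integral_grid_single_line:
  fixes f :: "grid_line_index \<times> real \<Rightarrow> real"
  assumes f: "f \<in> borel_measurable grid_measure" and nn: "\<And>x. f x \<ge> 0" and z: "\<And>i t. i \<noteq> i0 \<Longrightarrow> f (i, t) = 0"
    and int: "integrable lborel (\<lambda>t. f (i0, t))"
  shows "integrable grid_measure f" "(\<integral>x. f x \<partial>grid_measure) = (\<integral>t. f (i0, t) \<partial>lborel)"
proof -
  note [measurable] = f
  have "(\<integral>\<^sup>+x. ennreal (f x) \<partial>grid_measure) = (\<integral>\<^sup>+i. (\<integral>\<^sup>+t. ennreal (f (i, t)) \<partial>lborel) \<partial>count_space UNIV)"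
    by (rule nn_integral_grid) measurable
  also have "\<dots> = (\<Sum>i\<in>{i0}. \<integral>\<^sup>+t. ennreal (f (i, t)) \<partial>lborel)"
    by (rule nn_integral_count_space') (auto simp: z)
  also have "\<dots> = ennreal (\<integral>t. f (i0, t) \<partial>lborel)"
    using nn_integral_eq_integral[OF int] nn by simp
  finally have *: "(\<integral>\<^sup>+x. ennreal (f x) \<partial>grid_measure) = ennreal (\<integral>t. f (i0, t) \<partial>lborel)" .
  show i: "integrable grid_measure f"
    by (rule integrableI_nonneg) (use * nn in auto)
  have "ennreal (\<integral>x. f x \<partial>grid_measure) = ennreal (\<integral>t. f (i0, t) \<partial>lborel)"
    using nn_integral_eq_integral[OF i] nn * by simp
  then show "(\<integral>x. f x \<partial>grid_measure) = (\<integral>t. f (i0, t) \<partial>lborel)"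
    by (subst (asm) ennreal_inj) (auto intro!: integral_nonneg_AE simp: nn)
qed

lemma is_primitive_affine:
  fixes u :: "real \<Rightarrow> real"
  assumes u: "is_primitive u v" and s: "s > 0"
  shows "is_primitive (\<lambda>t. u (s * (t - b))) (\<lambda>t. s * v (s * (t - b)))"
  unfolding is_primitive_def
proof (intro conjI allI impI)
  note [measurable] = is_primitiveD(1)[OF u]
  show "(\<lambda>t. s * v (s * (t - b))) \<in> borel_measurable borel" by measurable
  have e: "(\<lambda>t. indicator {c..d} t *\<^sub>R (s * v (s * (t - b)))) = (\<lambda>t. s * (\<lambda>r. indicator {s * (c - b)..s * (d - b)} r *\<^sub>R v r) (- (s * b) + s * t))" for c d
    using s by (auto simp: indicator_def fun_eq_iff algebra_simps)
  have i: "integrable lborel (\<lambda>r. indicator {s * (c - b)..s * (d - b)} r *\<^sub>R v r)" for c d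
    using is_primitiveD(2)[OF u, of "s * (c - b)" "s * (d - b)"] by (simp add: set_integrable_def)
  show "set_integrable lborel {c..d} (\<lambda>t. s * v (s * (t - b)))" for c d
    unfolding set_integrable_def e
    by (intro integrable_mult_right impI lborel_integrable_real_affine[OF i]) (use s in simp)
  show "u (s * (d - b)) - u (s * (c - b)) = (LINT t:{c..d}|lborel. s * v (s * (t - b)))" if "c \<le> d" for c d
  proof -
    have "s * (c - b) \<le> s * (d - b)" using that s by simp
    from is_primitiveD(3)[OF u this] show ?thesis
      using lborel_integral_real_affine[of s "\<lambda>r. indicator {s * (c - b)..s * (d - b)} r *\<^sub>R v r" "- (s * b)"] s
      unfolding set_lebesgue_integral_def e by simp
  qed
qed

text \<open>The rescaled profile is centred in the edge from 0 to \<open>l\<close> and has support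
  of width \<open>2 * R / s < l\<close>. It therefore vanishes at all vertices and can be extended
  by 0 to every other line.\<close>

lemma concentrated_function:
  assumes l: "l > 0" and R: "R > 0" and s: "s > 2 * R / l"
  obtains \<psi> V where "H1_pair l \<psi> V" "mass_of l \<psi> = (\<integral>t. (sech_profile R t)\<^sup>2 \<partial>lborel) / s"
    "kinetic V = s * (\<integral>t. (sech_profile_deriv R t)\<^sup>2 \<partial>lborel)" "power_of l 6 \<psi> = (\<integral>t. (sech_profile R t) ^ 6 \<partial>lborel) / s"
proof -
  have s0: "s > 0" using s l R by (meson divide_nonneg_pos le_less_trans less_imp_le mult_nonneg_nonneg zero_le_numeral)
  define u where "u t = sech_profile R (s * (t - l / 2))" for t
  define v where "v t = s * sech_profile_deriv R (s * (t - l / 2))" for t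
  have uv: "is_primitive u v" unfolding u_def v_def by (rule is_primitive_affine[OF sech_profile_primitive[OF R] s0])
  note [measurable] = is_primitive_borel[OF uv] is_primitiveD(1)[OF uv]
  define i0 :: grid_line_index where "i0 = (XAxis, 0, 0)"
  define \<psi> :: "real ^ 3 \<Rightarrow> complex" where "\<psi> x = (if x $ 2 = 0 \<and> x $ 3 = 0 then complex_of_real (u (x $ 1)) else 0)" for x
  define V where "V x = (if fst x = i0 then complex_of_real (v (snd x)) else 0)" for x
  have uvert: "u (of_int i * l) = 0" for i :: int
  proof -
    have "l / 2 \<le> \<bar>of_int i * l - l / 2\<bar>"
    proof (cases "i \<le> 0")
      case True
      then have "of_int i * l \<le> 0" using l by (simp add: mult_le_0_iff)
      then show ?thesis using l by linarith
    next
      case False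
      then have "1 * l \<le> of_int i * l" using l by (intro mult_right_mono) auto
      then show ?thesis using l by linarith
    qed
    then have "s * (l / 2) \<le> \<bar>s * (of_int i * l - l / 2)\<bar>" using s0 by (simp add: abs_mult)
    moreover have "R < s * (l / 2)" using s l by (simp add: field_simps)
    ultimately show ?thesis by (simp add: u_def sech_profile_def)
  qed
  have line: "\<psi> (grid_point l (i0, t)) = complex_of_real (u t)" for t by (simp add: \<psi>_def i0_def grid_point_def)
  have other: "\<psi> (grid_point l (i, t)) = 0" if "i \<noteq> i0" for i t
  proof -
    obtain a m n where i: "i = (a, m, n)" by (cases i)
    show ?thesis using that l uvert by (cases a) (auto simp: i i0_def \<psi>_def grid_point_def)
  qed
  have \<psi>m: "(\<lambda>x. \<psi> (grid_point l x)) \<in> borel_measurable grid_measure"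
  proof (rule borel_measurable_grid)
    show "(\<lambda>t. \<psi> (grid_point l (i, t))) \<in> borel_measurable borel" for i
      by (cases "i = i0") (simp_all add: line other)
  qed
  have Vm: "V \<in> borel_measurable grid_measure"
  proof (rule borel_measurable_grid)
    show "(\<lambda>t. V (i, t)) \<in> borel_measurable borel" for i by (cases "i = i0") (simp_all add: V_def)
  qed
  note I = sech_profile_integrals[OF R]
  have aff: "integrable lborel (\<lambda>t. h (s * (t - l / 2)))" "(\<integral>t. h (s * (t - l / 2)) \<partial>lborel) = (\<integral>t. h t \<partial>lborel) / s"
    if h: "integrable lborel h" for h :: "real \<Rightarrow> real"
  proof -
    have e: "s * (t - l / 2) = - (s * l / 2) + s * t" for t by (simp add: algebra_simps)
    show "integrable lborel (\<lambda>t. h (s * (t - l / 2)))" unfolding e by (rule lborel_integrable_real_affine[OF h]) (use s0 in simp)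
    show "(\<integral>t. h (s * (t - l / 2)) \<partial>lborel) = (\<integral>t. h t \<partial>lborel) / s"
      unfolding e using lborel_integral_real_affine[of s h "- (s * l / 2)"] s0 by simp
  qed
  have m: "integrable grid_measure (\<lambda>x. (norm (\<psi> (grid_point l x)))\<^sup>2)" "mass_of l \<psi> = (\<integral>t. (sech_profile R t)\<^sup>2 \<partial>lborel) / s"
  proof -
    have "integrable lborel (\<lambda>t. (norm (\<psi> (grid_point l (i0, t))))\<^sup>2)" using aff(1)[OF I(1)] by (simp add: line u_def)
    from integral_grid_single_line[where f = "\<lambda>x. (norm (\<psi> (grid_point l x)))\<^sup>2" and ?i0.0 = i0, OF _ _ _ this] \<psi>m
    show "integrable grid_measure (\<lambda>x. (norm (\<psi> (grid_point l x)))\<^sup>2)" "mass_of l \<psi> = (\<integral>t. (sech_profile R t)\<^sup>2 \<partial>lborel) / s"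
      using aff(2)[OF I(1)] by (simp_all add: mass_of_def line u_def other)
  qed
  have k: "integrable grid_measure (\<lambda>x. (norm (V x))\<^sup>2)" "kinetic V = s * (\<integral>t. (sech_profile_deriv R t)\<^sup>2 \<partial>lborel)"
  proof -
    have nV: "(norm (V (i0, t)))\<^sup>2 = s\<^sup>2 * (sech_profile_deriv R (s * (t - l / 2)))\<^sup>2" for t
      by (simp add: V_def v_def norm_mult power_mult_distrib)
    have Vz: "(norm (V (i, t)))\<^sup>2 = 0" if "i \<noteq> i0" for i t using that by (simp add: V_def)
    have "integrable lborel (\<lambda>t. (norm (V (i0, t)))\<^sup>2)" unfolding nV using aff(1)[OF I(3)] by simp
    note L = integral_grid_single_line[where f = "\<lambda>x. (norm (V x))\<^sup>2" and ?i0.0 = i0, OF _ _ Vz this]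
    show "integrable grid_measure (\<lambda>x. (norm (V x))\<^sup>2)" by (rule L(1)) (use Vm in auto)
    have "kinetic V = (\<integral>t. (norm (V (i0, t)))\<^sup>2 \<partial>lborel)" unfolding kinetic_def by (rule L(2)) (use Vm in auto)
    also have "\<dots> = s\<^sup>2 * ((\<integral>t. (sech_profile_deriv R t)\<^sup>2 \<partial>lborel) / s)" unfolding nV using aff(2)[OF I(3)] by simp
    also have "\<dots> = s * (\<integral>t. (sech_profile_deriv R t)\<^sup>2 \<partial>lborel)" using s0 by (simp add: power2_eq_square)
    finally show "kinetic V = s * (\<integral>t. (sech_profile_deriv R t)\<^sup>2 \<partial>lborel)" .
  qed
  have p6: "norm z powr 6 = norm z ^ 6" for z :: complex by (cases "z = 0") auto
  have S: "power_of l 6 \<psi> = (\<integral>t. (sech_profile R t) ^ 6 \<partial>lborel) / s"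
  proof -
    have "integrable lborel (\<lambda>t. norm (\<psi> (grid_point l (i0, t))) ^ 6)" using aff(1)[OF I(5)] by (simp add: line u_def power_even_abs)
    from integral_grid_single_line(2)[where f = "\<lambda>x. norm (\<psi> (grid_point l x)) ^ 6" and ?i0.0 = i0, OF _ _ _ this] \<psi>m
    show ?thesis using aff(2)[OF I(5)] unfolding power_of_def p6 by (simp add: line u_def other power_even_abs)
  qed
  have "H1_pair l \<psi> V" unfolding H1_pair_def
  proof (intro conjI allI m(1) k(1))
    show "is_primitive (\<lambda>t. \<psi> (grid_point l (i, t))) (\<lambda>t. V (i, t))" for i
    proof (cases "i = i0")
      case True
      have "is_primitive (\<lambda>t. complex_of_real (u t)) (\<lambda>t. complex_of_real (v t))"
        by (rule is_primitive_linear[OF bounded_linear_of_real uv])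
      then show ?thesis using True by (simp add: line V_def)
    next
      case False
      then show ?thesis by (simp add: other V_def is_primitive_def set_integrable_def set_lebesgue_integral_def)
    qed
  qed
  then show thesis using that m(2) k(2) S by blast
qed

lemma energy_unbounded_supercritical:
  assumes l: "l > 0" and \<mu>: "\<mu> > sqrt 3 * pi / 2"
  shows "\<exists>\<psi> V. H1_pair l \<psi> V \<and> mass_of l \<psi> = \<mu> \<and> energy_of l 6 \<psi> V < E"
proof -
  have \<mu>0: "\<mu> > 0" using \<mu> by (meson divide_pos_pos less_trans mult_pos_pos pi_gt_zero real_sqrt_gt_0_iff zero_less_numeral)
  have \<mu>2: "\<mu>\<^sup>2 > 3 * pi\<^sup>2 / 4"
  proof -
    have "(sqrt 3 * pi / 2)\<^sup>2 < \<mu>\<^sup>2" using \<mu> by (intro power_strict_mono) auto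
    then show ?thesis by (simp add: power_mult_distrib power_divide)
  qed
  \<comment> \<open>For the ideal soliton, with mass \<open>pi\<close> and kinetic term
    \<open>pi / 8\<close>, scaled up to mass \<open>\<mu>\<close>, this is the sixth power at which
    the energy would be 0. It is less than the actual value \<open>pi / 2\<close> exactly because
    \<open>\<mu>\<close> exceeds \<open>sqrt 3 * pi / 2\<close>.\<close>
  define \<sigma> where "\<sigma> = 3 * pi ^ 3 / (8 * \<mu>\<^sup>2)"
  have \<sigma>: "0 < \<sigma>" "\<sigma> < pi / 2"
  proof -
    show "0 < \<sigma>" using \<mu>0 by (simp add: \<sigma>_def)
    have "3 * pi ^ 3 < pi / 2 * (8 * \<mu>\<^sup>2)"
    proof -
      have "4 * pi * (3 * pi\<^sup>2 / 4) < 4 * pi * \<mu>\<^sup>2" using \<mu>2 by (intro mult_strict_left_mono) auto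
      then show ?thesis by (simp add: power2_eq_square power3_eq_cube)
    qed
    then show "\<sigma> < pi / 2" unfolding \<sigma>_def using \<mu>0 by (subst pos_divide_less_eq) auto
  qed
  have "((\<lambda>R::real. arctan (sinh R) + sinh R / (cosh R)\<^sup>2 - 12 * R / sqrt (cosh R)) \<longlongrightarrow> pi / 2) at_top"
    by real_asymp
  then have "\<forall>\<^sub>F R in at_top. \<sigma> < arctan (sinh R) + sinh R / (cosh R)\<^sup>2 - 12 * R / sqrt (cosh R)"
    using \<sigma>(2) by (rule order_tendstoD(1))
  then have "\<forall>\<^sub>F R in at_top. \<sigma> < arctan (sinh R) + sinh R / (cosh R)\<^sup>2 - 12 * R / sqrt (cosh R) \<and> R > 0"
    using eventually_gt_at_top[of 0] by (rule eventually_conj)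
  then obtain R :: real where R: "R > 0" "\<sigma> < arctan (sinh R) + sinh R / (cosh R)\<^sup>2 - 12 * R / sqrt (cosh R)"
    using eventually_happens[of _ "at_top :: real filter"] by auto
  note I = sech_profile_integrals[OF R(1)]
  define m k S where "m = (\<integral>t. (sech_profile R t)\<^sup>2 \<partial>lborel)" and "k = (\<integral>t. (sech_profile_deriv R t)\<^sup>2 \<partial>lborel)" and "S = (\<integral>t. (sech_profile R t) ^ 6 \<partial>lborel)"
  have S: "\<sigma> < S" using R(2) I(6) by (simp add: S_def)
  have m: "0 < m" "m \<le> pi"
  proof -
    show "m \<le> pi" using I(2) by (simp add: m_def)
    have "S \<le> m" unfolding S_def m_def
    proof (rule integral_mono[OF I(5,1)])
      show "sech_profile R t ^ 6 \<le> (sech_profile R t)\<^sup>2" for t using sech_profile_bounds[of R t] by (intro power_decreasing) auto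
    qed
    then show "0 < m" using S \<sigma> by linarith
  qed
  have k: "k \<le> pi / 8" using I(4) by (simp add: k_def)
  define q where "q = \<mu> / m"
  have q: "q > 0" using \<mu>0 m by (simp add: q_def)
  \<comment> \<open>Minus the energy after normalising the mass to \<open>\<mu>\<close>, for
    \<open>s = 1\<close>. Concentrating by a factor \<open>s\<close> multiplies it by the square of
    \<open>s\<close>, since at exponent 6 both terms scale alike.\<close>
  define \<epsilon> where "\<epsilon> = q ^ 3 * S / 6 - q * k / 2"
  have \<epsilon>: "\<epsilon> > 0"
  proof -
    have "pi / 8 = \<sigma> * (\<mu>\<^sup>2 / pi\<^sup>2) / 3" using \<mu>0 by (simp add: \<sigma>_def power2_eq_square power3_eq_cube)
    also have "\<dots> \<le> \<sigma> * q\<^sup>2 / 3"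
    proof -
      have "\<mu> / pi \<le> q" unfolding q_def using m \<mu>0 by (intro divide_left_mono) auto
      then have "(\<mu> / pi)\<^sup>2 \<le> q\<^sup>2" using \<mu>0 by (intro power_mono) auto
      then show ?thesis using \<sigma> by (intro divide_right_mono mult_left_mono) (auto simp: power_divide)
    qed
    also have "\<dots> < S * q\<^sup>2 / 3" using S q by (intro divide_strict_right_mono mult_strict_right_mono) auto
    finally have "k < S * q\<^sup>2 / 3" using k by linarith
    then have "q / 2 * k < q / 2 * (S * q\<^sup>2 / 3)" using q by (intro mult_strict_left_mono) auto
    then show ?thesis by (simp add: \<epsilon>_def power2_eq_square power3_eq_cube mult_ac)
  qed
  define s where "s = max (2 * R / l + 1) (max 1 (\<bar>E\<bar> / \<epsilon> + 1))"
  have s: "s > 2 * R / l" "s \<ge> 1" "s > \<bar>E\<bar> / \<epsilon>" by (auto simp: s_def)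
  obtain \<psi> V where \<psi>: "H1_pair l \<psi> V" "mass_of l \<psi> = m / s" "kinetic V = s * k" "power_of l 6 \<psi> = S / s"
    unfolding m_def k_def S_def using concentrated_function[OF l R(1) s(1)] by metis
  define c where "c = complex_of_real (sqrt (q * s))"
  have qs: "q * s > 0" using q s by simp
  have c2: "(norm c)\<^sup>2 = q * s" using qs by (simp add: c_def)
  have c6: "norm c powr 6 = (q * s) ^ 3"
  proof -
    have "norm c powr 6 = ((norm c)\<^sup>2) ^ 3" by (cases "c = 0") (auto simp flip: power_mult)
    then show ?thesis by (simp add: c2)
  qed
  have mass: "mass_of l (\<lambda>x. c * \<psi> x) = \<mu>" unfolding mass_of_scale c2 \<psi>(2) using m s by (simp add: q_def)
  have "energy_of l 6 (\<lambda>x. c * \<psi> x) (\<lambda>x. c * V x) = q * s / 2 * (s * k) - (q * s) ^ 3 / 6 * (S / s)"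
    unfolding energy_of_scale c2 c6 \<psi>(3,4) by simp
  also have "\<dots> = - (s\<^sup>2 * \<epsilon>)" using s by (simp add: \<epsilon>_def power2_eq_square power3_eq_cube field_simps)
  also have "\<dots> \<le> - (s * \<epsilon>)" using s \<epsilon> by (simp add: power2_eq_square)
  also have "\<dots> < - \<bar>E\<bar>" using s(3) \<epsilon> by (simp add: pos_divide_less_eq)
  also have "\<dots> \<le> E" by simp
  finally have "energy_of l 6 (\<lambda>x. c * \<psi> x) (\<lambda>x. c * V x) < E" .
  then show ?thesis using H1_pair_scale[OF \<psi>(1), of c] mass by blast
qed

section \<open>The critical mass\<close>

lemma powr_le_add_powr:
  fixes x :: real
  assumes "0 \<le> x" "a \<le> p" "p \<le> b"
  shows "x powr p \<le> x powr a + x powr b"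
proof (cases "x \<le> 1")
  case True
  then have "x powr p \<le> x powr a" using assms by (intro powr_mono') auto
  then show ?thesis using powr_ge_zero[of x b] by linarith
next
  case False
  then have "x powr p \<le> x powr b" using assms by (intro powr_mono) auto
  then show ?thesis using powr_ge_zero[of x a] by linarith
qed

text \<open>The \<open>p\<close>-th power is at most the sum of the powers \<open>10/3\<close> and
  6. Both integrals are linear in the kinetic term, with coefficients that vanish with the mass; for
  mass up to \<open>m0\<close> the sum is at most the kinetic term, and \<open>p > 2\<close> leaves
  a positive remainder.\<close>

lemma energy_pos_small_mass:
  assumes l: "l > 0" and p: "10/3 \<le> p" "p \<le> 6"
  obtains m0 where "m0 > 0" "\<And>\<psi> V. H1_pair l \<psi> V \<Longrightarrow> 0 < mass_of l \<psi> \<Longrightarrow> mass_of l \<psi> \<le> m0 \<Longrightarrow> 0 < energy_of l p \<psi> V"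
proof -
  define C where "C = 1 + 2 ^ 28 * l ^ 4"
  have C: "C > 0" using l by (auto simp: C_def intro!: add_pos_nonneg)
  define m0 where "m0 = min 1 ((1 / (C + 1)) powr (3/2))"
  show thesis
  proof
    show "m0 > 0" using C by (simp add: m0_def)
    fix \<psi> V assume H: "H1_pair l \<psi> V" and m: "0 < mass_of l \<psi>" "mass_of l \<psi> \<le> m0"
    define M K where "M = mass_of l \<psi>" and "K = kinetic V"
    have M: "0 < M" "M \<le> 1" "M \<le> (1 / (C + 1)) powr (3/2)" using m by (auto simp: M_def m0_def)
    have K: "K > 0" unfolding K_def by (rule kinetic_pos[OF H m(1)])
    have "M powr (2/3) \<le> ((1 / (C + 1)) powr (3/2)) powr (2/3)" using M by (intro powr_mono2) auto
    also have "\<dots> = 1 / (C + 1)" using C by (simp add: powr_powr)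
    finally have M23: "(C + 1) * M powr (2/3) \<le> 1" using C by (simp add: pos_le_divide_eq mult.commute)
    have M2: "M\<^sup>2 \<le> M powr (2/3)"
    proof -
      have "M powr 2 \<le> M powr (2/3)" using M by (intro powr_mono') auto
      then show ?thesis using M by simp
    qed
    have "power_of l p \<psi> \<le> (\<integral>x. norm (\<psi> (grid_point l x)) powr (10/3) + norm (\<psi> (grid_point l x)) powr 6 \<partial>grid_measure)"
      unfolding power_of_def
      by (intro integral_mono powr_le_add_powr Bochner_Integration.integrable_add integrable_power_of[OF H]) (use p in auto)
    also have "\<dots> = power_of l (10/3) \<psi> + power_of l 6 \<psi>"
      unfolding power_of_def by (intro Bochner_Integration.integral_add integrable_power_of[OF H]) auto
    also have "\<dots> \<le> C * M powr (2/3) * K + M\<^sup>2 * K"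
    proof (rule add_mono)
      show "power_of l (10/3) \<psi> \<le> C * M powr (2/3) * K"
        unfolding C_def M_def K_def by (rule Gagliardo_Nirenberg_3d[OF l H])
      show "power_of l 6 \<psi> \<le> M\<^sup>2 * K"
        using power_of_le_mass_kinetic[OF H, of 6] M K by (simp add: M_def K_def power2_eq_square mult_ac)
    qed
    also have "\<dots> \<le> C * M powr (2/3) * K + M powr (2/3) * K" using M2 K by (intro add_left_mono mult_right_mono) auto
    also have "\<dots> = (C + 1) * M powr (2/3) * K" by (simp add: distrib_right)
    also have "\<dots> \<le> 1 * K" using M23 K by (intro mult_right_mono) auto
    finally have "power_of l p \<psi> / p \<le> K / p" using p by (intro divide_right_mono) auto
    moreover have "K / p < K / 2" using K p by (intro divide_strict_left_mono) auto
    moreover have "energy_of l p \<psi> V = K / 2 - power_of l p \<psi> / p" by (simp add: energy_of_def K_def)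
    ultimately show "0 < energy_of l p \<psi> V" by linarith
  qed
qed

text \<open>The contrapositive of \<open>energy_ge_proportion\<close> with
  \<open>I = 0\<close>.\<close>

lemma negative_energy_larger_mass:
  assumes p: "p > 2" and H: "H1_pair l \<psi> V" and E: "energy_of l p \<psi> V < 0" and m: "mass_of l \<psi> \<le> \<mu>" "0 < mass_of l \<psi>"
  shows "\<exists>\<phi> W. H1_pair l \<phi> W \<and> mass_of l \<phi> = \<mu> \<and> energy_of l p \<phi> W < 0"
proof (rule ccontr)
  assume none: "\<not> ?thesis"
  have \<mu>: "\<mu> > 0" using m by linarith
  have "mass_of l \<psi> / \<mu> * 0 \<le> energy_of l p \<psi> V"
    by (rule energy_ge_proportion[OF p \<mu> _ H m(1)]) (use none in force)
  then show False using E by simp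
qed

lemma negative_energy_exists:
  assumes l: "l > 0" and p: "p > 2"
  obtains \<psi> V where "H1_pair l \<psi> V" "0 < mass_of l \<psi>" "energy_of l p \<psi> V < 0"
proof -
  obtain \<phi> W where \<phi>: "H1_pair l \<phi> W" "mass_of l \<phi> = 1" "kinetic W = 1\<^sup>2 * 1"
    using spread_function[OF l, of 1 1] by (metis zero_less_one)
  define S where "S = power_of l p \<phi>"
  have S: "S > 0" unfolding S_def by (rule power_of_pos[OF \<phi>(1)]) (use p \<phi> in auto)
  \<comment> \<open>Makes the power term after scaling equal to the square of \<open>c\<close>,
    twice the kinetic contribution.\<close>
  define c where "c = (p / S) powr (1 / (p - 2))"
  have c: "c > 0" using S p by (simp add: c_def)
  have cp: "c powr p = c\<^sup>2 * (p / S)"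
  proof -
    have "c powr p = c powr 2 * c powr (p - 2)" by (simp flip: powr_add)
    also have "c powr (p - 2) = p / S" using S p by (simp add: c_def powr_powr)
    finally show ?thesis using c by simp
  qed
  have "energy_of l p (\<lambda>x. complex_of_real c * \<phi> x) (\<lambda>x. complex_of_real c * W x) = c\<^sup>2 / 2 - c\<^sup>2"
    unfolding energy_of_scale \<phi>(3) S_def[symmetric] using c S p by (simp add: cp)
  also have "\<dots> < 0" using c by simp
  finally have "energy_of l p (\<lambda>x. complex_of_real c * \<phi> x) (\<lambda>x. complex_of_real c * W x) < 0" .
  moreover have "0 < mass_of l (\<lambda>x. complex_of_real c * \<phi> x)" using c by (simp add: mass_of_scale \<phi>(2))
  ultimately show thesis using that H1_pair_scale[OF \<phi>(1), of "complex_of_real c"] by blast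
qed

text \<open>Small masses have positive energy, so the infimum of the masses admitting negative
  energy is positive; scaling up shows that these masses fill everything above it.\<close>

lemma mass_threshold:
  assumes l: "l > 0" and p: "10/3 \<le> p" "p \<le> 6"
  obtains \<mu> where "\<mu> > 0"
    "\<And>\<psi> V. H1_pair l \<psi> V \<Longrightarrow> 0 < mass_of l \<psi> \<Longrightarrow> mass_of l \<psi> < \<mu> \<Longrightarrow> 0 < energy_of l p \<psi> V"
    "\<And>\<psi> V. H1_pair l \<psi> V \<Longrightarrow> mass_of l \<psi> = \<mu> \<Longrightarrow> 0 \<le> energy_of l p \<psi> V"
    "\<And>m. m > \<mu> \<Longrightarrow> \<exists>\<psi> V. H1_pair l \<psi> V \<and> mass_of l \<psi> = m \<and> energy_of l p \<psi> V < 0"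
proof -
  have p2: "p > 2" using p by simp
  define A where "A = {mass_of l \<psi> | \<psi> V. H1_pair l \<psi> V \<and> 0 < mass_of l \<psi> \<and> energy_of l p \<psi> V < 0}"
  obtain m0 where m0: "m0 > 0" "\<And>\<psi> V. H1_pair l \<psi> V \<Longrightarrow> 0 < mass_of l \<psi> \<Longrightarrow> mass_of l \<psi> \<le> m0 \<Longrightarrow> 0 < energy_of l p \<psi> V"
    by (rule energy_pos_small_mass[OF l p]) blast
  obtain \<psi>0 V0 where "H1_pair l \<psi>0 V0" "0 < mass_of l \<psi>0" "energy_of l p \<psi>0 V0 < 0"
    by (rule negative_energy_exists[OF l p2])
  then have A_ne: "A \<noteq> {}" by (auto simp: A_def)
  have A_ge: "m0 \<le> a" if aA: "a \<in> A" for a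
  proof (rule ccontr)
    assume "\<not> m0 \<le> a"
    moreover obtain \<psi> V where \<psi>: "a = mass_of l \<psi>" "H1_pair l \<psi> V" "0 < mass_of l \<psi>" "energy_of l p \<psi> V < 0"
      using aA by (auto simp: A_def)
    ultimately show False using m0(2)[OF \<psi>(2,3)] by simp
  qed
  have bdd: "bdd_below A" using A_ge by (rule bdd_belowI)
  define \<mu> where "\<mu> = Inf A"
  have \<mu>: "\<mu> > 0" using cInf_greatest[OF A_ne A_ge] m0(1) by (simp add: \<mu>_def)
  have below: "0 \<le> energy_of l p \<psi> V" if "H1_pair l \<psi> V" "0 < mass_of l \<psi>" "mass_of l \<psi> < \<mu>" for \<psi> V
  proof (rule ccontr)
    assume "\<not> 0 \<le> energy_of l p \<psi> V"
    then have "mass_of l \<psi> \<in> A" using that by (auto simp: A_def not_le)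
    from cInf_lower[OF this bdd] show False using that(3) by (simp add: \<mu>_def)
  qed
  show thesis
  proof (rule that[OF \<mu>])
    fix \<psi> V assume H: "H1_pair l \<psi> V" and m: "0 < mass_of l \<psi>" "mass_of l \<psi> < \<mu>"
    \<comment> \<open>The infimum by itself yields only nonnegative energy. Comparison with an
      intermediate mass \<open>\<nu>\<close>, at which the energy is still nonnegative, makes the
      scaling gain available and the inequality strict.\<close>
    define \<nu> where "\<nu> = (mass_of l \<psi> + \<mu>) / 2"
    have \<nu>: "mass_of l \<psi> < \<nu>" "\<nu> < \<mu>" "0 < \<nu>" using m by (auto simp: \<nu>_def)
    have inf: "0 \<le> energy_of l p \<phi> W" if "H1_pair l \<phi> W" "mass_of l \<phi> = \<nu>" for \<phi> W
      using below[OF that(1)] that(2) \<nu> by simp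
    have "mass_of l \<psi> / \<nu> * 0 + ((\<nu> / mass_of l \<psi>) powr ((p - 2) / 2) - 1) / p * power_of l p \<psi> \<le> energy_of l p \<psi> V"
      by (rule energy_scale_up[OF p2 \<nu>(3) inf H m(1)])
    moreover have "0 < ((\<nu> / mass_of l \<psi>) powr ((p - 2) / 2) - 1) / p * power_of l p \<psi>"
    proof -
      have "1 < (\<nu> / mass_of l \<psi>) powr ((p - 2) / 2)" using \<nu> m p2 by (intro gr_one_powr) (auto simp: less_divide_eq)
      moreover have "0 < power_of l p \<psi>" by (rule power_of_pos[OF H _ m(1)]) (use p2 in simp)
      ultimately show ?thesis using p2 by simp
    qed
    ultimately show "0 < energy_of l p \<psi> V" by linarith
  next
    fix \<psi> V assume H: "H1_pair l \<psi> V" and m: "mass_of l \<psi> = \<mu>"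
    show "0 \<le> energy_of l p \<psi> V"
    proof (rule ccontr)
      assume neg: "\<not> 0 \<le> energy_of l p \<psi> V"
      define E where "E c = c\<^sup>2 / 2 * kinetic V - c powr p / p * power_of l p \<psi>" for c :: real
      have "E 1 < 0" using neg by (simp add: E_def energy_of_def)
      \<comment> \<open>Multiplication by a factor slightly below 1 would keep the energy negative
        while moving the mass below \<open>\<mu>\<close>, which contradicts
        \<open>below\<close>.\<close>
      have "(E \<longlongrightarrow> E 1) (at_left 1)" unfolding E_def[abs_def]
        by (intro tendsto_intros) (use p2 in auto)
      then have "\<forall>\<^sub>F c in at_left 1. E c < 0" using \<open>E 1 < 0\<close> by (rule order_tendstoD(2))
      moreover have "\<forall>\<^sub>F c in at_left (1::real). 0 < c \<and> c < 1"
        by (auto simp: eventually_at_left_field intro!: exI[of _ 0])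
      ultimately have "\<forall>\<^sub>F c in at_left 1. E c < 0 \<and> 0 < c \<and> c < 1" by eventually_elim simp
      then obtain c where c: "E c < 0" "0 < c" "c < 1"
        using eventually_happens[of _ "at_left (1::real)"] by (auto simp: trivial_limit_at_left_real)
      define \<phi> W where "\<phi> = (\<lambda>x. complex_of_real c * \<psi> x)" and "W = (\<lambda>x. complex_of_real c * V x)"
      have "H1_pair l \<phi> W" unfolding \<phi>_def W_def by (rule H1_pair_scale[OF H])
      moreover have "energy_of l p \<phi> W < 0" unfolding \<phi>_def W_def energy_of_scale using c by (simp add: E_def)
      moreover have m\<phi>: "mass_of l \<phi> = c\<^sup>2 * \<mu>" using m by (simp add: \<phi>_def mass_of_scale)
      moreover have "0 < c\<^sup>2 * \<mu>" using c \<mu> by simp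
      moreover have "c\<^sup>2 * \<mu> < \<mu>" using c \<mu> power_strict_mono[of c 1 2] by simp
      ultimately show False using below[of \<phi> W] by simp
    qed
  next
    fix m assume "\<mu> < m"
    then obtain a where "a \<in> A" "a < m" using cInf_lessD[OF A_ne] by (auto simp: \<mu>_def)
    then obtain \<psi> V where \<psi>: "a = mass_of l \<psi>" "H1_pair l \<psi> V" "0 < mass_of l \<psi>" "energy_of l p \<psi> V < 0"
      by (auto simp: A_def)
    show "\<exists>\<psi> V. H1_pair l \<psi> V \<and> mass_of l \<psi> = m \<and> energy_of l p \<psi> V < 0"
      by (rule negative_energy_larger_mass[OF p2 \<psi>(2,4) _ \<psi>(3)]) (use \<open>a < m\<close> \<psi>(1) in simp)
  qed
qed

section \<open>Transfer to ground states on the grid\<close>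

lemma H1_grid_iff:
  assumes "l > 0"
  shows "\<psi> \<in> H1_grid l \<longleftrightarrow> (\<exists>V. H1_pair l \<psi> V)"
  using H1_pair_imp_H1_grid[OF assms] H1_grid_obtain_pair by metis

lemma grid_quantities:
  assumes "H1_pair l \<psi> V"
  shows "grid_mass l \<psi> = mass_of l \<psi>" "grid_energy l p \<psi> = energy_of l p \<psi> V"
  unfolding grid_mass_eq[OF assms] grid_energy_eq[OF assms]
  by (simp_all add: mass_of_def energy_of_def kinetic_def power_of_def)

lemma ground_state_if_minimiser:
  assumes l: "l > 0" and H: "H1_pair l \<psi> V" "mass_of l \<psi> = \<mu>"
    and min: "\<And>\<phi> W. H1_pair l \<phi> W \<Longrightarrow> mass_of l \<phi> = \<mu> \<Longrightarrow> energy_of l p \<psi> V \<le> energy_of l p \<phi> W"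
  shows "ground_state l p \<mu> \<psi>"
  unfolding ground_state_def
proof (intro conjI ballI impI)
  show "\<psi> \<in> H1_grid l" "grid_mass l \<psi> = \<mu>" using H H1_grid_iff[OF l] grid_quantities(1)[OF H(1)] by auto
  fix \<phi> assume "\<phi> \<in> H1_grid l" and m: "grid_mass l \<phi> = \<mu>"
  then obtain W where W: "H1_pair l \<phi> W" using H1_grid_iff[OF l] by blast
  show "grid_energy l p \<psi> \<le> grid_energy l p \<phi>"
    using min[OF W] m by (simp add: grid_quantities[OF W] grid_quantities[OF H(1)])
qed

lemma ground_state_energy_le:
  assumes l: "l > 0" and g: "ground_state l p \<mu> \<psi>" and H: "H1_pair l \<phi> W" "mass_of l \<phi> = \<mu>"
  shows "grid_energy l p \<psi> \<le> energy_of l p \<phi> W"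
  using g H H1_grid_iff[OF l] unfolding ground_state_def by (metis grid_quantities)

text \<open>The infimum is never positive, since spreading a function out makes its kinetic energy vanish.\<close>

lemma no_ground_state_if_energy_pos:
  assumes l: "l > 0" and \<mu>: "\<mu> > 0" and p: "p > 0"
    and pos: "\<And>\<phi> W. H1_pair l \<phi> W \<Longrightarrow> mass_of l \<phi> = \<mu> \<Longrightarrow> 0 < energy_of l p \<phi> W"
  shows "\<not> ground_state l p \<mu> \<psi>"
proof
  assume g: "ground_state l p \<mu> \<psi>"
  then obtain V where V: "H1_pair l \<psi> V" "mass_of l \<psi> = \<mu>"
    unfolding ground_state_def using H1_grid_iff[OF l] grid_quantities(1) by metis
  define e where "e = grid_energy l p \<psi>"
  have e: "e > 0" using pos[OF V] by (simp add: e_def grid_quantities[OF V(1)])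
  \<comment> \<open>Gives the spread-out competitor kinetic term \<open>e\<close>, hence energy at
    most \<open>e / 2\<close>.\<close>
  define \<epsilon> where "\<epsilon> = sqrt (e / \<mu>)"
  have "\<epsilon> > 0" using e \<mu> by (simp add: \<epsilon>_def)
  then obtain \<phi> W where \<phi>: "H1_pair l \<phi> W" "mass_of l \<phi> = \<mu>" "kinetic W = \<epsilon>\<^sup>2 * \<mu>" using spread_function[OF l _ \<mu>] by metis
  have "e \<le> energy_of l p \<phi> W" unfolding e_def by (rule ground_state_energy_le[OF l g \<phi>(1,2)])
  also have "\<dots> \<le> 1 / 2 * kinetic W" using p by (simp add: energy_of_def)
  also have "\<dots> = e / 2" using e \<mu> by (simp add: \<phi>(3) \<epsilon>_def)
  finally show False using e by simp
qed

theorem theorem1p1: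
  fixes l :: real
  assumes "l > 0"
  shows
    "(\<forall>p::real. 2 < p \<and> p < 10 / 3 \<longrightarrow>
        (\<forall>\<mu>>0. (\<exists>\<psi>. ground_state l p \<mu> \<psi>) \<and>
                (\<forall>\<psi>. ground_state l p \<mu> \<psi> \<longrightarrow> grid_energy l p \<psi> < 0))) \<and>
     (\<forall>p::real. 10 / 3 \<le> p \<and> p \<le> 6 \<longrightarrow>
        (\<exists>\<mu>\<^sub>p>0.
           (\<forall>\<mu>. 0 < \<mu> \<and> \<mu> < \<mu>\<^sub>p \<longrightarrow>
              (\<forall>\<psi>\<in>H1_grid l. grid_mass l \<psi> = \<mu> \<longrightarrow> grid_energy l p \<psi> > 0) \<and>
              \<not> (\<exists>\<psi>. ground_state l p \<mu> \<psi>)) \<and>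
           (p \<noteq> 10 / 3 \<and> p \<noteq> 6 \<longrightarrow>
              (\<exists>\<psi>. ground_state l p \<mu>\<^sub>p \<psi> \<and> grid_energy l p \<psi> = 0)) \<and>
           (p \<noteq> 6 \<longrightarrow>
              (\<forall>\<mu>>\<mu>\<^sub>p. \<exists>\<psi>. ground_state l p \<mu> \<psi> \<and> grid_energy l p \<psi> < 0)) \<and>
           (p = 6 \<longrightarrow>
              (\<forall>\<mu>\<ge>\<mu>\<^sub>p. \<not> (\<exists>\<psi>. ground_state l p \<mu> \<psi>)))))"
proof (intro conjI allI impI)
  note l = assms
  have exists: "\<exists>\<psi>. ground_state l p \<mu> \<psi> \<and> grid_energy l p \<psi> < 0"
    if p: "2 < p" "p < 6" and \<mu>: "\<mu> > 0" and neg: "\<exists>\<phi> W. H1_pair l \<phi> W \<and> mass_of l \<phi> = \<mu> \<and> energy_of l p \<phi> W < 0" for p \<mu>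
  proof -
    obtain \<phi> W where "H1_pair l \<phi> W" "mass_of l \<phi> = \<mu>" "energy_of l p \<phi> W < 0" using neg by blast
    from minimiser_if_negative_energy[OF l p \<mu> this]
    obtain \<psi> V where \<psi>: "H1_pair l \<psi> V" "mass_of l \<psi> = \<mu>" "energy_of l p \<psi> V < 0"
      "\<And>\<phi> W. H1_pair l \<phi> W \<Longrightarrow> mass_of l \<phi> = \<mu> \<Longrightarrow> energy_of l p \<psi> V \<le> energy_of l p \<phi> W" by blast
    have "ground_state l p \<mu> \<psi>" by (rule ground_state_if_minimiser[OF l \<psi>(1,2,4)])
    then show ?thesis using \<psi>(3) grid_quantities(2)[OF \<psi>(1)] by (intro exI[of _ \<psi>]) simp
  qed
  have pos_grid: "grid_energy l p \<psi> > 0"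
    if pos: "\<And>\<phi> W. H1_pair l \<phi> W \<Longrightarrow> mass_of l \<phi> = \<mu> \<Longrightarrow> 0 < energy_of l p \<phi> W"
      and \<psi>: "\<psi> \<in> H1_grid l" "grid_mass l \<psi> = \<mu>" for p \<mu> \<psi>
  proof -
    obtain V where V: "H1_pair l \<psi> V" using \<psi>(1) H1_grid_iff[OF l] by blast
    then show ?thesis using pos[OF V] \<psi>(2) by (simp add: grid_quantities[OF V])
  qed
  {
    fix p \<mu> :: real assume p: "2 < p \<and> p < 10 / 3" and \<mu>: "0 < \<mu>"
    have neg: "\<exists>\<phi> W. H1_pair l \<phi> W \<and> mass_of l \<phi> = \<mu> \<and> energy_of l p \<phi> W < 0"
    proof -
      obtain \<phi> W where "H1_pair l \<phi> W" "mass_of l \<phi> = \<mu>" "energy_of l p \<phi> W < 0"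
        by (rule negative_energy_subcritical[OF l _ _ \<mu>, of p]) (use p in auto)
      then show ?thesis by blast
    qed
    show "\<exists>\<psi>. ground_state l p \<mu> \<psi>" using exists[OF _ _ \<mu> neg] p by force
    fix \<psi> assume g: "ground_state l p \<mu> \<psi>"
    obtain \<phi> W where \<phi>: "H1_pair l \<phi> W" "mass_of l \<phi> = \<mu>" "energy_of l p \<phi> W < 0" using neg by blast
    show "grid_energy l p \<psi> < 0" using ground_state_energy_le[OF l g \<phi>(1,2)] \<phi>(3) by linarith
  }
  fix p :: real assume p: "10 / 3 \<le> p \<and> p \<le> 6"
  show "\<exists>\<mu>\<^sub>p>0.
           (\<forall>\<mu>. 0 < \<mu> \<and> \<mu> < \<mu>\<^sub>p \<longrightarrow>
              (\<forall>\<psi>\<in>H1_grid l. grid_mass l \<psi> = \<mu> \<longrightarrow> grid_energy l p \<psi> > 0) \<and>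
              \<not> (\<exists>\<psi>. ground_state l p \<mu> \<psi>)) \<and>
           (p \<noteq> 10 / 3 \<and> p \<noteq> 6 \<longrightarrow>
              (\<exists>\<psi>. ground_state l p \<mu>\<^sub>p \<psi> \<and> grid_energy l p \<psi> = 0)) \<and>
           (p \<noteq> 6 \<longrightarrow>
              (\<forall>\<mu>>\<mu>\<^sub>p. \<exists>\<psi>. ground_state l p \<mu> \<psi> \<and> grid_energy l p \<psi> < 0)) \<and>
           (p = 6 \<longrightarrow>
              (\<forall>\<mu>\<ge>\<mu>\<^sub>p. \<not> (\<exists>\<psi>. ground_state l p \<mu> \<psi>)))"
  proof (cases "p = 6")
    case True
    \<comment> \<open>Positivity holds up to and including this mass, so at equality nonexistence
      comes from spreading out, as for smaller masses; above it the energy is unbounded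
      below.\<close>
    define \<mu>6 where "\<mu>6 = sqrt 3 * pi / 2"
    have \<mu>6: "\<mu>6 > 0" by (simp add: \<mu>6_def)
    have pos: "0 < energy_of l p \<phi> W" if "0 < \<mu>" "\<mu> \<le> \<mu>6" "H1_pair l \<phi> W" "mass_of l \<phi> = \<mu>" for \<mu> \<phi> W
      using energy_pos_critical[OF l that(3)] that by (simp add: True \<mu>6_def)
    have none: "\<not> ground_state l p \<mu> \<psi>" if "0 < \<mu>" "\<mu> \<le> \<mu>6" for \<mu> \<psi>
      by (rule no_ground_state_if_energy_pos[OF l that(1)]) (use p pos that in auto)
    have none': "\<not> ground_state l p \<mu> \<psi>" if big: "\<mu> > \<mu>6" for \<mu> \<psi>
    proof
      assume g: "ground_state l p \<mu> \<psi>"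
      obtain \<phi> W where "H1_pair l \<phi> W" "mass_of l \<phi> = \<mu>" "energy_of l 6 \<phi> W < grid_energy l p \<psi>"
        using energy_unbounded_supercritical[OF l big[unfolded \<mu>6_def]] by blast
      then show False using ground_state_energy_le[OF l g, of \<phi> W] True by simp
    qed
    show ?thesis
    proof (intro exI[of _ \<mu>6] conjI allI ballI impI \<mu>6 notI; (elim exE conjE)?)
      fix \<mu> \<psi> assume "0 < \<mu>" "\<mu> < \<mu>6" "\<psi> \<in> H1_grid l" "grid_mass l \<psi> = \<mu>"
      then show "grid_energy l p \<psi> > 0" by (intro pos_grid[of \<mu> p \<psi>] pos[of \<mu>]) auto
    next
      fix \<mu> \<psi> assume "0 < \<mu>" "\<mu> < \<mu>6" "ground_state l p \<mu> \<psi>"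
      then show False using none[of \<mu> \<psi>] by simp
    next
      fix \<mu> \<psi> assume "\<mu>6 \<le> \<mu>" "ground_state l p \<mu> \<psi>"
      then show False using none[of \<mu> \<psi>] none'[of \<mu> \<psi>] \<mu>6 by linarith
    qed (use True in auto)
  next
    case False
    then have p6: "2 < p" "p < 6" using p by auto
    obtain \<mu>p where \<mu>p: "\<mu>p > 0"
      "\<And>\<psi> V. H1_pair l \<psi> V \<Longrightarrow> 0 < mass_of l \<psi> \<Longrightarrow> mass_of l \<psi> < \<mu>p \<Longrightarrow> 0 < energy_of l p \<psi> V"
      "\<And>\<psi> V. H1_pair l \<psi> V \<Longrightarrow> mass_of l \<psi> = \<mu>p \<Longrightarrow> 0 \<le> energy_of l p \<psi> V"
      "\<And>m. m > \<mu>p \<Longrightarrow> \<exists>\<psi> V. H1_pair l \<psi> V \<and> mass_of l \<psi> = m \<and> energy_of l p \<psi> V < 0"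
      by (rule mass_threshold[OF l, of p]) (use p in auto)
    have pos: "0 < energy_of l p \<phi> W" if "0 < \<mu>" "\<mu> < \<mu>p" "H1_pair l \<phi> W" "mass_of l \<phi> = \<mu>" for \<mu> \<phi> W
      using \<mu>p(2)[OF that(3)] that by simp
    have none: "\<not> ground_state l p \<mu> \<psi>" if "0 < \<mu>" "\<mu> < \<mu>p" for \<mu> \<psi>
      by (rule no_ground_state_if_energy_pos[OF l that(1)]) (use p pos that in auto)
    have b: "\<exists>\<psi>. ground_state l p \<mu>p \<psi> \<and> grid_energy l p \<psi> = 0" if "p \<noteq> 10 / 3"
    proof -
      have "10 / 3 < p" using p that by simp
      from minimiser_at_threshold[OF l this p6(2) \<mu>p(1,3,4)]
      obtain \<psi> V where \<psi>: "H1_pair l \<psi> V" "mass_of l \<psi> = \<mu>p" "energy_of l p \<psi> V = 0" by blast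
      have "ground_state l p \<mu>p \<psi>" by (rule ground_state_if_minimiser[OF l \<psi>(1,2)]) (use \<psi>(3) \<mu>p(3) in simp)
      then show ?thesis using \<psi>(3) grid_quantities(2)[OF \<psi>(1)] by (intro exI[of _ \<psi>]) simp
    qed
    have c: "\<exists>\<psi>. ground_state l p \<mu> \<psi> \<and> grid_energy l p \<psi> < 0" if "\<mu> > \<mu>p" for \<mu>
      by (rule exists[OF p6 _ \<mu>p(4)[OF that]]) (use \<mu>p(1) that in simp)
    show ?thesis
    proof (intro exI[of _ \<mu>p] conjI allI ballI impI \<mu>p(1) notI; (elim exE conjE)?)
      fix \<mu> \<psi> assume "0 < \<mu>" "\<mu> < \<mu>p" "\<psi> \<in> H1_grid l" "grid_mass l \<psi> = \<mu>"
      then show "grid_energy l p \<psi> > 0" by (intro pos_grid[of \<mu> p \<psi>] pos[of \<mu>]) auto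
    next
      fix \<mu> \<psi> assume "0 < \<mu>" "\<mu> < \<mu>p" "ground_state l p \<mu> \<psi>"
      then show False using none[of \<mu> \<psi>] by simp
    next
      assume "p \<noteq> 10 / 3"
      then show "\<exists>\<psi>. ground_state l p \<mu>p \<psi> \<and> grid_energy l p \<psi> = 0" by (rule b)
    next
      fix \<mu> assume "\<mu>p < \<mu>"
      then show "\<exists>\<psi>. ground_state l p \<mu> \<psi> \<and> grid_energy l p \<psi> < 0" by (rule c)
    qed (use False in auto)
  qed
qed

end
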